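(* Let $x,y\in F^\times$ with $x\neq \pm y$, and put $\gamma=\mathrm{diag}(x,y,-y,-x)\in\mathfrak{g}_1(F)$ and $\gamma_H=(\mathrm{diag}(x,-x),\mathrm{diag}(y,-y))\in\mathfrak{h}_1(F)$. Assume that $\gamma$ is nearly singular, i.e. $v(x+y)>v(x-y)$, and let $\kappa:\mathcal{D}\to\mathbb{C}^\times$ be the nontrivial character. Then there is a number $\Delta(\gamma,\gamma_H)\in\mathbb{C}$, equal to a root of unity times an integral power of $q$, such that $$\mathcal{O}^\kappa_\gamma(\mathbf{1}_{\mathfrak{g}_1(\mathfrak{o})})=\Delta(\gamma,\gamma_H)\,\mathcal{S}\mathcal{O}_{\gamma_H}(\mathbf{1}_{\mathfrak{h}_1(\mathfrak{o})}).$$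
   Context: Fields. $F$ is a complete nonarchimedean local field of odd positive characteristic with algebraic closure $\overline F$, ring of integers $\mathfrak{o}$, maximal ideal $\mathfrak{m}$, uniformiser $\pi$, valuation $v$ with $v(\pi)=1$, and $q=|\mathfrak{o}/\mathfrak{m}|$. $E/F$ is an unramified quadratic extension with ring of integers $\mathfrak{o}_E$; $z\mapsto\overline z$ is the nontrivial element of $\mathrm{Gal}(E/F)$. The symmetric space $(G,\theta)$. Let $J_n$ be the $n\times n$ matrix with $1$'s on the antidiagonal and $0$ elsewhere. For $F$-algebras $R$, $\mathrm{U}_n(R)=\{g\in \mathrm{GL}_n(R\otimes_F E): J_n(\overline g^{\,t})^{-1}J_n=g\}$, with Lie algebra $\mathfrak{u}_n(R)=\{X\in\mathfrak{gl}_n(R\otimes_F E): -J_n\overline X^{\,t}J_n=X\}$. Let $G=\mathrm{U}_4$, $\mathfrak{g}=\mathfrak{u}_4$, and let $\theta$ be the involution given by conjugation by $$\begin{pmatrix}0&0&0&1\\0&0&-1&0\\0&-1&0&0\\1&0&0&0\end{pmatrix}.$$ Put $G_0=(G^\theta)^\circ\cong \mathrm{U}_2\times\mathrm{U}_2$ and $\mathfrak{g}_1=\{X\in\mathfrak{g}:\theta(X)=-X\}$, on which $G_0$ acts by $\mathrm{Ad}$. Put $G_0(\mathfrak{o})=G_0(F)\cap \mathrm{GL}_4(\mathfrak{o}_E)$ and $\mathfrak{g}_1(\mathfrak{o})=\mathfrak{g}_1(F)\cap\mathfrak{gl}_4(\mathfrak{o}_E)$. $\kappa$-orbital integrals. The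 stabiliser of $\gamma$ in $G_0$ is $I_\gamma\cong \mathrm{U}_1\times \mathrm{U}_1$, and $I_\gamma(F)$ is compact. The stable conjugacy class of $\gamma$ is $G_0(\overline F)\gamma\cap\mathfrak{g}_1(F)$. The $G_0(F)$-orbits in it are in bijection with $\mathcal{D}=\ker[H^1(F,I_\gamma)\to H^1(F,G_0)]$ via $\mathrm{Ad}(g)\gamma\mapsto(\sigma\mapsto g^{-1}\sigma(g))$; the group $\mathcal{D}$ is isomorphic to $\mathbb{Z}/2$, with $\gamma$ corresponding to the identity. For a character $\kappa:\mathcal{D}\to\mathbb{C}^\times$ and a compactly supported smooth function $f$ on $\mathfrak{g}_1(F)$, $$\mathcal{O}^\kappa_\gamma(f)=\sum_{\gamma'}\kappa(\gamma')\int_{I_{\gamma'}(F)\backslash G_0(F)}f(\mathrm{Ad}(g^{-1})\gamma')\,\frac{dg}{dt},$$ where $\gamma'$ runs over representatives of the $G_0(F)$-orbits in the stable conjugacy class, $\kappa(\gamma')$ is the value of $\kappa$ at the class of $\gamma'$ in $\mathcal{D}$, $dg$ gives $G_0(\mathfrak{o})$ volume $1$, and $dt$ gives the compact group $I_{\gamma'}(F)$ volume $1$. The stable orbital integral $\mathcal{S}\mathcal{O}_\gamma$ is the case $\kappa=1$. $\mathbf{1}_S$ denotes the characteristic function of $S$. The endoscopic symmetric space. $H=\mathrm{U}_2\times\mathrm{U}_2$ with Lie algebra $\mathfrak{h}=\mathfrak{u}_2\oplus\mathfrak{u}_2$, and $\theta_H$ is the involution given by conjugation by $J_2$ on each factor,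 so $H_0=(H^{\theta_H})^\circ\cong(\mathrm{U}_1\times\mathrm{U}_1)\times(\mathrm{U}_1\times\mathrm{U}_1)$. $\mathfrak{h}_1=\{X\in\mathfrak{h}:\theta_H(X)=-X\}$, on which $H_0$ acts by $\mathrm{Ad}$, $\mathfrak{h}_1(\mathfrak{o})$ is the set of elements of $\mathfrak{h}_1(F)$ with entries in $\mathfrak{o}_E$, and $H_0(\mathfrak{o})=H_0(F)\cap(\mathrm{GL}_2(\mathfrak{o}_E)\times\mathrm{GL}_2(\mathfrak{o}_E))$. For a compactly supported smooth function $f$ on $\mathfrak{h}_1(F)$, $$\mathcal{S}\mathcal{O}_{\gamma_H}(f)=\sum_{\gamma_H'}\int_{I_{\gamma_H'}(F)\backslash H_0(F)}f(\mathrm{Ad}(h^{-1})\gamma_H')\,\frac{dh}{dt},$$ where $\gamma_H'$ runs over representatives of the $H_0(F)$-orbits in $H_0(\overline F)\gamma_H\cap \mathfrak{h}_1(F)$, $I_{\gamma_H'}$ is the stabiliser of $\gamma_H'$ in $H_0$, $dh$ gives $H_0(\mathfrak{o})$ volume $1$, and $dt$ gives the compact group $I_{\gamma_H'}(F)$ volume $1$. *)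

theory Defs
  imports
    "HOL-Analysis.Bochner_Integration"
    "HOL-Analysis.Abstract_Metric_Spaces"
    "HOL-Algebra.Coset"
    "HOL-Computational_Algebra.Computational_Algebra"
    "Jordan_Normal_Form.Matrix"
begin

section \<open>Fields\<close>

text \<open>
  All fields live inside one algebraically closed type \<open>'k\<close>, the algebraic closure of \<open>F\<close>;
  \<open>F\<close>, \<open>E\<close> and the separable closure of \<open>F\<close> are subsets of it.
  Valuations are maps \<open>'k \<Rightarrow> int\<close> whose values at \<open>0\<close> and outside the
  field in question are irrelevant.
\<close>

definition is_subfield :: "'k::field set \<Rightarrow> bool" where
  "is_subfield S \<longleftrightarrow> 0 \<in> S \<and> 1 \<in> S \<and>
     (\<forall>a\<in>S. \<forall>b\<in>S. a + b \<in> S \<and> a - b \<in> S \<and> a * b \<in> S) \<and> (\<forall>a\<in>S. inverse a \<in> S)"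

definition discrete_valuation :: "'k::field set \<Rightarrow> ('k \<Rightarrow> int) \<Rightarrow> bool" where
  "discrete_valuation S v \<longleftrightarrow>
     (\<forall>a\<in>S - {0}. \<forall>b\<in>S - {0}. v (a * b) = v a + v b) \<and>
     (\<forall>a\<in>S - {0}. \<forall>b\<in>S - {0}. a + b \<noteq> 0 \<longrightarrow> v (a + b) \<ge> min (v a) (v b)) \<and>
     (\<exists>\<pi>\<in>S - {0}. v \<pi> = 1)"

definition integers_of :: "'k::field set \<Rightarrow> ('k \<Rightarrow> int) \<Rightarrow> 'k set" where
  "integers_of S v = {a \<in> S. a = 0 \<or> v a \<ge> 0}"

definition maximal_ideal_of :: "'k::field set \<Rightarrow> ('k \<Rightarrow> int) \<Rightarrow> 'k set" where
  "maximal_ideal_of S v = {a \<in> S. a = 0 \<or> v a > 0}"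

definition residue_field :: "'k::field set \<Rightarrow> ('k \<Rightarrow> int) \<Rightarrow> 'k set set" where
  "residue_field S v =
     (\<lambda>a. {b \<in> integers_of S v. b - a \<in> maximal_ideal_of S v}) ` integers_of S v"

text \<open>The base \<open>2\<close> is immaterial; the value \<open>0\<close> outside \<open>S\<close> makes this
  symmetric everywhere, as the locale \<open>Metric_space\<close> demands.\<close>

definition vdist :: "'k::field set \<Rightarrow> ('k \<Rightarrow> int) \<Rightarrow> 'k \<Rightarrow> 'k \<Rightarrow> real" where
  "vdist S v a b = (if a \<in> S \<and> b \<in> S \<and> a \<noteq> b then 2 powi (- v (a - b)) else 0)"

definition local_field :: "'k::field set \<Rightarrow> ('k \<Rightarrow> int) \<Rightarrow> bool" where
  "local_field F v \<longleftrightarrow> is_subfield F \<and> discrete_valuation F v \<and>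
     Metric_space.mcomplete F (vdist F v) \<and> finite (residue_field F v)"

definition poly_over :: "'k::field set \<Rightarrow> 'k poly \<Rightarrow> bool" where
  "poly_over F p \<longleftrightarrow> (\<forall>i. coeff p i \<in> F)"

definition algebraic_over :: "'k::field set \<Rightarrow> 'k \<Rightarrow> bool" where
  "algebraic_over F a \<longleftrightarrow> (\<exists>p. poly_over F p \<and> p \<noteq> 0 \<and> poly p a = 0)"

definition separable_closure :: "'k::field set \<Rightarrow> 'k set" where
  "separable_closure F = {a. \<exists>p. poly_over F p \<and> coprime p (pderiv p) \<and> poly p a = 0}"

text \<open>In odd characteristic every quadratic extension has this form, with
  nontrivial automorphism \<open>a + b s \<mapsto> a - b s\<close>.\<close>

definition quadratic_ext :: "'k::field set \<Rightarrow> 'k set \<Rightarrow> 'k \<Rightarrow> bool" where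
  "quadratic_ext F E s \<longleftrightarrow> s \<notin> F \<and> s\<^sup>2 \<in> F \<and> E = {a + b * s | a b. a \<in> F \<and> b \<in> F}"

text \<open>Here \<open>v\<close> on \<open>E\<close> is the (unique) extension of \<open>v\<close> on \<open>F\<close>. As
  \<open>v\<close> takes the value \<open>1\<close> on \<open>F\<close> already, requiring it to be integer-valued on
  \<open>E\<close> says that the ramification index is \<open>1\<close>; the residue fields are finite, so
  separability of the residue extension is automatic.\<close>

definition unramified_quadratic_ext ::
    "'k::field set \<Rightarrow> 'k set \<Rightarrow> ('k \<Rightarrow> int) \<Rightarrow> 'k \<Rightarrow> bool" where
  "unramified_quadratic_ext F E v s \<longleftrightarrow>
     quadratic_ext F E s \<and> discrete_valuation F v \<and> discrete_valuation E v"


section \<open>Matrices over \<open>R \<otimes>\<^sub>F E\<close>\<close>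

text \<open>
  Let \<open>F \<subseteq> R \<subseteq> 'k\<close> and \<open>E = F + F s\<close> with \<open>s\<^sup>2 \<in> F\<close>. Then
  \<open>R \<otimes>\<^sub>F E\<close> is free over \<open>R\<close> on \<open>1 \<otimes> 1\<close> and \<open>1 \<otimes> s\<close>, so the pair
  \<open>(A, B)\<close> stands for the matrix \<open>A \<otimes> 1 + B \<otimes> s\<close>. The tensor is formal: only for
  \<open>R = F\<close> may one evaluate it to \<open>A + s B\<close>.
\<close>

type_synonym 'k tmat = "'k mat \<times> 'k mat"

definition tmats :: "nat \<Rightarrow> 'k set \<Rightarrow> 'k tmat set" where
  "tmats n R = {(A, B). A \<in> carrier_mat n n \<and> B \<in> carrier_mat n n \<and>
                        elements_mat A \<subseteq> R \<and> elements_mat B \<subseteq> R}"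

definition tmult :: "'k::field \<Rightarrow> 'k tmat \<Rightarrow> 'k tmat \<Rightarrow> 'k tmat" where
  "tmult s X Y = (fst X * fst Y + s\<^sup>2 \<cdot>\<^sub>m (snd X * snd Y), fst X * snd Y + snd X * fst Y)"

definition temb :: "nat \<Rightarrow> 'k::field mat \<Rightarrow> 'k tmat" where
  "temb n A = (A, 0\<^sub>m n n)"

definition tmat_monoid :: "nat \<Rightarrow> 'k::field \<Rightarrow> 'k set \<Rightarrow> 'k tmat monoid" where
  "tmat_monoid n s R = \<lparr>carrier = tmats n R, monoid.mult = tmult s, one = temb n (1\<^sub>m n)\<rparr>"

definition tinv :: "nat \<Rightarrow> 'k::field \<Rightarrow> 'k tmat \<Rightarrow> 'k tmat" where
  "tinv n s g = inv\<^bsub>tmat_monoid n s UNIV\<^esub> g"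

definition tneg :: "'k::field tmat \<Rightarrow> 'k tmat" where
  "tneg X = (- fst X, - snd X)"

definition tbar :: "'k::field tmat \<Rightarrow> 'k tmat" where
  "tbar X = (fst X, - snd X)"

definition ttranspose :: "'k tmat \<Rightarrow> 'k tmat" where
  "ttranspose X = (transpose_mat (fst X), transpose_mat (snd X))"

definition tmap :: "('k \<Rightarrow> 'k) \<Rightarrow> 'k tmat \<Rightarrow> 'k tmat" where
  "tmap \<sigma> X = (map_mat \<sigma> (fst X), map_mat \<sigma> (snd X))"

definition Ad :: "nat \<Rightarrow> 'k::field \<Rightarrow> 'k tmat \<Rightarrow> 'k tmat \<Rightarrow> 'k tmat" where
  "Ad n s g X = tmult s (tmult s g X) (tinv n s g)"

definition teval :: "'k::field \<Rightarrow> 'k tmat \<Rightarrow> 'k mat" where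
  "teval s X = fst X + s \<cdot>\<^sub>m snd X"

definition tintegral :: "'k::field set \<Rightarrow> ('k \<Rightarrow> int) \<Rightarrow> 'k \<Rightarrow> 'k tmat \<Rightarrow> bool" where
  "tintegral E v s X \<longleftrightarrow> elements_mat (teval s X) \<subseteq> integers_of E v"

definition tdist :: "nat \<Rightarrow> 'k::field set \<Rightarrow> ('k \<Rightarrow> int) \<Rightarrow> 'k \<Rightarrow> 'k tmat \<Rightarrow> 'k tmat \<Rightarrow> real" where
  "tdist n E v s X Y = Max ((\<lambda>ij. vdist E v (teval s X $$ ij) (teval s Y $$ ij)) ` ({..<n} \<times> {..<n}))"


section \<open>Unitary groups and their Lie algebras\<close>

definition Jmat :: "nat \<Rightarrow> 'k::field mat" where
  "Jmat n = mat n n (\<lambda>(i, j). if i + j + 1 = n then 1 else 0)"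

definition unitary :: "nat \<Rightarrow> 'k::field \<Rightarrow> 'k set \<Rightarrow> 'k tmat set" where
  "unitary n s R = {g \<in> Units (tmat_monoid n s R).
     tmult s (tmult s (temb n (Jmat n)) (tinv n s (ttranspose (tbar g)))) (temb n (Jmat n)) = g}"

definition unitary_Lie :: "nat \<Rightarrow> 'k::field \<Rightarrow> 'k set \<Rightarrow> 'k tmat set" where
  "unitary_Lie n s R = {X \<in> tmats n R.
     tneg (tmult s (tmult s (temb n (Jmat n)) (ttranspose (tbar X))) (temb n (Jmat n))) = X}"


section \<open>Zariski topology and identity components\<close>

inductive_set poly_functions :: "('a \<Rightarrow> 'k::field) set \<Rightarrow> ('a \<Rightarrow> 'k) set"
  for C :: "('a \<Rightarrow> 'k) set" where
  const: "(\<lambda>_. c) \<in> poly_functions C"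
| coord: "p \<in> C \<Longrightarrow> p \<in> poly_functions C"
| add: "p \<in> poly_functions C \<Longrightarrow> r \<in> poly_functions C \<Longrightarrow> (\<lambda>a. p a + r a) \<in> poly_functions C"
| mult: "p \<in> poly_functions C \<Longrightarrow> r \<in> poly_functions C \<Longrightarrow> (\<lambda>a. p a * r a) \<in> poly_functions C"

definition zariski_on :: "('a \<Rightarrow> 'k::field) set \<Rightarrow> 'a set \<Rightarrow> 'a topology" where
  "zariski_on C S =
     subtopology (topology_generated_by ((\<lambda>p. {a. p a \<noteq> 0}) ` poly_functions C)) S"

definition tcoords :: "nat \<Rightarrow> ('k tmat \<Rightarrow> 'k) set" where
  "tcoords n = {p. \<exists>i<n. \<exists>j<n. p = (\<lambda>X. fst X $$ (i, j)) \<or> p = (\<lambda>X. snd X $$ (i, j))}"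


section \<open>The symmetric space of \<open>U\<^sub>4\<close>\<close>

definition theta_mat :: "'k::field mat" where
  "theta_mat = mat_of_rows_list 4 [[0, 0, 0, 1], [0, 0, -1, 0], [0, -1, 0, 0], [1, 0, 0, 0]]"

definition theta :: "'k::field \<Rightarrow> 'k tmat \<Rightarrow> 'k tmat" where
  "theta s X = Ad 4 s (temb 4 theta_mat) X"

definition G_theta :: "'k::field \<Rightarrow> 'k set \<Rightarrow> 'k tmat set" where
  "G_theta s R = {g \<in> unitary 4 s R. theta s g = g}"

definition G0 :: "'k::field \<Rightarrow> 'k set \<Rightarrow> 'k tmat monoid" where
  "G0 s R = (tmat_monoid 4 s R)\<lparr>carrier := {g \<in> G_theta s R.
     connected_component_of (zariski_on (tcoords 4) (G_theta s UNIV)) (temb 4 (1\<^sub>m 4)) g}\<rparr>"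

definition g1 :: "'k::field \<Rightarrow> 'k set \<Rightarrow> 'k tmat set" where
  "g1 s R = {X \<in> unitary_Lie 4 s R. theta s X = tneg X}"

definition G0_int :: "'k::field set \<Rightarrow> 'k set \<Rightarrow> ('k \<Rightarrow> int) \<Rightarrow> 'k \<Rightarrow> 'k tmat set" where
  "G0_int F E v s = {g \<in> carrier (G0 s F). tintegral E v s g \<and> tintegral E v s (tinv 4 s g)}"

definition g1_int :: "'k::field set \<Rightarrow> 'k set \<Rightarrow> ('k \<Rightarrow> int) \<Rightarrow> 'k \<Rightarrow> 'k tmat set" where
  "g1_int F E v s = {X \<in> g1 s F. tintegral E v s X}"

definition G0_top :: "'k::field set \<Rightarrow> 'k set \<Rightarrow> ('k \<Rightarrow> int) \<Rightarrow> 'k \<Rightarrow> 'k tmat topology" where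
  "G0_top F E v s = Metric_space.mtopology (carrier (G0 s F)) (tdist 4 E v s)"


section \<open>The symmetric space of \<open>U\<^sub>2 \<times> U\<^sub>2\<close>\<close>

definition AdH :: "'k::field \<Rightarrow> 'k tmat \<times> 'k tmat \<Rightarrow> 'k tmat \<times> 'k tmat \<Rightarrow> 'k tmat \<times> 'k tmat" where
  "AdH s h X = (Ad 2 s (fst h) (fst X), Ad 2 s (snd h) (snd X))"

definition thetaH :: "'k::field \<Rightarrow> 'k tmat \<times> 'k tmat \<Rightarrow> 'k tmat \<times> 'k tmat" where
  "thetaH s X = AdH s (temb 2 (Jmat 2), temb 2 (Jmat 2)) X"

definition H_theta :: "'k::field \<Rightarrow> 'k set \<Rightarrow> ('k tmat \<times> 'k tmat) set" where
  "H_theta s R = {h \<in> unitary 2 s R \<times> unitary 2 s R. thetaH s h = h}"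

definition H_coords :: "('k tmat \<times> 'k tmat \<Rightarrow> 'k) set" where
  "H_coords = (\<lambda>p. p \<circ> fst) ` tcoords 2 \<union> (\<lambda>p. p \<circ> snd) ` tcoords 2"

definition H0 :: "'k::field \<Rightarrow> 'k set \<Rightarrow> ('k tmat \<times> 'k tmat) monoid" where
  "H0 s R = (tmat_monoid 2 s R \<times>\<times> tmat_monoid 2 s R)\<lparr>carrier := {h \<in> H_theta s R.
     connected_component_of (zariski_on H_coords (H_theta s UNIV))
       (temb 2 (1\<^sub>m 2), temb 2 (1\<^sub>m 2)) h}\<rparr>"

definition h1 :: "'k::field \<Rightarrow> 'k set \<Rightarrow> ('k tmat \<times> 'k tmat) set" where
  "h1 s R = {X \<in> unitary_Lie 2 s R \<times> unitary_Lie 2 s R. thetaH s X = (tneg (fst X), tneg (snd X))}"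

definition H0_int ::
    "'k::field set \<Rightarrow> 'k set \<Rightarrow> ('k \<Rightarrow> int) \<Rightarrow> 'k \<Rightarrow> ('k tmat \<times> 'k tmat) set" where
  "H0_int F E v s = {h \<in> carrier (H0 s F).
     tintegral E v s (fst h) \<and> tintegral E v s (tinv 2 s (fst h)) \<and>
     tintegral E v s (snd h) \<and> tintegral E v s (tinv 2 s (snd h))}"

definition h1_int ::
    "'k::field set \<Rightarrow> 'k set \<Rightarrow> ('k \<Rightarrow> int) \<Rightarrow> 'k \<Rightarrow> ('k tmat \<times> 'k tmat) set" where
  "h1_int F E v s = {X \<in> h1 s F. tintegral E v s (fst X) \<and> tintegral E v s (snd X)}"

definition H0_top ::
    "'k::field set \<Rightarrow> 'k set \<Rightarrow> ('k \<Rightarrow> int) \<Rightarrow> 'k \<Rightarrow> ('k tmat \<times> 'k tmat) topology" where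
  "H0_top F E v s = Metric_space.mtopology (carrier (H0 s F))
     (\<lambda>X Y. max (tdist 2 E v s (fst X) (fst Y)) (tdist 2 E v s (snd X) (snd Y)))"


section \<open>Group actions, Haar measures and orbital integrals\<close>

definition stabiliser :: "'g monoid \<Rightarrow> ('g \<Rightarrow> 'x \<Rightarrow> 'x) \<Rightarrow> 'x \<Rightarrow> 'g monoid" where
  "stabiliser G act X = G\<lparr>carrier := {g \<in> carrier G. act g X = X}\<rparr>"

definition orbit_of :: "'g monoid \<Rightarrow> ('g \<Rightarrow> 'x \<Rightarrow> 'x) \<Rightarrow> 'x \<Rightarrow> 'x set" where
  "orbit_of G act X = (\<lambda>g. act g X) ` carrier G"

definition borel_sets :: "'a topology \<Rightarrow> 'a set set" where
  "borel_sets T = sigma_sets (topspace T) {U. openin T U}"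

definition haar_measure :: "'g monoid \<Rightarrow> 'g topology \<Rightarrow> 'g measure \<Rightarrow> bool" where
  "haar_measure G T \<mu> \<longleftrightarrow>
     space \<mu> = carrier G \<and> sets \<mu> = borel_sets T \<and>
     (\<forall>g\<in>carrier G. \<forall>A\<in>sets \<mu>. emeasure \<mu> (g <#\<^bsub>G\<^esub> A) = emeasure \<mu> A) \<and>
     (\<forall>K\<in>sets \<mu>. compactin T K \<longrightarrow> emeasure \<mu> K < \<infinity>) \<and>
     (\<forall>U. openin T U \<and> U \<noteq> {} \<longrightarrow> emeasure \<mu> U > 0)"

text \<open>\<open>\<rho>\<close> is the measure \<open>\<mu>/\<nu>\<close> on \<open>I\G\<close>, a Borel measure for the quotient
  topology with
  \<open>\<integral>\<^sub>G \<phi>(g) d\<mu>(g) = \<integral>\<^bsub>I\G\<^esub> \<integral>\<^sub>I \<phi>(t g) d\<nu>(t) d\<rho>(g)\<close>.\<close>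

definition quotient_measure ::
    "'g monoid \<Rightarrow> 'g topology \<Rightarrow> 'g set \<Rightarrow> 'g measure \<Rightarrow> 'g measure \<Rightarrow> 'g set measure \<Rightarrow> bool" where
  "quotient_measure G T I \<mu> \<nu> \<rho> \<longleftrightarrow>
     space \<rho> = rcosets\<^bsub>G\<^esub> I \<and>
     sets \<rho> = sigma_sets (rcosets\<^bsub>G\<^esub> I) {V. V \<subseteq> rcosets\<^bsub>G\<^esub> I \<and> openin T (\<Union>V)} \<and>
     (\<forall>\<phi>\<in>borel_measurable \<mu>.
        (\<integral>\<^sup>+ g. \<phi> g \<partial>\<mu>) = (\<integral>\<^sup>+ c. (\<integral>\<^sup>+ t. \<phi> (t \<otimes>\<^bsub>G\<^esub> (SOME g. g \<in> c)) \<partial>\<nu>) \<partial>\<rho>))"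

definition normalised_measures ::
    "'g monoid \<Rightarrow> 'g topology \<Rightarrow> 'g set \<Rightarrow> ('g \<Rightarrow> 'x \<Rightarrow> 'x) \<Rightarrow> 'x set \<Rightarrow>
     'g measure \<Rightarrow> ('x \<Rightarrow> 'g measure) \<Rightarrow> ('x \<Rightarrow> 'g set measure) \<Rightarrow> bool" where
  "normalised_measures G T K act S dg dt dq \<longleftrightarrow>
     haar_measure G T dg \<and> emeasure dg K = 1 \<and>
     (\<forall>X\<in>S. let I = stabiliser G act X in
        haar_measure I (subtopology T (carrier I)) (dt X) \<and>
        emeasure (dt X) (carrier I) = 1 \<and>
        quotient_measure G T (carrier I) dg (dt X) (dq X))"

definition orbital_integral ::
    "'g monoid \<Rightarrow> ('g \<Rightarrow> 'x \<Rightarrow> 'x) \<Rightarrow> 'g set measure \<Rightarrow> ('x \<Rightarrow> complex) \<Rightarrow> 'x \<Rightarrow> complex" where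
  "orbital_integral G act \<rho> f X = (\<integral>c. f (act (inv\<^bsub>G\<^esub> (SOME g. g \<in> c)) X) \<partial>\<rho>)"

definition weighted_orbital_integral ::
    "'g monoid \<Rightarrow> ('g \<Rightarrow> 'x \<Rightarrow> 'x) \<Rightarrow> ('x \<Rightarrow> 'g set measure) \<Rightarrow> 'x set \<Rightarrow> ('x \<Rightarrow> complex) \<Rightarrow>
     ('x \<Rightarrow> complex) \<Rightarrow> complex" where
  "weighted_orbital_integral G act dq S w f =
     (\<Sum>Y \<in> orbit_of G act ` S. let X = (SOME X. X \<in> Y) in w X * orbital_integral G act (dq X) f X)"


section \<open>Galois cohomology\<close>

text \<open>The automorphisms of the algebraic closure over \<open>F\<close>; restriction identifies this group
  with that of the separable closure.\<close>

definition galois_group :: "'k::field set \<Rightarrow> ('k \<Rightarrow> 'k) set" where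
  "galois_group F = {\<sigma>. bij \<sigma> \<and> (\<forall>a b. \<sigma> (a + b) = \<sigma> a + \<sigma> b) \<and>
     (\<forall>a b. \<sigma> (a * b) = \<sigma> a * \<sigma> b) \<and> (\<forall>a\<in>F. \<sigma> a = a)}"

text \<open>Continuous for the Krull topology and the discrete topology on the target.\<close>

definition krull_continuous :: "('k \<Rightarrow> 'k) set \<Rightarrow> (('k \<Rightarrow> 'k) \<Rightarrow> 'g) \<Rightarrow> bool" where
  "krull_continuous \<Gamma> c \<longleftrightarrow>
     (\<forall>\<sigma>\<in>\<Gamma>. \<exists>A. finite A \<and> (\<forall>\<tau>\<in>\<Gamma>. (\<forall>a\<in>A. \<tau> a = \<sigma> a) \<longrightarrow> c \<tau> = c \<sigma>))"

text \<open>In the following \<open>ga\<close> is the action of the Galois group \<open>\<Gamma>\<close> on the group \<open>M\<close>.\<close>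

definition cocycles ::
    "('k \<Rightarrow> 'k) set \<Rightarrow> (('k \<Rightarrow> 'k) \<Rightarrow> 'g \<Rightarrow> 'g) \<Rightarrow> 'g monoid \<Rightarrow> (('k \<Rightarrow> 'k) \<Rightarrow> 'g) set" where
  "cocycles \<Gamma> ga M = {c \<in> \<Gamma> \<rightarrow>\<^sub>E carrier M.
     (\<forall>\<sigma>\<in>\<Gamma>. \<forall>\<tau>\<in>\<Gamma>. c (\<sigma> \<circ> \<tau>) = c \<sigma> \<otimes>\<^bsub>M\<^esub> ga \<sigma> (c \<tau>)) \<and> krull_continuous \<Gamma> c}"

definition cohomologous ::
    "('k \<Rightarrow> 'k) set \<Rightarrow> (('k \<Rightarrow> 'k) \<Rightarrow> 'g \<Rightarrow> 'g) \<Rightarrow> 'g monoid \<Rightarrow> (('k \<Rightarrow> 'k) \<Rightarrow> 'g) rel" where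
  "cohomologous \<Gamma> ga M = {(c, d). c \<in> cocycles \<Gamma> ga M \<and> d \<in> cocycles \<Gamma> ga M \<and>
     (\<exists>m\<in>carrier M. \<forall>\<sigma>\<in>\<Gamma>. d \<sigma> = inv\<^bsub>M\<^esub> m \<otimes>\<^bsub>M\<^esub> c \<sigma> \<otimes>\<^bsub>M\<^esub> ga \<sigma> m)}"

definition H1 ::
    "('k \<Rightarrow> 'k) set \<Rightarrow> (('k \<Rightarrow> 'k) \<Rightarrow> 'g \<Rightarrow> 'g) \<Rightarrow> 'g monoid \<Rightarrow> (('k \<Rightarrow> 'k) \<Rightarrow> 'g) set set" where
  "H1 \<Gamma> ga M = cocycles \<Gamma> ga M // cohomologous \<Gamma> ga M"

text \<open>The kernel of \<open>H\<^sup>1(I) \<rightarrow> H\<^sup>1(M)\<close> for a subgroup \<open>I\<close> of \<open>M\<close>, that is,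
  the preimage of the base point, as a group. The multiplication is the one induced by the
  pointwise multiplication of cocycles and makes sense for commutative \<open>I\<close>.\<close>

definition kernel_H1 ::
    "('k \<Rightarrow> 'k) set \<Rightarrow> (('k \<Rightarrow> 'k) \<Rightarrow> 'g \<Rightarrow> 'g) \<Rightarrow> 'g monoid \<Rightarrow> 'g monoid \<Rightarrow>
     (('k \<Rightarrow> 'k) \<Rightarrow> 'g) set monoid" where
  "kernel_H1 \<Gamma> ga I M =
     \<lparr>carrier = {C \<in> H1 \<Gamma> ga I.
        cohomologous \<Gamma> ga M `` C = cohomologous \<Gamma> ga M `` {\<lambda>\<sigma>\<in>\<Gamma>. \<one>\<^bsub>M\<^esub>}},
      monoid.mult = (\<lambda>C D. \<Union>c\<in>C. \<Union>d\<in>D. cohomologous \<Gamma> ga I `` {\<lambda>\<sigma>\<in>\<Gamma>. c \<sigma> \<otimes>\<^bsub>I\<^esub> d \<sigma>}),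
      one = cohomologous \<Gamma> ga I `` {\<lambda>\<sigma>\<in>\<Gamma>. \<one>\<^bsub>I\<^esub>}\<rparr>"

definition complex_units :: "complex monoid" where
  "complex_units = \<lparr>carrier = UNIV - {0}, monoid.mult = (*), one = 1\<rparr>"


section \<open>Stable and \<open>\<kappa>\<close>-orbital integrals\<close>

definition stable_class :: "'k::field set \<Rightarrow> 'k \<Rightarrow> 'k tmat \<Rightarrow> 'k tmat set" where
  "stable_class F s X = orbit_of (G0 s UNIV) (Ad 4 s) X \<inter> g1 s F"

definition stable_classH ::
    "'k::field set \<Rightarrow> 'k \<Rightarrow> 'k tmat \<times> 'k tmat \<Rightarrow> ('k tmat \<times> 'k tmat) set" where
  "stable_classH F s X = orbit_of (H0 s UNIV) (AdH s) X \<inter> h1 s F"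

definition stab_sep :: "'k::field set \<Rightarrow> 'k \<Rightarrow> 'k tmat \<Rightarrow> 'k tmat monoid" where
  "stab_sep F s X = stabiliser (G0 s (separable_closure F)) (Ad 4 s) X"

definition D_group :: "'k::field set \<Rightarrow> 'k \<Rightarrow> 'k tmat \<Rightarrow> (('k \<Rightarrow> 'k) \<Rightarrow> 'k tmat) set monoid" where
  "D_group F s X = kernel_H1 (galois_group F) tmap (stab_sep F s X) (G0 s (separable_closure F))"

text \<open>All \<open>g\<close> with \<open>Ad(g) X = Y\<close> give the same cohomology class, so the union is that class.
  Stable conjugacy is defined over the algebraic closure, but as the stabiliser is smooth, such a
  \<open>g\<close> exists over the separable closure.\<close>

definition D_class ::
    "'k::field set \<Rightarrow> 'k \<Rightarrow> 'k tmat \<Rightarrow> 'k tmat \<Rightarrow> (('k \<Rightarrow> 'k) \<Rightarrow> 'k tmat) set" where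
  "D_class F s X Y = (\<Union>g \<in> {g \<in> carrier (G0 s (separable_closure F)). Ad 4 s g X = Y}.
     cohomologous (galois_group F) tmap (stab_sep F s X)
       `` {\<lambda>\<sigma>\<in>galois_group F. tmult s (tinv 4 s g) (tmap \<sigma> g)})"

definition kappa_orbital_integral ::
    "'k::field set \<Rightarrow> 'k \<Rightarrow> ('k tmat \<Rightarrow> 'k tmat set measure) \<Rightarrow>
     ((('k \<Rightarrow> 'k) \<Rightarrow> 'k tmat) set \<Rightarrow> complex) \<Rightarrow> 'k tmat \<Rightarrow> ('k tmat \<Rightarrow> complex) \<Rightarrow> complex" where
  "kappa_orbital_integral F s dq \<kappa> X f =
     weighted_orbital_integral (G0 s F) (Ad 4 s) dq (stable_class F s X) (\<lambda>Y. \<kappa> (D_class F s X Y)) f"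

definition stable_orbital_integralH ::
    "'k::field set \<Rightarrow> 'k \<Rightarrow> ('k tmat \<times> 'k tmat \<Rightarrow> ('k tmat \<times> 'k tmat) set measure) \<Rightarrow>
     'k tmat \<times> 'k tmat \<Rightarrow> ('k tmat \<times> 'k tmat \<Rightarrow> complex) \<Rightarrow> complex" where
  "stable_orbital_integralH F s dq X f =
     weighted_orbital_integral (H0 s F) (AdH s) dq (stable_classH F s X) (\<lambda>_. 1) f"

definition gamma :: "'k::field \<Rightarrow> 'k \<Rightarrow> 'k tmat" where
  "gamma x y = temb 4 (mat_diag 4 (\<lambda>i. [x, y, - y, - x] ! i))"

definition gammaH :: "'k::field \<Rightarrow> 'k \<Rightarrow> 'k tmat \<times> 'k tmat" where
  "gammaH x y = (temb 2 (mat_diag 2 (\<lambda>i. [x, - x] ! i)), temb 2 (mat_diag 2 (\<lambda>i. [y, - y] ! i)))"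

end

theory Submission
  imports Defs "Jordan_Normal_Form.Determinant"
begin

text \<open>
  The two sides can be computed, and the comparison is a comparison of numbers.

  \<^bold>\<open>Coordinates.\<close> The fixed points of \<open>\<theta>\<close> in \<open>GL\<^sub>4\<close> form a product of two copies of \<open>GL\<^sub>2\<close>, and the
  antifixed points of its Lie algebra are pairs of \<open>2 \<times> 2\<close> matrices. So \<open>G\<^sub>0\<close> consists of pairs
  \<open>el k g\<close>, \<open>g\<^sub>1\<close> of pairs \<open>lie A B\<close>, and \<open>Ad (el k g) (lie A B) = lie (g A k\<^sup>-\<^sup>1) (k B g\<^sup>-\<^sup>1)\<close>. Over \<open>F\<close>,
  \<open>k\<close> and \<open>g\<close> are unitary for the form \<open>diag(1, -1)\<close> and \<open>B\<close> is the adjoint of \<open>A\<close>. The element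
  \<open>\<gamma>\<close> is \<open>lie d d\<close> with \<open>d = dia x y\<close>.

  \<^bold>\<open>Stable class.\<close> If \<open>lie A B\<close> is stably conjugate to \<open>\<gamma>\<close>, then \<open>B A\<close> is self-adjoint with
  eigenvalues \<open>x\<^sup>2\<close> and \<open>y\<^sup>2\<close>. An eigenbasis over \<open>E\<close> can be scaled to a similitude \<open>u\<close>, and
  \<open>A = w d u\<^sup>-\<^sup>1\<close> with a similitude \<open>w\<close> of the same multiplier \<open>a \<in> F\<^sup>\<times>\<close>
  (\<open>stable_class_structure\<close>). As units are norms, only the parity of \<open>v a\<close> matters for the rational
  orbit. So there are two orbits, and the nontrivial character is \<open>1\<close> on the orbit of \<open>\<gamma>\<close> and
  \<open>-1\<close> on the other (\<open>kappa_values\<close>): a point is conjugate to \<open>\<gamma>\<close> over \<open>E\<close>, which makes its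
  cohomology class an involution.

  \<^bold>\<open>Counting.\<close> The stabilisers have volume one, so the integral over an orbit is the number of those
  cosets of \<open>G\<^sub>0(o)\<close> that carry the point into \<open>g\<^sub>1(o)\<close> (\<open>orbital_integral_count\<close>). A coset of the integral
  unitary group in the similitudes is given by \<open>m \<ge> 0\<close> with the parity of \<open>v a\<close>, the distance to
  a vertex of the tree of \<open>U\<^sub>2\<close>, and a norm one element \<open>z\<close> modulo the \<open>m\<close>-th power of the maximal
  ideal. A pair of cosets \<open>(m, z)\<close>, \<open>(m', z')\<close> counts if and only if it is \<open>good\<close>, a pair of
  congruences on \<open>x z' - y z\<close> and \<open>x z' + y z\<close> (\<open>rep_integral_iff\<close>). The \<open>\<kappa>\<close>-orbital integral
  is therefore the number of good pairs of even parity minus that of odd parity.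
  In this alternating sum nearly everything cancels, and there remains \<open>(-1)\<^sup>r q\<^sup>r\<^sup>+\<^sup>2\<^sup>n\<close> with
  \<open>r = v (x + y) - v x\<close> and \<open>n = v x\<close>, provided that \<open>n \<ge> 0\<close> (\<open>card_Good_diff\<close>); otherwise it is \<open>0\<close>.

  \<^bold>\<open>The endoscopic side.\<close> \<open>H\<^sub>0(F)\<close> consists of norm one elements, all integral, and it acts
  transitively on the stable class. So the integral is \<open>1\<close> if \<open>v x \<ge> 0\<close> and \<open>0\<close> otherwise
  (\<open>stable_orbital_integral_H\<close>), and \<open>\<Delta> = (-1)\<^sup>r q\<^sup>r\<^sup>+\<^sup>2\<^sup>n\<close>.

  \<^bold>\<open>Galois descent.\<close> Cocycles take values in the separable closure of \<open>F\<close>. That this is a ring, and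
  that its elements fixed by all automorphisms lie in \<open>F\<close>, is derived from extending partial
  homomorphisms to the algebraic closure by Zorn's lemma (\<open>separable_closure_ring\<close>,
  \<open>separable_fixed\<close>).
\<close>

section \<open>Subfields with a discrete valuation\<close>

locale valued_field =
 fixes S :: "'k::field set" and v :: "'k => int"
 assumes subfield: "is_subfield S" and valuation: "discrete_valuation S v"
begin

lemma zero_closed [simp, intro]: "0 : S" and one_closed [simp, intro]: "1 : S"
 and add_closed [simp, intro]: "a : S ==> b : S ==> a + b : S"
 and diff_closed [simp, intro]: "a : S ==> b : S ==> a - b : S"
 and mult_closed [simp, intro]: "a : S ==> b : S ==> a * b : S"
 and inverse_closed [simp, intro]: "a : S ==> inverse a : S"
 using subfield unfolding is_subfield_def by auto

lemma uminus_closed [simp, intro]: "a : S ==> - a : S"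
 using diff_closed[of 0 a] by simp

lemma divide_closed [simp, intro]: "a : S ==> b : S ==> a / b : S"
 by (simp add: divide_inverse inverse_closed mult_closed)

lemma power_closed [simp, intro]: "a : S ==> a ^ n : S"
 by (induction n) auto

lemma powi_closed [simp, intro]: "a : S ==> a powi n : S"
 by (auto simp: power_int_def)

lemma of_nat_closed [simp, intro]: "of_nat n : S"
 by (induction n) auto

lemma numeral_closed [intro, simp]: "numeral n : S"
 using of_nat_closed[of "numeral n"] by simp

lemma v_mult: "a : S ==> b : S ==> a ~= 0 ==> b ~= 0 ==> v (a * b) = v a + v b"
 using valuation unfolding discrete_valuation_def by auto

lemma v_add: "a : S ==> b : S ==> a ~= 0 ==> b ~= 0 ==> a + b ~= 0 ==> v (a + b) \<ge> min (v a) (v b)"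
 using valuation unfolding discrete_valuation_def by auto

lemma v_one [simp]: "v 1 = 0"
 using v_mult[of 1 1] by auto

lemma v_minus [simp]: "a : S ==> v (- a) = v a"
proof (cases "a = 0")
 case False
 assume a: "a : S"
 have "v (- 1) + v (- 1) = 0" using v_mult[of "-1" "-1"] uminus_closed[of 1] by auto
 then have "v (-1) = 0" by simp
 then show ?thesis using v_mult[of "-1" a] a False uminus_closed[of 1] by auto
qed simp

lemma v_inverse: "a : S ==> a ~= 0 ==> v (inverse a) = - v a"
 using v_mult[of a "inverse a"] inverse_closed[of a] by auto

lemma v_divide: "a : S ==> b : S ==> a ~= 0 ==> b ~= 0 ==> v (a / b) = v a - v b"
 using v_mult[of a "inverse b"] v_inverse[of b] inverse_closed[of b] by (auto simp: divide_inverse)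

lemma v_power: "a : S ==> a ~= 0 ==> v (a ^ n) = int n * v a"
 by (induction n) (auto simp: v_mult power_closed algebra_simps)

lemma v_powi: "a : S ==> a ~= 0 ==> v (a powi n) = n * v a"
 by (auto simp: power_int_def v_power inverse_closed v_inverse)

text \<open>The fractional ideal of exponent \<open>n\<close>, as a predicate: it treats \<open>0\<close> as having infinite
 valuation, so that the ultrametric inequality needs no case distinctions.\<close>

definition vge :: "int => 'k => bool" where
 "vge n a \<longleftrightarrow> a : S & (a = 0 | v a \<ge> n)"

lemma vge_in: "vge n a ==> a : S" by (simp add: vge_def)
lemma vge_0 [simp, intro]: "vge n 0" by (simp add: vge_def)
lemma vge_iff: "a : S ==> a ~= 0 ==> vge n a \<longleftrightarrow> n <= v a" by (simp add: vge_def)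
lemma vge_v: "a : S ==> vge (v a) a" by (simp add: vge_def)
lemma vge_mono: "vge n a ==> m <= n ==> vge m a" by (auto simp: vge_def)
lemma vge_minus: "vge n a ==> vge n (- a)" by (auto simp: vge_def)
lemma vge_one [simp]: "vge n 1 \<longleftrightarrow> n <= 0" by (simp add: vge_iff)

lemma vge_add: "vge n a ==> vge n b ==> vge n (a + b)"
 using v_add[of a b] unfolding vge_def by (cases "a = 0 | b = 0 | a + b = 0") auto

lemma vge_diff: "vge n a ==> vge n b ==> vge n (a - b)"
 using vge_add[of n a "- b"] by (simp add: vge_minus)

lemma vge_diff_commute: "vge n (a - b) \<longleftrightarrow> vge n (b - a)"
 using vge_minus[of n "a - b"] vge_minus[of n "b - a"] by auto

lemma vge_trans: "vge n (a - b) ==> vge n (b - c) ==> vge n (a - c)"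
 using vge_add[of n "a - b" "b - c"] by simp

lemma vge_mult: "vge m a ==> vge n b ==> vge (m + n) (a * b)"
 unfolding vge_def by (cases "a = 0 | b = 0") (auto simp: v_mult)

lemma vge_mult0: "vge n a ==> vge 0 b ==> vge n (a * b)" "vge 0 a ==> vge n b ==> vge n (a * b)"
 using vge_mult[of n a 0 b] vge_mult[of 0 a n b] by auto

lemma vge_scale: "c : S ==> c ~= 0 ==> a : S ==> vge n (c * a) \<longleftrightarrow> vge (n - v c) a"
 unfolding vge_def by (cases "a = 0") (auto simp: v_mult)

lemma vge_of_nat: "vge 0 (of_nat n)"
 by (induction n) (auto intro: vge_add)

lemma vge_all: "a : S ==> (!!n. vge n a) ==> a = 0"
 using vge_iff[of a "v a + 1"] by fastforce

lemma v_add_less: "a : S ==> a ~= 0 ==> vge (v a + 1) b ==> a + b ~= 0 & v (a + b) = v a"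
proof -
 assume a: "a : S" "a ~= 0" and b: "vge (v a + 1) b"
 have nz: "a + b ~= 0"
 proof
  assume "a + b = 0"
  then have "b = - a" by (simp add: add_eq_0_iff)
  then show False using a b by (auto simp: vge_def)
 qed
 have "vge (v a) (a + b)" using vge_add[of "v a" a b] vge_v a vge_mono[OF b] by auto
 then have "v a <= v (a + b)" using nz by (auto simp: vge_def)
 moreover have "v (a + b) <= v a"
 proof (rule ccontr)
  assume "~ ?thesis"
  then have "vge (v a + 1) (a + b)" using a vge_in[OF b] by (auto simp: vge_def)
  then have "vge (v a + 1) a" using vge_diff[OF _ b] by force
  then show False using a by (auto simp: vge_def)
 qed
 ultimately show ?thesis using nz by simp
qed

lemma v_uniformiser: obtains p where "p : S" "p ~= 0" "v p = 1"
 using valuation unfolding discrete_valuation_def by auto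

text \<open>The valuation metric.\<close>

lemma two_powi_le: "(2::real) powi a <= 2 powi b \<longleftrightarrow> a <= b"
 by (simp flip: powr_real_of_int')

lemma vdist_le_iff:
 assumes "a : S" "b : S"
 shows "vdist S v a b <= 2 powi (- n) \<longleftrightarrow> vge n (a - b)"
 using assms diff_closed[of a b] by (simp add: vdist_def vge_def two_powi_le)

lemma vdist_less_iff:
 assumes "a : S" "b : S"
 shows "vdist S v a b < 2 powi (- n) \<longleftrightarrow> vge (n + 1) (a - b)"
proof (cases "a = b")
 case False
 have "(2::real) powi (- v (a - b)) < 2 powi (- n) \<longleftrightarrow> n < v (a - b)"
  using two_powi_le[of "- n" "- v (a - b)"] by linarith
 then show ?thesis using False assms diff_closed[of a b] by (auto simp: vdist_def vge_def)
qed (use assms in \<open>simp add: vdist_def\<close>)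

lemma vdist_ultra:
 assumes "a : S" "b : S" "c : S"
 shows "vdist S v a c <= max (vdist S v a b) (vdist S v b c)"
proof (cases "a = b | b = c")
 case False
 let ?n = "min (v (a - b)) (v (b - c))"
 have "vge ?n (a - b)" "vge ?n (b - c)" using assms diff_closed by (simp_all add: vge_def)
 then have "vge ?n (a - c)" by (rule vge_trans)
 then have "vdist S v a c <= 2 powi (- ?n)" using assms by (simp add: vdist_le_iff)
 also have "... = max (vdist S v a b) (vdist S v b c)"
  using False assms by (simp add: vdist_def min_def max_def two_powi_le)
 finally show ?thesis .
next
 case True
 then show ?thesis
 proof
  assume "a = b"
  then show ?thesis by simp
 next
  assume "b = c"
  then show ?thesis by simp
 qed
qed

lemma vdist_nonneg: "vdist S v a b \<ge> 0"
 by (simp add: vdist_def)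

lemma vdist_commute: "vdist S v a b = vdist S v b a"
 using v_minus[of "a - b"] by (auto simp: vdist_def diff_closed)

lemma vdist_zero: "a : S ==> b : S ==> vdist S v a b = 0 \<longleftrightarrow> a = b"
 by (simp add: vdist_def)

lemma Metric_space_vdist: "Metric_space S (vdist S v)"
proof
 fix a b c assume "a : S" "b : S" "c : S"
 then show "vdist S v a c <= vdist S v a b + vdist S v b c"
  using vdist_ultra[of a b c] vdist_nonneg[of a b] vdist_nonneg[of b c] by linarith
qed (auto simp: vdist_nonneg vdist_commute vdist_zero)

end

section \<open>The local field and its unramified quadratic extension\<close>

locale unramified_extension =
 fixes F E :: "'k::field set" and v :: "'k => int" and s :: 'k
 assumes F: "local_field F v" and E: "unramified_quadratic_ext F E v s"
  and char: "CHAR('k) > 0" "odd CHAR('k)"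
begin

lemma two_nonzero: "(2::'k) ~= 0"
proof -
 have "~ CHAR('k) dvd 2"
 proof
  assume "CHAR('k) dvd 2"
  then have "CHAR('k) <= 2" by (rule dvd_imp_le) simp
  then have "CHAR('k) = 1 | CHAR('k) = 2" using char(1) by linarith
  then show False using char(2) CHAR_not_1'[where 'a='k] by auto
 qed
 then show ?thesis using of_nat_eq_0_iff_char_dvd[where 'a='k, of 2] by simp
qed

lemma s_props: "s ~: F" "s\<^sup>2 : F" "E = {a + b * s | a b. a : F & b : F}"
 using E unfolding unramified_quadratic_ext_def quadratic_ext_def by auto

sublocale FF: valued_field F v
 using F unfolding local_field_def by unfold_locales auto

lemma s_nonzero: "s ~= 0" using s_props(1) by auto

lemma E_I: "a : F ==> b : F ==> a + b * s : E" using s_props by auto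
lemma F_E: "a : F ==> a : E" using E_I[of a 0] by simp

lemma decomp_unique:
 assumes "a : F" "b : F" "a' : F" "b' : F" "a + b * s = a' + b' * s"
 shows "a = a' & b = b'"
proof (cases "b = b'")
 case False
 have "(b - b') * s = a' - a" using assms(5) by (simp add: algebra_simps)
 then have "s = (a' - a) / (b - b')" using False by (simp add: field_simps)
 then show ?thesis using s_props(1) assms by (metis FF.divide_closed FF.diff_closed)
qed (use assms in auto)

text \<open>The nontrivial automorphism of \<open>E\<close> over \<open>F\<close>.\<close>

definition bar :: "'k => 'k" where
 "bar z = (THE z'. \<exists>a\<in>F. \<exists>b\<in>F. z = a + b * s & z' = a - b * s)"

lemma bar_eq: "a : F ==> b : F ==> bar (a + b * s) = a - b * s"
 unfolding bar_def using decomp_unique by (intro the_equality) blast+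

lemma E_cases: assumes "z : E" obtains a b where "a : F" "b : F" "z = a + b * s" "bar z = a - b * s"
 using assms s_props(3) bar_eq by blast

lemma bar_F [simp]: "a : F ==> bar a = a" using bar_eq[of a 0] by simp

lemma bar_closed [simp, intro]: "z : E ==> bar z : E"
 by (metis E_cases E_I FF.uminus_closed diff_conv_add_uminus mult_minus_left)

lemma bar_bar [simp]: "z : E ==> bar (bar z) = z"
 by (metis E_cases bar_eq FF.uminus_closed diff_conv_add_uminus diff_minus_eq_add mult_minus_left)

lemma bar_add: "z : E ==> w : E ==> bar (z + w) = bar z + bar w"
proof -
 assume "z : E" "w : E"
 then obtain a b c d where h: "a : F" "b : F" "z = a + b * s" "c : F" "d : F" "w = c + d * s"
  using s_props by auto
 have "bar ((a + c) + (b + d) * s) = (a + c) - (b + d) * s" using h by (intro bar_eq) auto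
 moreover have "z + w = (a + c) + (b + d) * s" using h by (simp add: algebra_simps)
 moreover have "bar z = a - b * s" "bar w = c - d * s" using h bar_eq by auto
 ultimately show ?thesis by (simp only:) (simp add: algebra_simps)
qed

lemma bar_mult: "z : E ==> w : E ==> bar (z * w) = bar z * bar w"
proof -
 assume "z : E" "w : E"
 then obtain a b c d where h: "a : F" "b : F" "z = a + b * s" "c : F" "d : F" "w = c + d * s"
  using s_props by auto
 have "bar ((a * c + b * d * s\<^sup>2) + (a * d + b * c) * s) = (a * c + b * d * s\<^sup>2) - (a * d + b * c) * s"
  using h s_props by (intro bar_eq) auto
 moreover have "z * w = (a * c + b * d * s\<^sup>2) + (a * d + b * c) * s" using h by (simp add: algebra_simps power2_eq_square)
 moreover have "bar z = a - b * s" "bar w = c - d * s" using h bar_eq by auto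
 ultimately show ?thesis by (simp only:) (simp add: algebra_simps power2_eq_square)
qed

lemma E_subfield: "is_subfield E"
 unfolding is_subfield_def
proof (intro conjI ballI)
 show "0 : E" "1 : E" by (auto intro: F_E)
next
 fix z w assume "z : E" "w : E"
 then obtain a b c d where h: "a : F" "b : F" "z = a + b * s" "c : F" "d : F" "w = c + d * s"
  using s_props by auto
 have "(a + c) + (b + d) * s : E" "(a - c) + (b - d) * s : E"
  "(a * c + b * d * s\<^sup>2) + (a * d + b * c) * s : E"
  using h s_props(2) by (auto intro!: E_I)
 then show "z + w : E" "z - w : E" "z * w : E" using h by (simp_all add: algebra_simps power2_eq_square)
next
 fix z assume "z : E"
 then obtain a b where h: "a : F" "b : F" "z = a + b * s" using s_props by auto
 show "inverse z : E"
 proof (cases "z = 0")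
  case False
  have nz: "a - b * s ~= 0"
  proof
   assume "a - b * s = 0"
   then have "a + (- b) * s = 0 + 0 * s" by simp
   then have "a = 0 & - b = 0" using h by (intro decomp_unique) auto
   then show False using h False by simp
  qed
  let ?n = "a\<^sup>2 - b\<^sup>2 * s\<^sup>2"
  have n: "z * (a - b * s) = ?n" using h by (simp add: algebra_simps power2_eq_square)
  then have "?n ~= 0" using False nz by (metis mult_eq_0_iff)
  then have "inverse z = a / ?n + (- b / ?n) * s"
  proof -
   have "z * (a / ?n + (- b / ?n) * s) = z * (a - b * s) / ?n"
    by (simp add: diff_divide_distrib algebra_simps)
   also have "... = 1" using n \<open>?n \<noteq> 0\<close> by simp
   finally show ?thesis by (rule inverse_unique)
  qed
  moreover have "a / ?n : F" "- b / ?n : F"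
   using h s_props by (auto intro!: FF.divide_closed FF.diff_closed FF.mult_closed FF.power_closed FF.uminus_closed)
  ultimately show ?thesis using E_I by metis
 qed (auto intro: F_E)
qed

sublocale EE: valued_field E v
 using E E_subfield unfolding unramified_quadratic_ext_def by unfold_locales auto

lemma s_E: "s : E" using E_I[of 0 1] by auto

lemma bar_s: "bar s = - s" using bar_eq[of 0 1] by auto

lemma bar_minus: "z : E ==> bar (- z) = - bar z"
 by (metis EE.uminus_closed EE.zero_closed FF.zero_closed bar_F bar_add eq_neg_iff_add_eq_0 add.commute)

lemma bar_diff: "z : E ==> w : E ==> bar (z - w) = bar z - bar w"
 using bar_add[of z "- w"] bar_minus[of w] by auto

lemma bar_eq_0: "z : E ==> bar z = 0 \<longleftrightarrow> z = 0"
 by (metis FF.zero_closed bar_F bar_bar)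

lemma bar_inverse: "z : E ==> bar (inverse z) = inverse (bar z)"
proof (cases "z = 0")
 case False
 assume z: "z : E"
 have "bar z * bar (inverse z) = 1"
  using bar_mult[of z "inverse z"] z False EE.inverse_closed by auto
 then show ?thesis by (metis inverse_unique)
qed simp

lemma bar_divide: "z : E ==> w : E ==> bar (z / w) = bar z / bar w"
 using bar_mult[of z "inverse w"] by (simp add: divide_inverse bar_inverse EE.inverse_closed)

lemma bar_fixed: "z : E ==> bar z = z ==> z : F"
proof -
 assume "z : E" "bar z = z"
 then obtain a b where h: "a : F" "b : F" "z = a + b * s" "a - b * s = a + b * s" by (metis E_cases)
 have "2 * (b * s) = 0" using h(4) by (simp add: algebra_simps)
 then have "b = 0" using two_nonzero s_nonzero by simp
 then show ?thesis using h by simp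
qed

lemma norm_F: "z : E ==> z * bar z : F"
 by (intro bar_fixed) (auto simp: bar_mult bar_closed mult.commute)

lemma trace_F: "z : E ==> z + bar z : F"
 by (intro bar_fixed) (auto simp: bar_add bar_closed add.commute)

lemma v_two [simp]: "v 2 = 0"
proof -
 obtain k where k: "CHAR('k) = 2 * k + 1" using char by (auto elim: oddE)
 have "of_nat (2 * (k + 1)) = (1::'k)"
 proof -
  have "(of_nat (2 * (k + 1)) :: 'k) = of_nat (CHAR('k)) + 1" unfolding k by simp
  then show ?thesis by simp
 qed
 then have e: "(2::'k) * of_nat (k + 1) = 1" by simp
 then have nz: "of_nat (k + 1) ~= (0::'k)" by (metis mult_zero_right zero_neq_one)
 have "v 2 + v (of_nat (k + 1)) = 0"
  using FF.v_mult[of 2 "of_nat (k+1)"] nz two_nonzero FF.of_nat_closed[of "k+1"] e by (metis FF.numeral_closed FF.v_one)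
 moreover have "v 2 \<ge> 0" using FF.vge_of_nat[of 2] two_nonzero by (simp add: FF.vge_def)
 moreover have "v (of_nat (k + 1)) \<ge> 0" using FF.vge_of_nat[of "k + 1"] nz unfolding FF.vge_def by blast
 ultimately show ?thesis by simp
qed

lemma vge_double: "z : E ==> EE.vge n (2 * z) \<longleftrightarrow> EE.vge n z"
 using EE.vge_scale[of 2 z n] two_nonzero by simp

lemma vge_half: "z : E ==> EE.vge n (z / 2) \<longleftrightarrow> EE.vge n z"
 using vge_double[of "z / 2" n] two_nonzero EE.divide_closed[of z 2] by simp

lemma vge_F: "a : F ==> FF.vge n a \<longleftrightarrow> EE.vge n a"
 by (simp add: FF.vge_def EE.vge_def F_E)

end

section \<open>Hensel's lemma and the norm group\<close>

context unramified_extension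
begin

text \<open>The map \<open>z \<mapsto> z\<^sup>2 + c\<close> is a contraction of the maximal ideal
 when \<open>c\<close> lies in it.\<close>

lemma quadratic_root:
 assumes c: "FF.vge 1 c"
 obtains z where "z : F" "z = z * z + c"
proof -
 interpret M: Metric_space F "vdist F v" by (rule FF.Metric_space_vdist)
 define z where "z = rec_nat 0 (%_ w. w * w + c)"
 have z0: "z 0 = 0" and zS: "!!n. z (Suc n) = z n * z n + c" by (simp_all add: z_def)
 have z1: "FF.vge 1 (z n)" for n
 proof (induction n)
  case (Suc n)
  have "FF.vge 1 (z n * z n)" using FF.vge_mult[OF Suc Suc] FF.vge_mono by fastforce
  then show ?case unfolding zS by (rule FF.vge_add[OF _ c])
 qed (simp add: z0)
 have zF: "z n : F" for n using z1 FF.vge_in by blast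
 have step: "FF.vge (int n + 1) (z (Suc n) - z n)" for n
 proof (induction n)
  case 0
  then show ?case using z1[of 1] by (simp add: z0)
 next
  case (Suc n)
  have "FF.vge (int n + 1 + 1) ((z (Suc n) - z n) * (z (Suc n) + z n))"
   by (intro FF.vge_mult Suc FF.vge_add z1)
  moreover have "z (Suc (Suc n)) - z (Suc n) = (z (Suc n) - z n) * (z (Suc n) + z n)"
   unfolding zS[of "Suc n"] zS[of n] by (simp add: algebra_simps)
  ultimately show ?case by (simp add: add.commute)
 qed
 have far: "FF.vge (int n + 1) (z (n + k) - z n)" for n k
 proof (induction k)
  case (Suc k)
  have "FF.vge (int n + 1) (z (Suc (n + k)) - z (n + k))" by (rule FF.vge_mono[OF step]) simp
  then show ?case using FF.vge_trans[OF _ Suc] by simp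
 qed simp
 have close: "vdist F v (z m) (z n) <= 2 powi (- int N)" if "N <= m" "N <= n" for m n N
 proof -
  have "FF.vge (int N) (z m - z N)" "FF.vge (int N) (z n - z N)"
   using FF.vge_mono[OF far[of N "m - N"]] FF.vge_mono[OF far[of N "n - N"]] that by auto
  then have "FF.vge (int N) (z m - z n)" using FF.vge_trans FF.vge_diff_commute by blast
  then show ?thesis using FF.vdist_le_iff zF by blast
 qed
 have eps: "EX N. (2::real) powi (- int N) < e" if "e > 0" for e
 proof -
  obtain N where "(1/2::real) ^ N < e" using real_arch_pow_inv[of e "1/2"] \<open>e > 0\<close> by auto
  then show ?thesis by (intro exI[of _ N]) (simp add: power_int_minus power_one_over field_simps)
 qed
 have "M.MCauchy z"
  unfolding M.MCauchy_def
 proof (intro conjI allI impI)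
  fix e :: real assume "e > 0"
  then obtain N where N: "(2::real) powi (- int N) < e" using eps by blast
  show "EX N. ALL n n'. N <= n --> N <= n' --> vdist F v (z n) (z n') < e"
   using le_less_trans[OF close N] by blast
 qed (use zF in auto)
 moreover have "M.mcomplete" using F unfolding local_field_def by auto
 ultimately obtain l where "limitin M.mtopology z l sequentially"
  unfolding M.mcomplete_def by blast
 then have l: "l : F" "!!e. e > 0 ==> EX N. \<forall>n\<ge>N. z n : F & vdist F v (z n) l < e"
  unfolding M.limit_metric_sequentially by auto
 have lim: "EX N. \<forall>n\<ge>N. FF.vge k (z n - l)" for k
 proof -
  obtain N where "\<forall>n\<ge>N. z n : F & vdist F v (z n) l < 2 powi (- k)"
   using l(2)[of "2 powi (- k)"] by auto
  then have "FF.vge k (z n - l)" if "n \<ge> N" for n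
   using that FF.vdist_less_iff[OF zF[of n] l(1), of k] FF.vge_mono[of "k+1" "z n - l" k] by auto
  then show ?thesis by blast
 qed
 have "FF.vge k (l * l + c - l)" for k
 proof -
  obtain N where N: "!!n. n \<ge> N ==> FF.vge (max k 0) (z n - l)" using lim[of "max k 0"] by auto
  have a: "FF.vge (max k 0) (z N - l)" "FF.vge (max k 0) (z (Suc N) - l)" using N by auto
  have "FF.vge 0 (z N)" using FF.vge_mono[OF z1] by simp
  moreover from this have "FF.vge 0 l"
   using FF.vge_diff[of 0 "z N" "z N - l"] FF.vge_mono[OF a(1), of 0] by simp
  ultimately have "FF.vge (max k 0) ((z N - l) * (z N + l))"
   using a(1) by (intro FF.vge_mult0 FF.vge_add)
  then have "FF.vge (max k 0) (z (Suc N) - l - (z N - l) * (z N + l))" by (rule FF.vge_diff[OF a(2)])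
  moreover have "z (Suc N) - l - (z N - l) * (z N + l) = l * l + c - l"
   unfolding zS by (simp add: algebra_simps)
  ultimately have "FF.vge (max k 0) (l * l + c - l)" by (simp only:)
  then show ?thesis by (rule FF.vge_mono) simp
 qed
 then have "l * l + c - l = 0" using l(1) c FF.vge_in by (intro FF.vge_all) blast+
 then show thesis using that[of l] l(1) by simp
qed

text \<open>Completing the square turns the fixed point equation into a square root.\<close>

lemma square_root_near_one:
 assumes u: "FF.vge 1 (u - 1)"
 obtains w where "w : F" "w * w = u"
proof -
 have four: "(4::'k) = 2 * 2" by simp
 have uF: "u : F" using FF.add_closed[OF FF.vge_in[OF u] FF.one_closed] by simp
 have "v 4 = 0" unfolding four using FF.v_mult[of 2 2] two_nonzero by simp
 moreover have nz: "(4::'k) ~= 0" unfolding four using two_nonzero by (metis mult_eq_0_iff)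
 moreover have "FF.vge 1 (1 - u)" using u FF.vge_diff_commute by blast
 moreover have e4: "4 * ((1 - u) / 4) = 1 - u" using nz by (simp only: nonzero_mult_div_cancel_left times_divide_eq_right simp_thms)
 ultimately have "FF.vge 1 ((1 - u) / 4)"
  using FF.vge_scale[of 4 "(1 - u)/4" 1, OF _ nz] uF unfolding e4 by simp
 then obtain z where z: "z : F" "z = z * z + (1 - u) / 4" using quadratic_root by blast
 have "4 * z = 4 * (z * z + (1 - u) / 4)" using z(2) by (rule arg_cong)
 then have "4 * z = 4 * (z * z) + (1 - u)" by (simp only: distrib_left e4)
 then have "(1 - 2 * z) * (1 - 2 * z) = u" by (simp add: algebra_simps)
 moreover have "1 - 2 * z : F" using z(1) by auto
 ultimately show thesis using that by blast
qed

text \<open>If conjugation changed the valuation of \<open>z\<close>, the discriminant of the minimal polynomial of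
 \<open>z\<close> would be a square in \<open>F\<close> by Hensel's lemma, and \<open>s\<close> would lie in \<open>F\<close>.\<close>

lemma v_bar [simp]:
 assumes "z : E" shows "v (bar z) = v z"
proof -
 have no: "~ v (bar z) < v z" if z: "z : E" "z ~= 0" for z
 proof
  assume less: "v (bar z) < v z"
  obtain a b where ab: "a : F" "b : F" "z = a + b * s" "bar z = a - b * s" using z E_cases by blast
  have bz: "bar z : E" "bar z ~= 0" using z by (auto simp: bar_eq_0 bar_closed)
  have t: "bar z + z ~= 0" "v (bar z + z) = v (bar z)"
   using EE.v_add_less[OF bz, of z] z less by (auto simp: EE.vge_def)
  let ?t = "bar z + z"
  have tF: "?t : F" using trace_F[OF z(1)] by (simp add: add.commute)
  have nF: "z * bar z : F" using norm_F z by auto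
  let ?u = "1 - 4 * (z * bar z) / (?t * ?t)"
  have four: "(4::'k) = 2 * 2" by simp
  have "(4::'k) ~= 0" unfolding four using two_nonzero by (metis mult_eq_0_iff)
  moreover have "v 4 = 0" unfolding four using FF.v_mult[of 2 2] two_nonzero by simp
  moreover have "?u - 1 = - (4 * (z * bar z) / (?t * ?t))" by simp
  moreover have "v (4 * (z * bar z) / (?t * ?t)) = v z + v (bar z) - 2 * v (bar z)"
   using z bz t tF F_E[OF tF] \<open>v 4 = 0\<close> \<open>4 \<noteq> 0\<close>
   by (simp add: EE.v_divide EE.v_mult EE.mult_closed)
  moreover have "4 * (z * bar z) / (?t * ?t) : F" using nF tF by auto
  ultimately have "FF.vge 1 (?u - 1)" using less by (auto simp: FF.vge_def)
  then obtain w where w: "w : F" "w * w = ?u" using square_root_near_one by blast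
  have "(w * ?t) * (w * ?t) = ?t * ?t - 4 * (z * bar z)"
  proof -
   have "(w * ?t) * (w * ?t) = (w * w) * (?t * ?t)" by (simp only: ac_simps)
   also have "... = ?t * ?t - 4 * (z * bar z)"
    unfolding w(2) using t(1) by (simp only: left_diff_distrib) simp
   finally show ?thesis .
  qed
  also have "... = (2 * b * s) * (2 * b * s)" unfolding ab(4) unfolding ab(3) by (simp add: algebra_simps)
  finally have "w * ?t = 2 * b * s | w * ?t = - (2 * b * s)" by (simp only: square_eq_iff)
  then have "2 * b * s : F" using w(1) tF by (metis FF.mult_closed FF.uminus_closed minus_minus)
  moreover have "b ~= 0" using ab less by auto
  ultimately have "s : F" using FF.divide_closed[of "2 * b * s" "2 * b"] ab(2) two_nonzero by auto
  then show False using s_props by blast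
 qed
 show ?thesis
 proof (cases "z = 0")
  case False
  then show ?thesis using no[of z] no[of "bar z"] assms bar_eq_0[of z] bar_closed by fastforce
 qed simp
qed

lemma vge_bar: "z : E ==> EE.vge n (bar z) \<longleftrightarrow> EE.vge n z"
 by (auto simp: EE.vge_def bar_eq_0 bar_closed)

lemma v_norm: "z : E ==> z ~= 0 ==> v (z * bar z) = 2 * v z"
 by (simp add: EE.v_mult bar_closed bar_eq_0)

definition unif :: 'k where "unif = (SOME p. p : F & p ~= 0 & v p = 1)"

lemma unif: "unif : F" "unif ~= 0" "v unif = 1"
proof -
 have "EX p. p : F & p ~= 0 & v p = 1" using FF.v_uniformiser by blast
 then have "unif : F & unif ~= 0 & v unif = 1" unfolding unif_def by (rule someI_ex)
 then show "unif : F" "unif ~= 0" "v unif = 1" by auto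
qed

text \<open>A unit \<open>s\<^sub>0\<close> of \<open>E\<close> with square in \<open>F\<close>; it exists because the valuation of \<open>E\<close> is already
 attained on \<open>F\<close>.\<close>

definition s0 :: 'k where "s0 = s * unif powi (- v s)"

lemma s0: "s0 : E" "s0 ~= 0" "v s0 = 0" "bar s0 = - s0" "s0 * s0 : F"
proof -
 have p: "unif powi (- v s) : F" "unif powi (- v s) : E" "unif powi (- v s) ~= 0"
  "v (unif powi (- v s)) = - v s"
  using unif FF.powi_closed F_E FF.v_powi[of unif "- v s"] by auto
 show "s0 : E" "s0 ~= 0" "v s0 = 0" "bar s0 = - s0"
  using p s_E s_nonzero by (auto simp: s0_def EE.v_mult EE.mult_closed bar_mult bar_s)
 have "s0 * s0 = s\<^sup>2 * (unif powi (- v s) * unif powi (- v s))" by (simp add: s0_def power2_eq_square)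
 then show "s0 * s0 : F" using s_props(2) p(1) by (metis FF.mult_closed)
qed

end

text \<open>\<open>T\<close> contains exactly one representative of each class of \<open>A\<close> modulo the ideal of
 exponent \<open>n\<close>. All cardinalities below are computed with such systems instead of quotients.\<close>

context valued_field
begin

definition transversal :: "'k set => int => 'k set => bool" where
 "transversal A n T \<longleftrightarrow> finite T & T <= A & A <= S & (\<forall>a\<in>A. \<exists>!t. t : T & vge n (a - t))"

lemma transversalI:
 assumes "finite T" "T <= A" "A <= S" "!!a. a : A ==> \<exists>t\<in>T. vge n (a - t)"
  "!!t t'. t : T ==> t' : T ==> vge n (t - t') ==> t = t'"
 shows "transversal A n T"
 unfolding transversal_def
proof (intro conjI ballI ex_ex1I)
 fix a t t' assume "a : A" "t : T & vge n (a - t)" "t' : T & vge n (a - t')"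
 then show "t = t'" using assms(5) vge_trans vge_diff_commute by blast
next
 fix a assume "a : A"
 then show "EX t. t : T & vge n (a - t)" using assms(4) by blast
qed (use assms(1-3) in auto)

lemma transversalD:
 assumes "transversal A n T"
 shows "finite T" "T <= A" "A <= S" "!!a. a : A ==> \<exists>t\<in>T. vge n (a - t)"
  "!!t t'. t : T ==> t' : T ==> vge n (t - t') ==> t = t'"
proof -
 show "finite T" "T <= A" "A <= S" "!!a. a : A ==> \<exists>t\<in>T. vge n (a - t)"
  using assms unfolding transversal_def by blast+
 fix t t' assume t: "t : T" "t' : T" "vge n (t - t')"
 then have "\<exists>!r. r : T & vge n (t - r)" using assms unfolding transversal_def by blast
 then show "t = t'" using t by (metis vge_0 diff_self)
qed

lemma transversal_card_unique:
 assumes T: "transversal A n T" and T': "transversal A n T'"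
 shows "card T = card T'"
proof -
 have le: "card T <= card T'" if T: "transversal A n T" and T': "transversal A n T'" for T T'
 proof -
  note D = transversalD[OF T] and D' = transversalD[OF T']
  define f where "f a = (SOME t. t : T' & vge n (a - t))" for a
  have f: "f a : T' & vge n (a - f a)" if "a : T" for a
  proof -
   have "EX t. t : T' & vge n (a - t)" using D'(4)[of a] D(2) that by blast
   then show ?thesis unfolding f_def by (rule someI_ex)
  qed
  have "inj_on f T"
  proof
   fix a b assume ab: "a : T" "b : T" "f a = f b"
   then have "vge n (a - f a)" "vge n (f a - b)" using f[of a] f[of b] vge_diff_commute[of n b] by auto
   then have "vge n (a - b)" by (rule vge_trans)
   then show "a = b" using D(5) ab by blast
  qed
  then show ?thesis using f D'(1) by (intro card_inj_on_le[of f]) auto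
 qed
 show ?thesis using le[OF T T'] le[OF T' T] by simp
qed

lemma transversal_isometry:
 assumes T: "transversal A n T"
  and f: "!!a b. a : A ==> b : A ==> vge n (f a - f b) \<longleftrightarrow> vge n (a - b)" "f ` A <= S"
 shows "transversal (f ` A) n (f ` T)" "card (f ` T) = card T"
proof -
 note D = transversalD[OF T]
 have inj: "inj_on f T"
 proof
  fix a b assume ab: "a : T" "b : T" "f a = f b"
  then have "vge n (f a - f b)" by simp
  then have "vge n (a - b)" using f(1) ab D(2) by blast
  then show "a = b" using D(5) ab by blast
 qed
 then show "card (f ` T) = card T" by (rule card_image)
 show "transversal (f ` A) n (f ` T)"
 proof (rule transversalI)
  fix b assume "b : f ` A"
  then obtain a where a: "a : A" "b = f a" by blast
  then obtain t where "t : T" "vge n (a - t)" using D(4) by blast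
  then show "\<exists>t\<in>f ` T. vge n (b - t)" using a f(1) D(2) by blast
 next
  fix t t' assume t: "t : f ` T" "t' : f ` T" "vge n (t - t')"
  then obtain r r' where r: "r : T" "r' : T" "t = f r" "t' = f r'" by blast
  then have "r : A" "r' : A" using D(2) by auto
  then have "vge n (r - r')" using t(3) f(1) r by auto
  then show "t = t'" using r D(5) by blast
 qed (use D(1-2) f(2) in auto)
qed

lemma transversal_ball:
 assumes T: "transversal A n T" and "e <= n"
 shows "transversal {a : A. vge e (a - c)} n {t : T. vge e (t - c)}"
proof (rule transversalI)
 note D = transversalD[OF T]
 fix a assume a: "a : {a : A. vge e (a - c)}"
 then obtain t where t: "t : T" "vge n (a - t)" using D(4) by blast
 then have "vge e (t - a)" using vge_mono[OF _ assms(2)] vge_diff_commute by blast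
 then have "vge e (t - c)" using a vge_trans by blast
 then show "\<exists>t\<in>{t : T. vge e (t - c)}. vge n (a - t)" using t by blast
next
 fix t t' assume "t : {t : T. vge e (t - c)}" "t' : {t : T. vge e (t - c)}" "vge n (t - t')"
 then show "t = t'" using transversalD(5)[OF T] by blast
qed (use transversalD(1-3)[OF T] in auto)

lemma transversal_Un:
 assumes T: "transversal A n T" "transversal B n T'"
  and far: "!!a b. a : A ==> b : B ==> ~ vge n (a - b)"
 shows "transversal (A \<union> B) n (T \<union> T')" "card (T \<union> T') = card T + card T'"
proof -
 note D = transversalD[OF T(1)] and D' = transversalD[OF T(2)]
 show "card (T \<union> T') = card T + card T'"
 proof (rule card_Un_disjoint)
  show "T \<inter> T' = {}"
  proof (rule ccontr)
   assume "T \<inter> T' ~= {}"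
   then obtain t where "t : T" "t : T'" by blast
   then show False using far[of t t] D(2) D'(2) by auto
  qed
 qed (use D(1) D'(1) in auto)
 show "transversal (A \<union> B) n (T \<union> T')"
 proof (rule transversalI)
  fix a assume "a : A \<union> B"
  then show "\<exists>t\<in>T \<union> T'. vge n (a - t)" using D(4) D'(4) by blast
 next
  fix t t' assume t: "t : T \<union> T'" "t' : T \<union> T'" "vge n (t - t')"
  moreover from t(3) have "vge n (t' - t)" using vge_diff_commute by blast
  ultimately show "t = t'" using far D(2,5) D'(2,5) by blast
 qed (use D(1-3) D'(1-3) in auto)
qed

end

lemma card_image_same_kernel:
 assumes fg: "!!t t'. t : R ==> t' : R ==> f t = f t' \<longleftrightarrow> g t = g t'"
 shows "card (f ` R) = card (g ` R)"
proof -
 define h where "h y = (SOME t. t : R & f t = y)" for y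
 have h: "h y : R & f (h y) = y" if "y : f ` R" for y
  unfolding h_def using that by (intro someI_ex[of "%t. t : R & f t = y"]) auto
 have gh: "g (h (f t)) = g t" if "t : R" for t using h[of "f t"] fg[of "h (f t)" t] that by blast
 have inj: "inj_on (%y. g (h y)) (f ` R)"
 proof
  fix y y' assume y: "y : f ` R" "y' : f ` R" "g (h y) = g (h y')"
  then have "f (h y) = f (h y')" using h fg by blast
  then show "y = y'" using h y by simp
 qed
 have "(%y. g (h y)) ` f ` R = g ` R" unfolding image_image using gh by (rule image_cong[OF refl])
 then show ?thesis using card_image[OF inj] by simp
qed

context unramified_extension
begin

definition q :: nat where "q = card (residue_field F v)"

text \<open>The integers of \<open>F\<close> (for \<open>e = 0\<close>) and the powers of their maximal ideal.\<close>

definition ideal :: "int => 'k set" where "ideal e = {a : F. EE.vge e a}"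

lemma residue_transversal: "EX R. EE.transversal (ideal 0) 1 R & card R = q"
proof -
 define red where "red a = {b : integers_of F v. b - a : maximal_ideal_of F v}" for a
 have O: "integers_of F v = ideal 0"
  unfolding integers_of_def ideal_def EE.vge_def using F_E by auto
 have max: "a : maximal_ideal_of F v \<longleftrightarrow> EE.vge 1 a & a : F" for a
  unfolding maximal_ideal_of_def EE.vge_def using F_E by auto
 have fin: "finite (red ` ideal 0)" and q: "card (red ` ideal 0) = q"
  using F unfolding local_field_def residue_field_def q_def red_def O by auto
 have red_eq: "red a = red b \<longleftrightarrow> EE.vge 1 (a - b)" if "a : ideal 0" "b : ideal 0" for a b
 proof
  assume "red a = red b"
  moreover have "a : red a" using that by (auto simp: red_def O max)
  ultimately have "a : red b" by simp
  then show "EE.vge 1 (a - b)" unfolding red_def max by blast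
 next
  assume ab: "EE.vge 1 (a - b)"
  have sub: "red a <= red b" if ab: "EE.vge 1 (a - b)" "a : F" "b : F" for a b
  proof
   fix c assume "c : red a"
   then have "c : ideal 0" "EE.vge 1 (c - a)" unfolding red_def max O by auto
   moreover from this have "c : F" by (simp add: ideal_def)
   ultimately show "c : red b" unfolding red_def max O using ab EE.vge_trans by blast
  qed
  show "red a = red b"
   using sub[of a b] sub[of b a] ab that EE.vge_diff_commute by (auto simp: ideal_def)
 qed
 obtain R where R: "R <= ideal 0" "inj_on red R" "red ` R = red ` ideal 0"
  by (metis subset_image_inj order_refl)
 have "EE.transversal (ideal 0) 1 R"
 proof (rule EE.transversalI)
  show "finite R" using R fin by (metis finite_imageD)
  fix a assume a: "a : ideal 0"
  then obtain t where "t : R" "red a = red t" using R(3) by (metis imageE imageI)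
  then show "\<exists>t\<in>R. EE.vge 1 (a - t)" using red_eq a R(1) by blast
 next
  fix t t' assume t: "t : R" "t' : R" "EE.vge 1 (t - t')"
  then have "red t = red t'" using red_eq R(1) by blast
  then show "t = t'" using t R(2) by (auto dest: inj_onD)
 qed (use R F_E in \<open>auto simp: ideal_def\<close>)
 moreover have "card R = q" using R q by (metis card_image)
 ultimately show ?thesis by blast
qed

lemma ideal_closed:
 "a : ideal e ==> b : ideal e ==> a + b : ideal e" "a : ideal e ==> b : ideal e ==> a - b : ideal e"
 "a : ideal e ==> b : ideal 0 ==> a * b : ideal e" "0 : ideal e" "a : ideal e ==> - a : ideal e"
 unfolding ideal_def using EE.vge_add EE.vge_diff EE.vge_mult0 EE.vge_minus by auto

lemma ideal_scale:
 assumes "c : F" "c ~= 0"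
 shows "(%a. c * a) ` ideal e = ideal (v c + e)"
proof (intro Set.set_eqI iffI)
 fix b assume "b : ideal (v c + e)"
 moreover from this assms have "b / c : F" by (auto simp: ideal_def)
 ultimately have "b / c : ideal e" using assms F_E EE.vge_scale[of c "b/c" "v c + e"] by (auto simp: ideal_def)
 then show "b : (%a. c * a) ` ideal e" using assms by (intro image_eqI[of _ _ "b/c"]) auto
qed (use assms F_E EE.vge_scale[of c _ "v c + e"] in \<open>auto simp: ideal_def\<close>)

text \<open>The squares and the values \<open>u + s\<^sub>0\<^sup>2 t\<^sup>2\<close> each fill more than half of the residue
 field, so they meet; Hensel's lemma lifts the resulting solution of
 \<open>a\<^sup>2 - s\<^sub>0\<^sup>2 b\<^sup>2 = u\<close>.\<close>

lemma unit_is_norm: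
 assumes u: "u : F" "u ~= 0" "v u = 0"
 shows "\<exists>l\<in>E. l ~= 0 & l * bar l = u"
proof -
 let ?d = "s0 * s0"
 have d: "?d : F" "?d : E" "?d ~= 0" "v ?d = 0"
  using s0 F_E EE.v_mult[of s0 s0] by auto
 have uE: "u : E" using u F_E by auto
 obtain R where R: "EE.transversal (ideal 0) 1 R" "card R = q" using residue_transversal by blast
 note D = EE.transversalD[OF R(1)]
 define rep where "rep a = (THE t. t : R & EE.vge 1 (a - t))" for a
 have rep: "rep a : R" "EE.vge 1 (a - rep a)" if "a : ideal 0" for a
  using that R(1) theI'[of "%t. t : R & EE.vge 1 (a - t)"]
  unfolding rep_def EE.transversal_def by auto
 have rep_eq: "rep a = rep b \<longleftrightarrow> EE.vge 1 (a - b)" if "a : ideal 0" "b : ideal 0" for a b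
 proof
  assume "rep a = rep b"
  then have "EE.vge 1 (rep a - b)"
   using rep(2)[OF that(2)] EE.vge_diff_commute[of 1 b "rep b"] by simp
  then show "EE.vge 1 (a - b)" by (rule EE.vge_trans[OF rep(2)[OF that(1)]])
 next
  assume "EE.vge 1 (a - b)"
  then have "EE.vge 1 (rep a - rep b)"
   using rep(2)[OF that(1)] rep(2)[OF that(2)] EE.vge_trans EE.vge_diff_commute[of 1 a "rep a"] by blast
  then show "rep a = rep b" using D(5) rep(1) that by blast
 qed
 have RO: "t : ideal 0" "t : F" "t : E" "EE.vge 0 t" if "t : R" for t
  using D(2) that F_E by (auto simp: ideal_def)
 have sq: "t * t : ideal 0" and ut: "u + ?d * (t * t) : ideal 0" if "t : R" for t
 proof -
  have "u : ideal 0" "?d : ideal 0" using u d uE by (auto simp: ideal_def EE.vge_def)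
  then show "t * t : ideal 0" "u + ?d * (t * t) : ideal 0" using RO[OF that] ideal_closed by auto
 qed
 define f where "f t = rep (t * t)" for t
 define g where "g t = rep (u + ?d * (t * t))" for t
 have fg: "f t = f t' \<longleftrightarrow> g t = g t'" if "t : R" "t' : R" for t t'
 proof -
  have "g t = g t' \<longleftrightarrow> EE.vge 1 (?d * (t * t - t' * t'))"
   unfolding g_def using rep_eq[OF ut[OF that(1)] ut[OF that(2)]] by (simp add: algebra_simps)
  also have "... \<longleftrightarrow> EE.vge 1 (t * t - t' * t')"
   using EE.vge_scale[of ?d "t * t - t' * t'" 1] d RO that by auto
  also have "... \<longleftrightarrow> f t = f t'" unfolding f_def using rep_eq[OF sq[OF that(1)] sq[OF that(2)]] by blast
  finally show ?thesis by blast
 qed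
 have fib: "t' = t | t' = rep (- t)" if "t : R" "t' : R" "f t = f t'" for t t'
 proof -
  have "EE.vge 1 (t * t - t' * t')" using that(3) rep_eq[OF sq[OF that(1)] sq[OF that(2)]] unfolding f_def by blast
  then have *: "EE.vge 1 ((t - t') * (t + t'))" by (simp add: algebra_simps)
  show ?thesis
  proof (cases "EE.vge 1 (t - t')")
   case False
   then have nz: "t - t' ~= 0" by auto
   have "EE.vge 0 (t - t')" by (rule EE.vge_diff[OF RO(4)[OF that(1)] RO(4)[OF that(2)]])
   moreover have tt: "t - t' : E" "t + t' : E" using RO(3)[OF that(1)] RO(3)[OF that(2)] by auto
   ultimately have "v (t - t') = 0" using False nz EE.vge_iff[OF tt(1) nz] by simp
   then have "EE.vge 1 (t + t')" using EE.vge_scale[OF tt(1) nz tt(2), of 1] * by simp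
   then have "EE.vge 1 (- t - t')" using EE.vge_minus[of 1 "t + t'"] by simp
   then have "rep (- t) = rep t'"
    using rep_eq[OF ideal_closed(5)[OF RO(1)[OF that(1)]] RO(1)[OF that(2)]] by blast
   moreover have "EE.vge 1 (rep t' - t')"
    using rep(2)[OF RO(1)[OF that(2)]] EE.vge_diff_commute[of 1 t' "rep t'"] by blast
   then have "rep t' = t'" by (rule D(5)[OF rep(1)[OF RO(1)[OF that(2)]] that(2)])
   ultimately show ?thesis by simp
  next
   case True
   then have "t = t'" by (rule D(5)[OF that(1,2)])
   then show ?thesis by simp
  qed
 qed
 have finR: "finite R" by (rule D(1))
 define z where "z = rep 0"
 have z: "z : R" "EE.vge 1 z" using rep[of 0] ideal_closed(4) EE.vge_minus[of 1 "- z"] by (auto simp: z_def)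
 have cf: "card R <= 2 * card (f ` R) - 1"
 proof -
  have "card R = (\<Sum>y\<in>f ` R. card {t : R. f t = y})"
   using sum.image_gen[OF finR, of "%_. 1::nat" f] by (simp only: card_eq_sum)
  also have "... <= (\<Sum>y\<in>f ` R. if y = f z then 1 else 2)"
  proof (rule sum_mono)
   fix y assume "y : f ` R"
   then obtain t where t: "t : R" "y = f t" by blast
   show "card {t : R. f t = y} <= (if y = f z then 1 else 2)"
   proof (cases "y = f z")
    case True
    have "rep (- z) = rep 0"
    using rep_eq[of "- z" 0] RO(1)[OF z(1)] ideal_closed EE.vge_minus[OF z(2)] by simp
    then have "rep (- z) = z" by (simp add: z_def)
    then have "{t : R. f t = y} <= {z}" using fib[OF z(1)] unfolding True by fastforce
    then have "card {t : R. f t = y} <= 1" using card_mono[of "{z}"] by fastforce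
    then show ?thesis using True by simp
   next
    case False
    have "{t : R. f t = y} <= {t, rep (- t)}" using fib[OF t(1)] unfolding t(2) by fastforce
    then have "card {t : R. f t = y} <= card {t, rep (- t)}" by (intro card_mono) auto
    also have "... <= 2" by (simp add: card_insert_if)
    finally show ?thesis using False by simp
   qed
  qed
  also have "... = 2 * card (f ` R) - 1"
  proof -
   have "(\<Sum>y\<in>f ` R. if y = f z then 1 else 2) = 1 + (\<Sum>y\<in>f ` R - {f z}. if y = f z then 1 else (2::nat))"
    using sum.remove[of "f ` R" "f z" "%y. if y = f z then 1 else (2::nat)"] finR z(1) by simp
   also have "(\<Sum>y\<in>f ` R - {f z}. if y = f z then 1 else (2::nat)) = (\<Sum>y\<in>f ` R - {f z}. 2)"
    by (rule sum.cong) auto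
   also have "... = 2 * (card (f ` R) - 1)" using finR z(1) by simp
   finally show ?thesis using finR z(1) card_gt_0_iff[of "f ` R"] by auto
  qed
  finally show ?thesis .
 qed
 have "card (f ` R) = card (g ` R)" using fg by (rule card_image_same_kernel)
 have "f ` R \<inter> g ` R ~= {}"
 proof
  assume "f ` R \<inter> g ` R = {}"
  then have "card (f ` R \<union> g ` R) = 2 * card (f ` R)"
   using \<open>card (f ` R) = card (g ` R)\<close> finR by (simp add: card_Un_disjoint)
  moreover have "card (f ` R \<union> g ` R) <= card R"
  proof (rule card_mono[OF finR])
   show "f ` R \<union> g ` R <= R" using rep(1)[OF sq] rep(1)[OF ut] unfolding f_def g_def by blast
  qed
  moreover have "card R > 0" using z finR card_gt_0_iff by blast
  ultimately show False using cf by linarith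
 qed
 then obtain t r where tr: "t : R" "r : R" "f t = g r" by blast
 then have main: "EE.vge 1 (t * t - (u + ?d * (r * r)))"
  using rep_eq[OF sq[OF tr(1)] ut[OF tr(2)]] tr(3) unfolding f_def g_def by blast
 note E = RO[OF tr(1)] RO[OF tr(2)]
 have unit: "\<exists>w\<in>F. w * w = a / b" if "a : F" "b : F" "b ~= 0" "v b = 0" "EE.vge 1 (b - a)" for a b
 proof -
  have "a / b - 1 = inverse b * (a - b)" using that by (simp add: field_simps)
  moreover have "EE.vge 1 (inverse b * (a - b))"
   using that EE.vge_diff_commute[of 1 a b] F_E EE.v_inverse[of b]
   by (intro EE.vge_mult0(2)) (auto simp: EE.vge_def)
  ultimately have "FF.vge 1 (a / b - 1)" using vge_F that FF.diff_closed FF.divide_closed by auto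
  then show ?thesis using square_root_near_one by blast
 qed
 have "\<exists>a\<in>F. \<exists>b\<in>F. a * a - b * b * ?d = u"
 proof (cases "EE.vge 1 t")
  case False
  then have t: "t ~= 0" "v t = 0" using E by (auto simp: EE.vge_def)
  then have "v (t * t) = 0" using EE.v_mult E by simp
  moreover have "u + ?d * (r * r) : F" using u d E by auto
  ultimately obtain w where w: "w : F" "w * w = (u + ?d * (r * r)) / (t * t)"
   using unit[OF _ _ _ _ main] t E by auto
  then have "(w * t) * (w * t) - r * r * ?d = u" using t by (simp add: field_simps)
  then show ?thesis using w E by (metis FF.mult_closed)
 next
  case True
  then have tt: "EE.vge 1 (t * t)" using E EE.vge_mult0(1) by auto
  have m: "EE.vge 1 (u + ?d * (r * r))" using EE.vge_diff[OF tt main] by simp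
  have r: "r ~= 0 & v r = 0"
  proof (rule ccontr)
   assume "~ ?thesis"
   then have "EE.vge 1 r" using E by (auto simp: EE.vge_def)
   then have "EE.vge 1 (r * r)" by (rule EE.vge_mult0(1)) (rule E(8))
   moreover have "EE.vge 0 ?d" using d by (simp add: EE.vge_def)
   ultimately have "EE.vge 1 (?d * (r * r))" using EE.vge_mult0(2)[of ?d 1 "r * r"] by blast
   then have "EE.vge 1 u" using EE.vge_diff[OF m, of "?d * (r * r)"] by simp
   then show False using u by (auto simp: EE.vge_def)
  qed
  then have "v (?d * (r * r)) = 0" using EE.v_mult d E by simp
  moreover have "EE.vge 1 (?d * (r * r) - (t * t - u))" using EE.vge_minus[OF main] by (simp add: algebra_simps)
  ultimately obtain w where w: "w : F" "w * w = (t * t - u) / (?d * (r * r))"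
   using unit[of "t * t - u" "?d * (r * r)"] d r E u by auto
  then have "t * t - (w * r) * (w * r) * ?d = u" using r d by (simp add: field_simps)
  then show ?thesis using w E by (metis FF.mult_closed)
 qed
 then obtain a b where ab: "a : F" "b : F" "a * a - b * b * ?d = u" by blast
 have abE: "a : E" "b : E" using ab F_E by auto
 have "bar (a + b * s0) = a - b * s0"
  using ab abE s0 by (simp add: bar_add bar_mult EE.mult_closed)
 then have "(a + b * s0) * bar (a + b * s0) = a * a - b * b * ?d" by (simp only:) (simp add: algebra_simps)
 then have "(a + b * s0) * bar (a + b * s0) = u" by (simp only: ab(3))
 moreover have "a + b * s0 : E" using abE s0 by auto
 ultimately show ?thesis using u(2) by (metis mult_zero_left)
qed

lemma norm_of_even:
 assumes a: "a : F" "a ~= 0" "even (v a)"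
 shows "\<exists>l\<in>E. l ~= 0 & l * bar l = a"
proof -
 obtain k where k: "v a = 2 * k" using a(3) by (rule evenE)
 let ?p = "unif powi k"
 have p: "?p : F" "?p ~= 0" "v ?p = k" "?p : E"
  using unif FF.powi_closed FF.v_powi[of unif k] F_E by auto
 have "v (a / (?p * ?p)) = 0" using a k p by (simp add: FF.v_divide FF.v_mult FF.mult_closed)
 moreover have "a / (?p * ?p) : F" "a / (?p * ?p) ~= 0" using a p by auto
 ultimately obtain l where l: "l : E" "l ~= 0" "l * bar l = a / (?p * ?p)" using unit_is_norm by blast
 have "bar (?p * l) = ?p * bar l" using p l(1) by (simp add: bar_mult)
 then have "(?p * l) * bar (?p * l) = (?p * ?p) * (l * bar l)" by (simp only: ac_simps)
 also have "... = a" unfolding l(3) using p(2) by simp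
 finally have "(?p * l) * bar (?p * l) = a" .
 moreover have "?p * l : E" "?p * l ~= 0" using l p by auto
 ultimately show ?thesis by blast
qed

end

section \<open>Counting norm one elements modulo powers of the maximal ideal\<close>

context unramified_extension
begin

lemma vge_s0: "EE.vge 0 s0" using s0 by (simp add: EE.vge_def)

lemma q_pos: "q > 0"
proof -
 obtain R where R: "EE.transversal (ideal 0) 1 R" "card R = q" using residue_transversal by blast
 have "R ~= {}" using EE.transversalD(4)[OF R(1) ideal_closed(4)] by auto
 then show ?thesis using EE.transversalD(1)[OF R(1)] R(2) by (simp add: card_gt_0_iff flip: R(2))
qed

lemma ideal_transversal_0: "EX T. EE.transversal (ideal 0) (int n) T & card T = q ^ n"
proof (induction n)
 case 0
 have "EE.transversal (ideal 0) 0 {0}"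
  by (rule EE.transversalI) (auto simp: ideal_def F_E)
 then show ?case by (intro exI[of _ "{0}"]) simp
next
 case (Suc n)
 obtain T where T: "EE.transversal (ideal 0) (int n) T" "card T = q ^ n" using Suc by blast
 obtain R where R: "EE.transversal (ideal 0) 1 R" "card R = q" using residue_transversal by blast
 note D = EE.transversalD[OF T(1)] and DR = EE.transversalD[OF R(1)]
 have u: "unif : E" "unif ~= 0" "v unif = 1" "unif : F" using unif F_E by auto
 have O: "a : F" "a : E" "EE.vge 0 a" if "a : ideal 0" for a using that F_E by (auto simp: ideal_def)
 define f where "f = (%(r, t). r + unif * t)"
 have mult: "unif * a : ideal 1" if "a : ideal 0" for a
  using ideal_scale[OF u(4,2), of 0] that u(3) by auto
 have same: "r = r' & t = t'"
  if rt: "r : R" "r' : R" "t : T" "t' : T" "EE.vge (int (Suc n)) (f (r, t) - f (r', t'))" for r r' t t'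
 proof -
  have I: "r : ideal 0" "r' : ideal 0" "t : ideal 0" "t' : ideal 0" using rt DR(2) D(2) by auto
  have "EE.vge 1 (unif * t' - unif * t)"
   using mult[OF I(3)] mult[OF I(4)] EE.vge_diff by (simp add: ideal_def)
  then have "EE.vge 1 ((f (r, t) - f (r', t')) + (unif * t' - unif * t))"
   using EE.vge_mono[OF rt(5), of 1] by (intro EE.vge_add) auto
  then have "EE.vge 1 (r - r')" by (simp add: f_def algebra_simps)
  then have r: "r = r'" by (rule DR(5)[OF rt(1,2)])
  then have "EE.vge (int (Suc n)) (unif * (t - t'))" using rt(5) by (simp add: f_def algebra_simps)
  then have "EE.vge (int n) (t - t')"
   using EE.vge_scale[of unif "t - t'" "int (Suc n)"] u O(2)[OF I(3)] O(2)[OF I(4)] by simp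
  then show ?thesis using D(5)[OF rt(3,4)] r by blast
 qed
 have inj: "inj_on f (R \<times> T)"
 proof
  fix a b assume ab: "a : R \<times> T" "b : R \<times> T" "f a = f b"
  then show "a = b" using same[of "fst a" "fst b" "snd a" "snd b"] by (auto simp: prod_eq_iff)
 qed
 have "EE.transversal (ideal 0) (int (Suc n)) (f ` (R \<times> T))"
 proof (rule EE.transversalI)
  show "finite (f ` (R \<times> T))" using D(1) DR(1) by simp
  show "ideal 0 <= E" by (rule D(3))
  show "f ` (R \<times> T) <= ideal 0"
  proof
   fix a assume "a : f ` (R \<times> T)"
   then obtain r t where rt: "r : R" "t : T" "a = r + unif * t" by (auto simp: f_def)
   have "unif * t : ideal 0" using mult[of t] D(2) rt(2) EE.vge_mono[of 1 _ 0] by (auto simp: ideal_def)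
   then show "a : ideal 0" using rt DR(2) ideal_closed(1) by blast
  qed
 next
  fix a assume a: "a : ideal 0"
  obtain r where r: "r : R" "EE.vge 1 (a - r)" using DR(4)[OF a] by blast
  have rI: "r : ideal 0" using r DR(2) by blast
  have "a - r : ideal 1" using r O[OF a] O[OF rI] by (auto simp: ideal_def)
  then obtain b where b: "b : ideal 0" "a - r = unif * b" using ideal_scale[OF u(4,2), of 0] u(3) by auto
  obtain t where t: "t : T" "EE.vge (int n) (b - t)" using D(4)[OF b(1)] by blast
  have tI: "t : ideal 0" using t D(2) by blast
  have "EE.vge (int (Suc n)) (unif * (b - t))"
   using t(2) EE.vge_scale[of unif "b - t" "int (Suc n)"] u O[OF b(1)] O[OF tI] by simp
  moreover have "unif * (b - t) = a - f (r, t)" using b(2) by (simp add: f_def algebra_simps)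
  ultimately show "\<exists>t\<in>f ` (R \<times> T). EE.vge (int (Suc n)) (a - t)" using r t by auto
 next
  fix a b assume "a : f ` (R \<times> T)" "b : f ` (R \<times> T)" "EE.vge (int (Suc n)) (a - b)"
  then show "a = b" using same by blast
 qed
 moreover have "card (f ` (R \<times> T)) = q ^ Suc n" using card_image[OF inj] T R by (simp add: card_cartesian_product)
 ultimately show ?case by blast
qed

lemma ideal_transversal:
 assumes "e <= n"
 shows "EX T. EE.transversal (ideal e) n T & card T = q ^ nat (n - e)"
proof -
 let ?p = "unif powi e"
 have p: "?p : F" "?p : E" "?p ~= 0" "v ?p = e"
  using unif F_E FF.powi_closed FF.v_powi[of unif e] by auto
 obtain T where T: "EE.transversal (ideal 0) (n - e) T" "card T = q ^ nat (n - e)"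
  using ideal_transversal_0[of "nat (n - e)"] assms by auto
 have T': "EE.transversal (ideal e) n ((%a. ?p * a) ` T)" "card ((%a. ?p * a) ` T) = card T"
 proof -
  have iso: "EE.vge n (?p * a - ?p * b) \<longleftrightarrow> EE.vge (n - e) (a - b)" if "a : ideal 0" "b : ideal 0" for a b
   using EE.vge_scale[of ?p "a - b" n] p that F_E by (auto simp: ideal_def right_diff_distrib)
  have inj: "inj_on (%a. ?p * a) T" using p by (auto intro: inj_onI)
  then show "card ((%a. ?p * a) ` T) = card T" by (rule card_image)
  note D = EE.transversalD[OF T(1)]
  have img: "(%a. ?p * a) ` ideal 0 = ideal e" using ideal_scale[OF p(1,3), of 0] p by simp
  show "EE.transversal (ideal e) n ((%a. ?p * a) ` T)"
  proof (rule EE.transversalI)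
   show "finite ((%a. ?p * a) ` T)" using D(1) by simp
   show "(%a. ?p * a) ` T <= ideal e" using D(2) img by blast
   show "ideal e <= E" using F_E by (auto simp: ideal_def)
  next
   fix a assume "a : ideal e"
   then obtain b where b: "b : ideal 0" "a = ?p * b" using img by blast
   then obtain t where t: "t : T" "EE.vge (n - e) (b - t)" using D(4) by blast
   then have "EE.vge n (a - ?p * t)" using iso[of b t] b D(2) by blast
   then show "\<exists>t\<in>(%a. ?p * a) ` T. EE.vge n (a - t)" using t by blast
  next
   fix a b assume "a : (%a. ?p * a) ` T" "b : (%a. ?p * a) ` T" and ab: "EE.vge n (a - b)"
   then obtain t t' where t: "t : T" "t' : T" "a = ?p * t" "b = ?p * t'" by blast
   then have "t : ideal 0" "t' : ideal 0" using D(2) by auto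
   then have "EE.vge (n - e) (t - t')" using iso[of t t'] ab t by simp
   then have "t = t'" by (rule D(5)[OF t(1,2)])
   then show "a = b" using t by simp
  qed
 qed
 then show ?thesis using T(2) by auto
qed

definition U1 :: "'k set" where "U1 = {z : E. z * bar z = 1}"

lemma U1D: "z : U1 ==> z : E" "z : U1 ==> z ~= 0" "z : U1 ==> bar z = inverse z"
 "z : U1 ==> v z = 0" "z : U1 ==> EE.vge 0 z"
proof -
 assume z: "z : U1"
 then show E: "z : E" and nz: "z ~= 0" by (auto simp: U1_def)
 show "bar z = inverse z" using z by (metis (mono_tags, lifting) U1_def mem_Collect_eq inverse_unique)
 show "v z = 0" using v_norm[OF E nz] z by (simp add: U1_def)
 then show "EE.vge 0 z" using E by (simp add: EE.vge_def)
qed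

lemma U1_mult: "z : U1 ==> w : U1 ==> z * w : U1"
proof -
 assume a: "z : U1" "w : U1"
 have b: "bar (z * w) = bar z * bar w" by (rule bar_mult[OF U1D(1)[OF a(1)] U1D(1)[OF a(2)]])
 have "(z * w) * bar (z * w) = (z * bar z) * (w * bar w)" unfolding b by (simp only: ac_simps)
 also have "... = 1" using a unfolding U1_def by simp
 finally show ?thesis using EE.mult_closed[OF U1D(1)[OF a(1)] U1D(1)[OF a(2)]] by (simp add: U1_def)
qed

lemma U1_inverse: "z : U1 ==> inverse z : U1"
proof -
 assume z: "z : U1"
 have "bar (inverse z) = z" using bar_inverse[OF U1D(1)[OF z]] U1D(3)[OF z] by simp
 then show ?thesis using U1D(2)[OF z] EE.inverse_closed[OF U1D(1)[OF z]] by (simp add: U1_def)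
qed

lemma U1_minus: "z : U1 ==> - z : U1"
 by (simp add: U1_def bar_minus)

lemma U1_one: "1 : U1" by (simp add: U1_def)

text \<open>The two Cayley maps: they identify the norm one elements with the projective line over
 the integers of \<open>F\<close>, in its two affine charts \<open>[1 : b]\<close> and \<open>[a : 1]\<close> with \<open>a\<close> in the maximal
 ideal, and they are isometries.\<close>

definition cay :: "'k => 'k" where "cay b = (1 + b * s0) / (1 - b * s0)"
definition cay' :: "'k => 'k" where "cay' a = (a + s0) / (a - s0)"

lemma v_unit_of_sum:
 assumes "w : E" "EE.vge 0 w" "w + bar w = 2 | w - bar w = 2 * s0 | w - bar w = - (2 * s0)"
 shows "w ~= 0 & v w = 0"
proof (rule ccontr)
 assume "~ ?thesis"
 then have w: "EE.vge 1 w" using assms(1,2) by (auto simp: EE.vge_def)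
 then have bw: "EE.vge 1 (bar w)" using vge_bar assms(1) by blast
 have "v (2 * s0) = 0" "2 * s0 : E" "2 * s0 ~= 0" using EE.v_mult[of 2 s0] s0 two_nonzero by auto
 moreover have "EE.vge 1 (w + bar w)" "EE.vge 1 (w - bar w)" using w bw EE.vge_add EE.vge_diff by auto
 ultimately show False using assms(3) two_nonzero EE.v_minus[of "2 * s0"] by (auto simp: EE.vge_def)
qed

lemma denominators:
 assumes b: "b : ideal 0"
 shows "1 - b * s0 ~= 0" "v (1 - b * s0) = 0" "1 + b * s0 ~= 0" "v (1 + b * s0) = 0"
  "b - s0 ~= 0 | b ~: ideal 1" "b : ideal 1 ==> v (b - s0) = 0"
  "bar (1 - b * s0) = 1 + b * s0" "bar (b - s0) = b + s0" "bar (1 + b * s0) = 1 - b * s0" "bar (b + s0) = b - s0"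
proof -
 have bb: "b : F" "b : E" "EE.vge 0 b" using b F_E by (auto simp: ideal_def)
 show bars: "bar (1 - b * s0) = 1 + b * s0" "bar (b - s0) = b + s0" "bar (1 + b * s0) = 1 - b * s0" "bar (b + s0) = b - s0"
  using bb s0 by (simp_all add: bar_add bar_mult bar_diff)
 have "EE.vge 0 (b * s0)" using EE.vge_mult0 bb vge_s0 by blast
 then have i: "EE.vge 0 (1 - b * s0)" "EE.vge 0 (1 + b * s0)" "EE.vge 0 (b - s0)"
  using EE.vge_diff[of 0 1] EE.vge_add[of 0 1] EE.vge_diff[OF bb(3) vge_s0] by auto
 have "(1 - b * s0) + (1 + b * s0) = 2" "(1 + b * s0) + (1 - b * s0) = 2" by simp_all
 then show "1 - b * s0 ~= 0" "v (1 - b * s0) = 0" "1 + b * s0 ~= 0" "v (1 + b * s0) = 0"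
  using v_unit_of_sum[of "1 - b * s0"] v_unit_of_sum[of "1 + b * s0"] i bb s0 bars by auto
 have "(b - s0) - (b + s0) = - (2 * s0)" by simp
 then have "b - s0 ~= 0 & v (b - s0) = 0"
  using v_unit_of_sum[of "b - s0"] i bb s0 bars by auto
 then show "b - s0 ~= 0 | b ~: ideal 1" "b : ideal 1 ==> v (b - s0) = 0" by auto
qed

lemma cay_isometry:
 assumes "b : ideal 0" "c : ideal 0"
 shows "EE.vge n (cay b - cay c) \<longleftrightarrow> EE.vge n (b - c)"
proof -
 note B = denominators[OF assms(1)] and C = denominators[OF assms(2)]
 have E: "b : E" "c : E" using assms F_E by (auto simp: ideal_def)
 let ?k = "2 * s0 / ((1 - b * s0) * (1 - c * s0))"
 have k: "?k : E" "?k ~= 0" "v ?k = 0"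
  using B C E s0 two_nonzero by (auto simp: EE.v_divide EE.v_mult)
 have "cay b - cay c = ?k * (b - c)"
  unfolding cay_def using B(1) C(1) by (simp add: divide_simps) (simp add: algebra_simps)
 then show ?thesis using EE.vge_scale[of ?k "b - c" n] k E by simp
qed

lemma cay'_isometry:
 assumes "b : ideal 1" "c : ideal 1"
 shows "EE.vge n (cay' b - cay' c) \<longleftrightarrow> EE.vge n (b - c)"
proof -
 have I: "b : ideal 0" "c : ideal 0" using assms EE.vge_mono[of 1 _ 0] by (auto simp: ideal_def)
 note B = denominators[OF I(1)] and C = denominators[OF I(2)]
 have nz: "b - s0 ~= 0" "c - s0 ~= 0" "v (b - s0) = 0" "v (c - s0) = 0" using B C assms by auto
 have E: "b : E" "c : E" using assms F_E by (auto simp: ideal_def)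
 let ?k = "- (2 * s0) / ((b - s0) * (c - s0))"
 have k: "?k : E" "?k ~= 0" "v ?k = 0"
  using nz E s0 two_nonzero by (auto simp: EE.v_divide EE.v_mult)
 have "cay' b - cay' c = ?k * (b - c)"
  unfolding cay'_def using nz(1,2) by (simp add: divide_simps) (simp add: algebra_simps)
 then show ?thesis using EE.vge_scale[of ?k "b - c" n] k E by simp
qed

lemma cay_U1: assumes b: "b : ideal 0" shows "cay b : U1" "v (cay b + 1) = 0" "cay b + 1 ~= 0"
proof -
 note B = denominators[OF b]
 have E: "b : E" using b F_E by (auto simp: ideal_def)
 have "bar (cay b) = (1 - b * s0) / (1 + b * s0)"
  unfolding cay_def using B E s0 by (simp add: bar_divide)
 then have "cay b * bar (cay b) = 1" unfolding cay_def using B by simp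
 moreover have "cay b : E" unfolding cay_def using E s0 by auto
 ultimately show "cay b : U1" by (simp add: U1_def)
 have "cay b + 1 = 2 / (1 - b * s0)" unfolding cay_def using B by (simp add: field_simps)
 then show "v (cay b + 1) = 0" "cay b + 1 ~= 0" using B E s0 two_nonzero by (auto simp: EE.v_divide)
qed

lemma cay'_U1: assumes b: "b : ideal 1" shows "cay' b : U1" "EE.vge 1 (cay' b + 1)"
proof -
 have I: "b : ideal 0" using b EE.vge_mono[of 1 _ 0] by (auto simp: ideal_def)
 note B = denominators[OF I]
 have nz: "b - s0 ~= 0" "v (b - s0) = 0" using B b by auto
 have E: "b : E" using b F_E by (auto simp: ideal_def)
 have nz': "b + s0 ~= 0" using bar_eq_0[of "b - s0"] nz(1) B(8) E s0 by auto
 have "bar (cay' b) = (b - s0) / (b + s0)"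
  unfolding cay'_def using B E s0 by (simp add: bar_divide)
 then have "cay' b * bar (cay' b) = 1" unfolding cay'_def using nz nz' by simp
 moreover have "cay' b : E" unfolding cay'_def using E s0 by auto
 ultimately show "cay' b : U1" by (simp add: U1_def)
 have e: "cay' b + 1 = 2 / (b - s0) * b" unfolding cay'_def using nz by (simp add: field_simps)
 have k: "2 / (b - s0) : E" "2 / (b - s0) ~= 0" "v (2 / (b - s0)) = 0"
  using nz E s0 two_nonzero by (auto simp: EE.v_divide)
 show "EE.vge 1 (cay' b + 1)" unfolding e using EE.vge_scale[OF k(1,2) E, of 1] k(3) b by (simp add: ideal_def)
qed

lemma U1_cayley:
 assumes z: "z : U1"
 shows "z : cay ` ideal 0 \<union> cay' ` ideal 1"
proof (cases "EE.vge 1 (z + 1)")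
 case True
 note Z = U1D[OF z]
 have "EE.vge (v 2 + 1) (- (z + 1))" using EE.vge_minus[OF True] by simp
 then have "2 + - (z + 1) ~= 0 & v (2 + - (z + 1)) = v 2"
  using EE.v_add_less[of 2 "- (z + 1)"] two_nonzero by auto
 moreover have "2 + - (z + 1) = - (z - 1)" by simp
 ultimately have z1: "z - 1 ~= 0" "v (z - 1) = 0" using Z(1) EE.v_minus[of "z - 1"] by auto
 let ?a = "s0 * ((z + 1) / (z - 1))"
 have "bar ?a = - s0 * ((inverse z + 1) / (inverse z - 1))"
  using Z(1,3) s0 by (simp add: bar_mult bar_divide bar_add bar_diff)
 also have "(inverse z + 1) / (inverse z - 1) = - ((z + 1) / (z - 1))"
  using Z(2) z1(1) by (simp add: divide_simps) (simp add: algebra_simps)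
 finally have "bar ?a = ?a" by simp
 then have aF: "?a : F" using Z(1) s0 by (intro bar_fixed) auto
 have k: "s0 / (z - 1) : E" "s0 / (z - 1) ~= 0" "v (s0 / (z - 1)) = 0"
  using z1 s0 Z(1) by (auto simp: EE.v_divide)
 have "EE.vge 1 ((s0 / (z - 1)) * (z + 1))" using EE.vge_scale[OF k(1,2), of "z + 1" 1] k(3) True Z(1) by simp
 then have "?a : ideal 1" using aF by (simp add: ideal_def)
 moreover have "cay' ?a = z"
 proof -
  have "?a + s0 = s0 * 2 * z / (z - 1)" "?a - s0 = s0 * 2 / (z - 1)" using z1(1) by (simp_all add: field_simps)
  then show ?thesis unfolding cay'_def using z1(1) s0(2) two_nonzero by simp
 qed
 ultimately show ?thesis by (metis UnI2 imageI)
next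
 case False
 note Z = U1D[OF z]
 have "EE.vge 0 (z + 1)" using EE.vge_add[OF Z(5), of 1] by simp
 then have z1: "z + 1 ~= 0" "v (z + 1) = 0" using False Z(1) by (auto simp: EE.vge_def)
 let ?b = "(z - 1) / (s0 * (z + 1))"
 have "bar ?b = (inverse z - 1) / (- s0 * (inverse z + 1))"
  using Z(1,3) s0 by (simp add: bar_mult bar_divide bar_add bar_diff)
 also have "... = ?b"
  using Z(2) z1(1) s0(2) by (simp add: divide_simps) (simp add: algebra_simps)
 finally have bF: "?b : F" using Z(1) s0 by (intro bar_fixed) auto
 have k: "1 / (s0 * (z + 1)) : E" "1 / (s0 * (z + 1)) ~= 0" "v (1 / (s0 * (z + 1))) = 0"
  using z1 s0 Z(1) by (auto simp: EE.v_divide EE.v_mult)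
 have "EE.vge 0 (z - 1)" using EE.vge_diff[OF Z(5), of 1] by simp
 then have "EE.vge 0 (1 / (s0 * (z + 1)) * (z - 1))" using EE.vge_scale[OF k(1,2), of "z - 1" 0] k(3) Z(1) by simp
 then have "?b : ideal 0" using bF by (simp add: ideal_def)
 moreover have "cay ?b = z"
 proof -
  have "?b * s0 = (z - 1) / (z + 1)" using s0(2) by simp
  then have "1 + ?b * s0 = 2 * z / (z + 1)" "1 - ?b * s0 = 2 / (z + 1)" using z1(1) by (simp_all add: field_simps)
  then show ?thesis unfolding cay_def using z1(1) two_nonzero by simp
 qed
 ultimately show ?thesis by (metis UnI1 imageI)
qed

definition ncl :: "nat => nat" where "ncl m = (if m = 0 then 1 else q ^ m + q ^ (m - 1))"

lemma U1_transversal: "EX T. EE.transversal U1 (int m) T & card T = ncl m"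
proof (cases "m = 0")
 case True
 have "EE.transversal U1 0 {1}"
  by (rule EE.transversalI) (use U1_one U1D in \<open>auto intro!: EE.vge_diff\<close>)
 then show ?thesis using True by (intro exI[of _ "{1}"]) (simp add: ncl_def)
next
 case False
 obtain T where T: "EE.transversal (ideal 0) (int m) T" "card T = q ^ m"
  using ideal_transversal[of 0 "int m"] by auto
 obtain T' where T': "EE.transversal (ideal 1) (int m) T'" "card T' = q ^ (m - 1)"
  using ideal_transversal[of 1 "int m"] False by (auto simp: nat_diff_distrib)
 have A: "EE.transversal (cay ` ideal 0) (int m) (cay ` T)" "card (cay ` T) = card T"
  using EE.transversal_isometry[OF T(1), of cay] cay_isometry cay_U1(1) U1D(1) by blast+
 have B: "EE.transversal (cay' ` ideal 1) (int m) (cay' ` T')" "card (cay' ` T') = card T'"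
  using EE.transversal_isometry[OF T'(1), of cay'] cay'_isometry cay'_U1(1) U1D(1) by blast+
 have far: "~ EE.vge (int m) (a - b)" if "a : cay ` ideal 0" "b : cay' ` ideal 1" for a b
 proof
  assume "EE.vge (int m) (a - b)"
  then have "EE.vge 1 (a - b)" using False EE.vge_mono by auto
  moreover have "EE.vge 1 (b + 1)" using that cay'_U1(2) by blast
  ultimately have "EE.vge 1 ((a - b) + (b + 1))" by (rule EE.vge_add)
  then have "EE.vge 1 (a + 1)" by simp
  moreover have "v (a + 1) = 0" "a + 1 ~= 0" using that cay_U1(2,3) by auto
  ultimately show False by (simp add: EE.vge_def)
 qed
 have "U1 = cay ` ideal 0 \<union> cay' ` ideal 1" using U1_cayley cay_U1(1) cay'_U1(1) by blast
 then show ?thesis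
  using EE.transversal_Un[OF A(1) B(1) far] A(2) B(2) T(2) T'(2) False
  by (intro exI[of _ "cay ` T \<union> cay' ` T'"]) (simp add: ncl_def)
qed

lemma U1_ball:
 assumes c: "c : U1" and e: "1 <= e"
 shows "{z : U1. EE.vge e (z - c)} = (%b. c * cay b) ` ideal e"
proof -
 have one: "EE.vge e (cay b - 1) \<longleftrightarrow> EE.vge e b" if "b : ideal 0" for b
  using cay_isometry[OF that ideal_closed(4), of e] by (simp add: cay_def)
 note C = U1D[OF c]
 have e0: "ideal e <= ideal 0" using EE.vge_mono[of e _ 0] e by (auto simp: ideal_def)
 show ?thesis
 proof (intro Set.set_eqI iffI)
  fix z assume "z : {z : U1. EE.vge e (z - c)}"
  then have z: "z : U1" "EE.vge e (z - c)" by auto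
  let ?w = "z * inverse c"
  have w: "?w : U1" using U1_mult z(1) U1_inverse c by blast
  have k: "inverse c : E" "inverse c ~= 0" "v (inverse c) = 0" using C by (auto simp: EE.v_inverse)
  have "EE.vge e (inverse c * (z - c))"
   using EE.vge_scale[OF k(1,2), of "z - c" e] k(3) z(2) C(1) U1D(1)[OF z(1)] by simp
  moreover have "inverse c * (z - c) = ?w - 1" using C(2) by (simp add: field_simps)
  ultimately have w1: "EE.vge e (?w - 1)" by simp
  have "?w : cay ` ideal 0"
  proof (rule ccontr)
   assume "?w ~: cay ` ideal 0"
   then obtain a where "a : ideal 1" "?w = cay' a" using U1_cayley[OF w] by blast
   then have "EE.vge 1 (?w + 1)" using cay'_U1(2)[of a] by simp
   moreover have "EE.vge 1 (?w - 1)" by (rule EE.vge_mono[OF w1 e])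
   ultimately have "EE.vge 1 ((?w + 1) - (?w - 1))" by (rule EE.vge_diff)
   then show False using two_nonzero by (simp add: EE.vge_def)
  qed
  then obtain b where b: "b : ideal 0" "?w = cay b" by blast
  then have "b : ideal e" using one[OF b(1)] w1 by (simp add: ideal_def)
  moreover have "z = c * cay b" using b(2) C(2) by (simp add: field_simps)
  ultimately show "z : (%b. c * cay b) ` ideal e" by blast
 next
  fix z assume "z : (%b. c * cay b) ` ideal e"
  then obtain b where b: "b : ideal e" "z = c * cay b" by blast
  then have b0: "b : ideal 0" using e0 by blast
  have "EE.vge e (cay b - 1)" using one[OF b0] b(1) by (simp add: ideal_def)
  then have "EE.vge e (c * (cay b - 1))" by (rule EE.vge_mult0(2)[OF C(5)])
  then have "EE.vge e (z - c)" using b(2) by (simp add: algebra_simps)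
  then show "z : {z : U1. EE.vge e (z - c)}" using b(2) U1_mult[OF c cay_U1(1)[OF b0]] by simp
 qed
qed

lemma U1_ball_card:
 assumes T: "EE.transversal U1 (int m) T" and c: "c : U1" and e: "1 <= e" "e <= int m"
 shows "card {z : T. EE.vge e (z - c)} = q ^ nat (int m - e)"
proof -
 obtain T' where T': "EE.transversal (ideal e) (int m) T'" "card T' = q ^ nat (int m - e)"
  using ideal_transversal[OF e(2)] by blast
 note C = U1D[OF c]
 have e0: "ideal e <= ideal 0" using EE.vge_mono[of e _ 0] e by (auto simp: ideal_def)
 have iso: "EE.vge (int m) (c * cay a - c * cay b) \<longleftrightarrow> EE.vge (int m) (a - b)"
  if "a : ideal e" "b : ideal e" for a b
 proof -
  have ab: "a : ideal 0" "b : ideal 0" using that e0 by auto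
  have "EE.vge (int m) (c * (cay a - cay b)) \<longleftrightarrow> EE.vge (int m) (cay a - cay b)"
   using EE.vge_scale[OF C(1,2), of "cay a - cay b" "int m"] C(4) U1D(1)[OF cay_U1(1)] ab by simp
  then show ?thesis using cay_isometry[OF ab] by (simp add: right_diff_distrib)
 qed
 have im: "(%b. c * cay b) ` ideal e <= E" using U1_ball[OF c e(1)] U1D(1) by blast
 have "EE.transversal ((%b. c * cay b) ` ideal e) (int m) ((%b. c * cay b) ` T')"
  "card ((%b. c * cay b) ` T') = card T'"
  using EE.transversal_isometry[OF T'(1), of "%b. c * cay b"] iso im by blast+
 moreover have "EE.transversal {z : U1. EE.vge e (z - c)} (int m) {z : T. EE.vge e (z - c)}"
  by (rule EE.transversal_ball[OF T e(2)])
 ultimately have "card {z : T. EE.vge e (z - c)} = card ((%b. c * cay b) ` T')"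
  unfolding U1_ball[OF c e(1)] using EE.transversal_card_unique by blast
 then show ?thesis using \<open>card ((\<lambda>b. c * cay b) ` T') = card T'\<close> T'(2) by simp
qed

end

section \<open>The signed count\<close>

text \<open>Lattice chains in the tree of \<open>U\<^sub>2\<close> enter only through the sphere sizes \<open>N m\<close>; the next
 lemmas evaluate the resulting alternating double sum.\<close>

lemma alternating_sum: "(\<Sum>j\<le>2 * n. (- 1) ^ j) = (1::int)"
 by (induction n) auto

definition pairs :: "nat => nat => (nat \<times> nat) set" where
 "pairs n r = {(m, m'). even (m + m') & m <= m' + 2 * n & m' <= m + 2 * n & m + m' <= 2 * n + 2 * r}"

definition weight :: "int => (nat => int) => nat => nat \<times> nat => int" where
 "weight q N n = (%(m, m'). N m * (if m + m' <= 2 * n then N m' else q ^ (m' - ((m + m') div 2 - n))))"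

lemma finite_pairs: "finite (pairs n r)"
 by (rule finite_subset[of _ "{..2 * n + 2 * r} \<times> {..2 * n + 2 * r}"]) (auto simp: pairs_def)

context
 fixes q :: int and N :: "nat => int"
 assumes N0: "N 0 = 1" and NS: "!!m. N (Suc m) = q ^ Suc m + q ^ m"
begin

lemma antidiagonal_sum:
 "(\<Sum>m\<le>2 * Suc n. (- 1) ^ m * (N m * N (2 * Suc n - m))) = q ^ (2 * n + 2) - q ^ (2 * n)"
proof -
 let ?f = "%m. (- 1) ^ m * (N m * N (2 * Suc n - m))"
 have N1: "N m = (q + 1) * q ^ (m - 1)" if "m > 0" for m
  using that NS[of "m - 1"] by (cases m) (auto simp: algebra_simps)
 have mid: "?f (Suc j) = - ((q + 1)\<^sup>2 * q ^ (2 * n)) * (- 1) ^ j" if "j <= 2 * n" for j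
 proof -
  have "N (Suc j) * N (2 * Suc n - Suc j) = ((q + 1) * q ^ j) * ((q + 1) * q ^ (2 * n - j))"
  proof -
   have "2 * Suc n - Suc j > 0" "2 * Suc n - Suc j - 1 = 2 * n - j" "Suc j - 1 = j" using that by auto
   then show ?thesis using N1[of "Suc j"] N1[of "2 * Suc n - Suc j"] by simp
  qed
  also have "... = (q + 1)\<^sup>2 * (q ^ j * q ^ (2 * n - j))" by (simp add: power2_eq_square algebra_simps)
  also have "q ^ j * q ^ (2 * n - j) = q ^ (2 * n)" using that by (simp flip: power_add)
  finally show ?thesis by simp
 qed
 have "(\<Sum>m\<le>2 * Suc n. ?f m) = (\<Sum>m\<le>Suc (2 * n). ?f m) + ?f (2 * Suc n)" by simp
 also have "(\<Sum>m\<le>Suc (2 * n). ?f m) = ?f 0 + (\<Sum>j\<le>2 * n. ?f (Suc j))" by (rule sum.atMost_Suc_shift)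
 also have "(\<Sum>j\<le>2 * n. ?f (Suc j)) = (\<Sum>j\<le>2 * n. - ((q + 1)\<^sup>2 * q ^ (2 * n)) * (- 1) ^ j)"
  using mid by (intro sum.cong) (simp_all only: atMost_iff)
 also have "... = - ((q + 1)\<^sup>2 * q ^ (2 * n))"
  unfolding sum_distrib_left[symmetric] alternating_sum by simp
 also have "?f 0 + - ((q + 1)\<^sup>2 * q ^ (2 * n)) + ?f (2 * Suc n) = q ^ (2 * n + 2) - q ^ (2 * n)"
  using N1[of "2 * Suc n"] N0 by (simp add: power2_eq_square algebra_simps)
 finally show ?thesis .
qed

lemma signed_sum_0:
 "(\<Sum>p\<in>{(m, m'). even (m + m') & m + m' <= 2 * n}. (- 1) ^ fst p * (N (fst p) * N (snd p))) = q ^ (2 * n)"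
proof (induction n)
 case 0
 have "{(m, m'). even (m + m') & m + m' <= 2 * 0} = {(0::nat, 0::nat)}" by auto
 then show ?case by (simp add: N0)
next
 case (Suc n)
 let ?A = "%n. {(m, m'). even (m + m') & m + m' <= 2 * (n::nat)}"
 let ?B = "(%m. (m, 2 * Suc n - m)) ` {..2 * Suc n}"
 have eq: "?A (Suc n) = ?A n \<union> ?B"
 proof (intro Set.set_eqI iffI)
  fix p assume "p : ?A (Suc n)"
  then obtain m m' where p: "p = (m, m')" "even (m + m')" "m + m' <= 2 * Suc n" by auto
  show "p : ?A n \<union> ?B"
  proof (cases "m + m' <= 2 * n")
   case False
   then have "m + m' = 2 * n + 1 | m + m' = 2 * Suc n" using p(3) by auto
   then have "m + m' = 2 * Suc n" using p(2) by presburger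
   then show ?thesis using p(1) by (intro UnI2 image_eqI[of _ _ m]) auto
  qed (use p in auto)
 qed auto
 have fin: "finite (?A n)" by (rule finite_subset[of _ "{..2 * n} \<times> {..2 * n}"]) auto
 have "?A n \<inter> ?B = {}" by auto
 then have "(\<Sum>p\<in>?A (Suc n). (- 1) ^ fst p * (N (fst p) * N (snd p))) =
   (\<Sum>p\<in>?A n. (- 1) ^ fst p * (N (fst p) * N (snd p))) + (\<Sum>p\<in>?B. (- 1) ^ fst p * (N (fst p) * N (snd p)))"
  unfolding eq using fin by (intro sum.union_disjoint) auto
 also have "(\<Sum>p\<in>?B. (- 1) ^ fst p * (N (fst p) * N (snd p))) =
   (\<Sum>m\<le>2 * Suc n. (- 1) ^ m * (N m * N (2 * Suc n - m)))"
  by (subst sum.reindex) (auto intro: inj_onI)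
 finally show ?case unfolding Suc.IH antidiagonal_sum by simp
qed

lemma signed_sum: "(\<Sum>p\<in>pairs n r. (- 1) ^ fst p * weight q N n p) = (- 1) ^ r * q ^ (r + 2 * n)"
proof (induction r)
 case 0
 have "pairs n 0 = {(m, m'). even (m + m') & m + m' <= 2 * n}" by (auto simp: pairs_def)
 then show ?case using signed_sum_0[of n] by (auto simp: weight_def case_prod_unfold intro!: sum.cong)
next
 case (Suc r)
 let ?B = "(%j. (Suc r + j, 2 * n + Suc r - j)) ` {..2 * n}"
 have eq: "pairs n (Suc r) = pairs n r \<union> ?B"
 proof (intro Set.set_eqI iffI)
  fix p assume "p : pairs n (Suc r)"
  then obtain m m' where p: "p = (m, m')" "even (m + m')" "m <= m' + 2 * n" "m' <= m + 2 * n"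
   "m + m' <= 2 * n + 2 * Suc r" by (auto simp: pairs_def)
  show "p : pairs n r \<union> ?B"
  proof (cases "m + m' <= 2 * n + 2 * r")
   case False
   then have "m + m' = 2 * n + 2 * r + 1 | m + m' = 2 * n + 2 * Suc r" using p(5) by auto
   then have "m + m' = 2 * n + 2 * Suc r" using p(2) by presburger
   then show ?thesis using p by (intro UnI2 image_eqI[of _ _ "m - Suc r"]) auto
  qed (use p in \<open>auto simp: pairs_def\<close>)
 qed (auto simp: pairs_def)
 have "pairs n r \<inter> ?B = {}" by (auto simp: pairs_def)
 then have "(\<Sum>p\<in>pairs n (Suc r). (- 1) ^ fst p * weight q N n p) =
   (\<Sum>p\<in>pairs n r. (- 1) ^ fst p * weight q N n p) + (\<Sum>p\<in>?B. (- 1) ^ fst p * weight q N n p)"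
  unfolding eq using finite_pairs by (intro sum.union_disjoint) auto
 also have "(\<Sum>p\<in>?B. (- 1) ^ fst p * weight q N n p) =
   (\<Sum>j\<le>2 * n. (- 1) ^ (Suc r + j) * weight q N n (Suc r + j, 2 * n + Suc r - j))"
  by (subst sum.reindex) (auto intro: inj_onI)
 also have "... = (\<Sum>j\<le>2 * n. (- 1) ^ Suc r * (q + 1) * q ^ (2 * n + r) * (- 1) ^ j)"
 proof (rule sum.cong)
  fix j assume j: "j : {..2 * n}"
  have "weight q N n (Suc r + j, 2 * n + Suc r - j) = N (Suc (r + j)) * q ^ (2 * n - j)"
   using j by (simp add: weight_def)
  also have "... = (q + 1) * (q ^ (r + j) * q ^ (2 * n - j))" unfolding NS by (simp add: algebra_simps)
  also have "q ^ (r + j) * q ^ (2 * n - j) = q ^ (2 * n + r)" using j by (simp add: add.commute flip: power_add)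
  finally show "(- 1) ^ (Suc r + j) * weight q N n (Suc r + j, 2 * n + Suc r - j) =
    (- 1) ^ Suc r * (q + 1) * q ^ (2 * n + r) * (- 1) ^ j" by (simp add: power_add algebra_simps)
 qed simp
 also have "... = (- 1) ^ Suc r * (q + 1) * q ^ (2 * n + r)"
  unfolding sum_distrib_left[symmetric] alternating_sum by simp
 finally show ?case unfolding Suc.IH by (simp add: algebra_simps)
qed

end

locale nearly_singular_pair = unramified_extension F E v s
 for F E :: "'k::field set" and v :: "'k => int" and s :: 'k +
 fixes x y :: 'k
 assumes xy: "x : F" "y : F" "x ~= 0" "y ~= 0" "x ~= y" "x ~= - y"
  and nearly_singular: "v (x + y) > v (x - y)"
begin

lemma xyE: "x : E" "y : E" using xy F_E by auto

lemma xpy: "x + y ~= 0" "x - y ~= 0" using xy by (auto simp: add_eq_0_iff2)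

lemma v_xy: "v (x - y) = v x" "v y = v x"
proof -
 have "EE.vge (v (x - y) + 1) (x + y)" using nearly_singular xyE by (auto simp: EE.vge_def)
 then have a: "(x - y) + (x + y) ~= 0 & v ((x - y) + (x + y)) = v (x - y)"
  and b: "(x - y) + - (x + y) ~= 0 & v ((x - y) + - (x + y)) = v (x - y)"
  using EE.v_add_less[of "x - y"] xpy xyE EE.vge_minus by blast+
 have "v (2 * x) = v x" "v (2 * (- y)) = v y"
  using EE.v_mult[of 2 x] EE.v_mult[of 2 "- y"] two_nonzero xy xyE by auto
 moreover have "(x - y) + (x + y) = 2 * x" "(x - y) + - (x + y) = 2 * (- y)" by (simp_all add: algebra_simps)
 ultimately show "v (x - y) = v x" "v y = v x" using a b by auto
qed

definition depth :: nat where "depth = nat (v (x + y) - v x)"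

lemma depth: "v (x + y) = v x + int depth" "depth > 0"
 using nearly_singular v_xy by (auto simp: depth_def)

definition T :: "nat => 'k set" where
 "T m = (SOME T. EE.transversal U1 (int m) T & card T = ncl m)"

lemma T: "EE.transversal U1 (int m) (T m)" "card (T m) = ncl m"
 using someI_ex[OF U1_transversal[of m]] unfolding T_def by auto

lemma T_U1: "z : T m ==> z : U1" using EE.transversalD(2)[OF T(1)] by blast
lemma finite_T: "finite (T m)" using EE.transversalD(1)[OF T(1)] .

text \<open>This is the condition that a pair of cosets, given by \<open>(m, z)\<close> and \<open>(m', z')\<close>, contributes
 to the orbital integral.\<close>

definition good :: "nat => 'k => nat => 'k => bool" where
 "good m z m' z' \<longleftrightarrow> EE.vge (int (m + m') div 2) (x * z' - y * z) &
   EE.vge (\<bar>int m - int m'\<bar> div 2) (x * z' + y * z)"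

lemma vge_xz: "z : U1 ==> EE.vge k (x * z) \<longleftrightarrow> k <= v x" "z : U1 ==> EE.vge k (y * z) \<longleftrightarrow> k <= v x"
 using xy xyE U1D v_xy by (auto simp: EE.vge_iff EE.v_mult)

lemma good_negative:
 assumes "v x < 0" "z : U1" "z' : U1" shows "~ good m z m' z'"
proof
 assume g: "good m z m' z'"
 have "EE.vge 0 (x * z' - y * z)" "EE.vge 0 (x * z' + y * z)"
  using g EE.vge_mono[of _ _ 0] unfolding good_def by auto
 then have "EE.vge 0 ((x * z' - y * z) + (x * z' + y * z))" by (rule EE.vge_add)
 then have "EE.vge 0 (2 * (x * z'))" by (simp add: algebra_simps)
 then show False using vge_double[of "x * z'" 0] vge_xz(1)[OF assms(3), of 0] assms U1D(1)[OF assms(3)] xyE by auto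
qed

lemma good_near:
 assumes "int (m + m') div 2 <= v x" "z : U1" "z' : U1" shows "good m z m' z'"
proof -
 have "\<bar>int m - int m'\<bar> div 2 <= v x" using assms(1) by linarith
 then show ?thesis unfolding good_def
  using assms vge_xz[of z] vge_xz[of z'] by (intro conjI EE.vge_add EE.vge_diff) auto
qed

lemma good_far:
 assumes far: "int (m + m') div 2 > v x" and par: "even (m + m')" and z: "z : U1" "z' : U1"
 shows "good m z m' z' \<longleftrightarrow> \<bar>int m - int m'\<bar> <= 2 * v x & int (m + m') div 2 <= v x + int depth &
  EE.vge (int (m + m') div 2 - v x) (z' - (- z))"
proof -
 define k where "k = int (m + m') div 2"
 have zE: "z : E" "z' : E" using z U1D by auto
 have second: "EE.vge (\<bar>int m - int m'\<bar> div 2) (x * z' + y * z) \<longleftrightarrow> \<bar>int m - int m'\<bar> <= 2 * v x"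
  if "EE.vge k (x * z' - y * z)"
 proof -
  have v2: "v (2 * (x * z')) = v x" "2 * (x * z') : E" "2 * (x * z') ~= 0"
   using xy xyE zE z U1D two_nonzero by (auto simp: EE.v_mult)
  have "EE.vge (v (2 * (x * z')) + 1) (- (x * z' - y * z))"
   using EE.vge_minus[OF EE.vge_mono[OF that, of "v x + 1"]] far v2 by (simp add: k_def)
  then have "2 * (x * z') + - (x * z' - y * z) ~= 0 & v (2 * (x * z') + - (x * z' - y * z)) = v (2 * (x * z'))"
   by (rule EE.v_add_less[OF v2(2,3)])
  moreover have "2 * (x * z') + - (x * z' - y * z) = x * z' + y * z" by (simp add: algebra_simps)
  ultimately have "x * z' + y * z ~= 0 & v (x * z' + y * z) = v x" by (simp only: v2(1) simp_thms)
  then have "EE.vge (\<bar>int m - int m'\<bar> div 2) (x * z' + y * z) \<longleftrightarrow> \<bar>int m - int m'\<bar> div 2 <= v x"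
   using xyE zE by (subst EE.vge_iff) simp_all
  also have "... \<longleftrightarrow> \<bar>int m - int m'\<bar> <= 2 * v x" using par by presburger
  finally show ?thesis .
 qed
 have bound: "k <= v x + int depth" if g: "EE.vge k (x * z' - y * z)"
 proof -
  have "EE.vge k (bar (x * z' - y * z))" using g vge_bar[of "x * z' - y * z"] xyE zE by simp
  also have "bar (x * z' - y * z) = x * inverse z' - y * inverse z"
   using xy xyE zE z U1D by (simp add: bar_diff bar_mult)
  finally have "EE.vge k (z * z' * (x * inverse z' - y * inverse z))"
   by (rule EE.vge_mult0(2)[OF EE.vge_mult0(1)[OF U1D(5)[OF z(1)] U1D(5)[OF z(2)]]])
  also have "z * z' * (x * inverse z' - y * inverse z) = x * z - y * z'"
   using U1D(2)[OF z(1)] U1D(2)[OF z(2)] by (simp add: algebra_simps)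
  finally have g': "EE.vge k (x * z - y * z')" .
  have "EE.vge (v x + k) (x * (x * z - y * z') + y * (x * z' - y * z))"
   using EE.vge_mult[OF EE.vge_v[OF xyE(1)] g'] EE.vge_mult[OF EE.vge_v[OF xyE(2)] g] v_xy
   by (intro EE.vge_add) simp_all
  also have "x * (x * z - y * z') + y * (x * z' - y * z) = ((x + y) * (x - y)) * z" by (simp add: algebra_simps)
  finally have "EE.vge (v x + k) (((x + y) * (x - y)) * z)" .
  moreover have "v (((x + y) * (x - y)) * z) = v x + int depth + v x"
   "((x + y) * (x - y)) * z : E" "((x + y) * (x - y)) * z ~= 0"
   using xpy xyE zE z U1D depth v_xy by (simp_all add: EE.v_mult)
  ultimately show ?thesis by (simp add: EE.vge_iff)
 qed
 have first: "EE.vge k (x * z' - y * z) \<longleftrightarrow> EE.vge (k - v x) (z' - (- z))" if "k <= v x + int depth"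
 proof -
  have w: "EE.vge k ((x + y) * z)"
   using EE.vge_mult0(1)[OF EE.vge_v[of "x + y"] U1D(5)[OF z(1)]] xyE depth(1) EE.vge_mono that by auto
  have e: "x * z' - y * z = x * (z' - (- z)) - (x + y) * z" by (simp add: algebra_simps)
  have "EE.vge k (x * z' - y * z) \<longleftrightarrow> EE.vge k (x * (z' - (- z)))"
  proof
   assume "EE.vge k (x * z' - y * z)"
   then have "EE.vge k ((x * z' - y * z) + (x + y) * z)" using w by (rule EE.vge_add)
   then show "EE.vge k (x * (z' - (- z)))" unfolding e by simp
  next
   assume "EE.vge k (x * (z' - (- z)))"
   then show "EE.vge k (x * z' - y * z)" unfolding e using w by (rule EE.vge_diff)
  qed
  also have "... \<longleftrightarrow> EE.vge (k - v x) (z' - (- z))" using xy xyE zE by (intro EE.vge_scale) auto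
  finally show ?thesis .
 qed
 show ?thesis unfolding good_def k_def[symmetric] using second bound first by blast
qed

definition Good :: "nat => ((nat \<times> 'k) \<times> (nat \<times> 'k)) set" where
 "Good par = {((m, z), (m', z')). m mod 2 = par & m' mod 2 = par & z : T m & z' : T m' & good m z m' z'}"

lemma good_fibre:
 assumes "even (m + m')" "z : U1" "v x \<ge> 0"
 shows "int (card {z' : T m'. good m z m' z'}) * int (ncl m) =
  (if (m, m') : pairs (nat (v x)) depth then weight (int q) (%m. int (ncl m)) (nat (v x)) (m, m') else 0)"
proof (cases "int (m + m') div 2 <= v x")
 case True
 have "{z' : T m'. good m z m' z'} = T m'" using good_near[OF True assms(2)] T_U1 by blast
 moreover have "m + m' <= 2 * nat (v x)" using True assms by presburger
 moreover from this have "(m, m') : pairs (nat (v x)) depth" using assms(1) by (auto simp: pairs_def)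
 ultimately show ?thesis using T(2) by (simp add: weight_def)
next
 case False
 then have far: "int (m + m') div 2 > v x" by simp
 show ?thesis
 proof (cases "(m, m') : pairs (nat (v x)) depth")
  case True
  then have le: "\<bar>int m - int m'\<bar> <= 2 * v x" "int (m + m') div 2 <= v x + int depth"
   using assms(3) by (auto simp: pairs_def)
  let ?e = "int (m + m') div 2 - v x"
  have "{z' : T m'. good m z m' z'} = {z' : T m'. EE.vge ?e (z' - (- z))}"
   using good_far[OF far assms(1,2)] T_U1 le by blast
  moreover have "card {z' : T m'. EE.vge ?e (z' - (- z))} = q ^ nat (int m' - ?e)"
   using far le assms by (intro U1_ball_card T(1) U1_minus) auto
  moreover have "nat (int m' - ?e) = m' - ((m + m') div 2 - nat (v x))" using far assms(3) by linarith
  ultimately have "card {z' : T m'. good m z m' z'} = q ^ (m' - ((m + m') div 2 - nat (v x)))"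
   by (simp only:)
  moreover have "~ m + m' <= 2 * nat (v x)" using far assms(3) by linarith
  ultimately show ?thesis using True by (simp add: weight_def)
 next
  case F: False
  have "~ (\<bar>int m - int m'\<bar> <= 2 * v x & int (m + m') div 2 <= v x + int depth)"
  proof -
   obtain n where n: "v x = int n" using assms(3) nonneg_int_cases by blast
   show ?thesis using F assms(1) unfolding pairs_def n by simp presburger
  qed
  then have e: "{z' : T m'. good m z m' z'} = {}" using good_far[OF far assms(1,2)] T_U1 by blast
  show ?thesis unfolding e using F by simp
 qed
qed

lemma finite_Good: assumes "v x \<ge> 0" shows "finite (Good par)"
proof (rule finite_subset)
 let ?P = "pairs (nat (v x)) depth"
 let ?M = "Sigma (fst ` ?P) T" and ?M' = "Sigma (snd ` ?P) T"
 show "Good par <= ?M \<times> ?M'"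
 proof
  fix p assume "p : Good par"
  then obtain m z m' z' where p: "p = ((m, z), (m', z'))" "m mod 2 = par" "m' mod 2 = par"
   "z : T m" "z' : T m'" "good m z m' z'" unfolding Good_def by blast
  have "even (m + m')" using p(2,3) by presburger
  moreover have "{z' : T m'. good m z m' z'} ~= {}" using p by blast
  then have "card {z' : T m'. good m z m' z'} ~= 0" using finite_T by simp
  moreover have "ncl m ~= 0" using q_pos by (simp add: ncl_def)
  ultimately have "(m, m') : ?P" using good_fibre[OF _ T_U1[OF p(4)] assms, of m m']
   by (auto split: if_splits)
  then show "p : ?M \<times> ?M'" using p by force
 qed
 have "finite (fst ` ?P)" "finite (snd ` ?P)" using finite_pairs by auto
 then show "finite (?M \<times> ?M')" using finite_T by blast
qed

lemma card_Good:
 assumes "v x \<ge> 0"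
 shows "int (card (Good par)) = (\<Sum>p\<in>{p : pairs (nat (v x)) depth. fst p mod 2 = par}.
  weight (int q) (%m. int (ncl m)) (nat (v x)) p)"
proof -
 let ?P = "pairs (nat (v x)) depth"
 define fib where "fib m m' = {(z, z'). z : T m & z' : T m' & good m z m' z'}" for m m'
 have cf: "int (card (fib m m')) = (if (m, m') : ?P then weight (int q) (%m. int (ncl m)) (nat (v x)) (m, m') else 0)"
  if "even (m + m')" for m m'
 proof -
  let ?w = "if (m, m') : ?P then weight (int q) (%m. int (ncl m)) (nat (v x)) (m, m') else 0"
  have nz: "int (ncl m) ~= 0" using q_pos by (simp add: ncl_def)
  have "fib m m' = Sigma (T m) (%z. {z' : T m'. good m z m' z'})" by (auto simp: fib_def)
  then have "card (fib m m') = (\<Sum>z\<in>T m. card {z' : T m'. good m z m' z'})"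
   using finite_T by simp
  then have "int (card (fib m m')) * int (ncl m) = (\<Sum>z\<in>T m. int (card {z' : T m'. good m z m' z'}) * int (ncl m))"
   by (simp add: sum_distrib_right)
  also have "... = (\<Sum>z\<in>T m. ?w)"
   using good_fibre[OF that _ assms] T_U1 by (intro sum.cong) blast+
  also have "... = ?w * int (ncl m)" by (simp add: T(2))
  finally show ?thesis using nz by simp
 qed
 have fin: "finite {p : ?P. fst p mod 2 = par}" using finite_pairs by simp
 let ?g = "%(p, z, z'). ((fst p, z), (snd p, z'))"
 let ?S = "Sigma {p : ?P. fst p mod 2 = par} (%p. fib (fst p) (snd p))"
 have fib_fin: "finite (fib m m')" for m m'
  by (rule finite_subset[of _ "T m \<times> T m'"]) (auto simp: fib_def finite_T)
 have "Good par = ?g ` ?S"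
 proof (intro Set.set_eqI iffI)
  fix p assume "p : Good par"
  then obtain m z m' z' where p: "p = ((m, z), (m', z'))" "m mod 2 = par" "m' mod 2 = par"
   "z : T m" "z' : T m'" "good m z m' z'" unfolding Good_def by blast
  have ev: "even (m + m')" using p(2,3) by presburger
  have f: "(z, z') : fib m m'" using p by (simp add: fib_def)
  then have "card (fib m m') ~= 0" using fib_fin by (auto simp: card_eq_0_iff)
  then have "(m, m') : ?P" using cf[OF ev] by (auto split: if_splits)
  then show "p : ?g ` ?S" using p f by (intro image_eqI[of _ _ "((m, m'), z, z')"]) auto
 next
  fix p assume "p : ?g ` ?S"
  then obtain m m' z z' where h: "p = ((m, z), (m', z'))" "(m, m') : ?P" "m mod 2 = par" "(z, z') : fib m m'" by auto
  moreover have "even (m + m')" using h(2) by (simp add: pairs_def)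
  then have "m' mod 2 = par" using h(3) by presburger
  ultimately show "p : Good par" unfolding Good_def fib_def by blast
 qed
 moreover have "inj_on ?g ?S" by (rule inj_onI) (auto simp: prod_eq_iff)
 ultimately have "card (Good par) = card ?S" by (simp add: card_image)
 also have "... = (\<Sum>p\<in>{p : ?P. fst p mod 2 = par}. card (fib (fst p) (snd p)))"
  using fin fib_fin by (intro card_SigmaI) auto
 finally have "int (card (Good par)) = (\<Sum>p\<in>{p : ?P. fst p mod 2 = par}. int (card (fib (fst p) (snd p))))" by simp
 also have "... = (\<Sum>p\<in>{p : ?P. fst p mod 2 = par}. weight (int q) (%m. int (ncl m)) (nat (v x)) p)"
 proof (rule sum.cong)
  fix p assume p: "p : {p : ?P. fst p mod 2 = par}"
  then have "even (fst p + snd p)" by (auto simp: pairs_def)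
  then show "int (card (fib (fst p) (snd p))) = weight (int q) (%m. int (ncl m)) (nat (v x)) p"
   using cf p by simp
 qed simp
 finally show ?thesis .
qed

lemma card_Good_diff:
 assumes "v x \<ge> 0"
 shows "int (card (Good 0)) - int (card (Good 1)) = (- 1) ^ depth * int q ^ (depth + 2 * nat (v x))"
proof -
 let ?P = "pairs (nat (v x)) depth" and ?w = "weight (int q) (%m. int (ncl m)) (nat (v x))"
 have fin: "finite ?P" by (rule finite_pairs)
 have "(\<Sum>p\<in>?P. (- 1) ^ fst p * ?w p) = (- 1) ^ depth * int q ^ (depth + 2 * nat (v x))"
  by (rule signed_sum) (simp_all add: ncl_def)
 moreover have "(\<Sum>p\<in>?P. (- 1) ^ fst p * ?w p) =
   (\<Sum>p\<in>{p : ?P. fst p mod 2 = 0}. (- 1) ^ fst p * ?w p) + (\<Sum>p\<in>{p : ?P. fst p mod 2 = 1}. (- 1) ^ fst p * ?w p)"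
  using fin by (subst sum.union_disjoint[symmetric]) (auto intro!: sum.cong)
 moreover have "(\<Sum>p\<in>{p : ?P. fst p mod 2 = 0}. (- 1) ^ fst p * ?w p) = (\<Sum>p\<in>{p : ?P. fst p mod 2 = 0}. ?w p)"
  by (rule sum.cong) (auto simp: even_iff_mod_2_eq_zero[symmetric])
 moreover have "(\<Sum>p\<in>{p : ?P. fst p mod 2 = 1}. (- 1) ^ fst p * ?w p) = (\<Sum>p\<in>{p : ?P. fst p mod 2 = 1}. - ?w p)"
 proof (rule sum.cong)
  fix p assume "p : {p : ?P. fst p mod 2 = 1}"
  then have "odd (fst p)" by (simp add: odd_iff_mod_2_eq_one)
  then show "(- 1) ^ fst p * ?w p = - ?w p" by simp
 qed simp
 ultimately show ?thesis unfolding card_Good[OF assms] by (simp add: sum_negf)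
qed

end

section \<open>Two by two matrices\<close>

datatype 'a m2 = M2 'a 'a 'a 'a

text \<open>A type with a ring structure lets the calculations below ignore carrier conditions.\<close>

instantiation m2 :: (comm_ring_1) ring_1
begin

fun plus_m2 :: "'a m2 => 'a m2 => 'a m2" where
 "M2 a b c d + M2 a' b' c' d' = M2 (a + a') (b + b') (c + c') (d + d')"
fun minus_m2 :: "'a m2 => 'a m2 => 'a m2" where
 "M2 a b c d - M2 a' b' c' d' = M2 (a - a') (b - b') (c - c') (d - d')"
fun uminus_m2 :: "'a m2 => 'a m2" where
 "- M2 a b c d = M2 (- a) (- b) (- c) (- d)"
fun times_m2 :: "'a m2 => 'a m2 => 'a m2" where
 "M2 a b c d * M2 a' b' c' d' = M2 (a * a' + b * c') (a * b' + b * d') (c * a' + d * c') (c * b' + d * d')"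
definition zero_m2 :: "'a m2" where "0 = M2 0 0 0 0"
definition one_m2 :: "'a m2" where "1 = M2 1 0 0 1"

instance
proof
 fix A B C :: "'a m2"
 show "A + B + C = A + (B + C)" by (cases A; cases B; cases C) simp
 show "A + B = B + A" by (cases A; cases B) simp
 show "0 + A = A" by (cases A) (simp add: zero_m2_def)
 show "- A + A = 0" by (cases A) (simp add: zero_m2_def)
 show "A - B = A + - B" by (cases A; cases B) simp
 show "A * B * C = A * (B * C)" by (cases A; cases B; cases C) (simp add: algebra_simps)
 show "1 * A = A" "A * 1 = A" by (cases A; simp add: one_m2_def)+
 show "(A + B) * C = A * C + B * C" "A * (B + C) = A * B + A * C"
  by (cases A; cases B; cases C; simp add: algebra_simps)+
 show "(0::'a m2) ~= 1" by (simp add: zero_m2_def one_m2_def)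
qed

end

fun det2 :: "'a::comm_ring_1 m2 => 'a" where "det2 (M2 a b c d) = a * d - b * c"

definition dia :: "'a::comm_ring_1 => 'a => 'a m2" where "dia a b = M2 a 0 0 b"

abbreviation scal :: "'a::comm_ring_1 => 'a m2" where "scal a \<equiv> dia a a"

fun inv2 :: "'a::field m2 => 'a m2" where
 "inv2 (M2 a b c d) = (let e = inverse (a * d - b * c) in M2 (e * d) (- e * b) (- e * c) (e * a))"

text \<open>The adjoint \<open>A \<mapsto> D A\<^sup>t D\<close> for the bilinear form with matrix \<open>D = diag(1, -1)\<close>.\<close>

fun dag :: "'a::comm_ring_1 m2 => 'a m2" where "dag (M2 a b c d) = M2 a (- c) (- b) d"

lemma dag_dag [simp]: "dag (dag A) = A" by (cases A) simp
lemma dag_mult: "dag (A * B) = dag B * dag A" by (cases A; cases B) (simp add: algebra_simps)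
lemma dag_add: "dag (A + B) = dag A + dag B" by (cases A; cases B) simp
lemma dag_diff: "dag (A - B) = dag A - dag B" by (cases A; cases B) simp
lemma dag_dia [simp]: "dag (dia a b) = dia a b" by (simp add: dia_def)
lemma dag_one [simp]: "dag 1 = 1" by (simp add: one_m2_def)
lemma dag_inject [simp]: "dag A = dag B \<longleftrightarrow> A = B" by (metis dag_dag)

lemma dia_mult: "dia a b * dia c d = dia (a * c) (b * d)" by (simp add: dia_def)
lemma dia_one: "dia 1 1 = 1" by (simp add: dia_def one_m2_def)
lemma scal_central: "scal c * A = A * scal c" by (cases A) (simp add: dia_def mult.commute)

lemma det2_mult: "det2 (A * B) = det2 A * det2 B" by (cases A; cases B) (simp add: algebra_simps)
lemma det2_one [simp]: "det2 1 = 1" by (simp add: one_m2_def)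
lemma det2_dag [simp]: "det2 (dag A) = det2 A" by (cases A) (simp add: algebra_simps)
lemma det2_dia [simp]: "det2 (dia a b) = a * b" by (simp add: dia_def)

lemma inv2: assumes "det2 A ~= (0::'a::field)" shows "A * inv2 A = 1" "inv2 A * A = 1"
proof -
 obtain a b c d where A: "A = M2 a b c d" by (cases A)
 let ?e = "inverse (a * d - b * c)"
 have e: "?e * (a * d - b * c) = 1" using assms A by simp
 have "a * (?e * d) + b * (- ?e * c) = ?e * (a * d - b * c)" "c * (- ?e * b) + d * (?e * a) = ?e * (a * d - b * c)"
  "?e * d * a + - ?e * b * c = ?e * (a * d - b * c)" "- ?e * c * b + ?e * a * d = ?e * (a * d - b * c)"
  by (simp_all add: algebra_simps)
 note r = this[unfolded e]
 show "A * inv2 A = 1" "inv2 A * A = 1"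
  unfolding A by (simp_all only: inv2.simps Let_def times_m2.simps one_m2_def r) (simp_all add: algebra_simps)
qed

lemma inv2_unique: assumes "A * B = (1::'a::field m2)" shows "inv2 A = B" "det2 A ~= 0" "B * A = 1"
proof -
 have "det2 A * det2 B = 1" using arg_cong[OF assms, of det2] by (simp add: det2_mult)
 then show d: "det2 A ~= 0" by auto
 have "inv2 A = inv2 A * (A * B)" using assms by simp
 also have "... = B" using inv2(2)[OF d] by (simp flip: mult.assoc)
 finally show "inv2 A = B" .
 then show "B * A = 1" using inv2(2)[OF d] by simp
qed

lemma inv2_mult: assumes "det2 A ~= (0::'a::field)" "det2 B ~= 0" shows "inv2 (A * B) = inv2 B * inv2 A"
proof (rule inv2_unique)
 have "A * B * (inv2 B * inv2 A) = A * (B * inv2 B) * inv2 A" by (simp only: mult.assoc)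
 then show "A * B * (inv2 B * inv2 A) = 1" by (simp only: inv2(1)[OF assms(1)] inv2(1)[OF assms(2)] mult_1_right)
qed

lemma inv2_one [simp]: "inv2 1 = (1::'a::field m2)" by (rule inv2_unique) simp
lemma det2_inv2: "det2 A ~= (0::'a::field) ==> det2 (inv2 A) ~= 0" using inv2(2) inv2_unique(2) by blast
lemma inv2_inv2: "det2 A ~= (0::'a::field) ==> inv2 (inv2 A) = A" using inv2(2) by (rule inv2_unique)
lemma inv2_dag: "det2 A ~= (0::'a::field) ==> inv2 (dag A) = dag (inv2 A)"
 by (rule inv2_unique) (simp flip: dag_mult add: inv2)
lemma inv2_dia: "a ~= 0 ==> b ~= 0 ==> inv2 (dia a b) = dia (inverse a) (inverse (b::'a::field))"
 by (rule inv2_unique) (simp add: dia_mult dia_one)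

section \<open>The eigenspaces of the involution\<close>

definition mk4 :: "'a => 'a => 'a => 'a => 'a => 'a => 'a => 'a => 'a => 'a => 'a => 'a => 'a => 'a => 'a => 'a => 'a mat" where
 "mk4 a b c d e f g h i j k l m n p r = mat_of_rows_list 4 [[a, b, c, d], [e, f, g, h], [i, j, k, l], [m, n, p, r]]"

lemma mk4_carrier [simp]: "mk4 a b c d e f g h i j k l m n p r : carrier_mat 4 4"
 unfolding mk4_def mat_of_rows_list_def by (simp add: numeral_eq_Suc)

lemma mk4_dim [simp]:
 "dim_row (mk4 a b c d e f g h i j k l m n p r) = 4" "dim_col (mk4 a b c d e f g h i j k l m n p r) = 4"
 using mk4_carrier[of a b c d e f g h i j k l m n p r] by blast+

lemma all4: "(ALL i<4. P i) \<longleftrightarrow> P 0 & P 1 & P 2 & P (3::nat)"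
 by (simp add: numeral_eq_Suc All_less_Suc conj_ac)

lemma mk4_index:
 "i < 4 ==> j < 4 ==> mk4 a b c d e f g h k l m n p r s t $$ (i, j) =
  [[a, b, c, d], [e, f, g, h], [k, l, m, n], [p, r, s, t]] ! i ! j"
 by (simp add: mk4_def mat_of_rows_list_def)

lemma mat4_eqI:
 assumes "A : carrier_mat 4 4" "B : carrier_mat 4 4" "ALL i<4. ALL j<4. A $$ (i, j) = B $$ (i, j)"
 shows "A = B"
 using assms by (intro eq_matI) auto

lemma mat4_mult_index:
 assumes "A : carrier_mat 4 4" "B : carrier_mat 4 4" "i < 4" "j < 4"
 shows "(A * B) $$ (i, j) = A $$ (i, 0) * B $$ (0, j) + A $$ (i, 1) * B $$ (1, j) +
  A $$ (i, 2) * B $$ (2, j) + A $$ (i, 3) * B $$ (3, j)"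
 using assms by (simp add: scalar_prod_def eval_nat_numeral)

lemma mk4_eta:
 assumes "A : carrier_mat 4 4"
 shows "A = mk4 (A $$ (0,0)) (A $$ (0,1)) (A $$ (0,2)) (A $$ (0,3)) (A $$ (1,0)) (A $$ (1,1)) (A $$ (1,2)) (A $$ (1,3))
  (A $$ (2,0)) (A $$ (2,1)) (A $$ (2,2)) (A $$ (2,3)) (A $$ (3,0)) (A $$ (3,1)) (A $$ (3,2)) (A $$ (3,3))" (is "A = ?B")
proof -
 have "ALL i<4. ALL j<4. A $$ (i, j) = ?B $$ (i, j)" unfolding all4 by (simp add: mk4_index)
 moreover have "?B : carrier_mat 4 4" by (rule mk4_carrier)
 ultimately show ?thesis using assms mat4_eqI by blast
qed

lemma mk4_inject:
 "mk4 a b c d e f g h i j k l m n p r = mk4 a' b' c' d' e' f' g' h' i' j' k' l' m' n' p' r' \<longleftrightarrow>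
  a = a' & b = b' & c = c' & d = d' & e = e' & f = f' & g = g' & h = h' &
  i = i' & j = j' & k = k' & l = l' & m = m' & n = n' & p = p' & r = r'" (is "?A = ?B \<longleftrightarrow> ?R")
proof
 assume "?A = ?B"
 then have "ALL i<4. ALL j<4. ?A $$ (i, j) = ?B $$ (i, j)" by simp
 then show ?R unfolding all4 by (simp add: mk4_index)
qed simp

lemma mk4_mult:
 "mk4 a b c d e f g h i j k l m n p r * mk4 a' b' c' d' e' f' g' h' i' j' k' l' m' n' p' r' = (mk4
  (a*a'+b*e'+c*i'+d*m') (a*b'+b*f'+c*j'+d*n') (a*c'+b*g'+c*k'+d*p') (a*d'+b*h'+c*l'+d*r')
  (e*a'+f*e'+g*i'+h*m') (e*b'+f*f'+g*j'+h*n') (e*c'+f*g'+g*k'+h*p') (e*d'+f*h'+g*l'+h*r')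
  (i*a'+j*e'+k*i'+l*m') (i*b'+j*f'+k*j'+l*n') (i*c'+j*g'+k*k'+l*p') (i*d'+j*h'+k*l'+l*r')
  (m*a'+n*e'+p*i'+r*m') (m*b'+n*f'+p*j'+r*n') (m*c'+n*g'+p*k'+r*p') (m*d'+n*h'+p*l'+r*r') :: 'a::comm_ring_1 mat)"
  (is "?A * ?B = ?C")
proof -
 have C: "?A : carrier_mat 4 4" "?B : carrier_mat 4 4" "?C : carrier_mat 4 4" by (rule mk4_carrier)+
 have "ALL i<4. ALL j<4. (?A * ?B) $$ (i, j) = ?C $$ (i, j)"
  unfolding all4 by (simp add: mat4_mult_index[OF C(1,2)] mk4_index del: index_mult_mat)
 then show ?thesis by (rule mat4_eqI[OF mult_carrier_mat[OF C(1,2)] C(3)])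
qed

lemma mk4_transpose: "transpose_mat (mk4 a b c d e f g h i j k l m n p r) = mk4 a e i m b f j n c g k p d h l r"
 (is "transpose_mat ?A = ?C")
proof -
 have C: "?A : carrier_mat 4 4" "?C : carrier_mat 4 4" by (rule mk4_carrier)+
 have "ALL i<4. ALL j<4. ?A $$ (j, i) = ?C $$ (i, j)" unfolding all4 by (simp add: mk4_index)
 then show ?thesis using C by (intro mat4_eqI) auto
qed

lemma mk4_theta: "theta_mat = mk4 0 0 0 1 0 0 (-1) 0 0 (-1) 0 0 1 0 0 (0::'a::field)"
 by (simp add: theta_mat_def mk4_def)

lemma mk4_one: "1\<^sub>m 4 = mk4 1 0 0 0 0 1 0 0 0 0 1 0 0 0 0 (1::'a::comm_ring_1)"
 by (subst mk4_eta[of "1\<^sub>m 4"]) simp_all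

lemma mk4_J: "Jmat 4 = mk4 0 0 0 1 0 0 1 0 0 1 0 0 1 0 0 (0::'a::field)"
 by (subst mk4_eta[of "Jmat 4"]) (simp_all add: Jmat_def)

text \<open>Let \<open>V\<^sub>+ = \<langle>e\<^sub>1 + e\<^sub>4, e\<^sub>2 - e\<^sub>3\<rangle>\<close> and \<open>V\<^sub>- = \<langle>e\<^sub>1 - e\<^sub>4, e\<^sub>2 + e\<^sub>3\<rangle>\<close> be the eigenspaces of the matrix
 that defines \<open>\<theta>\<close>. A matrix commuting with it acts on them by \<open>R + S\<close> and \<open>R - S\<close>; an
 anticommuting one maps \<open>V\<^sub>+\<close> to \<open>V\<^sub>-\<close> by \<open>R + S\<close> and \<open>V\<^sub>-\<close> to \<open>V\<^sub>+\<close> by \<open>R - S\<close>.\<close>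

fun evn :: "'a::comm_ring_1 m2 => 'a m2 => 'a mat" where
 "evn (M2 a b c d) (M2 a' b' c' d') = mk4 a b (- b') a'  c d (- d') c'  (- c') (- d') d (- c)  a' b' (- b) a"
fun odn :: "'a::comm_ring_1 m2 => 'a m2 => 'a mat" where
 "odn (M2 a b c d) (M2 a' b' c' d') = mk4 a b (- b') a'  c d (- d') c'  c' d' (- d) c  (- a') (- b') b (- a)"

lemma evn_carrier [simp]: "evn R S : carrier_mat 4 4" by (cases R; cases S) simp
lemma odn_carrier [simp]: "odn R S : carrier_mat 4 4" by (cases R; cases S) simp

lemma evn_evn: "evn R S * evn R' S' = evn (R * R' + S * S') (R * S' + S * R')"
 by (cases R; cases S; cases R'; cases S') (simp add: mk4_mult mk4_inject algebra_simps)
lemma evn_odn: "evn R S * odn R' S' = odn (R * R' - S * S') (R * S' - S * R')"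
 by (cases R; cases S; cases R'; cases S') (simp add: mk4_mult mk4_inject algebra_simps)
lemma odn_evn: "odn R S * evn R' S' = odn (R * R' + S * S') (R * S' + S * R')"
 by (cases R; cases S; cases R'; cases S') (simp add: mk4_mult mk4_inject algebra_simps)

lemma evn_inject: "evn R S = evn R' S' \<longleftrightarrow> R = R' & S = S'"
 by (cases R; cases S; cases R'; cases S') (auto simp: mk4_inject)
lemma odn_inject: "odn R S = odn R' S' \<longleftrightarrow> R = R' & S = S'"
 by (cases R; cases S; cases R'; cases S') (auto simp: mk4_inject)

lemma evn_one: "evn 1 0 = 1\<^sub>m 4" by (simp add: one_m2_def zero_m2_def mk4_one)

lemma evn_adjoint: "Jmat 4 * transpose_mat (evn R S) * Jmat 4 = evn (dag R) (dag (S :: 'a::field m2))"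
 by (cases R; cases S) (simp add: mk4_mult mk4_inject mk4_J mk4_transpose)
lemma odn_adjoint: "Jmat 4 * transpose_mat (odn R S) * Jmat 4 = odn (- dag R) (dag (S :: 'a::field m2))"
 by (cases R; cases S) (simp add: mk4_mult mk4_inject mk4_J mk4_transpose)

lemma theta_square: "theta_mat * theta_mat = (1\<^sub>m 4 :: 'a::field mat)"
 by (simp add: mk4_theta mk4_mult mk4_one)
lemma J_square: "Jmat 4 * Jmat 4 = (1\<^sub>m 4 :: 'a::field mat)"
 by (simp add: mk4_J mk4_mult mk4_one)

lemma theta_evn: "theta_mat * evn R S * theta_mat = evn R (S :: 'a::field m2)"
 by (cases R; cases S) (simp add: mk4_mult mk4_inject mk4_theta)
lemma theta_conj_mk4: "theta_mat * mk4 a b c d e f g h i j k l m n p r * theta_mat =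
  (mk4 r (-p) (-n) m (-l) k j (-i) (-h) g f (-e) d (-c) (-b) a :: 'a::field mat)"
 by (simp add: mk4_theta mk4_mult)

lemma mk4_uminus: "- mk4 a b c d e f g h i j k l m n p r =
  (mk4 (-a) (-b) (-c) (-d) (-e) (-f) (-g) (-h) (-i) (-j) (-k) (-l) (-m) (-n) (-p) (-r) :: 'a::field mat)"
 (is "- ?A = ?C")
proof -
 have C: "?A : carrier_mat 4 4" "?C : carrier_mat 4 4" by (rule mk4_carrier)+
 have "ALL i<4. ALL j<4. - (?A $$ (i, j)) = ?C $$ (i, j)" unfolding all4 by (simp add: mk4_index)
 then show ?thesis using C by (intro mat4_eqI) auto
qed

lemma theta_odn: "theta_mat * odn R S * theta_mat = - odn R (S :: 'a::field m2)"
 by (cases R; cases S) (simp add: theta_conj_mk4 mk4_uminus mk4_inject)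

lemma theta_fixed:
 assumes P: "P : carrier_mat 4 4" "theta_mat * P * theta_mat = (P :: 'a::field mat)"
 shows "EX R S. P = evn R S"
proof -
 obtain a b c d e f g h i j k l m n p r where m: "P = mk4 a b c d e f g h i j k l m n p r" using mk4_eta[OF P(1)] by blast
 have "i = - h & j = g & k = f & l = - e & m = d & n = - c & p = - b & r = a"
  using P(2) unfolding m theta_conj_mk4 mk4_inject by (elim conjE) (intro conjI; erule sym)
 then have "P = evn (M2 a b e f) (M2 d (- c) h (- g))" unfolding m by simp
 then show ?thesis by blast
qed

lemma theta_antifixed:
 assumes P: "P : carrier_mat 4 4" "theta_mat * P * theta_mat = - (P :: 'a::field mat)"
 shows "EX R S. P = odn R S"
proof -
 obtain a b c d e f g h i j k l m n p r where m: "P = mk4 a b c d e f g h i j k l m n p r" using mk4_eta[OF P(1)] by blast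
 have "i = h & j = - g & k = - f & l = e & m = - d & n = c & p = b & r = - a"
  using P(2) unfolding m mk4_uminus theta_conj_mk4 mk4_inject neg_equal_iff_equal
  by (elim conjE) (intro conjI; assumption)
 then have "P = odn (M2 a b e f) (M2 d (- c) h (- g))" unfolding m by simp
 then show ?thesis by blast
qed

section \<open>Splitting the tensor product\<close>

text \<open>Over a ring containing \<open>s\<close> the tensor product with \<open>E\<close> splits: \<open>A \<otimes> 1 + B \<otimes> s\<close> is
 determined by its two evaluations \<open>A + s B\<close> and \<open>A - s B\<close>, which are ring homomorphisms.
 As all our rings lie in one field containing \<open>s\<close>, these two evaluations are available
 throughout, and the unitarity conditions express one through the other.\<close>

locale tensor =
 fixes s :: "'k::field"
 assumes s_nz: "s ~= 0" and two_nz: "(2::'k) ~= 0"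
begin

abbreviation "id4 \<equiv> temb 4 (1\<^sub>m 4)"

definition tm :: "'k mat => 'k mat => 'k tmat" where
 "tm P Q = ((1 / 2) \<cdot>\<^sub>m (P + Q), (1 / (2 * s)) \<cdot>\<^sub>m (P - Q))"

lemma tmats_UNIV: "X : tmats n UNIV \<longleftrightarrow> fst X : carrier_mat n n & snd X : carrier_mat n n"
 by (cases X) (auto simp: tmats_def)

lemma tmats_mono: "X : tmats n R ==> R <= R' ==> X : tmats n R'"
 by (auto simp: tmats_def)

lemma tmats_U: "X : tmats n R ==> X : tmats n UNIV"
 by (auto simp: tmats_def)

lemma sq_mult [simp]: "A : carrier_mat n n ==> B : carrier_mat n n ==> A * B : carrier_mat n n"
 by simp

lemma teval_carrier [simp]: "X : tmats n UNIV ==> teval t X : carrier_mat n n"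
 by (auto simp: tmats_def teval_def)

lemma tm_in [simp]: "P : carrier_mat n n ==> Q : carrier_mat n n ==> tm P Q : tmats n UNIV"
 by (auto simp: tm_def tmats_UNIV)

lemma tm_teval: assumes "X : tmats n UNIV" shows "tm (teval s X) (teval (- s) X) = X"
proof -
 obtain A B where X: "X = (A, B)" by (cases X)
 have C: "A : carrier_mat n n" "B : carrier_mat n n" using assms X by (auto simp: tmats_UNIV)
 have "(1 / 2) * ((a + s * b) + (a + - s * b)) = a" "(1 / (2 * s)) * ((a + s * b) - (a + - s * b)) = b" for a b
  using s_nz two_nz by (simp_all add: field_simps)
 then show ?thesis using C unfolding X tm_def teval_def by (auto intro!: eq_matI)
qed

lemma teval_tm:
 assumes "P : carrier_mat n n" "Q : carrier_mat n n"
 shows "teval s (tm P Q) = P" "teval (- s) (tm P Q) = Q"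
proof -
 have "1 / 2 * (a + b) + s * (1 / (2 * s) * (a - b)) = a" "1 / 2 * (a + b) + - s * (1 / (2 * s) * (a - b)) = b" for a b
 proof -
  have e: "s * (1 / (2 * s) * (a - b)) = 1 / 2 * (a - b)" using s_nz by simp
  have h: "1 / 2 * (a + b) + 1 / 2 * (a - b) = a" "1 / 2 * (a + b) - 1 / 2 * (a - b) = b"
  proof -
   have "1 / 2 * (a + b) + 1 / 2 * (a - b) = 1 / 2 * (2 * a)" "1 / 2 * (a + b) - 1 / 2 * (a - b) = 1 / 2 * (2 * b)"
    unfolding distrib_left[symmetric] right_diff_distrib[symmetric] by (simp_all add: algebra_simps)
   then show "1 / 2 * (a + b) + 1 / 2 * (a - b) = a" "1 / 2 * (a + b) - 1 / 2 * (a - b) = b" using two_nz by simp_all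
  qed
  show "1 / 2 * (a + b) + s * (1 / (2 * s) * (a - b)) = a" unfolding e by (rule h)
  show "1 / 2 * (a + b) + - s * (1 / (2 * s) * (a - b)) = b" using h(2) e by (simp only: mult_minus_left add_uminus_conv_diff)
 qed
 then show "teval s (tm P Q) = P" "teval (- s) (tm P Q) = Q"
  using assms unfolding tm_def teval_def by (auto intro!: eq_matI)
qed

lemma tmat_eqI:
 assumes "X : tmats n UNIV" "Y : tmats n UNIV" "teval s X = teval s Y" "teval (- s) X = teval (- s) Y"
 shows "X = Y"
 using tm_teval assms by metis

lemma teval_tmult:
 assumes "X : tmats n UNIV" "Y : tmats n UNIV" and t: "t * t = s * s"
 shows "teval t (tmult s X Y) = teval t X * teval t Y"
proof -
 obtain A B C D where XY: "X = (A, B)" "Y = (C, D)" by (cases X; cases Y)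
 have C: "A : carrier_mat n n" "B : carrier_mat n n" "C : carrier_mat n n" "D : carrier_mat n n"
  using assms XY by (auto simp: tmats_UNIV)
 have e: "(\<Sum>k\<in>K. a k * c k) + s\<^sup>2 * (\<Sum>k\<in>K. b k * d k) + t * ((\<Sum>k\<in>K. a k * d k) + (\<Sum>k\<in>K. b k * c k)) =
   (\<Sum>k\<in>K. (a k + t * b k) * (c k + t * d k))" for K :: "nat set" and a b c d :: "nat => 'k"
 proof -
  have "(\<Sum>k\<in>K. (a k + t * b k) * (c k + t * d k)) = (\<Sum>k\<in>K. a k * c k + s\<^sup>2 * (b k * d k) + t * (a k * d k + b k * c k))"
   by (rule sum.cong) (auto simp: algebra_simps power2_eq_square t[symmetric])
  then show ?thesis by (simp add: sum.distrib sum_distrib_left distrib_left)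
 qed
 show ?thesis
  using C unfolding XY teval_def tmult_def by (intro eq_matI) (auto simp: scalar_prod_def e)
qed

lemma teval_temb [simp]: "A : carrier_mat n n ==> teval t (temb n A) = A"
 by (auto simp: teval_def temb_def)

lemma temb_in [simp]: "A : carrier_mat n n ==> temb n A : tmats n UNIV"
 by (auto simp: temb_def tmats_UNIV)

lemma tmult_in [simp]: "X : tmats n UNIV ==> Y : tmats n UNIV ==> tmult s X Y : tmats n UNIV"
 by (auto simp: tmult_def tmats_UNIV)

lemma teval_tneg: "X : tmats n UNIV ==> teval t (tneg X) = - teval t X"
 by (auto simp: teval_def tneg_def tmats_UNIV intro!: eq_matI)

lemma tneg_in [simp]: "X : tmats n UNIV ==> tneg X : tmats n UNIV"
 by (auto simp: tneg_def tmats_UNIV)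

lemma tt_in [simp]: "X : tmats n UNIV ==> ttranspose (tbar X) : tmats n UNIV"
 by (auto simp: tbar_def ttranspose_def tmats_UNIV)

lemma teval_tt: "X : tmats n UNIV ==> teval t (ttranspose (tbar X)) = transpose_mat (teval (- t) X)"
 by (auto simp: teval_def tbar_def ttranspose_def tmats_UNIV intro!: eq_matI)

lemma tevals: "X : tmats n UNIV ==> Y : tmats n UNIV ==> teval s (tmult s X Y) = teval s X * teval s Y"
 "X : tmats n UNIV ==> Y : tmats n UNIV ==> teval (- s) (tmult s X Y) = teval (- s) X * teval (- s) Y"
 by (rule teval_tmult; simp)+

lemma tm_mult:
 assumes "P : carrier_mat n n" "Q : carrier_mat n n" "P' : carrier_mat n n" "Q' : carrier_mat n n"
 shows "tmult s (tm P Q) (tm P' Q') = tm (P * P') (Q * Q')"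
 by (rule tmat_eqI[of _ n]) (use assms in \<open>simp_all add: tevals[of _ n] teval_tm[of _ n]\<close>)

lemma temb_tm: "A : carrier_mat n n ==> temb n A = tm A A"
 by (rule tmat_eqI[of _ n]) (simp_all add: teval_tm[of _ n])

definition ring_over :: "'k set => bool" where
 "ring_over R \<longleftrightarrow> 0 : R & 1 : R & s\<^sup>2 : R & (\<forall>a\<in>R. - a : R) & (\<forall>a\<in>R. \<forall>b\<in>R. a + b : R & a * b : R)"

lemma ring_over_UNIV: "ring_over UNIV" by (simp add: ring_over_def)

lemma ring_over_sum: "ring_over R ==> (!!k. k : K ==> f k : R) ==> sum f K : R"
 by (induction K rule: infinite_finite_induct) (auto simp: ring_over_def)

lemma tmats_entries: "X : tmats n R \<longleftrightarrow> X : tmats n UNIV & (ALL i<n. ALL j<n. fst X $$ (i, j) : R & snd X $$ (i, j) : R)"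
proof -
 have "elements_mat A <= R \<longleftrightarrow> (ALL i<n. ALL j<n. A $$ (i, j) : R)" if "A : carrier_mat n n" for A
  using that unfolding elements_mat_def by fastforce
 then show ?thesis by (cases X) (auto simp: tmats_def)
qed

lemma tmult_closed:
 assumes "ring_over R" "X : tmats n R" "Y : tmats n R" shows "tmult s X Y : tmats n R"
proof -
 obtain A B C D where XY: "X = (A, B)" "Y = (C, D)" by (cases X; cases Y)
 have C: "A : carrier_mat n n" "B : carrier_mat n n" "C : carrier_mat n n" "D : carrier_mat n n"
  using assms(2,3)[THEN tmats_U] XY by (auto simp: tmats_UNIV)
 have E: "A $$ (i, j) : R" "B $$ (i, j) : R" "C $$ (i, j) : R" "D $$ (i, j) : R" if "i < n" "j < n" for i j
  using assms(2,3) that unfolding tmats_entries[of _ n R] XY by auto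
 have s2: "s\<^sup>2 : R" and m: "!!a b. a : R ==> b : R ==> a * b : R" and p: "!!a b. a : R ==> b : R ==> a + b : R"
  using assms(1) unfolding ring_over_def by auto
 show ?thesis
  unfolding tmats_entries[of _ n R]
  using C assms(2,3)[THEN tmats_U] unfolding XY
  by (auto simp: tmult_def tmats_UNIV scalar_prod_def intro!: p m s2 ring_over_sum[OF assms(1)] E)
qed

lemma temb_closed: "ring_over R ==> A : carrier_mat n n ==> (!!i j. i < n ==> j < n ==> A $$ (i, j) : R) ==> temb n A : tmats n R"
 unfolding tmats_entries[of _ n R] by (auto simp: temb_def tmats_UNIV ring_over_def)

lemma temb_one_closed: "ring_over R ==> temb n (1\<^sub>m n) : tmats n R"
 by (rule temb_closed) (auto simp: ring_over_def)

lemma temb_J_closed: "ring_over R ==> temb n (Jmat n) : tmats n R"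
 by (rule temb_closed) (auto simp: ring_over_def Jmat_def)

lemma tt_closed: "ring_over R ==> X : tmats n R ==> ttranspose (tbar X) : tmats n R"
 unfolding tmats_entries[of _ n R] by (auto simp: tbar_def ttranspose_def tmats_UNIV ring_over_def)

lemma tmult_assoc: "X : tmats n UNIV ==> Y : tmats n UNIV ==> Z : tmats n UNIV ==>
  tmult s (tmult s X Y) Z = tmult s X (tmult s Y Z)"
 by (rule tmat_eqI[of _ n]) (simp_all add: tevals[of _ n] assoc_mult_mat[of _ n n _ n _ n])

lemma tmult_one: "X : tmats n UNIV ==> tmult s X (temb n (1\<^sub>m n)) = X" "X : tmats n UNIV ==> tmult s (temb n (1\<^sub>m n)) X = X"
 by (rule tmat_eqI[of _ n]; simp add: tevals[of _ n] right_mult_one_mat[of _ n n] left_mult_one_mat[of _ n n])+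

lemma tmat_monoid: assumes "ring_over R" shows "monoid (tmat_monoid n s R)"
proof (rule monoidI)
 fix X Y Z assume "X : carrier (tmat_monoid n s R)" "Y : carrier (tmat_monoid n s R)" "Z : carrier (tmat_monoid n s R)"
 then have "X : tmats n UNIV" "Y : tmats n UNIV" "Z : tmats n UNIV"
  by (simp_all add: tmat_monoid_def tmats_U)
 then show "X \<otimes>\<^bsub>tmat_monoid n s R\<^esub> Y \<otimes>\<^bsub>tmat_monoid n s R\<^esub> Z = X \<otimes>\<^bsub>tmat_monoid n s R\<^esub> (Y \<otimes>\<^bsub>tmat_monoid n s R\<^esub> Z)"
  by (simp add: tmat_monoid_def tmult_assoc)
next
 fix X assume "X : carrier (tmat_monoid n s R)"
 then have "X : tmats n UNIV" by (simp add: tmat_monoid_def tmats_U)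
 then show "\<one>\<^bsub>tmat_monoid n s R\<^esub> \<otimes>\<^bsub>tmat_monoid n s R\<^esub> X = X" "X \<otimes>\<^bsub>tmat_monoid n s R\<^esub> \<one>\<^bsub>tmat_monoid n s R\<^esub> = X"
  by (simp_all add: tmat_monoid_def tmult_one)
qed (auto simp: tmat_monoid_def tmult_closed[OF assms] temb_one_closed[OF assms])

lemma tinv_eq:
 assumes "X : tmats n UNIV" "Y : tmats n UNIV" "tmult s X Y = temb n (1\<^sub>m n)" "tmult s Y X = temb n (1\<^sub>m n)"
 shows "tinv n s X = Y"
proof -
 interpret monoid "tmat_monoid n s UNIV" by (rule tmat_monoid[OF ring_over_UNIV])
 show ?thesis unfolding tinv_def
  using inv_unique'[of X Y] assms by (simp add: tmat_monoid_def)
qed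

text \<open>The adjoint for the form with matrix \<open>J\<^sub>n\<close>.\<close>

definition madj :: "nat => 'k mat => 'k mat" where "madj n A = Jmat n * transpose_mat A * Jmat n"

definition ust :: "nat => 'k tmat => 'k tmat" where
 "ust n X = tmult s (tmult s (temb n (Jmat n)) (ttranspose (tbar X))) (temb n (Jmat n))"

lemma J_carrier [simp]: "Jmat n : carrier_mat n n" by (simp add: Jmat_def)
lemma J_sym: "transpose_mat (Jmat n) = Jmat n" by (auto simp: Jmat_def add.commute intro!: eq_matI)
lemma madj_carrier [simp]: "A : carrier_mat n n ==> madj n A : carrier_mat n n"
 unfolding madj_def by (intro sq_mult) auto

lemma ust_in [simp]: "X : tmats n UNIV ==> ust n X : tmats n UNIV" by (simp add: ust_def)

lemma ust_closed: "ring_over R ==> X : tmats n R ==> ust n X : tmats n R"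
 unfolding ust_def by (intro tmult_closed temb_J_closed tt_closed)

lemma teval_ust: "X : tmats n UNIV ==> teval s (ust n X) = madj n (teval (- s) X)"
 "X : tmats n UNIV ==> teval (- s) (ust n X) = madj n (teval s X)"
 by (simp_all add: ust_def madj_def tevals[of _ n] teval_tt[of _ n])

end

text \<open>The involutivity of \<open>J\<^sub>n\<close> is verified for the sizes that occur.\<close>

locale tensor_form = tensor s for s :: "'k::field" +
 fixes n :: nat
 assumes JJ: "Jmat n * Jmat n = (1\<^sub>m n :: 'k mat)"
begin

lemma J_cancel: "A : carrier_mat n n ==> Jmat n * (Jmat n * A) = (A :: 'k mat)"
 using assoc_mult_mat[of "Jmat n" n n "Jmat n" n A n] JJ by simp

lemma assoc_sq: "A : carrier_mat n n ==> B : carrier_mat n n ==> C : carrier_mat n n ==> A * B * C = A * (B * (C :: 'k mat))"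
 by (rule assoc_mult_mat)

lemma transpose_sq: "A : carrier_mat n n ==> B : carrier_mat n n ==> transpose_mat (A * B) = transpose_mat B * transpose_mat (A :: 'k mat)"
 by (rule transpose_mult)

lemma madj_madj: "A : carrier_mat n n ==> madj n (madj n A) = A"
proof -
 assume A: "A : carrier_mat n n"
 then have T: "transpose_mat A : carrier_mat n n" by simp
 have "transpose_mat (madj n A) = Jmat n * (A * Jmat n)"
  unfolding madj_def using A T by (simp add: transpose_sq J_sym assoc_sq del: transpose_carrier_mat)
 then show ?thesis unfolding madj_def[of n "madj n A"] using A
  by (simp add: J_cancel JJ assoc_sq right_mult_one_mat[of _ n n])
qed

lemma madj_mult: "A : carrier_mat n n ==> B : carrier_mat n n ==> madj n (A * B) = madj n B * madj n A"
proof -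
 assume A: "A : carrier_mat n n" and B: "B : carrier_mat n n"
 then have T: "transpose_mat A : carrier_mat n n" "transpose_mat B : carrier_mat n n" by simp_all
 show ?thesis unfolding madj_def using A B T
  by (simp add: transpose_sq assoc_sq J_cancel del: transpose_carrier_mat)
qed

lemma madj_one: "madj n (1\<^sub>m n) = 1\<^sub>m n" by (simp add: madj_def JJ right_mult_one_mat[of _ n n])

lemma ust_ust: "X : tmats n UNIV ==> ust n (ust n X) = X"
 by (rule tmat_eqI[of _ n]) (simp_all add: teval_ust madj_madj)

lemma unitary_iff:
 assumes R: "ring_over R" and X: "X : tmats n R"
 shows "X : unitary n s R \<longleftrightarrow> teval s X * madj n (teval (- s) X) = 1\<^sub>m n"
  and "X : unitary n s R ==> tinv n s X = ust n X"
proof -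
 note XU = tmats_U[OF X]
 let ?P = "teval s X" and ?Q = "teval (- s) X"
 have PQ: "?P : carrier_mat n n" "?Q : carrier_mat n n" using XU by auto
 have T: "tinv n s (ttranspose (tbar Z)) = ttranspose (tbar Y)"
  if Z: "Z : tmats n UNIV" "Y : tmats n UNIV" "tmult s Z Y = temb n (1\<^sub>m n)" "tmult s Y Z = temb n (1\<^sub>m n)" for Z Y
 proof (rule tinv_eq)
  have e: "teval s Z * teval s Y = 1\<^sub>m n" "teval s Y * teval s Z = 1\<^sub>m n"
   "teval (- s) Z * teval (- s) Y = 1\<^sub>m n" "teval (- s) Y * teval (- s) Z = 1\<^sub>m n"
   using Z(3,4) tevals[OF Z(1,2), symmetric] tevals[OF Z(2,1), symmetric] by simp_all
  have tr: "transpose_mat A * transpose_mat B = 1\<^sub>m n" if "B * A = 1\<^sub>m n" "A : carrier_mat n n" "B : carrier_mat n n" for A B :: "'k mat"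
   using transpose_mult[of B n n A n] that by simp
  show "tmult s (ttranspose (tbar Z)) (ttranspose (tbar Y)) = temb n (1\<^sub>m n)"
   "tmult s (ttranspose (tbar Y)) (ttranspose (tbar Z)) = temb n (1\<^sub>m n)"
   by (rule tmat_eqI[of _ n]; use Z(1,2) e in \<open>simp add: tevals[of _ n] teval_tt[of _ n] tr\<close>)+
 qed (use Z in auto)
 have fwd: "tmult s X (ust n X) = temb n (1\<^sub>m n) & tmult s (ust n X) X = temb n (1\<^sub>m n)" if u: "X : unitary n s R"
 proof -
  obtain Y where Y: "Y : tmats n R" "tmult s X Y = temb n (1\<^sub>m n)" "tmult s Y X = temb n (1\<^sub>m n)"
   using u unfolding unitary_def Units_def by (auto simp: tmat_monoid_def)
  have "ust n Y = X" using u T[OF XU tmats_U[OF Y(1)] Y(2,3)] by (simp add: unitary_def ust_def)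
  then have "ust n X = Y" using ust_ust[OF tmats_U[OF Y(1)]] by simp
  then show ?thesis using Y by simp
 qed
 show "X : unitary n s R ==> tinv n s X = ust n X"
  using fwd by (intro tinv_eq) (use XU in auto)
 show "X : unitary n s R \<longleftrightarrow> ?P * madj n ?Q = 1\<^sub>m n"
 proof
  assume "X : unitary n s R"
  then have "teval s (tmult s X (ust n X)) = teval s (temb n (1\<^sub>m n))" using fwd by simp
  then show "?P * madj n ?Q = 1\<^sub>m n" using XU by (simp add: tevals[of _ n] teval_ust)
 next
  assume a: "?P * madj n ?Q = 1\<^sub>m n"
  have a': "madj n ?Q * ?P = 1\<^sub>m n" by (rule mat_mult_left_right_inverse[OF PQ(1) madj_carrier[OF PQ(2)] a])
  have b: "?Q * madj n ?P = 1\<^sub>m n" "madj n ?P * ?Q = 1\<^sub>m n"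
   using arg_cong[OF a, of "madj n"] arg_cong[OF a', of "madj n"] PQ
   by (simp_all add: madj_mult madj_madj madj_one)
  have inv: "tmult s X (ust n X) = temb n (1\<^sub>m n)" "tmult s (ust n X) X = temb n (1\<^sub>m n)"
   by (rule tmat_eqI[of _ n]; use XU a a' b in \<open>simp add: tevals[of _ n] teval_ust\<close>)+
  then have "X : Units (tmat_monoid n s R)"
   unfolding Units_def using X ust_closed[OF R X] by (auto simp: tmat_monoid_def)
  moreover have "tmult s (tmult s (temb n (Jmat n)) (tinv n s (ttranspose (tbar X)))) (temb n (Jmat n)) = X"
   unfolding T[OF XU ust_in[OF XU] inv] using ust_ust[OF XU] by (simp add: ust_def)
  ultimately show "X : unitary n s R" by (simp add: unitary_def)
 qed
qed

lemma unitary_tmats: "X : unitary n s R ==> X : tmats n R"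
 by (auto simp: unitary_def Units_def tmat_monoid_def)

lemma unitary_Lie_iff:
 assumes X: "X : tmats n R"
 shows "X : unitary_Lie n s R \<longleftrightarrow> - madj n (teval (- s) X) = teval s X"
proof -
 note XU = tmats_U[OF X]
 have "X : unitary_Lie n s R \<longleftrightarrow> tneg (ust n X) = X" using X by (simp add: unitary_Lie_def ust_def)
 also have "... \<longleftrightarrow> - madj n (teval (- s) X) = teval s X"
 proof
  assume "tneg (ust n X) = X"
  then have "teval s (tneg (ust n X)) = teval s X" by simp
  then show "- madj n (teval (- s) X) = teval s X" using XU by (simp add: teval_tneg[of _ n] teval_ust)
 next
  assume a: "- madj n (teval (- s) X) = teval s X"
  have m: "madj n (- A) = - madj n A" if "A : carrier_mat n n" for A
  proof -
   have T: "transpose_mat A : carrier_mat n n" "transpose_mat (- A) = - transpose_mat A" using that by (auto simp: transpose_uminus)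
   have "Jmat n * - transpose_mat A = - (Jmat n * transpose_mat A)"
    using T(1) by (intro eq_matI) (auto simp: Jmat_def scalar_prod_def sum_negf)
   moreover have "- (Jmat n * transpose_mat A) * Jmat n = - (Jmat n * transpose_mat A * Jmat n)"
    using T(1) by (intro eq_matI) (auto simp: Jmat_def scalar_prod_def sum_negf)
   ultimately show ?thesis unfolding madj_def T(2) by simp
  qed
  have "madj n (teval s X) = - teval (- s) X"
   using arg_cong[OF a, of "madj n"] m[of "madj n (teval (- s) X)"] madj_madj[of "teval (- s) X"] XU by simp
  then have "- madj n (teval s X) = teval (- s) X" using XU by simp
  then show "tneg (ust n X) = X"
   using XU a by (intro tmat_eqI[of _ n]) (simp_all add: teval_tneg[of _ n] teval_ust)
 qed
 finally show ?thesis .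
qed

end

section \<open>The symmetric space as a space of two by two matrices\<close>

context tensor
begin

text \<open>\<open>e4 k g\<close> acts on \<open>V\<^sub>+\<close> by \<open>k\<close> and on \<open>V\<^sub>-\<close> by \<open>g\<close>; \<open>o4 A B\<close> maps \<open>V\<^sub>+\<close> to \<open>V\<^sub>-\<close> by \<open>A\<close> and
 \<open>V\<^sub>-\<close> to \<open>V\<^sub>+\<close> by \<open>B\<close>.\<close>

definition e4 :: "'k m2 => 'k m2 => 'k mat" where
 "e4 k g = evn (scal (1 / 2) * (k + g)) (scal (1 / 2) * (k - g))"
definition o4 :: "'k m2 => 'k m2 => 'k mat" where
 "o4 A B = odn (scal (1 / 2) * (A + B)) (scal (1 / 2) * (A - B))"

lemma half_sum: "scal (1 / 2) * (A + A) = (A :: 'k m2)"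
proof -
 have h: "1 / 2 * (a + a) = a" for a :: 'k
 proof -
  have "1 / 2 * (a + a) = 1 / 2 * (2 * a)" by (simp only: mult_2)
  then show ?thesis using two_nz by simp
 qed
 show ?thesis by (cases A) (simp only: dia_def plus_m2.simps times_m2.simps h mult_zero_left add_0_left add_0_right)
qed

lemma half2: "scal (1 / 2) * A * (scal (1 / 2) * B) = scal (1 / 2) * (scal (1 / 2) * (A * (B :: 'k m2)))"
proof -
 have "scal (1 / 2) * A * (scal (1 / 2) * B) = scal (1 / 2) * (A * scal (1 / 2)) * B" by (simp only: mult.assoc)
 also have "... = scal (1 / 2) * (scal (1 / 2) * A) * B" by (simp only: scal_central[of "1 / 2" A])
 finally show ?thesis by (simp only: mult.assoc)
qed

lemma e4_carrier [simp]: "e4 k g : carrier_mat 4 4" by (simp add: e4_def)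
lemma o4_carrier [simp]: "o4 A B : carrier_mat 4 4" by (simp add: o4_def)

lemma half_products:
 fixes k g k' g' :: "'k m2"
 defines "h \<equiv> scal (1 / 2 :: 'k)"
 shows "h * (k + g) * (h * (k' + g')) + h * (k - g) * (h * (k' - g')) = h * (k * k' + g * g')"
  and "h * (k + g) * (h * (k' - g')) + h * (k - g) * (h * (k' + g')) = h * (k * k' - g * g')"
  and "h * (k + g) * (h * (k' + g')) - h * (k - g) * (h * (k' - g')) = h * (g * k' + k * g')"
  and "h * (k + g) * (h * (k' - g')) - h * (k - g) * (h * (k' + g')) = h * (g * k' - k * g')"
proof -
 have hh: "h * (h * (A + A)) = h * A" for A using half_sum[of A] by (simp add: h_def)
 have "(k + g) * (k' + g') + (k - g) * (k' - g') = (k * k' + g * g') + (k * k' + g * g')"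
  "(k + g) * (k' - g') + (k - g) * (k' + g') = (k * k' - g * g') + (k * k' - g * g')"
  "(k + g) * (k' + g') - (k - g) * (k' - g') = (g * k' + k * g') + (g * k' + k * g')"
  "(k + g) * (k' - g') - (k - g) * (k' + g') = (g * k' - k * g') + (g * k' - k * g')"
  by (simp_all add: algebra_simps)
 note this[THEN arg_cong[of _ _ "%z. h * (h * z)"], unfolded hh]
 then show "h * (k + g) * (h * (k' + g')) + h * (k - g) * (h * (k' - g')) = h * (k * k' + g * g')"
  and "h * (k + g) * (h * (k' - g')) + h * (k - g) * (h * (k' + g')) = h * (k * k' - g * g')"
  and "h * (k + g) * (h * (k' + g')) - h * (k - g) * (h * (k' - g')) = h * (g * k' + k * g')"
  and "h * (k + g) * (h * (k' - g')) - h * (k - g) * (h * (k' + g')) = h * (g * k' - k * g')"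
  unfolding h_def half2 by (simp_all only: distrib_left right_diff_distrib)
qed

lemma e4_e4: "e4 k g * e4 k' g' = e4 (k * k') (g * g')"
 unfolding e4_def evn_evn half_products ..
lemma e4_o4: "e4 k g * o4 A B = o4 (g * A) (k * B)"
 unfolding e4_def o4_def evn_odn half_products ..
lemma o4_e4: "o4 A B * e4 k g = o4 (A * k) (B * g)"
 unfolding e4_def o4_def odn_evn half_products ..

lemma half_inject:
 fixes k g :: "'k m2"
 assumes "scal (1 / 2) * (k + g) = scal (1 / 2) * (k' + g')" "scal (1 / 2) * (k - g) = scal (1 / 2) * (k' - g')"
 shows "k = k' & g = g'"
proof -
 have "scal (1 / 2) * (k + g) + scal (1 / 2) * (k - g) = scal (1 / 2) * (k + k)"
  "scal (1 / 2) * (k' + g') + scal (1 / 2) * (k' - g') = scal (1 / 2) * (k' + k')"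
  "scal (1 / 2) * (k + g) - scal (1 / 2) * (k - g) = scal (1 / 2) * (g + g)"
  "scal (1 / 2) * (k' + g') - scal (1 / 2) * (k' - g') = scal (1 / 2) * (g' + g')"
  unfolding distrib_left[symmetric] right_diff_distrib[symmetric] by simp_all
 then show ?thesis using assms unfolding half_sum by metis
qed

lemma e4_inject: "e4 k g = e4 k' g' \<longleftrightarrow> k = k' & g = g'"
 unfolding e4_def evn_inject using half_inject by blast
lemma o4_inject: "o4 k g = o4 k' g' \<longleftrightarrow> k = k' & g = g'"
 unfolding o4_def odn_inject using half_inject by blast

lemma e4_one: "e4 1 1 = 1\<^sub>m 4" unfolding e4_def half_sum by (simp add: evn_one)

lemma evn_e4: "evn R S = e4 (R + S) (R - S)"
proof -
 have "(R + S) + (R - S) = R + R" "(R + S) - (R - S) = S + S" by simp_all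
 then show ?thesis unfolding e4_def by (simp only: half_sum)
qed
lemma odn_o4: "odn R S = o4 (R + S) (R - S)"
proof -
 have "(R + S) + (R - S) = R + R" "(R + S) - (R - S) = S + S" by simp_all
 then show ?thesis unfolding o4_def by (simp only: half_sum)
qed

lemma dag_half: "dag (scal (1 / 2) * A) = scal (1 / 2) * dag (A :: 'k m2)"
 by (simp add: dag_mult scal_central)

lemma madj_e4: "madj 4 (e4 k g) = e4 (dag k) (dag g)"
 unfolding madj_def e4_def evn_adjoint dag_half dag_add dag_diff ..

lemma madj_o4: "madj 4 (o4 A B) = o4 (- dag B) (- dag A)"
proof -
 have "- (scal (1 / 2) * (dag A + dag B)) = scal (1 / 2) * (- dag B + - dag A)"
  "scal (1 / 2) * (dag A - dag B) = scal (1 / 2) * (- dag B - - dag A)"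
  by (simp_all add: algebra_simps)
 then show ?thesis unfolding madj_def o4_def odn_adjoint dag_half dag_add dag_diff by simp
qed

lemma o4_uminus: "- o4 A B = o4 (- A) (- B)"
proof -
 have u: "- odn R S = odn (- R) (- S)" for R S :: "'k m2" by (cases R; cases S) (simp add: mk4_uminus)
 show ?thesis unfolding o4_def u by (simp add: algebra_simps)
qed

definition el :: "'k m2 => 'k m2 => 'k tmat" where
 "el k g = tm (e4 k g) (e4 (dag (inv2 k)) (dag (inv2 g)))"
definition lie :: "'k m2 => 'k m2 => 'k tmat" where
 "lie A B = tm (o4 A B) (o4 (dag B) (dag A))"

lemma el_in [simp]: "el k g : tmats 4 UNIV" by (simp add: el_def)
lemma lie_in [simp]: "lie A B : tmats 4 UNIV" by (simp add: lie_def)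

lemma teval_el: "teval s (el k g) = e4 k g" "teval (- s) (el k g) = e4 (dag (inv2 k)) (dag (inv2 g))"
 by (simp_all add: el_def teval_tm[of _ 4])
lemma teval_lie: "teval s (lie A B) = o4 A B" "teval (- s) (lie A B) = o4 (dag B) (dag A)"
 by (simp_all add: lie_def teval_tm[of _ 4])

lemma el_inject: "el k g = el k' g' \<longleftrightarrow> k = k' & g = g'"
 using teval_el(1)[of k g] teval_el(1)[of k' g'] e4_inject by metis
lemma lie_inject: "lie k g = lie k' g' \<longleftrightarrow> k = k' & g = g'"
 using teval_lie(1)[of k g] teval_lie(1)[of k' g'] o4_inject by metis

lemma el_mult:
 assumes "det2 k ~= 0" "det2 g ~= 0" "det2 k' ~= 0" "det2 g' ~= 0"
 shows "tmult s (el k g) (el k' g') = el (k * k') (g * g')"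
 unfolding el_def by (subst tm_mult[of _ 4]) (use assms in \<open>simp_all add: e4_e4 inv2_mult dag_mult\<close>)

lemma el_one: "el 1 1 = id4"
 by (simp add: el_def e4_one temb_tm)

lemma tinv_el:
 assumes "det2 k ~= 0" "det2 g ~= 0" shows "tinv 4 s (el k g) = el (inv2 k) (inv2 g)"
 by (rule tinv_eq) (use assms in \<open>simp_all add: el_mult det2_inv2 inv2 el_one\<close>)

lemma Ad_el:
 assumes "det2 k ~= 0" "det2 g ~= 0"
 shows "Ad 4 s (el k g) (lie A B) = lie (g * A * inv2 k) (k * B * inv2 g)"
proof -
 have "tmult s (el k g) (lie A B) = tm (o4 (g * A) (k * B)) (o4 (dag (inv2 g) * dag B) (dag (inv2 k) * dag A))"
  unfolding el_def lie_def by (subst tm_mult[of _ 4]) (simp_all add: e4_o4)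
 then show ?thesis unfolding Ad_def tinv_el[OF assms] unfolding el_def lie_def
  by (simp add: tm_mult[of _ 4] o4_e4 inv2_inv2 assms dag_mult mult.assoc)
qed

lemma theta_teval: "X : tmats 4 UNIV ==> theta s X : tmats 4 UNIV"
 "X : tmats 4 UNIV ==> teval s (theta s X) = theta_mat * teval s X * theta_mat"
 "X : tmats 4 UNIV ==> teval (- s) (theta s X) = theta_mat * teval (- s) X * theta_mat"
proof -
 have W: "(theta_mat :: 'k mat) : carrier_mat 4 4" by (simp add: mk4_theta)
 have "tinv 4 s (temb 4 theta_mat) = temb 4 theta_mat"
  by (rule tinv_eq) (use W in \<open>auto intro!: tmat_eqI[of _ 4] simp: tevals[of _ 4] theta_square\<close>)
 then have t: "theta s X = tmult s (tmult s (temb 4 theta_mat) X) (temb 4 theta_mat)" by (simp add: theta_def Ad_def)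
 show "X : tmats 4 UNIV ==> theta s X : tmats 4 UNIV"
  "X : tmats 4 UNIV ==> teval s (theta s X) = theta_mat * teval s X * theta_mat"
  "X : tmats 4 UNIV ==> teval (- s) (theta s X) = theta_mat * teval (- s) X * theta_mat"
  using W unfolding t by (simp_all add: tevals[of _ 4])
qed

lemma tensor_form_4: "tensor_form s 4"
 by unfold_locales (rule J_square)

lemma G_theta_iff:
 assumes R: "ring_over R"
 shows "X : G_theta s R \<longleftrightarrow> X : tmats 4 R & (EX k g. det2 k ~= 0 & det2 g ~= 0 & X = el k g)"
proof -
 interpret f: tensor_form s 4 by (rule tensor_form_4)
 show ?thesis
 proof
  assume X: "X : G_theta s R"
  then have XR: "X : tmats 4 R" and u: "X : unitary 4 s R" and th: "theta s X = X"
   using f.unitary_tmats by (auto simp: G_theta_def)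
  note XU = tmats_U[OF XR]
  have tt: "theta_mat * teval s X * theta_mat = teval s X" "theta_mat * teval (- s) X * theta_mat = teval (- s) X"
   using theta_teval(2,3)[OF XU] th by simp_all
  obtain U V where UV: "teval s X = evn U V" using theta_fixed[OF teval_carrier[OF XU] tt(1)] by blast
  obtain U' V' where UV': "teval (- s) X = evn U' V'" using theta_fixed[OF teval_carrier[OF XU] tt(2)] by blast
  from UV UV' obtain k g k' g' where PQ: "teval s X = e4 k g" "teval (- s) X = e4 k' g'" unfolding evn_e4 by blast
  have "e4 (k * dag k') (g * dag g') = e4 1 1"
   using f.unitary_iff(1)[OF R XR] u unfolding PQ madj_e4 e4_e4 e4_one by blast
  then have e: "k * dag k' = 1" "g * dag g' = 1" unfolding e4_inject by auto
  then have "inv2 k = dag k'" "inv2 g = dag g'" "det2 k ~= 0" "det2 g ~= 0" using inv2_unique by blast+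
  moreover from this have "X = el k g"
   using XU PQ by (intro tmat_eqI[of _ 4]) (simp_all add: teval_el)
  ultimately show "X : tmats 4 R & (EX k g. det2 k ~= 0 & det2 g ~= 0 & X = el k g)" using XR by blast
 next
  assume "X : tmats 4 R & (EX k g. det2 k ~= 0 & det2 g ~= 0 & X = el k g)"
  then obtain k g where X: "X : tmats 4 R" "det2 k ~= 0" "det2 g ~= 0" "X = el k g" by blast
  have "X : unitary 4 s R"
   unfolding f.unitary_iff(1)[OF R X(1)] using X(2,3) unfolding X(4) teval_el madj_e4 e4_e4
   by (simp add: inv2 e4_one)
  moreover have "theta s X = X"
   by (rule tmat_eqI[of _ 4]) (use X(4) in \<open>simp_all add: theta_teval teval_el e4_def theta_evn\<close>)
  ultimately show "X : G_theta s R" by (simp add: G_theta_def)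
 qed
qed

lemma g1_iff:
 assumes R: "ring_over R"
 shows "X : g1 s R \<longleftrightarrow> X : tmats 4 R & (EX A B. X = lie A B)"
proof -
 interpret f: tensor_form s 4 by (rule tensor_form_4)
 show ?thesis
 proof
  assume X: "X : g1 s R"
  then have XR: "X : tmats 4 R" and u: "X : unitary_Lie 4 s R" and th: "theta s X = tneg X"
   by (auto simp: g1_def unitary_Lie_def)
  note XU = tmats_U[OF XR]
  have tt: "theta_mat * teval s X * theta_mat = - teval s X" "theta_mat * teval (- s) X * theta_mat = - teval (- s) X"
   using theta_teval(2,3)[OF XU] teval_tneg[OF XU] th by simp_all
  obtain U V where UV: "teval s X = odn U V" using theta_antifixed[OF teval_carrier[OF XU] tt(1)] by blast
  obtain U' V' where UV': "teval (- s) X = odn U' V'" using theta_antifixed[OF teval_carrier[OF XU] tt(2)] by blast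
  from UV UV' obtain A B A' B' where PQ: "teval s X = o4 A B" "teval (- s) X = o4 A' B'" unfolding odn_o4 by blast
  have "o4 (dag B') (dag A') = o4 A B"
   using f.unitary_Lie_iff[OF XR] u unfolding PQ madj_o4 o4_uminus by simp
  then have "A = dag B'" "B = dag A'" unfolding o4_inject by auto
  then have "X = lie A B"
   using XU PQ by (intro tmat_eqI[of _ 4]) (simp_all add: teval_lie)
  then show "X : tmats 4 R & (EX A B. X = lie A B)" using XR by blast
 next
  assume "X : tmats 4 R & (EX A B. X = lie A B)"
  then obtain A B where X: "X : tmats 4 R" "X = lie A B" by blast
  have "X : unitary_Lie 4 s R"
   using f.unitary_Lie_iff[OF X(1)] unfolding X(2) teval_lie madj_o4 o4_uminus by simp
  moreover have "theta s X = tneg X"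
   by (rule tmat_eqI[of _ 4]) (use X(2) in \<open>simp_all add: theta_teval teval_lie o4_def theta_odn teval_tneg[of _ 4]\<close>)
  ultimately show "X : g1 s R" by (simp add: g1_def)
 qed
qed

lemma gamma_lie: "gamma x y = lie (dia x y) (dia x y)"
proof -
 have "o4 (dia x y) (dia x y) = odn (dia x y) 0" unfolding o4_def half_sum by simp
 also have "... = mk4 x 0 0 0 0 y 0 0 0 0 (-y) 0 0 0 0 (-x)" by (simp add: dia_def zero_m2_def)
 also have "... = mat_diag 4 (%i. [x, y, - y, - x] ! i)"
 proof (rule mat4_eqI)
  show "ALL i<4. ALL j<4. mk4 x 0 0 0 0 y 0 0 0 0 (-y) 0 0 0 0 (-x) $$ (i, j) = mat_diag 4 (%i. [x, y, - y, - x] ! i) $$ (i, j)"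
   unfolding all4 by (simp add: mk4_index mat_diag_def)
 qed (simp_all add: mat_diag_def)
 finally show ?thesis by (simp add: gamma_def lie_def temb_tm)
qed

end

section \<open>Connectedness in the Zariski topology\<close>

definition rational_off :: "'k::field set => ('k => 'k) => bool" where
 "rational_off B h \<longleftrightarrow> (EX f d. ALL t. t ~: B --> poly d t ~= 0 & h t * poly d t = poly f t)"

lemma rational_const: "rational_off B (%t. c)"
 unfolding rational_off_def by (intro exI[of _ "[:c:]"] exI[of _ "[:1:]"]) simp

lemma rational_id: "rational_off B (%t. t)"
 unfolding rational_off_def by (intro exI[of _ "[:0, 1:]"] exI[of _ "[:1:]"]) simp

lemma rational_add: assumes "rational_off B g" "rational_off B h" shows "rational_off B (%t. g t + h t)"
proof -
 obtain f d f' d' where fd: "ALL t. t ~: B --> poly d t ~= 0 & g t * poly d t = poly f t"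
  "ALL t. t ~: B --> poly d' t ~= 0 & h t * poly d' t = poly f' t"
  using assms unfolding rational_off_def by blast
 have "poly (d * d') t ~= 0 & (g t + h t) * poly (d * d') t = poly (f * d' + f' * d) t" if "t ~: B" for t
 proof -
  have "g t * poly d t = poly f t" "h t * poly d' t = poly f' t" using fd that by auto
  then have "(g t + h t) * (poly d t * poly d' t) = poly f t * poly d' t + poly f' t * poly d t"
   by (simp add: algebra_simps flip: \<open>g t * poly d t = poly f t\<close> \<open>h t * poly d' t = poly f' t\<close>)
  then show ?thesis using fd that by simp
 qed
 then show ?thesis unfolding rational_off_def by blast
qed

lemma rational_mult: assumes "rational_off B g" "rational_off B h" shows "rational_off B (%t. g t * h t)"
proof -
 obtain f d f' d' where fd: "ALL t. t ~: B --> poly d t ~= 0 & g t * poly d t = poly f t"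
  "ALL t. t ~: B --> poly d' t ~= 0 & h t * poly d' t = poly f' t"
  using assms unfolding rational_off_def by blast
 have "poly (d * d') t ~= 0 & (g t * h t) * poly (d * d') t = poly (f * f') t" if "t ~: B" for t
 proof -
  have "g t * poly d t = poly f t" "h t * poly d' t = poly f' t" using fd that by auto
  then have "(g t * h t) * (poly d t * poly d' t) = poly f t * poly f' t"
   by (metis mult.assoc mult.left_commute)
  then show ?thesis using fd that by simp
 qed
 then show ?thesis unfolding rational_off_def by blast
qed

lemma rational_inverse: assumes "rational_off B h" "!!t. t ~: B ==> h t ~= 0" shows "rational_off B (%t. inverse (h t))"
proof -
 obtain f d where fd: "ALL t. t ~: B --> poly d t ~= 0 & h t * poly d t = poly f t"
  using assms unfolding rational_off_def by blast
 have "poly f t ~= 0 & inverse (h t) * poly f t = poly d t" if "t ~: B" for t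
 proof -
  have e: "poly f t = h t * poly d t" "h t ~= 0" "poly d t ~= 0" using fd assms(2) that by auto
  then show ?thesis by simp
 qed
 then show ?thesis unfolding rational_off_def by blast
qed

lemma rational_minus: assumes "rational_off B h" shows "rational_off B (%t. - h t)"
 using rational_mult[OF rational_const[of B "- 1"] assms] by simp

lemma rational_diff: assumes "rational_off B g" "rational_off B h" shows "rational_off B (%t. g t - h t)"
 using rational_add[OF assms(1) rational_minus[OF assms(2)]] by simp

lemmas rational_intros = rational_const rational_id rational_add rational_mult rational_minus rational_diff

lemma rational_poly_function:
 assumes "!!p. p : C ==> rational_off B (%t. p (c t))" "p : poly_functions C"
 shows "rational_off B (%t. p (c t))"
 using assms(2) by (induction rule: poly_functions.induct) (auto intro: rational_intros assms(1))

text \<open>A rational curve, being the image of a cofinite subset of the affine line, meets every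
 Zariski open set either not at all or in all but finitely many points. So no two disjoint
 open sets can both meet it.\<close>

lemma rational_curve_connected:
 fixes c :: "'k::field => 'a"
 assumes inf: "infinite (UNIV :: 'k set)" and B: "finite B" and S: "!!t. t ~: B ==> c t : S"
  and C: "!!p. p : C ==> rational_off B (%t. p (c t))"
  and ab: "a ~: B" "b ~: B"
 shows "connected_component_of (zariski_on C S) (c a) (c b)"
proof -
 define basis where "basis = (%p. {a. p a ~= 0}) ` poly_functions C"
 define dich where "dich U \<longleftrightarrow> (ALL t. t ~: B --> c t ~: U) | finite {t. t ~: B & c t ~: U}" for U
 have d: "dich U" if "generate_topology_on basis U" for U
  using that
 proof induction
  case Empty
  then show ?case by (simp add: dich_def)
 next
  case (Int U V)
  have "{t. t ~: B & c t ~: U \<inter> V} = {t. t ~: B & c t ~: U} \<union> {t. t ~: B & c t ~: V}" by auto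
  then show ?case using Int.IH unfolding dich_def by auto
 next
  case (UN K)
  show ?case
  proof (cases "\<exists>U\<in>K. finite {t. t ~: B & c t ~: U}")
   case True
   then obtain U where U: "U : K" "finite {t. t ~: B & c t ~: U}" by blast
   have "{t. t ~: B & c t ~: \<Union> K} <= {t. t ~: B & c t ~: U}" using U by blast
   then show ?thesis unfolding dich_def using U finite_subset by blast
  next
   case False
   then have "ALL t. t ~: B --> c t ~: U" if "U : K" for U using UN.IH[OF that] that unfolding dich_def by blast
   then show ?thesis unfolding dich_def by blast
  qed
 next
  case (Basis U)
  then obtain p where p: "p : poly_functions C" "U = {a. p a ~= 0}" unfolding basis_def by blast
  obtain f d where fd: "!!t. t ~: B ==> poly d t ~= 0 & p (c t) * poly d t = poly f t"
   using rational_poly_function[of C B c p] C p(1) unfolding rational_off_def by blast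
  have iff: "c t ~: U \<longleftrightarrow> poly f t = 0" if "t ~: B" for t
  proof -
   have "poly f t = p (c t) * poly d t" "poly d t ~= 0" using fd[OF that] by simp_all
   then show ?thesis unfolding p(2) by simp
  qed
  show ?case
  proof (cases "f = 0")
   case True
   then show ?thesis using iff unfolding dich_def by simp
  next
   case False
   then have "finite {t. poly f t = 0}" by (rule poly_roots_finite)
   then have "finite {t. t ~: B & c t ~: U}" by (rule rev_finite_subset) (use iff in blast)
   then show ?thesis unfolding dich_def by blast
  qed
 qed
 let ?X = "zariski_on C S"
 have top: "topspace ?X = S"
 proof -
  have "(%_. 1) : poly_functions C" by (rule poly_functions.const)
  then have "UNIV : basis" unfolding basis_def by (intro image_eqI[of _ _ "%_. 1"]) auto
  then show ?thesis unfolding zariski_on_def basis_def[symmetric] by (simp add: topology_generated_by_topspace) blast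
 qed
 have op: "dich U" if open_U: "openin ?X U" for U
 proof -
  obtain W where W: "generate_topology_on basis W" "U = W \<inter> S"
   using open_U unfolding zariski_on_def basis_def[symmetric] openin_subtopology openin_topology_generated_by_iff by blast
  have "c t : U \<longleftrightarrow> c t : W" if "t ~: B" for t using S[OF that] W(2) by blast
  then have "{t. t ~: B & c t ~: U} = {t. t ~: B & c t ~: W}" "(ALL t. t ~: B --> c t ~: U) \<longleftrightarrow> (ALL t. t ~: B --> c t ~: W)" by blast+
  then show ?thesis using d[OF W(1)] unfolding dich_def by simp
 qed
 have "connectedin ?X (c ` (- B))"
  unfolding connectedin
 proof (intro conjI notI)
  show "c ` (- B) <= topspace ?X" unfolding top using S by blast
  assume "EX U V. openin ?X U & openin ?X V & c ` (- B) <= U \<union> V & U \<inter> V \<inter> c ` (- B) = {} &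
   U \<inter> c ` (- B) ~= {} & V \<inter> c ` (- B) ~= {}"
  then obtain U V where UV: "openin ?X U" "openin ?X V" "U \<inter> V \<inter> c ` (- B) = {}"
   "U \<inter> c ` (- B) ~= {}" "V \<inter> c ` (- B) ~= {}" by blast
  have "finite {t. t ~: B & c t ~: U}" "finite {t. t ~: B & c t ~: V}"
  proof -
   have "EX t. t ~: B & c t : U" "EX t. t ~: B & c t : V" using UV(4,5) by auto
   then show "finite {t. t ~: B & c t ~: U}" "finite {t. t ~: B & c t ~: V}"
    using op[OF UV(1)] op[OF UV(2)] unfolding dich_def by auto
  qed
  then have "finite (B \<union> ({t. t ~: B & c t ~: U} \<union> {t. t ~: B & c t ~: V}))" using B by simp
  moreover have "t : B \<union> ({t. t ~: B & c t ~: U} \<union> {t. t ~: B & c t ~: V})" for t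
  proof -
   have "c t ~: U \<inter> V" if "t ~: B" using UV(3) that by auto
   then show ?thesis by auto
  qed
  then have "B \<union> ({t. t ~: B & c t ~: U} \<union> {t. t ~: B & c t ~: V}) = UNIV" by (auto simp only: UNIV_eq_I)
  ultimately show False using inf by simp
 qed
 then show ?thesis unfolding connected_component_of_def using ab by blast
qed

fun line2 :: "'k::field m2 => 'k => 'k m2" where
 "line2 (M2 a b c d) t = M2 (1 - t + t * a) (t * b) (t * c) (1 - t + t * d)"

lemma line2_ends: "line2 k 0 = 1" "line2 k 1 = k"
 by (cases k; simp add: one_m2_def)+

lemma line2_singular_finite: "finite {t. det2 (line2 k t) = (0::'k::field)}"
proof -
 obtain a b c d where k: "k = M2 a b c d" by (cases k)
 let ?p = "[:1, a - 1:] * [:1, d - 1:] - [:0, 0, b * c:]"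
 have e: "det2 (line2 k t) = poly ?p t" for t by (simp add: k algebra_simps)
 have "poly ?p 0 = 1" by simp
 then have "?p ~= 0" by (metis poly_0 zero_neq_one)
 then show ?thesis unfolding e by (rule poly_roots_finite)
qed

context tensor
begin

lemma rational_evn:
 assumes "rational_off B a" "rational_off B b" "rational_off B c" "rational_off B d"
  "rational_off B a'" "rational_off B b'" "rational_off B c'" "rational_off B d'"
 shows "ALL i<4. ALL j<4. rational_off B (%t. evn (scal h * (M2 (a t) (b t) (c t) (d t) + M2 (a' t) (b' t) (c' t) (d' t)))
  (scal h * (M2 (a t) (b t) (c t) (d t) - M2 (a' t) (b' t) (c' t) (d' t))) $$ (i, j))"
 unfolding all4 by (simp add: dia_def mk4_index) (intro conjI rational_intros assms)

lemma G_theta_connected: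
 assumes inf: "infinite (UNIV :: 'k set)" and X: "X : G_theta s UNIV"
 shows "connected_component_of (zariski_on (tcoords 4) (G_theta s UNIV)) (id4) X"
proof -
 obtain k g where kg: "det2 k ~= 0" "det2 g ~= 0" "X = el k g"
  using X unfolding G_theta_iff[OF ring_over_UNIV] by blast
 define c where "c t = el (line2 k t) (line2 g t)" for t
 define B where "B = {t. det2 (line2 k t) = 0} \<union> {t. det2 (line2 g t) = 0}"
 have B: "finite B" unfolding B_def using line2_singular_finite by blast
 have ends: "0 ~: B" "1 ~: B" "c 0 = id4" "c 1 = X"
  unfolding B_def c_def using kg by (simp_all add: line2_ends el_one)
 have inS: "c t : G_theta s UNIV" if "t ~: B" for t
  unfolding G_theta_iff[OF ring_over_UNIV] c_def using that unfolding B_def by auto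
 obtain k1 k2 k3 k4 where k: "k = M2 k1 k2 k3 k4" by (cases k)
 obtain g1 g2 g3 g4 where g: "g = M2 g1 g2 g3 g4" by (cases g)
 have dk: "rational_off B (%t. inverse ((1 - t + t * k1) * (1 - t + t * k4) - t * k2 * (t * k3)))"
  by (intro rational_inverse rational_intros) (auto simp: B_def k)
 have dg: "rational_off B (%t. inverse ((1 - t + t * g1) * (1 - t + t * g4) - t * g2 * (t * g3)))"
  by (intro rational_inverse rational_intros) (auto simp: B_def g)
 have P: "ALL i<4. ALL j<4. rational_off B (%t. teval s (c t) $$ (i, j))"
  unfolding c_def teval_el e4_def k g line2.simps by (intro rational_evn rational_intros)
 have Q: "ALL i<4. ALL j<4. rational_off B (%t. teval (- s) (c t) $$ (i, j))"
  unfolding c_def teval_el e4_def k g line2.simps inv2.simps Let_def dag.simps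
  by (intro rational_evn rational_intros dk dg)
 have coord: "fst (c t) $$ (i, j) = (1 / 2) * (teval s (c t) $$ (i, j) + teval (- s) (c t) $$ (i, j))"
  "snd (c t) $$ (i, j) = (1 / (2 * s)) * (teval s (c t) $$ (i, j) - teval (- s) (c t) $$ (i, j))"
  if "i < 4" "j < 4" for i j t
 proof -
  have "c t = tm (teval s (c t)) (teval (- s) (c t))" by (rule tm_teval[symmetric, of _ 4]) (simp add: c_def)
  moreover have "teval s (c t) : carrier_mat 4 4" "teval (- s) (c t) : carrier_mat 4 4" by (simp_all add: c_def)
  ultimately obtain M N where "c t = tm M N" "teval s (c t) = M" "teval (- s) (c t) = N" "M : carrier_mat 4 4" "N : carrier_mat 4 4" by blast
  then show "fst (c t) $$ (i, j) = (1 / 2) * (teval s (c t) $$ (i, j) + teval (- s) (c t) $$ (i, j))"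
   "snd (c t) $$ (i, j) = (1 / (2 * s)) * (teval s (c t) $$ (i, j) - teval (- s) (c t) $$ (i, j))"
   using that by (simp_all add: tm_def)
 qed
 have "rational_off B (%t. p (c t))" if p: "p : tcoords 4" for p
 proof -
  obtain i j where ij: "i < 4" "j < 4" "p = (%X. fst X $$ (i, j)) | p = (%X. snd X $$ (i, j))"
   using p unfolding tcoords_def by blast
  have "rational_off B (%t. fst (c t) $$ (i, j))" "rational_off B (%t. snd (c t) $$ (i, j))"
  proof -
   have PQ: "rational_off B (%t. teval s (c t) $$ (i, j))" "rational_off B (%t. teval (- s) (c t) $$ (i, j))"
    using P Q ij(1,2) by auto
   show "rational_off B (%t. fst (c t) $$ (i, j))"
    unfolding coord[OF ij(1,2)] by (rule rational_mult[OF rational_const rational_add[OF PQ]])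
   show "rational_off B (%t. snd (c t) $$ (i, j))"
    unfolding coord[OF ij(1,2)] by (rule rational_mult[OF rational_const rational_diff[OF PQ]])
  qed
  then show ?thesis using ij(3) by auto
 qed
 then have "connected_component_of (zariski_on (tcoords 4) (G_theta s UNIV)) (c 0) (c 1)"
  by (intro rational_curve_connected[OF inf B inS]) (use ends in auto)
 then show ?thesis using ends by simp
qed

lemma carrier_G0:
 assumes inf: "infinite (UNIV :: 'k set)" and R: "ring_over R"
 shows "carrier (G0 s R) = {X : tmats 4 R. EX k g. det2 k ~= 0 & det2 g ~= 0 & X = el k g}"
proof -
 have "X : G_theta s UNIV" if "X : G_theta s R" for X
  using that unfolding G_theta_iff[OF R] G_theta_iff[OF ring_over_UNIV] using tmats_U by blast
 then have "carrier (G0 s R) = G_theta s R" unfolding G0_def using G_theta_connected[OF inf] by auto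
 then show ?thesis by (simp add: set_eq_iff G_theta_iff[OF R])
qed

lemma G0_ops [simp]: "X \<otimes>\<^bsub>G0 s R\<^esub> Y = tmult s X Y" "\<one>\<^bsub>G0 s R\<^esub> = id4"
 by (simp_all add: G0_def tmat_monoid_def)

lemma G0_group:
 assumes inf: "infinite (UNIV :: 'k set)" and R: "ring_over R"
 shows "group (G0 s R)" "X : carrier (G0 s R) ==> inv\<^bsub>G0 s R\<^esub> X = tinv 4 s X"
proof -
 note C = carrier_G0[OF inf R]
 interpret f: tensor_form s 4 by (rule tensor_form_4)
 have inv: "tinv 4 s X : carrier (G0 s R) & tmult s (tinv 4 s X) X = id4" if X: "X : carrier (G0 s R)" for X
 proof -
  obtain k g where kg: "X : tmats 4 R" "det2 k ~= 0" "det2 g ~= 0" "X = el k g" using X unfolding C by blast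
  have "X : G_theta s R" using kg G_theta_iff[OF R] by blast
  then have "tinv 4 s X = ust 4 X" using f.unitary_iff(2)[OF R kg(1)] by (simp add: G_theta_def)
  then have "tinv 4 s X : tmats 4 R" using ust_closed[OF R kg(1)] by simp
  moreover have "tinv 4 s X = el (inv2 k) (inv2 g)" unfolding kg(4) by (rule tinv_el[OF kg(2,3)])
  moreover have "tmult s (el (inv2 k) (inv2 g)) X = id4"
   unfolding kg(4) using kg(2,3) by (simp add: el_mult det2_inv2 inv2 el_one)
  ultimately show ?thesis unfolding C using det2_inv2[OF kg(2)] det2_inv2[OF kg(3)] by auto
 qed
 show grp: "group (G0 s R)"
 proof (rule groupI)
  show "\<one>\<^bsub>G0 s R\<^esub> : carrier (G0 s R)"
  proof -
   have "id4 = el 1 1" "det2 (1 :: 'k m2) ~= 0" by (simp_all add: el_one)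
   then show ?thesis unfolding C G0_ops using temb_one_closed[OF R, of 4] by blast
  qed
 next
  fix X Y assume "X : carrier (G0 s R)" "Y : carrier (G0 s R)"
  then obtain k g k' g' where kg: "X : tmats 4 R" "det2 k ~= 0" "det2 g ~= 0" "X = el k g"
   "Y : tmats 4 R" "det2 k' ~= 0" "det2 g' ~= 0" "Y = el k' g'" unfolding C by blast
  have "tmult s X Y = el (k * k') (g * g')" unfolding kg(4,8) by (rule el_mult[OF kg(2,3,6,7)])
  moreover have "tmult s X Y : tmats 4 R" by (rule tmult_closed[OF R kg(1,5)])
  moreover have "det2 (k * k') ~= 0" "det2 (g * g') ~= 0" using kg by (simp_all add: det2_mult)
  ultimately show "X \<otimes>\<^bsub>G0 s R\<^esub> Y : carrier (G0 s R)" unfolding C G0_ops by blast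
 next
  fix X Y Z assume "X : carrier (G0 s R)" "Y : carrier (G0 s R)" "Z : carrier (G0 s R)"
  then have "X : tmats 4 UNIV" "Y : tmats 4 UNIV" "Z : tmats 4 UNIV" unfolding C by (auto intro: tmats_U)
  then show "X \<otimes>\<^bsub>G0 s R\<^esub> Y \<otimes>\<^bsub>G0 s R\<^esub> Z = X \<otimes>\<^bsub>G0 s R\<^esub> (Y \<otimes>\<^bsub>G0 s R\<^esub> Z)" by (simp add: tmult_assoc)
 next
  fix X assume X: "X : carrier (G0 s R)"
  then have "X : tmats 4 UNIV" unfolding C by (auto intro: tmats_U)
  then show "\<one>\<^bsub>G0 s R\<^esub> \<otimes>\<^bsub>G0 s R\<^esub> X = X" by (simp add: tmult_one)
  show "\<exists>Y\<in>carrier (G0 s R). Y \<otimes>\<^bsub>G0 s R\<^esub> X = \<one>\<^bsub>G0 s R\<^esub>" using inv[OF X] by auto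
 qed
 interpret group "G0 s R" by (rule grp)
 show "inv\<^bsub>G0 s R\<^esub> X = tinv 4 s X" if "X : carrier (G0 s R)"
  using inv[OF that] inv_equality that by simp
qed

end

section \<open>Rational points\<close>

lemma m2_entries_mult:
 assumes "!!a b. a : R ==> b : R ==> a + b : R" "!!a b. a : R ==> b : R ==> a * b : R"
 shows "set_m2 A <= R ==> set_m2 B <= R ==> set_m2 (A * B) <= (R :: 'a::comm_ring_1 set)"
 by (cases A; cases B) (auto intro!: assms)

context unramified_extension
begin

sublocale tensor s
 by unfold_locales (rule s_nonzero, rule two_nonzero)

lemma infinite_k: "infinite (UNIV :: 'k set)"
proof
 assume "finite (UNIV :: 'k set)"
 then have fin: "finite (range (%n::nat. unif ^ n))" by (rule rev_finite_subset) simp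
 have "inj (%n::nat. unif ^ n)"
 proof
  fix m n :: nat assume "unif ^ m = unif ^ n"
  then have "v (unif ^ m) = v (unif ^ n)" by simp
  then show "m = n" using FF.v_power[OF unif(1,2)] unif(3) by simp
 qed
 then show False using fin finite_imageD infinite_UNIV_nat by blast
qed

lemma ring_over_F: "ring_over F" using s_props(2) unfolding ring_over_def by auto
lemma ring_over_E: "ring_over E" using F_E[OF s_props(2)] unfolding ring_over_def by auto

text \<open>The \<open>F\<close>-rational points are those whose two evaluations are conjugate matrices over \<open>E\<close>.\<close>

lemma tm_in_F:
 assumes P: "P : carrier_mat n n" "Q : carrier_mat n n"
 shows "tm P Q : tmats n F \<longleftrightarrow> (ALL i<n. ALL j<n. P $$ (i, j) : E & Q $$ (i, j) = bar (P $$ (i, j)))"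
proof -
 have key: "(1 / 2) * (a + b) : F & (1 / (2 * s)) * (a - b) : F \<longleftrightarrow> a : E & b = bar a" for a b
 proof
  assume h: "(1 / 2) * (a + b) : F & (1 / (2 * s)) * (a - b) : F"
  have "teval s (tm (mat 1 1 (%_. a)) (mat 1 1 (%_. b))) = mat 1 1 (%_. a)"
   "teval (- s) (tm (mat 1 1 (%_. a)) (mat 1 1 (%_. b))) = mat 1 1 (%_. b)"
   by (rule teval_tm[of _ 1]; simp)+
  then have "teval s (tm (mat 1 1 (%_. a)) (mat 1 1 (%_. b))) $$ (0, 0) = a"
   "teval (- s) (tm (mat 1 1 (%_. a)) (mat 1 1 (%_. b))) $$ (0, 0) = b" by simp_all
  then have "a = (1 / 2) * (a + b) + ((1 / (2 * s)) * (a - b)) * s" "b = (1 / 2) * (a + b) - ((1 / (2 * s)) * (a - b)) * s"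
   by (simp_all add: teval_def tm_def mult.commute)
  then show "a : E & b = bar a" using E_I[of "(1 / 2) * (a + b)"] bar_eq[of "(1 / 2) * (a + b)"] h by metis
 next
  assume h: "a : E & b = bar a"
  then obtain c d where cd: "c : F" "d : F" "a = c + d * s" "b = c - d * s" using E_cases by metis
  have "(1 / 2) * (a + b) = (1 / 2) * (2 * c)" "(1 / (2 * s)) * (a - b) = (1 / (2 * s)) * ((2 * s) * d)"
   unfolding cd(3,4) by (simp_all add: algebra_simps)
  then have "(1 / 2) * (a + b) = c" "(1 / (2 * s)) * (a - b) = d" using two_nonzero s_nonzero by simp_all
  then show "(1 / 2) * (a + b) : F & (1 / (2 * s)) * (a - b) : F" using cd by simp
 qed
 have "tm P Q : tmats n F \<longleftrightarrow> (ALL i<n. ALL j<n. (1 / 2) * (P $$ (i, j) + Q $$ (i, j)) : F & (1 / (2 * s)) * (P $$ (i, j) - Q $$ (i, j)) : F)"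
  unfolding tmats_entries[of _ n F] using P by (auto simp: tm_def tmats_UNIV)
 then show ?thesis unfolding key .
qed

lemma e4_entries: "(ALL i<4. ALL j<4. e4 k g $$ (i, j) : E) \<longleftrightarrow> set_m2 k <= E & set_m2 g <= E"
proof -
 obtain a b c d where k: "k = M2 a b c d" by (cases k)
 obtain a' b' c' d' where g: "g = M2 a' b' c' d'" by (cases g)
 have *: "(1 / 2) * (a + b) : E & (1 / 2) * (a - b) : E \<longleftrightarrow> a : E & b : E" for a b
 proof
  assume "(1 / 2) * (a + b) : E & (1 / 2) * (a - b) : E"
  then have "(1 / 2) * (a + b) + (1 / 2) * (a - b) : E" "(1 / 2) * (a + b) - (1 / 2) * (a - b) : E" by blast+
  moreover have "(1 / 2) * (a + b) + (1 / 2) * (a - b) = (1 / 2) * (2 * a)" "(1 / 2) * (a + b) - (1 / 2) * (a - b) = (1 / 2) * (2 * b)"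
   unfolding distrib_left[symmetric] right_diff_distrib[symmetric] by (simp_all add: algebra_simps)
  ultimately show "a : E & b : E" using two_nonzero by simp
 qed auto
 have m: "- a : E \<longleftrightarrow> a : E" for a by (metis EE.uminus_closed minus_minus)
 define h :: 'k where "h = 1 / 2"
 have "(ALL i<4. ALL j<4. e4 k g $$ (i, j) : E) \<longleftrightarrow>
  (h * (a + a') : E & h * (a - a') : E) & (h * (b + b') : E & h * (b - b') : E) &
  (h * (c + c') : E & h * (c - c') : E) & (h * (d + d') : E & h * (d - d') : E)"
  unfolding all4 k g e4_def h_def[symmetric] by (simp add: dia_def mk4_index m) blast
 then show ?thesis unfolding h_def * k g by auto
qed

lemma o4_entries: "(ALL i<4. ALL j<4. o4 k g $$ (i, j) : E) \<longleftrightarrow> set_m2 k <= E & set_m2 g <= E"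
proof -
 have "(ALL i<4. ALL j<4. odn R S $$ (i, j) : E) \<longleftrightarrow> (ALL i<4. ALL j<4. evn R S $$ (i, j) : E)" for R S
 proof -
  have m: "- a : E \<longleftrightarrow> a : E" for a by (metis EE.uminus_closed minus_minus)
  show ?thesis unfolding all4 by (cases R; cases S) (simp add: mk4_index m)
 qed
 then show ?thesis unfolding o4_def e4_entries[symmetric] e4_def by blast
qed

abbreviation barm :: "'k m2 => 'k m2" where "barm \<equiv> map_m2 bar"

lemma barm_mult: "set_m2 A <= E ==> set_m2 B <= E ==> barm (A * B) = barm A * barm B"
 by (cases A; cases B) (simp add: bar_add bar_mult)
lemma barm_dag: "set_m2 A <= E ==> barm (dag A) = dag (barm A)"
 by (cases A) (simp add: bar_minus)
lemma barm_barm: "set_m2 A <= E ==> barm (barm A) = A"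
 by (cases A) simp
lemma barm_E: "set_m2 A <= E ==> set_m2 (barm A) <= E"
 by (cases A) auto
lemma dag_E: "set_m2 A <= E ==> set_m2 (dag A) <= E"
 by (cases A) auto
lemma mult_E: "set_m2 A <= E ==> set_m2 B <= E ==> set_m2 (A * B) <= E"
 by (rule m2_entries_mult) auto
lemma dia_E: "a : E ==> b : E ==> set_m2 (dia a b) <= E"
 by (auto simp: dia_def)
lemma barm_dia: "barm (dia a b) = dia (bar a) (bar b)"
 by (simp add: dia_def)
lemma inv2_E: "set_m2 A <= E ==> set_m2 (inv2 A) <= E"
 by (cases A) (auto simp: Let_def)
lemma det2_E: "set_m2 A <= E ==> det2 A : E"
 by (cases A) auto
lemma det2_barm: "set_m2 A <= E ==> det2 (barm A) = bar (det2 A)"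
 by (cases A) (simp add: bar_diff bar_mult)

lemma barm_one: "barm 1 = 1" by (simp add: one_m2_def)

lemma barm_inv2: "set_m2 A <= E ==> det2 A ~= 0 ==> barm (inv2 A) = inv2 (barm A)"
 using barm_mult[of A "inv2 A"] inv2_E[of A] inv2(1)[of A]
 by (intro inv2_unique(1)[symmetric]) (simp add: barm_one)

lemma e4_barm: "set_m2 k <= E ==> set_m2 g <= E ==> i < 4 ==> j < 4 ==> e4 (barm k) (barm g) $$ (i, j) = bar (e4 k g $$ (i, j))"
proof -
 assume E: "set_m2 k <= E" "set_m2 g <= E" and ij: "i < 4" "j < 4"
 define h :: 'k where "h = 1 / 2"
 have hF: "h : F" by (auto simp: h_def)
 then have h: "h : E" "bar h = h" using F_E by auto
 have "ALL i<4. ALL j<4. e4 (barm k) (barm g) $$ (i, j) = bar (e4 k g $$ (i, j))"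
  using E unfolding all4 e4_def h_def[symmetric]
  by (cases k; cases g) (simp add: dia_def mk4_index bar_mult bar_add bar_diff bar_minus h)
 then show ?thesis using ij by blast
qed

lemma o4_barm: "set_m2 k <= E ==> set_m2 g <= E ==> i < 4 ==> j < 4 ==> o4 (barm k) (barm g) $$ (i, j) = bar (o4 k g $$ (i, j))"
proof -
 assume E: "set_m2 k <= E" "set_m2 g <= E" and ij: "i < 4" "j < 4"
 define h :: 'k where "h = 1 / 2"
 have hF: "h : F" by (auto simp: h_def)
 then have h: "h : E" "bar h = h" using F_E by auto
 have "ALL i<4. ALL j<4. o4 (barm k) (barm g) $$ (i, j) = bar (o4 k g $$ (i, j))"
  using E unfolding all4 o4_def h_def[symmetric]
  by (cases k; cases g) (simp add: dia_def mk4_index bar_mult bar_add bar_diff bar_minus h)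
 then show ?thesis using ij by blast
qed

text \<open>The unitary group of the form \<open>diag(1, -1)\<close>.\<close>

definition UE :: "'k m2 set" where "UE = {k. set_m2 k <= E & dag (barm k) * k = 1}"

lemma UE_D: "k : UE ==> set_m2 k <= E" "k : UE ==> det2 k ~= 0" "k : UE ==> inv2 k = dag (barm k)"
proof -
 assume k: "k : UE"
 then show "set_m2 k <= E" by (simp add: UE_def)
 have "dag (barm k) * k = 1" using k by (simp add: UE_def)
 then have "k * dag (barm k) = 1" by (rule inv2_unique(3))
 then show "det2 k ~= 0" "inv2 k = dag (barm k)" using inv2_unique by blast+
qed

lemma el_in_F:
 assumes "det2 k ~= 0" "det2 g ~= 0"
 shows "el k g : tmats 4 F \<longleftrightarrow> k : UE & g : UE"
proof -
 have iff: "k : UE \<longleftrightarrow> set_m2 k <= E & dag (inv2 k) = barm k" if d: "det2 k ~= 0" for k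
 proof
  assume "k : UE"
  then show "set_m2 k <= E & dag (inv2 k) = barm k" using UE_D by simp
 next
  assume h: "set_m2 k <= E & dag (inv2 k) = barm k"
  then have "dag (barm k) = inv2 k" by (metis dag_dag)
  then show "k : UE" using h inv2(2)[OF d] by (simp add: UE_def)
 qed
 show ?thesis
 proof
  assume "el k g : tmats 4 F"
  then have h: "ALL i<4. ALL j<4. e4 k g $$ (i, j) : E & e4 (dag (inv2 k)) (dag (inv2 g)) $$ (i, j) = bar (e4 k g $$ (i, j))"
   unfolding el_def tm_in_F[OF e4_carrier e4_carrier] .
  then have E: "set_m2 k <= E" "set_m2 g <= E" using e4_entries[of k g] by auto
  have "e4 (dag (inv2 k)) (dag (inv2 g)) = e4 (barm k) (barm g)"
   by (rule mat4_eqI) (use h e4_barm[OF E] in auto)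
  then have "dag (inv2 k) = barm k" "dag (inv2 g) = barm g" unfolding e4_inject by auto
  then show "k : UE & g : UE" using iff[OF assms(1)] iff[OF assms(2)] E by simp
 next
  assume "k : UE & g : UE"
  then have E: "set_m2 k <= E" "set_m2 g <= E" and e: "dag (inv2 k) = barm k" "dag (inv2 g) = barm g"
   using iff[OF assms(1)] iff[OF assms(2)] by auto
  show "el k g : tmats 4 F"
   unfolding el_def tm_in_F[OF e4_carrier e4_carrier] e using e4_entries[of k g] E e4_barm[OF E] by blast
 qed
qed

lemma lie_in_F: "lie A B : tmats 4 F \<longleftrightarrow> set_m2 A <= E & B = dag (barm A)"
proof
 assume "lie A B : tmats 4 F"
 then have h: "ALL i<4. ALL j<4. o4 A B $$ (i, j) : E & o4 (dag B) (dag A) $$ (i, j) = bar (o4 A B $$ (i, j))"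
  unfolding lie_def tm_in_F[OF o4_carrier o4_carrier] .
 then have E: "set_m2 A <= E" "set_m2 B <= E" using o4_entries[of A B] by auto
 have "o4 (dag B) (dag A) = o4 (barm A) (barm B)"
  by (rule mat4_eqI) (use h o4_barm[OF E] in auto)
 then have "dag B = barm A" unfolding o4_inject by auto
 then show "set_m2 A <= E & B = dag (barm A)" using E by (metis dag_dag)
next
 assume h: "set_m2 A <= E & B = dag (barm A)"
 then have E: "set_m2 A <= E" "set_m2 B <= E" using barm_E dag_E by auto
 have "dag B = barm A" using h by simp
 moreover have "dag A = barm B" using h barm_dag[OF barm_E] barm_barm by auto
 ultimately show "lie A B : tmats 4 F"
  unfolding lie_def tm_in_F[OF o4_carrier o4_carrier] using o4_entries[of A B] E o4_barm[OF E] by auto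
qed

lemma carrier_G0_F: "carrier (G0 s F) = {el k g | k g. k : UE & g : UE}"
 unfolding carrier_G0[OF infinite_k ring_over_F] using el_in_F UE_D(2) by blast

lemma g1_F: "g1 s F = {lie A (dag (barm A)) | A. set_m2 A <= E}"
proof (intro Set.set_eqI iffI)
 fix X assume "X : g1 s F"
 then obtain A B where "X : tmats 4 F" "X = lie A B" unfolding g1_iff[OF ring_over_F] by blast
 then have "set_m2 A <= E" "X = lie A (dag (barm A))" using lie_in_F[of A B] by simp_all
 then show "X : {lie A (dag (barm A)) | A. set_m2 A <= E}" by blast
next
 fix X assume "X : {lie A (dag (barm A)) | A. set_m2 A <= E}"
 then obtain A where A: "X = lie A (dag (barm A))" "set_m2 A <= E" by blast
 then have "X : tmats 4 F" using lie_in_F[of A "dag (barm A)"] by simp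
 then show "X : g1 s F" unfolding g1_iff[OF ring_over_F] using A(1) by blast
qed

text \<open>Integrality of a \<open>4 \<times> 4\<close> matrix can be read off its blocks as \<open>2\<close> is a unit.\<close>

definition intm :: "'k m2 => bool" where "intm A \<longleftrightarrow> (\<forall>a\<in>set_m2 A. EE.vge 0 a)"

lemma integers_E: "integers_of E v = {a. EE.vge 0 a}"
 unfolding integers_of_def EE.vge_def by auto

lemma intm_E: "intm A ==> set_m2 A <= E" using EE.vge_in by (auto simp: intm_def)

lemma intm_mult: "intm A ==> intm B ==> intm (A * B)"
 using m2_entries_mult[of "{a. EE.vge 0 a}" A B] EE.vge_add EE.vge_mult0 unfolding intm_def by blast

lemma intm_dag: "intm A ==> intm (dag A)"
 by (cases A) (auto simp: intm_def EE.vge_minus)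

lemma intm_barm: "intm A ==> intm (barm A)"
 by (cases A) (auto simp: intm_def vge_bar EE.vge_in)

lemma vge0_minus_iff: "EE.vge 0 (- a) \<longleftrightarrow> EE.vge 0 a" using EE.vge_minus[of 0 a] EE.vge_minus[of 0 "- a"] by auto

lemma vge0_halves: "EE.vge 0 (1 / 2 * (a + b)) & EE.vge 0 (1 / 2 * (a - b)) \<longleftrightarrow> EE.vge 0 a & EE.vge 0 b"
proof
 assume h: "EE.vge 0 (1 / 2 * (a + b)) & EE.vge 0 (1 / 2 * (a - b))"
 then have "EE.vge 0 (1 / 2 * (a + b) + 1 / 2 * (a - b))" "EE.vge 0 (1 / 2 * (a + b) - 1 / 2 * (a - b))"
  using EE.vge_add EE.vge_diff by blast+
 moreover have "1 / 2 * (a + b) + 1 / 2 * (a - b) = 1 / 2 * (2 * a)" "1 / 2 * (a + b) - 1 / 2 * (a - b) = 1 / 2 * (2 * b)"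
  unfolding distrib_left[symmetric] right_diff_distrib[symmetric] by (simp_all add: algebra_simps)
 ultimately show "EE.vge 0 a & EE.vge 0 b" using two_nonzero by simp
next
 assume "EE.vge 0 a & EE.vge 0 b"
 then have s: "EE.vge 0 (a + b)" "EE.vge 0 (a - b)" using EE.vge_add EE.vge_diff by blast+
 show "EE.vge 0 (1 / 2 * (a + b)) & EE.vge 0 (1 / 2 * (a - b))"
  using vge_half[OF EE.vge_in[OF s(1)], of 0] vge_half[OF EE.vge_in[OF s(2)], of 0] s by simp
qed

lemma evn_vge0: "(ALL i<4. ALL j<4. evn R S $$ (i, j) : {a. EE.vge 0 a}) \<longleftrightarrow> intm R & intm S"
 unfolding all4 by (cases R; cases S) (auto simp: mk4_index vge0_minus_iff intm_def)

lemma odn_vge0: "(ALL i<4. ALL j<4. odn R S $$ (i, j) : {a. EE.vge 0 a}) \<longleftrightarrow> intm R & intm S"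
 unfolding all4 by (cases R; cases S) (auto simp: mk4_index vge0_minus_iff intm_def)

lemma intm_halves: "intm (scal (1 / 2) * (A + B)) & intm (scal (1 / 2) * (A - B)) \<longleftrightarrow> intm A & intm B"
proof -
 obtain a b c d where A: "A = M2 a b c d" by (cases A)
 obtain a' b' c' d' where B: "B = M2 a' b' c' d'" by (cases B)
 define h :: 'k where "h = 1 / 2"
 note H = vge0_halves[folded h_def]
 have "intm (scal h * (A + B)) & intm (scal h * (A - B)) \<longleftrightarrow>
   (EE.vge 0 (h * (a + a')) & EE.vge 0 (h * (a - a'))) & (EE.vge 0 (h * (b + b')) & EE.vge 0 (h * (b - b'))) &
   (EE.vge 0 (h * (c + c')) & EE.vge 0 (h * (c - c'))) & (EE.vge 0 (h * (d + d')) & EE.vge 0 (h * (d - d')))"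
  unfolding A B by (auto simp: dia_def intm_def)
 then have "intm (scal h * (A + B)) & intm (scal h * (A - B)) \<longleftrightarrow> intm A & intm B"
  unfolding H by (auto simp: A B intm_def)
 then show ?thesis unfolding h_def .
qed

lemma tintegral_iff: "X : tmats n UNIV ==> tintegral E v s X \<longleftrightarrow> (ALL i<n. ALL j<n. teval s X $$ (i, j) : {a. EE.vge 0 a})"
proof -
 assume "X : tmats n UNIV"
 then have "teval s X : carrier_mat n n" by simp
 then show ?thesis unfolding tintegral_def integers_E elements_mat_def by fastforce
qed

lemma tintegral_el: "tintegral E v s (el k g) \<longleftrightarrow> intm k & intm g"
 unfolding tintegral_iff[OF el_in] teval_el e4_def evn_vge0 by (rule intm_halves)

lemma tintegral_lie: "tintegral E v s (lie A B) \<longleftrightarrow> intm A & intm B"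
 unfolding tintegral_iff[OF lie_in] teval_lie o4_def odn_vge0 by (rule intm_halves)

definition UO :: "'k m2 set" where "UO = {k : UE. intm k}"

lemma UE_inv2: "k : UE ==> inv2 k : UE"
proof -
 assume k: "k : UE"
 note D = UE_D[OF k]
 have "dag (barm (inv2 k)) = k" using D barm_dag[OF barm_E[OF D(1)]] barm_barm[OF D(1)] by simp
 then show ?thesis using inv2(1)[OF D(2)] inv2_E[OF D(1)] by (simp add: UE_def)
qed

lemma UE_mult: "k : UE ==> g : UE ==> k * g : UE"
proof -
 assume k: "k : UE" and g: "g : UE"
 have "dag (barm (k * g)) * (k * g) = dag (barm g) * (dag (barm k) * k) * g"
  using UE_D(1)[OF k] UE_D(1)[OF g] by (simp add: barm_mult dag_mult mult.assoc)
 then show ?thesis using k g mult_E by (simp add: UE_def)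
qed

lemma UE_one: "1 : UE" by (auto simp: UE_def barm_one one_m2_def)

lemma UO_inv2: "k : UO ==> inv2 k : UO"
 using UE_inv2 UE_D(3) intm_dag intm_barm by (auto simp: UO_def)
lemma UO_mult: "k : UO ==> g : UO ==> k * g : UO"
 using UE_mult intm_mult by (auto simp: UO_def)
lemma G0_int_F: "G0_int F E v s = {el k g | k g. k : UO & g : UO}"
proof -
 have "tinv 4 s (el k g) = el (inv2 k) (inv2 g)" if "k : UE" "g : UE" for k g
  using tinv_el UE_D(2) that by blast
 moreover have "intm (inv2 k)" if "k : UE" "intm k" for k using UO_inv2[of k] that by (auto simp: UO_def)
 ultimately have i: "el k g : G0_int F E v s \<longleftrightarrow> intm k & intm g" if "k : UE" "g : UE" for k g
  unfolding G0_int_def carrier_G0_F using that tintegral_el by auto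
 show ?thesis
 proof (intro Set.set_eqI iffI)
  fix X assume X: "X : G0_int F E v s"
  then obtain k g where "k : UE" "g : UE" "X = el k g" unfolding G0_int_def carrier_G0_F by blast
  then show "X : {el k g | k g. k : UO & g : UO}" using X i unfolding UO_def by blast
 next
  fix X assume "X : {el k g | k g. k : UO & g : UO}"
  then show "X : G0_int F E v s" using i unfolding UO_def by blast
 qed
qed

lemma g1_int_F: "lie A (dag (barm A)) : g1_int F E v s \<longleftrightarrow> intm A"
proof -
 have "lie A (dag (barm A)) : g1 s F" if "intm A" unfolding g1_F using intm_E[OF that] by blast
 then show ?thesis unfolding g1_int_def using intm_dag intm_barm by (auto simp: tintegral_lie)
qed

end

section \<open>Automorphisms of the algebraic closure\<close>

locale algebraic_closure =
 fixes F :: "'k::alg_closed_field set"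
 assumes subF: "is_subfield F" and closure: "!!a. algebraic_over F a"
begin

lemma F_closed: "0 : F" "1 : F" "a : F ==> b : F ==> a + b : F" "a : F ==> b : F ==> a - b : F"
 "a : F ==> b : F ==> a * b : F" "a : F ==> inverse a : F" "a : F ==> - a : F"
proof -
 show "0 : F" "1 : F" "a : F ==> b : F ==> a + b : F" "a : F ==> b : F ==> a - b : F"
  "a : F ==> b : F ==> a * b : F" "a : F ==> inverse a : F"
  using subF unfolding is_subfield_def by blast+
 then show "a : F ==> - a : F" using subF unfolding is_subfield_def by (metis diff_0)
qed

text \<open>A partial homomorphism is treated as its graph, a subring of \<open>'k \<times> 'k\<close>; then unions of
 chains and polynomials with coefficients in the domain need no special care. The domain of
 such a homomorphism may be any ring between \<open>F\<close> and its algebraic closure, so that the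
 diagonal of such a ring also qualifies.\<close>

definition phom :: "('k \<times> 'k) set => bool" where
 "phom ph \<longleftrightarrow> (\<forall>a\<in>F. (a, a) : ph) & (ALL b. (0, b) : ph --> b = 0) &
  (ALL a b c d. (a, b) : ph --> (c, d) : ph --> (a + c, b + d) : ph & (a * c, b * d) : ph)"

lemma phomD:
 assumes "phom ph"
 shows "a : F ==> (a, a) : ph" "(0, b) : ph ==> b = 0"
  "(a, b) : ph ==> (c, d) : ph ==> (a + c, b + d) : ph" "(a, b) : ph ==> (c, d) : ph ==> (a * c, b * d) : ph"
 using assms unfolding phom_def by blast+

lemma phom_minus:
 assumes "phom ph" shows "(a, b) : ph ==> (- a, - b) : ph" "(a, b) : ph ==> (c, d) : ph ==> (a - c, b - d) : ph"
  "(a, b) : ph ==> (a, b') : ph ==> b = b'"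
proof -
 have m: "(- a, - b) : ph" if "(a, b) : ph" for a b
  using phomD(4)[OF assms phomD(1)[OF assms F_closed(7)[OF F_closed(2)]] that] by simp
 then show "(a, b) : ph ==> (- a, - b) : ph" .
 have d: "(a - c, b - d) : ph" if "(a, b) : ph" "(c, d) : ph" for a b c d
  using phomD(3)[OF assms that(1) m[OF that(2)]] by simp
 then show "(a, b) : ph ==> (c, d) : ph ==> (a - c, b - d) : ph" .
 assume "(a, b) : ph" "(a, b') : ph"
 then have "(0, b - b') : ph" using d[of a b a b'] by simp
 then show "b = b'" using phomD(2)[OF assms] by force
qed

lemma phom_sum: "phom ph ==> (!!i. i : A ==> (f i, g i) : ph) ==> (sum f A, sum g A) : ph"
 by (induction A rule: infinite_finite_induct) (auto intro: phomD F_closed)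

lemma phom_power: "phom ph ==> (a, b) : ph ==> (a ^ n, b ^ n) : ph"
 by (induction n) (auto intro: phomD F_closed)

definition pol :: "('k \<times> 'k) set => 'k poly => 'k poly => bool" where
 "pol ph f g \<longleftrightarrow> (ALL i. (coeff f i, coeff g i) : ph)"

lemma pol_eval: "phom ph ==> pol ph f g ==> (a, b) : ph ==> (poly f a, poly g b) : ph"
proof -
 assume p: "phom ph" "pol ph f g" "(a, b) : ph"
 let ?n = "max (degree f) (degree g)"
 have e: "poly h x = (\<Sum>i\<le>?n. coeff h i * x ^ i)" if "degree h <= ?n" for h :: "'k poly" and x
 proof -
  have "(\<Sum>i\<le>degree h. coeff h i * x ^ i) = (\<Sum>i\<le>?n. coeff h i * x ^ i)"
   using that by (intro sum.mono_neutral_left) (auto simp: coeff_eq_0)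
  then show ?thesis by (simp add: poly_altdef)
 qed
 have "((\<Sum>i\<le>?n. coeff f i * a ^ i), (\<Sum>i\<le>?n. coeff g i * b ^ i)) : ph"
  using p by (intro phom_sum phomD(4) phom_power) (auto simp: pol_def)
 then show ?thesis using e[of f a] e[of g b] by simp
qed

lemma pol_add: "phom ph ==> pol ph f g ==> pol ph f' g' ==> pol ph (f + f') (g + g')"
 by (auto simp: pol_def intro: phomD)
lemma pol_diff: "phom ph ==> pol ph f g ==> pol ph f' g' ==> pol ph (f - f') (g - g')"
 by (auto simp: pol_def intro: phom_minus)
lemma pol_mult: "phom ph ==> pol ph f g ==> pol ph f' g' ==> pol ph (f * f') (g * g')"
 unfolding pol_def coeff_mult by (intro allI phom_sum phomD(4)) auto
lemma pol_const: "phom ph ==> (a, b) : ph ==> pol ph [:a:] [:b:]"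
 by (auto simp: pol_def coeff_pCons split: nat.split intro: phomD F_closed)
lemma pol_monom: "phom ph ==> (a, b) : ph ==> pol ph (monom a n) (monom b n)"
 by (auto simp: pol_def intro: phomD F_closed)
lemma pol_F: "phom ph ==> poly_over F f ==> pol ph f f"
 by (auto simp: pol_def poly_over_def intro: phomD)
lemma pol_zero_left: "phom ph ==> pol ph 0 g ==> g = 0"
 by (auto simp: pol_def poly_eq_iff dest: phomD(2))

lemma phom_F: "phom (Id_on F)"
 unfolding phom_def by (auto simp: F_closed)

text \<open>The inverse of an algebraic element is a polynomial in it, so the domain of a partial
 homomorphism is a field.\<close>

lemma inverse_is_poly:
 assumes "a ~= 0" shows "EX r. poly_over F r & inverse a = poly r a"
proof -
 obtain p where p: "poly_over F p" "p ~= 0" "poly p a = 0" using closure[of a] unfolding algebraic_over_def by blast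
 define n where "n = (LEAST n. EX p. poly_over F p & p ~= 0 & poly p a = 0 & degree p = n)"
 have "EX p. poly_over F p & p ~= 0 & poly p a = 0 & degree p = n"
  unfolding n_def by (rule LeastI_ex) (use p in blast)
 then obtain f where f: "poly_over F f" "f ~= 0" "poly f a = 0" "degree f = n" by blast
 obtain c g where cg: "f = pCons c g" by (cases f)
 have gF: "poly_over F g" "c : F" using f(1) unfolding cg poly_over_def
  by (metis coeff_pCons_Suc, metis coeff_pCons_0)
 have "c ~= 0"
 proof
  assume c: "c = 0"
  then have "poly g a = 0" "g ~= 0" using f(2,3) assms cg by auto
  then have "n <= degree g" unfolding n_def using gF by (intro Least_le) blast
  then show False using f(4) \<open>g \<noteq> 0\<close> unfolding cg by simp
 qed
 have "c + a * poly g a = 0" using f(3) cg by simp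
 then have e: "a * poly g a = - c" by (simp add: eq_neg_iff_add_eq_0 add.commute)
 have "a * (- inverse c * poly g a) = - inverse c * (a * poly g a)" by (simp only: ac_simps)
 also have "... = 1" unfolding e using \<open>c \<noteq> 0\<close> by simp
 finally have "inverse a = poly (Polynomial.smult (- inverse c) g) a" by (simp add: inverse_unique)
 moreover have "poly_over F (Polynomial.smult (- inverse c) g)"
  using gF unfolding poly_over_def by (auto intro: F_closed)
 ultimately show ?thesis by blast
qed

lemma phom_inverse:
 assumes "phom ph" "(a, b) : ph" "a ~= 0"
 shows "b ~= 0" "(inverse a, inverse b) : ph"
proof -
 obtain r where r: "poly_over F r" "inverse a = poly r a" using inverse_is_poly[OF assms(3)] by blast
 have i: "(inverse a, poly r b) : ph" unfolding r(2) by (rule pol_eval[OF assms(1) pol_F[OF assms(1) r(1)] assms(2)])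
 have "(a * inverse a, b * poly r b) : ph" by (rule phomD(4)[OF assms(1,2) i])
 then have "b * poly r b = 1" using phom_minus(3)[OF assms(1)] phomD(1)[OF assms(1) F_closed(2)] assms(3) by simp
 then show "b ~= 0" "(inverse a, inverse b) : ph" using i by (auto simp: inverse_unique)
qed

text \<open>\<open>f\<close> is the minimal polynomial of \<open>b\<close> over the domain of \<open>\<phi>\<close>, and \<open>g\<close> is its image.\<close>

definition minp :: "('k \<times> 'k) set => 'k => 'k poly => 'k poly => bool" where
 "minp ph b f g \<longleftrightarrow> pol ph f g & lead_coeff f = 1 & poly f b = 0 &
  (ALL f' g'. pol ph f' g' --> f' ~= 0 --> poly f' b = 0 --> degree f <= degree f')"

lemma minp_least: "minp ph b f g ==> pol ph f' g' ==> f' ~= 0 ==> poly f' b = 0 ==> degree f <= degree f'"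
 unfolding minp_def by blast

lemma minp_exists: assumes ph: "phom ph" shows "EX f g. minp ph b f g"
proof -
 define Q where "Q n \<longleftrightarrow> (EX f g. pol ph f g & f ~= 0 & poly f b = 0 & degree f = n)" for n
 obtain p where p: "poly_over F p" "p ~= 0" "poly p b = 0" using closure[of b] unfolding algebraic_over_def by blast
 have "Q (degree p)" unfolding Q_def using pol_F[OF ph p(1)] p by blast
 then have "Q (LEAST n. Q n)" by (rule LeastI)
 then obtain f g where f: "pol ph f g" "f ~= 0" "poly f b = 0" "degree f = (LEAST n. Q n)" unfolding Q_def by blast
 have le: "degree f <= degree f'" if "pol ph f' g'" "f' ~= 0" "poly f' b = 0" for f' g'
 proof -
  have "Q (degree f')" unfolding Q_def using that by blast
  then show ?thesis unfolding f(4) by (rule Least_le)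
 qed
 let ?c = "lead_coeff f" and ?d = "coeff g (degree f)"
 have "(?c, ?d) : ph" using f(1) unfolding pol_def by (rule spec)
 then have c: "(inverse ?c, inverse ?d) : ph" by (rule phom_inverse(2)[OF ph]) (use f(2) in simp)
 have "pol ph (Polynomial.smult (inverse ?c) f) (Polynomial.smult (inverse ?d) g)"
  unfolding pol_def coeff_smult
  using phomD(4)[OF ph c] f(1) unfolding pol_def by blast
 then have "minp ph b (Polynomial.smult (inverse ?c) f) (Polynomial.smult (inverse ?d) g)"
  unfolding minp_def using f(2,3) le by (simp only: degree_smult_eq coeff_smult poly_smult) simp
 then show ?thesis by blast
qed

lemma minp_image:
 assumes ph: "phom ph" and m: "minp ph b f g" shows "degree g = degree f" "lead_coeff g = 1" "degree f > 0"
proof -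
 have mm: "pol ph f g" "lead_coeff f = 1" "poly f b = 0" using m unfolding minp_def by auto
 have 1: "coeff g (degree f) = 1"
 proof (rule phom_minus(3)[OF ph])
  show "(lead_coeff f, coeff g (degree f)) : ph" using mm(1) unfolding pol_def by (rule spec)
  show "(lead_coeff f, 1) : ph" using mm phomD(1)[OF ph F_closed(2)] by simp
 qed
 have "coeff g i = 0" if "i > degree f" for i
 proof (rule phomD(2)[OF ph])
  have "(coeff f i, coeff g i) : ph" using mm(1) unfolding pol_def by (rule spec)
  then show "(0, coeff g i) : ph" using that by (simp add: coeff_eq_0)
 qed
 then have "degree g <= degree f" by (intro degree_le) auto
 moreover have "degree f <= degree g" using 1 by (intro le_degree) auto
 ultimately show "degree g = degree f" by simp
 then show "lead_coeff g = 1" using 1 by simp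
 show "degree f > 0"
 proof (rule ccontr)
  assume "~ degree f > 0"
  then obtain a where "f = [:a:]" using degree_eq_zeroE by blast
  then show False using mm by auto
 qed
qed

lemma minp_dvd:
 assumes ph: "phom ph" and m: "minp ph b f g"
 shows "pol ph p p' ==> poly p b = 0 ==> f dvd p & g dvd p'"
proof (induction "if p = 0 then 0 else Suc (degree p)" arbitrary: p p' rule: less_induct)
 case less
 note I = minp_image[OF ph m]
 have mm: "pol ph f g" "lead_coeff f = 1" "poly f b = 0" using m unfolding minp_def by auto
 show ?case
 proof (cases "p = 0")
  case True
  then have "p' = 0" using pol_zero_left[OF ph, of p'] less.prems(1) by simp
  then show ?thesis using True by simp
 next
  case False
  then have deg: "degree f <= degree p" using minp_least[OF m less.prems(1) _ less.prems(2)] by blast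
  let ?c = "lead_coeff p" and ?d = "coeff p' (degree p)" and ?n = "degree p - degree f"
  have cd: "(?c, ?d) : ph" using less.prems(1) by (simp add: pol_def)
  define r where "r = p - monom ?c ?n * f"
  define r' where "r' = p' - monom ?d ?n * g"
  have rr: "pol ph r r'" unfolding r_def r'_def
   by (intro pol_diff pol_mult pol_monom ph less.prems mm cd)
  have rb: "poly r b = 0" using less.prems(2) mm(3) by (simp add: r_def)
  have "r ~= 0 ==> degree r < degree p"
  proof -
   assume rn: "r ~= 0"
   have ct: "coeff (monom ?c ?n * f) (degree p) = ?c"
    using deg mm(2) by (simp add: coeff_monom_mult)
   have "degree (monom ?c ?n * f) <= degree p"
    using degree_mult_le[of "monom ?c ?n" f] degree_monom_le[of ?c ?n] deg by linarith
   then have "degree r <= degree p" unfolding r_def by (intro degree_diff_le) auto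
   moreover have "degree r ~= degree p"
   proof
    assume "degree r = degree p"
    then have "lead_coeff r = 0" unfolding r_def using ct by simp
    then show False using rn by simp
   qed
   ultimately show ?thesis by simp
  qed
  then have "f dvd r & g dvd r'" using less.hyps[OF _ rr rb] False by simp
  moreover have "p = r + monom ?c ?n * f" "p' = r' + monom ?d ?n * g" by (simp_all add: r_def r'_def)
  ultimately show ?thesis by (metis dvd_add dvd_triv_right)
 qed
qed

lemma phom_extend:
 assumes ph: "phom ph" and m: "minp ph b f g" and b': "poly g b' = 0"
 shows "\<exists>\<psi>. phom \<psi> & ph <= \<psi> & (b, b') : \<psi>"
proof -
 define \<psi> where "\<psi> = {(poly p b, poly p' b') | p p'. pol ph p p'}"
 have "phom \<psi>"
  unfolding phom_def
 proof (intro conjI ballI allI impI)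
  fix a assume "a : F"
  then have "pol ph [:a:] [:a:]" using pol_const[OF ph phomD(1)[OF ph]] by blast
  then show "(a, a) : \<psi>" unfolding \<psi>_def by force
 next
  fix c assume "(0, c) : \<psi>"
  then obtain p p' where p: "pol ph p p'" "poly p b = 0" "c = poly p' b'" unfolding \<psi>_def by auto
  then have "g dvd p'" using minp_dvd[OF ph m] by blast
  then show "c = 0" using b' p(3) by auto
 next
  fix a c d e assume "(a, c) : \<psi>" "(d, e) : \<psi>"
  then obtain p p' r r' where p: "pol ph p p'" "a = poly p b" "c = poly p' b'"
   and r: "pol ph r r'" "d = poly r b" "e = poly r' b'" unfolding \<psi>_def by auto
  show "(a + d, c + e) : \<psi>" "(a * d, c * e) : \<psi>"
   using pol_add[OF ph p(1) r(1)] pol_mult[OF ph p(1) r(1)] unfolding \<psi>_def p r poly_add[symmetric] poly_mult[symmetric] by blast+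
 qed
 moreover have "ph <= \<psi>"
 proof
  fix z assume z: "z : ph"
  obtain a c where ac: "z = (a, c)" by (cases z)
  have "pol ph [:a:] [:c:]" using pol_const[OF ph] z ac by blast
  then show "z : \<psi>" unfolding \<psi>_def ac by force
 qed
 moreover have "(b, b') : \<psi>"
 proof -
  have "pol ph [:0, 1:] [:0, 1:]" using pol_monom[OF ph phomD(1)[OF ph F_closed(2)], of 1] by (simp add: monom_Suc one_pCons)
  then show ?thesis unfolding \<psi>_def by force
 qed
 ultimately show ?thesis by blast
qed

lemma phom_total:
 assumes ph: "phom ph" shows "\<exists>sg\<in>galois_group F. \<forall>(a, b)\<in>ph. sg a = b"
proof -
 define A where "A = {\<psi>. phom \<psi> & ph <= \<psi>}"
 have "\<exists>M\<in>A. \<forall>X\<in>A. M <= X --> X = M"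
 proof (rule subset_Zorn_nonempty)
  show "A ~= {}" using ph by (auto simp: A_def)
  fix C assume C: "C ~= {}" "subset.chain A C"
  have h: "!!\<psi>. \<psi> : C ==> phom \<psi>" and sup: "!!\<psi>. \<psi> : C ==> ph <= \<psi>"
   and lin: "!!\<psi> \<psi>'. \<psi> : C ==> \<psi>' : C ==> \<psi> <= \<psi>' | \<psi>' <= \<psi>"
   using C(2) unfolding A_def subset.chain_def by blast+
  have "phom (\<Union> C)"
   unfolding phom_def
  proof (intro conjI ballI allI impI)
   fix a assume "a : F"
   then show "(a, a) : \<Union> C" using C(1) phomD(1)[OF h] by blast
  next
   fix b assume "(0, b) : \<Union> C"
   then show "b = 0" using phomD(2)[OF h] by blast
  next
   fix a b c d assume "(a, b) : \<Union> C" "(c, d) : \<Union> C"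
   then obtain \<psi> \<psi>' where p: "\<psi> : C" "(a, b) : \<psi>" "\<psi>' : C" "(c, d) : \<psi>'" by blast
   then obtain \<xi> where x: "\<xi> : C" "(a, b) : \<xi>" "(c, d) : \<xi>" using lin[OF p(1,3)] by blast
   then show "(a + c, b + d) : \<Union> C" "(a * c, b * d) : \<Union> C"
    using phomD(3)[OF h[OF x(1)] x(2,3)] phomD(4)[OF h[OF x(1)] x(2,3)] by blast+
  qed
  moreover obtain \<psi> where "\<psi> : C" using C(1) by blast
  then have "ph <= (\<Union> C)" using sup by blast
  ultimately show "\<Union> C \<in> A" unfolding A_def by simp
 qed
 then obtain M where MA: "M : A" "\<forall>X\<in>A. M <= X --> X = M" by blast
 have M: "phom M" "ph <= M" using MA(1) by (simp_all add: A_def)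
 have max: "X = M" if "phom X" "M <= X" for X
  using MA(2) that M(2) by (auto simp: A_def)
 have tot: "EX b'. (b, b') : M" for b
 proof -
  obtain f g where m: "minp M b f g" using minp_exists[OF M(1)] by blast
  have "degree g > 0" using minp_image[OF M(1) m] by simp
  then obtain b' where "poly g b' = 0" using alg_closed_imp_poly_has_root by blast
  then obtain \<psi> where \<psi>: "phom \<psi>" "M <= \<psi>" "(b, b') : \<psi>" using phom_extend[OF M(1) m] by blast
  then have "\<psi> = M" by (intro max)
  then show ?thesis using \<psi>(3) by blast
 qed
 define sg where "sg a = (THE b. (a, b) : M)" for a
 have in_M: "(a, sg a) : M" for a
 proof -
  obtain b where b: "(a, b) : M" using tot by blast
  then have "sg a = b" unfolding sg_def using phom_minus(3)[OF M(1)] by blast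
  then show ?thesis using b by simp
 qed
 have eq: "sg a = b" if "(a, b) : M" for a b using phom_minus(3)[OF M(1) in_M that] .
 have add: "sg (a + b) = sg a + sg b" and mult: "sg (a * b) = sg a * sg b" for a b
  using eq phomD(3,4)[OF M(1) in_M in_M] by blast+
 have fix_F: "sg a = a" if "a : F" for a using eq phomD(1)[OF M(1) that] by blast
 have inj: "inj sg"
 proof
  fix a b assume ab: "sg a = sg b"
  show "a = b"
  proof (rule ccontr)
   assume "a ~= b"
   then have "a - b ~= 0" by simp
   moreover have "(a - b, sg a - sg b) : M" by (rule phom_minus(2)[OF M(1) in_M in_M])
   ultimately show False using phom_inverse(1)[OF M(1)] ab by force
  qed
 qed
 have "surj sg"
 proof -
  have "b : range sg" for b
  proof -
   obtain p where p: "poly_over F p" "p ~= 0" "poly p b = 0" using closure[of b] unfolding algebraic_over_def by blast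
   let ?R = "{z. poly p z = 0}"
   have "sg ` ?R <= ?R"
   proof
    fix w assume "w : sg ` ?R"
    then obtain z where z: "poly p z = 0" "w = sg z" by blast
    have "(poly p z, poly p w) : M" unfolding z(2) by (rule pol_eval[OF M(1) pol_F[OF M(1) p(1)] in_M])
    then show "w : ?R" using z(1) phomD(2)[OF M(1)] by simp
   qed
   then have "sg ` ?R = ?R" using poly_roots_finite[OF p(2)] inj by (intro endo_inj_surj) (auto intro: inj_on_subset)
   then show ?thesis using p(3) by blast
  qed
  then show ?thesis by blast
 qed
 then have "sg : galois_group F" using inj add mult fix_F by (auto simp: galois_group_def bij_def)
 moreover have "\<forall>(a, b)\<in>ph. sg a = b" using eq M(2) by blast
 ultimately show ?thesis by blast
qed

lemma double_root_not_separable: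
 assumes "coprime p (pderiv p)" "[:- a, 1:] * ([:- a, 1:] * h) dvd p" shows False
proof -
 define l where "l = [:- a, 1:]"
 obtain k where k: "p = l * (l * (h * k))" using assms(2) unfolding l_def by (metis dvdE mult.assoc)
 have "pderiv p = l * pderiv (l * (h * k)) + l * (h * k) * pderiv l" unfolding k by (rule pderiv_mult)
 then have "l dvd pderiv p" by (simp only: mult.assoc) (intro dvd_add dvd_triv_left)
 moreover have "l dvd p" unfolding k by simp
 ultimately have "l dvd 1" using assms(1) coprime_common_divisor by blast
 then obtain k' where k': "1 = l * k'" by (elim dvdE)
 show False using arg_cong[OF k', of "%r. poly r a"] by (simp add: l_def)
qed

text \<open>A separable element outside \<open>F\<close> has a conjugate different from itself.\<close>

lemma separable_fixed:
 assumes a: "a : separable_closure F" and fixed: "!!sg. sg : galois_group F ==> sg a = a"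
 shows "a : F"
proof -
 obtain p where p: "poly_over F p" "coprime p (pderiv p)" "poly p a = 0" using a unfolding separable_closure_def by blast
 obtain f g where m: "minp (Id_on F) a f g" using minp_exists[OF phom_F] by blast
 have "g = f" using m unfolding minp_def pol_def by (auto simp: poly_eq_iff)
 then have m: "minp (Id_on F) a f f" using m by simp
 have mm: "pol (Id_on F) f f" "lead_coeff f = 1" "poly f a = 0" using m unfolding minp_def by auto
 obtain h where h: "f = [:- a, 1:] * h" using mm(3) by (metis dvdE poly_eq_0_iff_dvd)
 show ?thesis
 proof (cases "degree h > 0")
  case True
  then obtain a' where a': "poly h a' = 0" using alg_closed_imp_poly_has_root by blast
  have "a' ~= a"
  proof
   assume "a' = a"
   then obtain h' where h': "h = [:- a, 1:] * h'" using a' by (metis dvdE poly_eq_0_iff_dvd)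
   have "f dvd p" using minp_dvd[OF phom_F m pol_F[OF phom_F p(1)] p(3)] by blast
   then show False using double_root_not_separable[OF p(2), of a h'] unfolding h h' by blast
  qed
  have fa': "poly f a' = 0" using a' h by simp
  from phom_extend[OF phom_F m fa'] obtain \<psi> where \<psi>: "phom \<psi>" "(a, a') : \<psi>" by (elim exE conjE)
  from phom_total[OF \<psi>(1)] obtain sg where sg: "sg : galois_group F" "\<forall>(a, b)\<in>\<psi>. sg a = b" by (elim bexE)
  then have "sg a = a'" using \<psi>(2) by auto
  then show ?thesis using fixed[OF sg(1)] \<open>a' \<noteq> a\<close> by simp
 next
  case False
  then obtain c where "h = [:c:]" using degree_eq_zeroE by blast
  then have f: "f = [:- a * c, c:]" using h by simp
  then have "c = 1" using mm(2) by (cases "c = 0") auto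
  then have "coeff f 0 = - a" using f by simp
  then have "- a : F" using mm(1) unfolding pol_def by (metis Id_onE prod.inject)
  then show ?thesis using F_closed(7) by force
 qed
qed

end

section \<open>The separable closure is a ring\<close>

inductive_set ring_gen :: "'a::comm_ring_1 set => 'a set => 'a set" for F S where
 base: "a : F ==> a : ring_gen F S"
| gen: "a : S ==> a : ring_gen F S"
| add: "a : ring_gen F S ==> b : ring_gen F S ==> a + b : ring_gen F S"
| mult: "a : ring_gen F S ==> b : ring_gen F S ==> a * b : ring_gen F S"

inductive_set add_gen :: "'a::comm_ring_1 set => 'a set" for S where
 base: "a : S ==> a : add_gen S"
| add: "a : add_gen S ==> b : add_gen S ==> a + b : add_gen S"

lemma ring_gen_mono: "a : ring_gen F S ==> S <= ring_gen F S' ==> a : ring_gen F S'"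
 by (induction rule: ring_gen.induct) (auto intro: ring_gen.intros)

locale algebraic_closure_p = algebraic_closure F for F :: "'k::alg_closed_field set" +
 assumes char_pos: "CHAR('k) > 0"
begin

definition Q :: nat where "Q = CHAR('k)"

lemma prime_Q: "prime Q" unfolding Q_def using char_pos by (rule prime_CHAR_semidom)
lemma Q_pos: "Q > 0" using prime_Q prime_gt_0_nat by blast

lemma frob_add: "((a::'k) + b) ^ Q = a ^ Q + b ^ Q"
 unfolding Q_def using freshmans_dream[OF prime_Q[unfolded Q_def]] by simp
lemma frob_sum: "(sum f A :: 'k) ^ Q = (\<Sum>i\<in>A. f i ^ Q)"
 by (induction A rule: infinite_finite_induct) (use Q_pos in \<open>auto simp: frob_add\<close>)
lemma frob_diff: "((a::'k) - b) ^ Q = a ^ Q - b ^ Q"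
 using frob_add[of "a - b" b] by (simp add: algebra_simps)
lemma frob_inj: "(a::'k) ^ Q = b ^ Q \<longleftrightarrow> a = b"
proof
 assume "a ^ Q = b ^ Q"
 then have "(a - b) ^ Q = 0" by (simp add: frob_diff)
 then show "a = b" using Q_pos by simp
qed simp

lemma F_sum: "(!!i. i : A ==> f i : F) ==> sum f A : F"
 by (induction A rule: infinite_finite_induct) (auto intro: F_closed)
lemma F_power: "a : F ==> a ^ n : F"
 by (induction n) (auto intro: F_closed)

lemma ring_gen_power: "a : ring_gen F S ==> a ^ n : ring_gen F S"
 by (induction n) (auto intro: ring_gen.intros F_closed)
lemma ring_gen_sum: "(!!i. i : A ==> f i : ring_gen F S) ==> sum f A : ring_gen F S"
 by (induction A rule: infinite_finite_induct) (auto intro: ring_gen.intros F_closed)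

lemma ring_gen_single: "a : ring_gen F {c} \<longleftrightarrow> (EX f. poly_over F f & a = poly f c)"
proof
 assume "a : ring_gen F {c}"
 then show "EX f. poly_over F f & a = poly f c"
 proof (induction rule: ring_gen.induct)
  case (base a)
  then have "poly_over F [:a:]" by (auto simp: poly_over_def coeff_pCons F_closed split: nat.split)
  then show ?case by (intro exI[of _ "[:a:]"]) simp
 next
  case (gen a)
  have "poly_over F [:0, 1:]" by (auto simp: poly_over_def coeff_pCons F_closed split: nat.split)
  then show ?case using gen by (intro exI[of _ "[:0, 1:]"]) simp
 next
  case (add a b)
  then obtain f g where "poly_over F f" "a = poly f c" "poly_over F g" "b = poly g c" by blast
  then show ?case by (intro exI[of _ "f + g"]) (auto simp: poly_over_def F_closed)
 next
  case (mult a b)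
  then obtain f g where "poly_over F f" "a = poly f c" "poly_over F g" "b = poly g c" by blast
  then show ?case by (intro exI[of _ "f * g"]) (auto simp: poly_over_def coeff_mult intro!: F_sum F_closed)
 qed
next
 assume "EX f. poly_over F f & a = poly f c"
 then obtain f where f: "poly_over F f" "a = poly f c" by blast
 show "a : ring_gen F {c}" unfolding f(2) poly_altdef
  by (intro ring_gen_sum ring_gen.mult ring_gen_power) (use f(1) in \<open>auto simp: poly_over_def intro: ring_gen.intros\<close>)
qed

lemma ring_gen_inverse: "a : ring_gen F S ==> a ~= 0 ==> inverse a : ring_gen F S"
proof -
 assume a: "a : ring_gen F S" "a ~= 0"
 obtain r where "poly_over F r" "inverse a = poly r a" using inverse_is_poly[OF a(2)] by blast
 then have "inverse a : ring_gen F {a}" using ring_gen_single by blast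
 then show ?thesis by (rule ring_gen_mono) (use a(1) in simp)
qed

text \<open>Separability of \<open>c\<close> means that adjoining \<open>c\<close> gives nothing more than adjoining its
 \<open>Q\<close>-th power. Indeed, if \<open>c = h(c\<^sup>Q)\<close> then \<open>c\<close> is a root of \<open>X - h(X\<^sup>Q)\<close>, whose
 derivative is \<open>1\<close>; conversely the minimal polynomial over \<open>F[c\<^sup>Q]\<close> of a separable \<open>c\<close>
 has simple roots and divides \<open>(X - c)\<^sup>Q\<close>.\<close>

lemma separable_if:
 assumes "c : ring_gen F {c ^ Q}" shows "c : separable_closure F"
proof -
 obtain h where h: "poly_over F h" "c = poly h (c ^ Q)" using assms ring_gen_single by blast
 let ?p = "[:0, 1:] - pcompose h (monom 1 Q)"
 have "poly ?p c = 0" using h(2) by (simp add: poly_pcompose poly_monom)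
 moreover have "pderiv ?p = 1"
 proof -
  have "pderiv (monom (1::'k) Q) = 0" by (simp add: pderiv_monom Q_def)
  then show ?thesis by (simp add: pderiv_diff pderiv_pcompose pderiv_pCons)
 qed
 then have "coprime ?p (pderiv ?p)" by simp
 moreover have "poly_over F ?p"
 proof -
  have P: "poly_over F (f * g)" "poly_over F (f + g)" "poly_over F (f - g)" if "poly_over F f" "poly_over F g" for f g
   using that by (auto simp: poly_over_def coeff_mult intro!: F_sum F_closed)
  have c: "poly_over F [:a:]" if "a : F" for a using that by (auto simp: poly_over_def coeff_pCons F_closed split: nat.split)
  have X: "poly_over F [:0, 1:]" by (auto simp: poly_over_def coeff_pCons F_closed split: nat.split)
  have m: "poly_over F (monom 1 Q)" by (auto simp: poly_over_def F_closed)
  have "poly_over F (pcompose h (monom 1 Q))" using h(1)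
  proof (induction h)
   case 0
   then show ?case by simp
  next
   case (pCons a h)
   have "a : F" "poly_over F h" using pCons.prems unfolding poly_over_def
    by (metis coeff_pCons_0, metis coeff_pCons_Suc)
   then show ?case using P m c pCons.IH by (simp add: pcompose_pCons)
  qed
  then show ?thesis using P X by blast
 qed
 ultimately show ?thesis unfolding separable_closure_def by blast
qed

lemma separable_only_if:
 assumes "c : separable_closure F" shows "c : ring_gen F {c ^ Q}"
proof -
 obtain p where p: "poly_over F p" "coprime p (pderiv p)" "poly p c = 0" using assms unfolding separable_closure_def by blast
 let ?L = "ring_gen F {c ^ Q}" and ?ph = "Id_on (ring_gen F {c ^ Q})"
 have ph: "phom ?ph" unfolding phom_def by (auto intro: ring_gen.intros)
 obtain f g where m: "minp ?ph c f g" using minp_exists[OF ph] by blast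
 have mm: "pol ?ph f g" "lead_coeff f = 1" "poly f c = 0" using m unfolding minp_def by auto
 obtain h where h: "f = [:- c, 1:] * h" using mm(3) by (metis dvdE poly_eq_0_iff_dvd)
 have "degree h = 0"
 proof (rule ccontr)
  assume "degree h ~= 0"
  then obtain c' where c': "poly h c' = 0" using alg_closed_imp_poly_has_root by blast
  let ?X = "monom 1 Q - [:c ^ Q:] :: 'k poly"
  have "pol ?ph ?X ?X"
   by (intro pol_diff[OF ph] pol_monom[OF ph] pol_const[OF ph]) (auto intro: ring_gen.intros F_closed)
  moreover have "poly ?X c = 0" by (simp add: poly_monom)
  ultimately have "f dvd ?X" using minp_dvd[OF ph m] by blast
  moreover have "poly f c' = 0" unfolding h using c' by simp
  ultimately have "poly ?X c' = 0" unfolding poly_eq_0_iff_dvd by (rule dvd_trans[rotated])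
  then have "c' ^ Q = c ^ Q" by (simp add: poly_monom)
  then have "c' = c" using frob_inj by blast
  then obtain h' where h': "h = [:- c, 1:] * h'" using c' by (metis dvdE poly_eq_0_iff_dvd)
  have "f dvd p" using minp_dvd[OF ph m pol_F[OF ph p(1)] p(3)] by blast
  then show False using double_root_not_separable[OF p(2), of c h'] unfolding h h' by blast
 qed
 then obtain d where "h = [:d:]" using degree_eq_zeroE by blast
 then have f: "f = [:- c * d, d:]" using h by simp
 then have "d = 1" using mm(2) by (cases "d = 0") auto
 then have "coeff f 0 = - c" using f by simp
 moreover have "(coeff f 0, coeff g 0) : ?ph" using mm(1) unfolding pol_def by blast
 ultimately have "- c : ?L" by auto
 moreover have "- 1 : ?L" using F_closed by (intro ring_gen.base) auto
 ultimately have "(- 1) * (- c) : ?L" by (intro ring_gen.mult)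
 then show ?thesis by simp
qed

text \<open>Linear combinations of a finite set with coefficients in \<open>M\<close>.\<close>

definition lin :: "'k set => 'k set => 'k set" where
 "lin M B = {\<Sum>x\<in>B. m x * x | m. \<forall>x\<in>B. m x : M}"

lemma linI: "(!!x. x : B ==> m x : M) ==> (\<Sum>x\<in>B. m x * x) : lin M B"
 unfolding lin_def by blast

lemma lin_add: "(!!a b. a : M ==> b : M ==> a + b : M) ==> y : lin M B ==> z : lin M B ==> y + z : lin M B"
proof -
 assume M: "!!a b. a : M ==> b : M ==> a + b : M" and "y : lin M B" "z : lin M B"
 then obtain m n where "y = (\<Sum>x\<in>B. m x * x)" "\<forall>x\<in>B. m x : M" "z = (\<Sum>x\<in>B. n x * x)" "\<forall>x\<in>B. n x : M"
  unfolding lin_def by blast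
 moreover have "(\<Sum>x\<in>B. (m x + n x) * x) : lin M B" using M calculation by (intro linI) auto
 ultimately show ?thesis by (simp add: sum.distrib distrib_right)
qed

lemma lin_scale: "(!!a b. a : M ==> b : M ==> a * b : M) ==> c : M ==> y : lin M B ==> c * y : lin M B"
proof -
 assume M: "!!a b. a : M ==> b : M ==> a * b : M" "c : M" and "y : lin M B"
 then obtain m where "y = (\<Sum>x\<in>B. m x * x)" "\<forall>x\<in>B. m x : M" unfolding lin_def by blast
 moreover have "(\<Sum>x\<in>B. (c * m x) * x) : lin M B" using M calculation by (intro linI) auto
 ultimately show ?thesis by (simp add: sum_distrib_left mult.assoc)
qed

lemma lin_gen: "finite B ==> 0 : M ==> c : M ==> x : B ==> c * x : lin M B"
proof -
 assume a: "finite B" "0 : M" "c : M" "x : B"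
 have "(\<Sum>y\<in>B. (if y = x then c else 0) * y) = c * x"
  using a by (simp add: if_distrib[of "%t. t * _"] sum.delta cong: if_cong)
 moreover have "(\<Sum>y\<in>B. (if y = x then c else 0) * y) : lin M B" using a by (intro linI) auto
 ultimately show ?thesis by simp
qed

lemma lin_sum: "(!!a b. a : M ==> b : M ==> a + b : M) ==> 0 : M ==> (!!i. i : A ==> f i : lin M B) ==> sum f A : lin M B"
proof (induction A rule: infinite_finite_induct)
 case (insert i A)
 then show ?case by (simp add: lin_add)
qed (use linI[of B "%_. 0" M] in auto)

lemma ring_gen_finite_span:
 "EX B. finite B & B <= ring_gen F {a, b} & ring_gen F {a, b} <= lin F B"
proof -
 obtain f where f: "minp (Id_on F) a f f" using minp_exists[OF phom_F, of a] minp_def pol_def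
  by (metis Id_onE Pair_inject poly_eqI)
 obtain g where g: "minp (Id_on F) b g g" using minp_exists[OF phom_F, of b] minp_def pol_def
  by (metis Id_onE Pair_inject poly_eqI)
 let ?n = "degree f" and ?k = "degree g"
 define B where "B = (%(i, j). a ^ i * b ^ j) ` ({..<?n} \<times> {..<?k})"
 have fin: "finite B" by (simp add: B_def)
 have aL: "a : ring_gen F {a, b}" "b : ring_gen F {a, b}" by (auto intro: ring_gen.gen)
 have BL: "B <= ring_gen F {a, b}" unfolding B_def by (auto intro!: ring_gen.mult ring_gen_power aL)
 have B: "c * (a ^ i * b ^ j) : lin F B" if "i < ?n" "j < ?k" "c : F" for i j c
  using that fin F_closed by (intro lin_gen) (auto simp: B_def)
 have top: "c ^ degree h = (\<Sum>i<degree h. - coeff h i * c ^ i)" "coeff h i : F" if "minp (Id_on F) c h h" for c h i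
 proof -
  have hh: "pol (Id_on F) h h" "lead_coeff h = 1" "poly h c = 0" using that unfolding minp_def by auto
  have "(\<Sum>i<degree h. coeff h i * c ^ i) + c ^ degree h = 0"
   using hh(2,3) unfolding poly_altdef lessThan_Suc_atMost[symmetric] by simp
  then have "c ^ degree h = - (\<Sum>i<degree h. coeff h i * c ^ i)" by (simp add: eq_neg_iff_add_eq_0 add.commute)
  then show "c ^ degree h = (\<Sum>i<degree h. - coeff h i * c ^ i)" by (simp add: sum_negf)
  show "coeff h i : F" using hh(1) unfolding pol_def by auto
 qed
 note FA = F_closed(3) and FM = F_closed(5)
 have span: "(a ^ i * b ^ j) * a : lin F B & (a ^ i * b ^ j) * b : lin F B" if ij: "i < ?n" "j < ?k" for i j
 proof
  show "(a ^ i * b ^ j) * a : lin F B"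
  proof (cases "Suc i < ?n")
   case True
   then show ?thesis using B[OF True ij(2), of 1] F_closed by (simp add: algebra_simps)
  next
   case False
   then have "(a ^ i * b ^ j) * a = (\<Sum>i<?n. - coeff f i * a ^ i) * b ^ j"
    using ij(1) top(1)[OF f] by (metis Suc_lessI mult.assoc mult.commute power_Suc2)
   also have "... = (\<Sum>i<?n. - coeff f i * (a ^ i * b ^ j))" by (simp add: sum_distrib_right mult.assoc)
   also have "... : lin F B"
    by (intro lin_sum B FA F_closed(1) F_closed(7) top(2)[OF f] ij(2)) (simp_all only: lessThan_iff)
   finally show ?thesis .
  qed
  show "(a ^ i * b ^ j) * b : lin F B"
  proof (cases "Suc j < ?k")
   case True
   then show ?thesis using B[OF ij(1) True, of 1] F_closed by (simp add: algebra_simps)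
  next
   case False
   then have "(a ^ i * b ^ j) * b = (\<Sum>j<?k. - coeff g j * b ^ j) * a ^ i"
    using ij(2) top(1)[OF g] by (metis Suc_lessI mult.assoc mult.commute power_Suc2)
   also have "... = (\<Sum>j<?k. - coeff g j * (a ^ i * b ^ j))" unfolding sum_distrib_right by (rule sum.cong) (auto simp: algebra_simps)
   also have "... : lin F B"
    by (intro lin_sum B FA F_closed(1) F_closed(7) top(2)[OF g] ij(1)) (simp_all only: lessThan_iff)
   finally show ?thesis .
  qed
 qed
 have stable: "l : ring_gen F {a, b} ==> y : lin F B ==> y * l : lin F B" for l y
 proof (induction arbitrary: y rule: ring_gen.induct)
  case (base c)
  then show ?case using lin_scale[OF FM base(1), of y] by (simp add: mult.commute)
 next
  case (gen c)
  obtain m where m: "y = (\<Sum>x\<in>B. m x * x)" "\<forall>x\<in>B. m x : F" using gen.prems unfolding lin_def by blast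
  have "y * c = (\<Sum>x\<in>B. m x * (x * c))" unfolding m(1) by (simp add: sum_distrib_right mult.assoc)
  also have "... : lin F B"
  proof (rule lin_sum[OF FA F_closed(1)])
   fix x assume x: "x : B"
   then obtain i j where "i < ?n" "j < ?k" "x = a ^ i * b ^ j" unfolding B_def by auto
   then have "x * c : lin F B" using span gen.hyps by auto
   then show "m x * (x * c) : lin F B" using lin_scale[OF FM] m(2) x by blast
  qed
  finally show ?case .
 next
  case (add c d)
  then show ?case using lin_add[OF FA] by (simp add: distrib_left)
 next
  case (mult c d)
  then show ?case by (simp flip: mult.assoc)
 qed
 have "0 < ?n" "0 < ?k" using minp_image(3)[OF phom_F f] minp_image(3)[OF phom_F g] by auto
 then have "1 : lin F B" using B[of 0 0 1] F_closed(2) by simp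
 then have "ring_gen F {a, b} <= lin F B" using stable[of _ 1] by auto
 then show ?thesis using fin BL by blast
qed

text \<open>For \<open>L = F[a, b]\<close> with \<open>a\<close> and \<open>b\<close> separable, \<open>L\<close> is the \<open>F\<close>-span of its \<open>Q\<close>-th
 powers. Take \<open>c\<close> in \<open>L\<close> and a generating set of \<open>L\<close> over \<open>F[c]\<close> of minimal size. Its \<open>Q\<close>-th
 powers generate \<open>L\<close> over \<open>F[c\<^sup>Q]\<close>, hence are independent over \<open>F[c]\<close> by minimality; comparing
 coefficients in an expansion of \<open>c x\<^sup>Q\<close> puts \<open>c\<close> into \<open>F[c\<^sup>Q]\<close>.\<close>

lemma separable_ring_gen:
 assumes a: "a : separable_closure F" and b: "b : separable_closure F" and c: "c : ring_gen F {a, b}"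
 shows "c : separable_closure F"
proof -
 let ?L = "ring_gen F {a, b}"
 define M where "M = ring_gen F {c}"
 define M' where "M' = ring_gen F {c ^ Q}"
 have m1: "- 1 : M" unfolding M_def by (rule ring_gen.base[OF F_closed(7)[OF F_closed(2)]])
 have Mc: "x + y : M" "x * y : M" "- x : M" if "x : M" "y : M" for x y
 proof -
  show "x + y : M" "x * y : M" using that unfolding M_def by (auto intro: ring_gen.intros)
  have "(- 1) * x : M" using that m1 unfolding M_def by (blast intro: ring_gen.mult)
  then show "- x : M" by simp
 qed
 have M'c: "x + y : M'" "x * y : M'" if "x : M'" "y : M'" for x y
  using that unfolding M'_def by (auto intro: ring_gen.intros)
 have FM: "F <= M" "F <= M'" unfolding M_def M'_def by (auto intro: ring_gen.intros)
 have M'M: "M' <= M"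
  unfolding M_def M'_def using ring_gen_mono[of _ F "{c ^ Q}" "{c}"] ring_gen_power[of c "{c}" Q] ring_gen.gen[of c "{c}" F] by blast
 have pow: "x ^ Q : M'" if "x : M" for x
  using that unfolding M_def M'_def
 proof (induction rule: ring_gen.induct)
  case (base x)
  then show ?case using F_power by (auto intro: ring_gen.intros)
 next
  case (gen x)
  then show ?case by (auto intro: ring_gen.intros)
 next
  case (add x y)
  then show ?case by (auto simp: frob_add intro: ring_gen.intros)
 next
  case (mult x y)
  then show ?case by (auto simp: power_mult_distrib intro: ring_gen.intros)
 qed
 define good where "good B \<longleftrightarrow> finite B & B <= ?L & ?L <= lin M B" for B
 have "EX B. good B"
 proof -
  obtain B where "finite B" "B <= ?L" "?L <= lin F B" using ring_gen_finite_span[of a b] by blast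
  moreover have "lin F B <= lin M B" using FM(1) unfolding lin_def by blast
  ultimately show ?thesis unfolding good_def by blast
 qed
 then obtain B where B: "good B" and min: "!!B'. good B' ==> card B <= card B'"
  using exists_least_iff[of "%n. EX B. good B & card B = n"] by (metis not_less)
 have finB: "finite B" "B <= ?L" "?L <= lin M B" using B unfolding good_def by auto
 let ?BQ = "(%x. x ^ Q) ` B"
 have inj: "inj_on (%x::'k. x ^ Q) B" using frob_inj by (auto intro: inj_onI)
 have invf: "inv_into B (%x. x ^ Q) (x ^ Q) = x" if "x : B" for x using inv_into_f_f[OF inj that] by simp
 have fl: "f * l ^ Q : lin M' ?BQ" if fl: "f : F" "l : ?L" for f l
 proof -
  obtain m where m: "l = (\<Sum>x\<in>B. m x * x)" "\<forall>x\<in>B. m x : M" using finB(3) fl(2) unfolding lin_def by blast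
  have "f * l ^ Q = (\<Sum>x\<in>B. (f * m x ^ Q) * x ^ Q)"
   unfolding m(1) frob_sum by (simp add: power_mult_distrib sum_distrib_left mult.assoc)
  also have "... = (\<Sum>y\<in>?BQ. (f * m (inv_into B (%x. x ^ Q) y) ^ Q) * y)"
   by (subst sum.reindex[OF inj]) (auto simp: invf intro!: sum.cong)
  also have "... : lin M' ?BQ"
   using m(2) pow fl(1) FM(2) M'c(2) by (intro linI) (auto simp: invf)
  finally show ?thesis .
 qed
 define S where "S = {f * l ^ Q | f l. f : F & l : ?L}"
 have SS: "y * z : S" if yz: "y : S" "z : S" for y z
 proof -
  obtain f l g k where "y = f * l ^ Q" "f : F" "l : ?L" "z = g * k ^ Q" "g : F" "k : ?L" using yz unfolding S_def by blast
  then have "y * z = (f * g) * (l * k) ^ Q" "f * g : F" "l * k : ?L"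
   by (auto simp: power_mult_distrib intro: F_closed ring_gen.mult)
  then show ?thesis unfolding S_def by blast
 qed
 have A1: "y * z : add_gen S" if "y : add_gen S" "z : S" for y z
  using that(1) by induction (auto simp: distrib_right intro: add_gen.intros SS that(2))
 have A2: "y * z : add_gen S" if "y : add_gen S" "z : add_gen S" for y z
  using that(2) by induction (auto simp: distrib_left intro: add_gen.intros A1 that(1))
 have FS: "f : add_gen S" if "f : F" for f
 proof -
  have "f * 1 ^ Q : S" unfolding S_def using that ring_gen.base[OF F_closed(2)] by blast
  then show ?thesis using add_gen.base by force
 qed
 have gens: "d : add_gen S" if d: "d : {a, b}" for d
 proof -
  have dQ: "d : ring_gen F {d ^ Q}" using d a b separable_only_if by blast
  have "1 * d ^ Q : S" unfolding S_def using d ring_gen.gen F_closed(2) by blast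
  then have p: "d ^ Q : add_gen S" using add_gen.base by force
  show ?thesis using dQ by induction (use FS p A2 in \<open>auto intro: add_gen.intros\<close>)
 qed
 have LS: "l : add_gen S" if "l : ?L" for l
  using that by induction (use FS gens A2 in \<open>auto intro: add_gen.intros\<close>)
 have Lspan: "l : lin M' ?BQ" if "l : ?L" for l
  using LS[OF that]
 proof induction
  case (base y)
  then show ?case unfolding S_def using fl by blast
 next
  case (add y z)
  then show ?case using lin_add[OF M'c(1)] by blast
 qed
 have mono: "lin M' ?BQ <= lin M ?BQ" using M'M unfolding lin_def by blast
 have BQL: "?BQ <= ?L" using finB(2) ring_gen_power by blast
 have "B ~= {}"
 proof
  assume "B = {}"
  then have "lin M B = {0}" unfolding lin_def by auto
  moreover have "(1::'k) : ?L" by (rule ring_gen.base[OF F_closed(2)])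
  ultimately have "(1::'k) : {0}" using finB(3) by blast
  then show False by simp
 qed
 then obtain x0 where x0: "x0 : B" by blast
 have "c * x0 ^ Q : ?L" using c x0 BQL by (intro ring_gen.mult) auto
 then obtain m where m: "c * x0 ^ Q = (\<Sum>y\<in>?BQ. m y * y)" "\<forall>y\<in>?BQ. m y : M'"
  using Lspan unfolding lin_def by blast
 define n where "n y = m y - (if y = x0 ^ Q then c else 0)" for y
 have cM: "c : M" unfolding M_def by (auto intro: ring_gen.gen)
 have nM: "n y : M" if "y : ?BQ" for y
 proof -
  have "m y : M" "(if y = x0 ^ Q then c else 0) : M" using m(2) that M'M cM FM(1) F_closed(1) by auto
  then show ?thesis unfolding n_def using Mc(1)[OF _ Mc(3)] by (metis diff_conv_add_uminus)
 qed
 have "(\<Sum>y\<in>?BQ. n y * y) = (\<Sum>y\<in>?BQ. m y * y) - (\<Sum>y\<in>?BQ. if y = x0 ^ Q then c * y else 0)"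
  unfolding n_def sum_subtractf[symmetric] by (rule sum.cong) (auto simp: algebra_simps)
 also have "(\<Sum>y\<in>?BQ. if y = x0 ^ Q then c * y else 0) = c * x0 ^ Q"
  using finB(1) x0 by (simp add: sum.delta')
 finally have n0: "(\<Sum>y\<in>?BQ. n y * y) = 0" using m(1) by simp
 have "n (x0 ^ Q) = 0"
 proof (rule ccontr)
  let ?y = "x0 ^ Q" and ?B' = "?BQ - {x0 ^ Q}"
  assume nz: "n ?y ~= 0"
  have yB: "?y : ?BQ" "finite ?BQ" using x0 finB(1) by auto
  have "n ?y * ?y + (\<Sum>y\<in>?B'. n y * y) = 0" using n0 sum.remove[OF yB(2,1), of "%y. n y * y"] by simp
  then have e: "n ?y * ?y = - (\<Sum>y\<in>?B'. n y * y)" by (simp add: eq_neg_iff_add_eq_0)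
  have "?y = inverse (n ?y) * (n ?y * ?y)" using nz by simp
  also have "... = (\<Sum>y\<in>?B'. (- inverse (n ?y) * n y) * y)"
   unfolding e by (simp add: sum_distrib_left sum_negf mult.assoc)
  also have "... : lin M ?B'"
  proof (rule linI)
   fix y assume "y : ?B'"
   then have "n y : M" "inverse (n ?y) : M" using nM yB(1) ring_gen_inverse[OF _ nz] unfolding M_def by auto
   then show "- inverse (n ?y) * n y : M" using Mc by blast
  qed
  finally have yl: "?y : lin M ?B'" .
  have "l : lin M ?B'" if l: "l : ?L" for l
  proof -
   obtain k where k: "l = (\<Sum>y\<in>?BQ. k y * y)" "\<forall>y\<in>?BQ. k y : M" using Lspan[OF l] mono unfolding lin_def by blast
   have "l = k ?y * ?y + (\<Sum>y\<in>?B'. k y * y)" unfolding k(1) using sum.remove[OF yB(2,1), of "%y. k y * y"] by simp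
   moreover have "k ?y * ?y : lin M ?B'" using lin_scale[OF Mc(2) _ yl] k(2) yB(1) by blast
   moreover have "(\<Sum>y\<in>?B'. k y * y) : lin M ?B'" using k(2) by (intro linI) auto
   ultimately show ?thesis using lin_add[OF Mc(1)] by simp
  qed
  then have "good ?B'" unfolding good_def using yB BQL by auto
  then have "card B <= card ?B'" by (rule min)
  moreover have "card ?B' < card ?BQ" using yB by (intro psubset_card_mono) auto
  ultimately show False using card_image[OF inj] by simp
 qed
 then have "c = m (x0 ^ Q)" by (simp add: n_def)
 then have "c : M'" using m(2) x0 by auto
 then show ?thesis unfolding M'_def by (rule separable_if)
qed

lemma separable_closure_ring:
 "a : F ==> a : separable_closure F"
 "a : separable_closure F ==> b : separable_closure F ==> a + b : separable_closure F"
 "a : separable_closure F ==> b : separable_closure F ==> a * b : separable_closure F"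
 "a : separable_closure F ==> - a : separable_closure F"
proof -
 show F: "a : separable_closure F" if "a : F" for a
  using that by (intro separable_if) (rule ring_gen.base)
 show "a + b : separable_closure F" if "a : separable_closure F" "b : separable_closure F" for a b
  by (rule separable_ring_gen[OF that]) (auto intro: ring_gen.intros)
 show m: "a * b : separable_closure F" if "a : separable_closure F" "b : separable_closure F" for a b
  by (rule separable_ring_gen[OF that]) (auto intro: ring_gen.intros)
 show "- a : separable_closure F" if "a : separable_closure F"
  using m[OF F[OF F_closed(7)[OF F_closed(2)]] that] by simp
qed

lemma galois_separable:
 assumes "sg : galois_group F" "a : separable_closure F" shows "sg a : separable_closure F"
proof -
 obtain p where p: "poly_over F p" "coprime p (pderiv p)" "poly p a = 0" using assms(2) unfolding separable_closure_def by blast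
 have s: "sg (x + y) = sg x + sg y" "sg (x * y) = sg x * sg y" "c : F ==> sg c = c" for x y c
  using assms(1) unfolding galois_group_def by auto
 have pw: "sg (x ^ n) = sg x ^ n" for x n by (induction n) (auto simp: s F_closed)
 have sm: "sg (sum f A) = (\<Sum>i\<in>A. sg (f i))" for f and A :: "nat set"
  by (induction A rule: infinite_finite_induct) (auto simp: s F_closed)
 have "sg (poly p a) = poly p (sg a)" using p(1) by (simp add: poly_altdef sm s pw poly_over_def)
 then have "poly p (sg a) = 0" using p(3) s(3)[OF F_closed(1)] by simp
 then show ?thesis using p unfolding separable_closure_def by blast
qed

end

section \<open>Cohomology classes and stable conjugacy\<close>

text \<open>The part of non-abelian cohomology that is needed: being cohomologous is an equivalence.\<close>

locale galois_module = group M for M :: "'g monoid" (structure) +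
 fixes Gal :: "('k => 'k) set" and ga :: "('k => 'k) => 'g => 'g"
 assumes ga_closed: "sg : Gal ==> x : carrier M ==> ga sg x : carrier M"
  and ga_mult: "sg : Gal ==> x : carrier M ==> y : carrier M ==> ga sg (x \<otimes> y) = ga sg x \<otimes> ga sg y"
begin

lemma ga_one: "sg : Gal ==> ga sg \<one> = \<one>"
 using ga_mult[of sg \<one> \<one>] ga_closed[of sg \<one>] l_cancel_one' by fastforce

lemma ga_inv: "sg : Gal ==> x : carrier M ==> ga sg (inv x) = inv (ga sg x)"
 using ga_mult[of sg "inv x" x] ga_one ga_closed inv_equality by fastforce

lemma cocycle_value: "c : cocycles Gal ga M ==> sg : Gal ==> c sg : carrier M"
 by (auto simp: cocycles_def PiE_iff)

lemma equiv_cohomologous: "equiv (cocycles Gal ga M) (cohomologous Gal ga M)"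
proof (rule equivI)
 show "cohomologous Gal ga M <= cocycles Gal ga M \<times> cocycles Gal ga M" by (auto simp: cohomologous_def)
 show "refl_on (cocycles Gal ga M) (cohomologous Gal ga M)"
 proof (rule refl_onI)
  fix c assume c: "c : cocycles Gal ga M"
  then have "\<forall>sg\<in>Gal. c sg = inv \<one> \<otimes> c sg \<otimes> ga sg \<one>" using cocycle_value ga_one by simp
  then show "(c, c) : cohomologous Gal ga M" using c unfolding cohomologous_def by blast
 qed
 show "sym (cohomologous Gal ga M)"
 proof (rule symI)
  fix c d assume "(c, d) : cohomologous Gal ga M"
  then obtain m where m: "c : cocycles Gal ga M" "d : cocycles Gal ga M" "m : carrier M"
   "\<forall>sg\<in>Gal. d sg = inv m \<otimes> c sg \<otimes> ga sg m" unfolding cohomologous_def by blast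
  have "c sg = inv (inv m) \<otimes> d sg \<otimes> ga sg (inv m)" if s: "sg : Gal" for sg
  proof -
   note C = cocycle_value[OF m(1) s] ga_closed[OF s m(3)] m(3)
   have "inv (inv m) \<otimes> d sg \<otimes> ga sg (inv m) = m \<otimes> (inv m \<otimes> c sg \<otimes> ga sg m) \<otimes> inv (ga sg m)"
    using m(4) s C by (simp add: ga_inv)
   also have "... = c sg" using C by (simp add: m_assoc inv_solve_left)
    (metis (no_types, lifting) C inv_closed m_assoc m_closed r_inv r_one l_one)
   finally show ?thesis by simp
  qed
  then show "(d, c) : cohomologous Gal ga M" using m inv_closed unfolding cohomologous_def by blast
 qed
 show "trans (cohomologous Gal ga M)"
 proof (rule transI)
  fix c d e assume "(c, d) : cohomologous Gal ga M" "(d, e) : cohomologous Gal ga M"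
  then obtain m n where m: "c : cocycles Gal ga M" "e : cocycles Gal ga M" "m : carrier M" "n : carrier M"
   "\<forall>sg\<in>Gal. d sg = inv m \<otimes> c sg \<otimes> ga sg m" "\<forall>sg\<in>Gal. e sg = inv n \<otimes> d sg \<otimes> ga sg n" unfolding cohomologous_def by blast
  have "e sg = inv (m \<otimes> n) \<otimes> c sg \<otimes> ga sg (m \<otimes> n)" if s: "sg : Gal" for sg
   using m(5,6) s cocycle_value[OF m(1) s] ga_closed[OF s m(3)] ga_closed[OF s m(4)] m(3,4)
   by (simp add: ga_mult inv_mult_group m_assoc)
  then show "(c, e) : cohomologous Gal ga M" using m m_closed unfolding cohomologous_def by blast
 qed
qed

lemma class_eq: "(c, d) : cohomologous Gal ga M ==> cohomologous Gal ga M `` {c} = cohomologous Gal ga M `` {d}"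
 by (rule equiv_class_eq[OF equiv_cohomologous])

lemma coboundary_cohomologous:
 assumes "c : cocycles Gal ga M" "d : cocycles Gal ga M" "m : carrier M" "!!sg. sg : Gal ==> d sg = inv m \<otimes> c sg \<otimes> ga sg m"
 shows "(c, d) : cohomologous Gal ga M"
 using assms unfolding cohomologous_def by blast

lemma trivial_cocycle:
 assumes "!!sg ta. sg : Gal ==> ta : Gal ==> sg \<circ> ta : Gal"
 shows "(\<lambda>sg\<in>Gal. \<one>) : cocycles Gal ga M"
 using assms ga_one by (auto simp: cocycles_def krull_continuous_def)

end

locale setting = nearly_singular_pair F E v s x y + algebraic_closure_p F
 for F E :: "'k::alg_closed_field set" and v :: "'k => int" and s x y :: 'k
begin

abbreviation "K \<equiv> separable_closure F"
abbreviation "Gal \<equiv> galois_group F"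
abbreviation "gm \<equiv> gamma x y"
abbreviation "GU \<equiv> G0 s UNIV"
abbreviation "GK \<equiv> G0 s K"
abbreviation "GF \<equiv> G0 s F"

lemma s_K: "s : K"
proof (rule separable_if)
 obtain k where k: "Q = 2 * k + 1" using char(2) unfolding Q_def by (auto elim: oddE)
 define r where "r = inverse ((s\<^sup>2) ^ k)"
 have "s ^ Q = (s\<^sup>2) ^ k * s" unfolding k by (simp add: power_mult)
 moreover have "(s\<^sup>2) ^ k ~= 0" using s_nonzero by simp
 ultimately have rs: "r * s ^ Q = s" unfolding r_def by (simp add: field_simps)
 have "r : F" unfolding r_def by (intro FF.inverse_closed FF.power_closed s_props(2))
 then have "r * s ^ Q : ring_gen F {s ^ Q}" by (intro ring_gen.mult) (auto intro: ring_gen.intros)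
 then show "s : ring_gen F {s ^ Q}" unfolding rs .
qed

lemma F_K: "F <= K" using separable_closure_ring(1) by blast

lemma E_K: "E <= K"
proof
 fix z assume "z : E"
 then obtain a b where ab: "a : F" "b : F" "z = a + b * s" using s_props(3) by blast
 then show "z : K" unfolding ab(3)
  by (intro separable_closure_ring(2)[OF separable_closure_ring(1) separable_closure_ring(3)[OF separable_closure_ring(1) s_K]])
qed

lemma ring_over_K: "ring_over K"
 unfolding ring_over_def
proof (intro conjI ballI)
 show "0 : K" "1 : K" "s\<^sup>2 : K" using F_K FF.zero_closed FF.one_closed s_props(2) by auto
qed (simp_all add: separable_closure_ring(2-4))

lemma gal:
 assumes "sg : Gal"
 shows "sg (a + b) = sg a + sg b" "sg (a * b) = sg a * sg b" "c : F ==> sg c = c" "sg 0 = 0" "sg 1 = 1" "sg (- a) = - sg a"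
  "sg (sum f A) = (\<Sum>i\<in>A. sg (f i))" "sg (s\<^sup>2) = s\<^sup>2" "sg s = s | sg s = - s"
proof -
 have h: "sg (a + b) = sg a + sg b" "sg (a * b) = sg a * sg b" "c : F ==> sg c = c" for a b c
  using assms unfolding galois_group_def by auto
 then show "sg (a + b) = sg a + sg b" "sg (a * b) = sg a * sg b" "c : F ==> sg c = c" .
 show z: "sg 0 = 0" "sg 1 = 1" by (rule h(3); simp)+
 show "sg (- a) = - sg a" using h(1)[of a "- a"] z(1) by (simp add: eq_neg_iff_add_eq_0 add.commute)
 show "sg (sum f A) = (\<Sum>i\<in>A. sg (f i))"
  by (induction A rule: infinite_finite_induct) (simp_all add: h(1) z)
 show s2: "sg (s\<^sup>2) = s\<^sup>2" by (rule h(3)[OF s_props(2)])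
 have "sg s * sg s = s * s" using s2 h(2)[of s s] by (simp add: power2_eq_square)
 then show "sg s = s | sg s = - s" by (simp only: square_eq_iff)
qed

lemma gal_comp: "sg : Gal ==> ta : Gal ==> sg \<circ> ta : Gal"
 unfolding galois_group_def by (auto intro: bij_comp)

lemma tmap_U: "X : tmats n UNIV ==> tmap sg X : tmats n UNIV"
 by (auto simp: tmap_def tmats_UNIV)

lemma tmap_K: "sg : Gal ==> X : tmats n K ==> tmap sg X : tmats n K"
 unfolding tmats_entries[of _ n K] using galois_separable by (auto simp: tmap_def tmats_UNIV)

lemma tmap_F: "sg : Gal ==> X : tmats n F ==> tmap sg X = X"
 unfolding tmats_entries[of _ n F] by (cases X) (auto simp: tmap_def tmats_UNIV gal(3) intro!: eq_matI)

lemma tmap_fixed: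
 assumes X: "X : tmats n K" and f: "!!sg. sg : Gal ==> tmap sg X = X"
 shows "X : tmats n F"
proof -
 have U: "fst X : carrier_mat n n" "snd X : carrier_mat n n" and e: "ALL i<n. ALL j<n. fst X $$ (i, j) : K & snd X $$ (i, j) : K"
  using X unfolding tmats_entries[of _ n K] tmats_UNIV by auto
 have "fst X $$ (i, j) : F & snd X $$ (i, j) : F" if "i < n" "j < n" for i j
 proof -
  have "sg (fst X $$ (i, j)) = fst X $$ (i, j) & sg (snd X $$ (i, j)) = snd X $$ (i, j)" if s: "sg : Gal" for sg
  proof -
   have "fst (tmap sg X) $$ (i, j) = fst X $$ (i, j)" "snd (tmap sg X) $$ (i, j) = snd X $$ (i, j)" using f[OF s] by simp_all
   then show ?thesis using U \<open>i < n\<close> \<open>j < n\<close> by (simp add: tmap_def)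
  qed
  then show ?thesis using separable_fixed e that by blast
 qed
 then show ?thesis unfolding tmats_entries[of _ n F] using tmats_U[OF X] by blast
qed

lemma tmap_tmult:
 assumes "sg : Gal" "X : tmats n UNIV" "Y : tmats n UNIV"
 shows "tmap sg (tmult s X Y) = tmult s (tmap sg X) (tmap sg Y)"
 using assms(2,3) unfolding tmap_def tmult_def
 by (cases X; cases Y) (auto simp: tmats_UNIV scalar_prod_def gal[OF assms(1)] intro!: eq_matI)

lemma tmap_tt: "sg : Gal ==> X : tmats n UNIV ==> tmap sg (ttranspose (tbar X)) = ttranspose (tbar (tmap sg X))"
 by (cases X) (auto simp: tmats_UNIV tmap_def ttranspose_def tbar_def gal intro!: eq_matI)

lemma J_F: "temb 4 (Jmat 4) : tmats 4 F" by (rule temb_J_closed[OF ring_over_F])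
lemma one_F: "id4 : tmats 4 F" by (rule temb_one_closed[OF ring_over_F])
lemma W_F: "temb 4 theta_mat : tmats 4 F"
proof (rule temb_closed[OF ring_over_F])
 show "theta_mat : carrier_mat 4 4" by (simp add: mk4_theta)
 have "ALL i<4. ALL j<4. theta_mat $$ (i, j) : F" unfolding all4 by (simp add: mk4_theta mk4_index)
 then show "!!i j. i < 4 ==> j < 4 ==> theta_mat $$ (i, j) : F" by blast
qed

lemma G_theta_equations:
 assumes R: "ring_over R" and X: "X : tmats 4 R"
 shows "X : G_theta s R \<longleftrightarrow> tmult s X (ust 4 X) = id4 & tmult s (tmult s (temb 4 theta_mat) X) (temb 4 theta_mat) = X"
proof -
 interpret f: tensor_form s 4 by (rule tensor_form_4)
 note XU = tmats_U[OF X]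
 have W: "(theta_mat :: 'k mat) : carrier_mat 4 4" by (simp add: mk4_theta)
 have th: "tmult s (tmult s (temb 4 theta_mat) X) (temb 4 theta_mat) = theta s X"
  by (rule tmat_eqI[of _ 4]) (use XU W in \<open>simp_all add: theta_teval tevals[of _ 4]\<close>)
 have "X : unitary 4 s R \<longleftrightarrow> tmult s X (ust 4 X) = id4"
 proof
  assume u: "X : unitary 4 s R"
  then obtain Y where Y: "Y : tmats 4 R" "tmult s X Y = id4" "tmult s Y X = id4"
   unfolding unitary_def Units_def by (auto simp: tmat_monoid_def)
  then have "tinv 4 s X = Y" using XU by (intro tinv_eq) (auto intro: tmats_U)
  then show "tmult s X (ust 4 X) = id4" using f.unitary_iff(2)[OF R X u] Y by simp
 next
  assume "tmult s X (ust 4 X) = id4"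
  then have "teval s (tmult s X (ust 4 X)) = 1\<^sub>m 4" by simp
  then show "X : unitary 4 s R" using f.unitary_iff(1)[OF R X] XU by (simp add: tevals[of _ 4] teval_ust)
 qed
 then show ?thesis unfolding th by (simp add: G_theta_def)
qed

lemma carrier_G0_theta: "ring_over R ==> carrier (G0 s R) = G_theta s R"
 using carrier_G0[OF infinite_k] G_theta_iff by (auto simp: set_eq_iff)

lemma G0_tmats: "ring_over R ==> X : carrier (G0 s R) ==> X : tmats 4 R"
 using carrier_G0[OF infinite_k] by blast

lemma G0_tmats_U: "ring_over R ==> X : carrier (G0 s R) ==> X : tmats 4 UNIV"
 using G0_tmats tmats_U by blast

lemma G0_mono: "ring_over R ==> ring_over R' ==> X : carrier (G0 s R) ==> X : tmats 4 R' ==> X : carrier (G0 s R')"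
 unfolding carrier_G0[OF infinite_k] by blast

lemma G0_sub: "ring_over R ==> ring_over R' ==> R <= R' ==> X : carrier (G0 s R) ==> X : carrier (G0 s R')"
 using G0_mono G0_tmats tmats_mono by blast

lemma GK_GU: "X : carrier GK ==> X : carrier GU" by (rule G0_sub[OF ring_over_K ring_over_UNIV]) auto
lemma GF_GK: "X : carrier GF ==> X : carrier GK" by (rule G0_sub[OF ring_over_F ring_over_K F_K])
lemma GF_GU: "X : carrier GF ==> X : carrier GU" using GF_GK GK_GU by blast

lemma tmap_G0: assumes s: "sg : Gal" and X: "X : carrier GK" shows "tmap sg X : carrier GK"
proof -
 have XK: "X : tmats 4 K" by (rule G0_tmats[OF ring_over_K X])
 note XU = tmats_U[OF XK] and JU = tmats_U[OF J_F] and WU = tmats_U[OF W_F]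
 have "tmult s X (ust 4 X) = id4 & tmult s (tmult s (temb 4 theta_mat) X) (temb 4 theta_mat) = X"
  using X unfolding carrier_G0_theta[OF ring_over_K] G_theta_equations[OF ring_over_K XK] .
 then have "tmap sg (tmult s X (ust 4 X)) = tmap sg (id4) & tmap sg (tmult s (tmult s (temb 4 theta_mat) X) (temb 4 theta_mat)) = tmap sg X"
  by simp
 then have "tmult s (tmap sg X) (ust 4 (tmap sg X)) = id4 &
   tmult s (tmult s (temb 4 theta_mat) (tmap sg X)) (temb 4 theta_mat) = tmap sg X"
  using XU JU WU by (simp add: tmap_tmult[OF s, of _ 4] ust_def tmap_tt[OF s, of _ 4] tmap_F[OF s one_F] tmap_F[OF s J_F] tmap_F[OF s W_F])
 then show ?thesis
  unfolding carrier_G0_theta[OF ring_over_K] G_theta_equations[OF ring_over_K tmap_K[OF s XK]] .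
qed

lemma group_GU: "group GU" and group_GK: "group GK" and group_GF: "group GF"
 using G0_group(1)[OF infinite_k] ring_over_UNIV ring_over_K ring_over_F by auto

lemma module_GK: "galois_module GK Gal tmap"
proof -
 interpret group GK by (rule group_GK)
 show ?thesis
 proof unfold_locales
  fix sg X Y assume s: "sg : Gal" and X: "X : carrier GK"
  show "tmap sg X : carrier GK" by (rule tmap_G0[OF s X])
  assume Y: "Y : carrier GK"
  show "tmap sg (X \<otimes>\<^bsub>GK\<^esub> Y) = tmap sg X \<otimes>\<^bsub>GK\<^esub> tmap sg Y"
   using tmap_tmult[OF s G0_tmats_U[OF ring_over_K X] G0_tmats_U[OF ring_over_K Y]] by simp
 qed
qed

lemma Ad_mult:
 assumes "g : carrier GU" "h : carrier GU" "X : tmats 4 UNIV"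
 shows "Ad 4 s (tmult s g h) X = Ad 4 s g (Ad 4 s h X)"
proof -
 interpret group GU by (rule group_GU)
 have i: "tinv 4 s (tmult s g h) = tmult s (tinv 4 s h) (tinv 4 s g)"
  using inv_mult_group[OF assms(1,2)] m_closed[OF assms(1,2)] assms(1,2)
  by (simp add: G0_group(2)[OF infinite_k ring_over_UNIV])
 have U: "g : tmats 4 UNIV" "h : tmats 4 UNIV" "tinv 4 s g : tmats 4 UNIV" "tinv 4 s h : tmats 4 UNIV"
  using assms inv_closed G0_tmats_U[OF ring_over_UNIV] G0_group(2)[OF infinite_k ring_over_UNIV] by metis+
 show ?thesis unfolding Ad_def i using U assms(3) by (simp add: tmult_assoc[of _ 4])
qed

lemma Ad_one: "X : tmats 4 UNIV ==> Ad 4 s (id4) X = X"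
proof -
 assume X: "X : tmats 4 UNIV"
 have "tinv 4 s (id4) = id4"
  by (rule tinv_eq) (use tmats_U[OF one_F] in \<open>auto simp: tmult_one\<close>)
 then show ?thesis using X by (simp add: Ad_def tmult_one)
qed

lemma Ad_inv:
 assumes "g : carrier GU" "X : tmats 4 UNIV" "Ad 4 s g X = Y" shows "Ad 4 s (tinv 4 s g) Y = X"
proof -
 interpret group GU by (rule group_GU)
 have i: "tinv 4 s g : carrier GU" "tmult s (tinv 4 s g) g = id4"
  using inv_closed[OF assms(1)] l_inv[OF assms(1)] assms(1) by (simp_all add: G0_group(2)[OF infinite_k ring_over_UNIV])
 show ?thesis using Ad_mult[OF i(1) assms(1,2)] Ad_one[OF assms(2)] i(2) assms(3) by simp
qed

lemma gamma_F: "gm : tmats 4 F"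
 unfolding gamma_lie lie_in_F using xy xyE dia_E by (simp add: barm_dia)

lemma gamma_g1: "gm : g1 s F"
 unfolding g1_iff[OF ring_over_F] using gamma_F gamma_lie by blast

abbreviation "I \<equiv> stab_sep F s gm"

lemma I_carrier: "carrier I = {g : carrier GK. Ad 4 s g gm = gm}"
 by (simp add: stab_sep_def stabiliser_def)

lemma I_ops [simp]: "X \<otimes>\<^bsub>I\<^esub> Y = tmult s X Y" "\<one>\<^bsub>I\<^esub> = id4"
 by (simp_all add: stab_sep_def stabiliser_def)

lemma tinv_GK: "g : carrier GK ==> tinv 4 s g : carrier GK"
 using group.inv_closed[OF group_GK] G0_group(2)[OF infinite_k ring_over_K] by metis

lemma group_I: "group I"
proof (rule groupI)
 interpret group GK by (rule group_GK)
 note gU = tmats_U[OF gamma_F]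
 show "\<one>\<^bsub>I\<^esub> : carrier I" using one_closed Ad_one[OF gU] by (simp add: I_carrier)
 show "!!X. X : carrier I ==> \<one>\<^bsub>I\<^esub> \<otimes>\<^bsub>I\<^esub> X = X" using l_one by (simp add: I_carrier)
 show "!!X Y. X : carrier I ==> Y : carrier I ==> X \<otimes>\<^bsub>I\<^esub> Y : carrier I"
  using m_closed Ad_mult[OF GK_GU GK_GU gU] by (simp add: I_carrier)
 show "!!X Y Z. X : carrier I ==> Y : carrier I ==> Z : carrier I ==> X \<otimes>\<^bsub>I\<^esub> Y \<otimes>\<^bsub>I\<^esub> Z = X \<otimes>\<^bsub>I\<^esub> (Y \<otimes>\<^bsub>I\<^esub> Z)"
  using m_assoc by (simp add: I_carrier)
 fix X assume "X : carrier I"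
 then have X: "X : carrier GK" "Ad 4 s X gm = gm" by (auto simp: I_carrier)
 have "tinv 4 s X : carrier I" using tinv_GK[OF X(1)] Ad_inv[OF GK_GU[OF X(1)] gU X(2)] by (simp add: I_carrier)
 moreover have "tmult s (tinv 4 s X) X = id4" using l_inv[OF X(1)] X(1) by (simp add: G0_group(2)[OF infinite_k ring_over_K])
 ultimately show "\<exists>Y\<in>carrier I. Y \<otimes>\<^bsub>I\<^esub> X = \<one>\<^bsub>I\<^esub>" by auto
qed

lemma inv_I: "X : carrier I ==> inv\<^bsub>I\<^esub> X = tinv 4 s X"
proof -
 assume X: "X : carrier I"
 interpret I: group I by (rule group_I)
 interpret G: group GK by (rule group_GK)
 have "inv\<^bsub>I\<^esub> X : carrier I" "inv\<^bsub>I\<^esub> X \<otimes>\<^bsub>I\<^esub> X = \<one>\<^bsub>I\<^esub>" using X I.inv_closed I.l_inv by blast+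
 then have "inv\<^bsub>GK\<^esub> X = inv\<^bsub>I\<^esub> X" using X by (intro G.inv_equality) (simp_all add: I_carrier)
 then show ?thesis using X G0_group(2)[OF infinite_k ring_over_K] by (simp add: I_carrier)
qed

lemma tmap_Ad:
 assumes s: "sg : Gal" and g: "g : carrier GK" and X: "X : tmats 4 UNIV"
 shows "tmap sg (Ad 4 s g X) = Ad 4 s (tmap sg g) (tmap sg X)"
proof -
 interpret galois_module GK Gal tmap by (rule module_GK)
 have "tmap sg (tinv 4 s g) = tinv 4 s (tmap sg g)"
  using ga_inv[OF s g] g tmap_G0[OF s g] by (simp add: G0_group(2)[OF infinite_k ring_over_K])
 then show ?thesis unfolding Ad_def
  using X G0_tmats_U[OF ring_over_K g] G0_tmats_U[OF ring_over_K tinv_GK[OF g]] by (simp add: tmap_tmult[OF s, of _ 4])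
qed

lemma module_I: "galois_module I Gal tmap"
proof -
 interpret group I by (rule group_I)
 interpret G: galois_module GK Gal tmap by (rule module_GK)
 show ?thesis
 proof unfold_locales
  fix sg X assume s: "sg : Gal" and "X : carrier I"
  then have X: "X : carrier GK" "Ad 4 s X gm = gm" by (auto simp: I_carrier)
  have "Ad 4 s (tmap sg X) gm = gm" using tmap_Ad[OF s X(1) tmats_U[OF gamma_F]] X(2) tmap_F[OF s gamma_F] by simp
  then show "tmap sg X : carrier I" using tmap_G0[OF s X(1)] by (simp add: I_carrier)
  fix Y assume "Y : carrier I"
  then show "tmap sg (X \<otimes>\<^bsub>I\<^esub> Y) = tmap sg X \<otimes>\<^bsub>I\<^esub> tmap sg Y"
   using G.ga_mult[OF s X(1)] by (simp add: I_carrier)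
 qed
qed

text \<open>The stabiliser of \<open>\<gamma>\<close> is the diagonal torus, hence commutative.\<close>

lemma x2_y2: "x * x ~= y * y"
 using xy by (simp add: square_eq_iff)

lemma commutes_with_diagonal:
 assumes "k * dia a b = dia a b * k" "a ~= (b :: 'k)" shows "EX c d. k = dia c d"
proof -
 obtain p q r t where k: "k = M2 p q r t" by (cases k)
 have "q * b = a * q" "r * a = b * r" using assms(1) by (simp_all add: k dia_def)
 then have "q * (b - a) = 0" "r * (a - b) = 0" by (simp_all add: algebra_simps)
 then show ?thesis using assms(2) k by (auto simp: dia_def)
qed

lemma I_diagonal:
 assumes "X : carrier I" shows "EX c d. X = el (dia c d) (dia c d) & c ~= 0 & d ~= 0"
proof -
 obtain k g where kg: "det2 k ~= 0" "det2 g ~= 0" "X = el k g" and st: "Ad 4 s X gm = gm"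
  using assms unfolding I_carrier carrier_G0[OF infinite_k ring_over_K] by blast
 let ?d = "dia x y"
 have "g * ?d * inv2 k = ?d" "k * ?d * inv2 g = ?d"
  using st unfolding kg(3) gamma_lie Ad_el[OF kg(1,2)] lie_inject by auto
 then have "g * ?d * inv2 k * k = ?d * k" "k * ?d * inv2 g * g = ?d * g" by simp_all
 then have e: "g * ?d = ?d * k" "k * ?d = ?d * g" using inv2(2)[OF kg(1)] inv2(2)[OF kg(2)] by (simp_all add: mult.assoc)
 have "k * (?d * ?d) = ?d * (g * ?d)" using e(2) by (simp flip: mult.assoc)
 then have "k * dia (x * x) (y * y) = dia (x * x) (y * y) * k" using e(1) by (simp add: dia_mult flip: mult.assoc)
 then obtain c d where k: "k = dia c d" using commutes_with_diagonal x2_y2 by blast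
 have "g * ?d = dia c d * ?d" using e(1) unfolding k by (simp add: dia_mult mult.commute)
 then have "g * ?d * inv2 ?d = dia c d * ?d * inv2 ?d" by simp
 then have "g = dia c d" using inv2(1)[of ?d] xy by (simp add: mult.assoc)
 then show ?thesis using kg k by auto
qed

lemma I_comm: "X : carrier I ==> Y : carrier I ==> tmult s X Y = tmult s Y X"
 using I_diagonal[of X] I_diagonal[of Y] by (auto simp: el_mult dia_mult mult.commute)

end

context setting
begin

lemma GK_calculus:
 assumes "g : carrier GK" "h : carrier GK" "k : carrier GK"
 shows "tmult s g h : carrier GK" "tmult s (tmult s g h) k = tmult s g (tmult s h k)"
  "tmult s (tinv 4 s g) (tmult s g h) = h" "tmult s g (tmult s (tinv 4 s g) h) = h"
  "tinv 4 s (tmult s g h) = tmult s (tinv 4 s h) (tinv 4 s g)" "tinv 4 s (tinv 4 s g) = g"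
  "tmult s (tinv 4 s g) g = id4" "tmult s g (tinv 4 s g) = id4"
  "tmult s g (id4) = g" "tmult s (id4) g = g"
proof -
 interpret group GK by (rule group_GK)
 note inv = G0_group(2)[OF infinite_k ring_over_K]
 show 0: "tmult s g h : carrier GK" using m_closed[OF assms(1,2)] by simp
 show 1: "tmult s (tmult s g h) k = tmult s g (tmult s h k)" using m_assoc[OF assms] by simp
 note ic = tinv_GK[OF assms(1)]
 show 2: "tmult s (tinv 4 s g) g = id4" "tmult s g (tinv 4 s g) = id4"
  using l_inv[OF assms(1)] r_inv[OF assms(1)] by (simp_all add: inv[OF assms(1)])
 show 3: "tmult s g (id4) = g" "tmult s (id4) g = g"
  using l_one[OF assms(1)] r_one[OF assms(1)] by simp_all
 have h1: "tmult s (id4) h = h" using l_one[OF assms(2)] by simp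
 show "tmult s (tinv 4 s g) (tmult s g h) = h" "tmult s g (tmult s (tinv 4 s g) h) = h"
  using m_assoc[OF ic assms(1,2)] m_assoc[OF assms(1) ic assms(2)] by (simp_all add: 2 h1)
 show "tinv 4 s (tmult s g h) = tmult s (tinv 4 s h) (tinv 4 s g)"
  using inv_mult_group[OF assms(1,2)] by (simp add: inv assms 0)
 show "tinv 4 s (tinv 4 s g) = g" using inv_inv[OF assms(1)] by (simp add: inv assms ic)
qed

lemma tmap_tinv: "sg : Gal ==> g : carrier GK ==> tmap sg (tinv 4 s g) = tinv 4 s (tmap sg g)"
 using galois_module.ga_inv[OF module_GK, of sg g] tmap_G0[of sg g]
 by (simp add: G0_group(2)[OF infinite_k ring_over_K])

lemma tmap_GK_mult: "sg : Gal ==> g : carrier GK ==> h : carrier GK ==> tmap sg (tmult s g h) = tmult s (tmap sg g) (tmap sg h)"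
 using galois_module.ga_mult[OF module_GK, of sg g h] by simp

lemma tmap_comp: "tmap (sg \<circ> ta) X = tmap sg (tmap ta X)"
 by (cases X) (auto simp: tmap_def intro!: eq_matI)

abbreviation "coh \<equiv> cohomologous Gal tmap I"
abbreviation "DG \<equiv> D_group F s gm"
abbreviation "cocI \<equiv> cocycles Gal tmap I"
abbreviation "cob g \<equiv> (\<lambda>sg\<in>Gal. tmult s (tinv 4 s g) (tmap sg g))"

abbreviation "cls c \<equiv> coh `` {c}"

lemma tmap_cong:
 assumes "X : tmats n UNIV" "!!a. a : elements_mat (fst X) \<union> elements_mat (snd X) ==> ta a = sg a"
 shows "tmap ta X = tmap sg X"
proof -
 have c: "fst X : carrier_mat n n" "snd X : carrier_mat n n" using assms(1) unfolding tmats_UNIV by auto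
 have "map_mat ta Z = map_mat sg Z" if Z: "Z : carrier_mat n n" "elements_mat Z <= elements_mat (fst X) \<union> elements_mat (snd X)" for Z
 proof (rule eq_matI)
  fix i j assume "i < dim_row (map_mat sg Z)" "j < dim_col (map_mat sg Z)"
  then have ij: "i < n" "j < n" using Z(1) by auto
  then have "Z $$ (i, j) : elements_mat Z" using Z(1) by (auto intro: elements_matI)
  then show "map_mat ta Z $$ (i, j) = map_mat sg Z $$ (i, j)" using assms(2) Z ij by auto
 qed auto
 then show ?thesis unfolding tmap_def using c by simp
qed

lemma krull_cob:
 assumes g: "g : carrier GK" shows "krull_continuous Gal (cob g)"
 unfolding krull_continuous_def
proof
 fix sg assume s: "sg : Gal"
 let ?A = "elements_mat (fst g) \<union> elements_mat (snd g)"
 have "finite ?A" by (simp add: elements_mat_def)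
 moreover have "\<forall>ta\<in>Gal. (\<forall>a\<in>?A. ta a = sg a) --> cob g ta = cob g sg"
 proof (intro ballI impI)
  fix ta assume "ta : Gal" "\<forall>a\<in>?A. ta a = sg a"
  moreover from this(2) have "tmap ta g = tmap sg g" by (intro tmap_cong[OF G0_tmats_U[OF ring_over_K g]]) auto
  ultimately show "cob g ta = cob g sg" using s by simp
 qed
 ultimately show "EX A. finite A & (\<forall>ta\<in>Gal. (\<forall>a\<in>A. ta a = sg a) --> cob g ta = cob g sg)" by blast
qed

text \<open>If \<open>g\<^sup>-\<^sup>1 \<sigma>(g)\<close> stabilises \<open>\<gamma>\<close> for all \<open>\<sigma>\<close>, then \<open>\<sigma>\<close> fixes \<open>Ad(g) \<gamma>\<close>: descent.\<close>

lemma Ad_rational: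
 assumes g: "g : carrier GK" and fixed: "!!sg. sg : Gal ==> tmult s (tinv 4 s g) (tmap sg g) : carrier I"
 shows "Ad 4 s g gm : tmats 4 F"
proof (rule tmap_fixed)
 note gU = tmats_U[OF gamma_F]
 have "gm : tmats 4 K" using gamma_F F_K tmats_mono by blast
 then show "Ad 4 s g gm : tmats 4 K" unfolding Ad_def
  using G0_tmats[OF ring_over_K g] G0_tmats[OF ring_over_K tinv_GK[OF g]] by (intro tmult_closed[OF ring_over_K])
 fix sg assume s: "sg : Gal"
 note m = tmap_G0[OF s g]
 have c: "tmult s (tinv 4 s g) (tmap sg g) : carrier GK" "Ad 4 s (tmult s (tinv 4 s g) (tmap sg g)) gm = gm"
  using fixed[OF s] by (auto simp: I_carrier)
 have "tmap sg (Ad 4 s g gm) = Ad 4 s (tmap sg g) gm" using tmap_Ad[OF s g gU] tmap_F[OF s gamma_F] by simp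
 also have "tmap sg g = tmult s g (tmult s (tinv 4 s g) (tmap sg g))" using GK_calculus(4)[OF g m m] by simp
 also have "Ad 4 s ... gm = Ad 4 s g gm" using Ad_mult[OF GK_GU[OF g] GK_GU[OF c(1)] gU] c(2) by simp
 finally show "tmap sg (Ad 4 s g gm) = Ad 4 s g gm" .
qed

lemma cob_cocycle:
 assumes g: "g : carrier GK" and Y: "Ad 4 s g gm : tmats 4 F"
 shows "cob g : cocI"
proof -
 note gU = tmats_U[OF gamma_F]
 have in_I: "tmult s (tinv 4 s g) (tmap sg g) : carrier I" if s: "sg : Gal" for sg
 proof -
  note m = tmap_G0[OF s g]
  have "Ad 4 s (tmap sg g) gm = Ad 4 s g gm" using tmap_Ad[OF s g gU] tmap_F[OF s gamma_F] tmap_F[OF s Y] by simp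
  then have "Ad 4 s (tmult s (tinv 4 s g) (tmap sg g)) gm = gm"
   using Ad_mult[OF GK_GU[OF tinv_GK[OF g]] GK_GU[OF m] gU] Ad_inv[OF GK_GU[OF g] gU refl] by simp
  then show ?thesis using GK_calculus(1)[OF tinv_GK[OF g] m m] by (simp add: I_carrier)
 qed
 have "cob g (sg \<circ> ta) = cob g sg \<otimes>\<^bsub>I\<^esub> tmap sg (cob g ta)" if s: "sg : Gal" and t: "ta : Gal" for sg ta
 proof -
  note C = g tinv_GK[OF g] tmap_G0[OF s g] tmap_G0[OF t g] tmap_G0[OF s tmap_G0[OF t g]] tinv_GK[OF tmap_G0[OF s g]]
  have "tmult s (tmult s (tinv 4 s g) (tmap sg g)) (tmult s (tinv 4 s (tmap sg g)) (tmap sg (tmap ta g)))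
    = tmult s (tinv 4 s g) (tmap sg (tmap ta g))" using C by (simp add: GK_calculus)
  moreover have "tmap sg (tmult s (tinv 4 s g) (tmap ta g)) = tmult s (tinv 4 s (tmap sg g)) (tmap sg (tmap ta g))"
   using tmap_GK_mult[OF s C(2,4)] tmap_tinv[OF s g] by simp
  ultimately show ?thesis using s t gal_comp[OF s t] by (simp add: tmap_comp)
 qed
 moreover have "cob g : Gal \<rightarrow>\<^sub>E carrier I" using in_I by simp
 ultimately show ?thesis unfolding cocycles_def using krull_cob[OF g] by blast
qed

lemma cob_cohomologous:
 assumes g: "g : carrier GK" "h : carrier GK" and Y: "Ad 4 s g gm : tmats 4 F" and e: "Ad 4 s h gm = Ad 4 s g gm"
 shows "(cob g, cob h) : coh"
proof -
 interpret M: galois_module I Gal tmap by (rule module_I)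
 note gU = tmats_U[OF gamma_F]
 let ?i = "tmult s (tinv 4 s g) h"
 have i: "?i : carrier GK" using GK_calculus(1)[OF tinv_GK[OF g(1)] g(2) g(1)] .
 have "Ad 4 s ?i gm = gm"
  using Ad_mult[OF GK_GU[OF tinv_GK[OF g(1)]] GK_GU[OF g(2)] gU] Ad_inv[OF GK_GU[OF g(1)] gU e[symmetric]] by simp
 then have iI: "?i : carrier I" using i by (simp add: I_carrier)
 show ?thesis
 proof (rule M.coboundary_cohomologous[OF cob_cocycle[OF g(1) Y] _ iI])
  show "cob h : cocI" using cob_cocycle[OF g(2)] e Y by simp
  fix sg assume s: "sg : Gal"
  note C = g tinv_GK[OF g(1)] tinv_GK[OF g(2)] tmap_G0[OF s g(1)] tmap_G0[OF s g(2)] tinv_GK[OF tmap_G0[OF s g(1)]]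
  have "tmap sg ?i = tmult s (tinv 4 s (tmap sg g)) (tmap sg h)" using tmap_GK_mult[OF s C(3,2)] tmap_tinv[OF s g(1)] by simp
  then show "cob h sg = inv\<^bsub>I\<^esub> ?i \<otimes>\<^bsub>I\<^esub> cob g sg \<otimes>\<^bsub>I\<^esub> tmap sg ?i"
   using s C by (simp add: inv_I[OF iI] GK_calculus)
 qed
qed

lemma D_class_cob:
 assumes g: "g : carrier GK" and Y: "Ad 4 s g gm : tmats 4 F"
 shows "D_class F s gm (Ad 4 s g gm) = cls (cob g)"
proof -
 interpret M: galois_module I Gal tmap by (rule module_I)
 have "cls (cob h) = cls (cob g)" if "h : {h : carrier GK. Ad 4 s h gm = Ad 4 s g gm}" for h
  using that cob_cohomologous[OF g _ Y] M.class_eq by blast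
 then show ?thesis unfolding D_class_def using g by blast
qed

text \<open>Changing the point by a rational \<open>h\<close> replaces \<open>g\<close> by \<open>h g\<close> and leaves \<open>g\<^sup>-\<^sup>1 \<sigma>(g)\<close> alone.\<close>

lemma D_class_orbit:
 assumes g: "g : carrier GK" and Y: "Ad 4 s g gm : tmats 4 F" and h: "h : carrier GF"
 shows "D_class F s gm (Ad 4 s h (Ad 4 s g gm)) = cls (cob g)"
proof -
 note gU = tmats_U[OF gamma_F] and hK = GF_GK[OF h] and hF = G0_tmats[OF ring_over_F h]
 have e: "Ad 4 s h (Ad 4 s g gm) = Ad 4 s (tmult s h g) gm" using Ad_mult[OF GK_GU[OF hK] GK_GU[OF g] gU] by simp
 have hg: "tmult s h g : carrier GK" using GK_calculus(1)[OF hK g g] .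
 have c: "cob (tmult s h g) = cob g"
 proof (rule restrict_ext)
  fix sg assume s: "sg : Gal"
  note C = g hK tinv_GK[OF g] tinv_GK[OF hK] tmap_G0[OF s g]
  show "tmult s (tinv 4 s (tmult s h g)) (tmap sg (tmult s h g)) = tmult s (tinv 4 s g) (tmap sg g)"
   using C tmap_F[OF s hF] by (simp add: GK_calculus tmap_GK_mult[OF s])
 qed
 have "tinv 4 s h : tmats 4 F"
  using group.inv_closed[OF group_GF h] G0_group(2)[OF infinite_k ring_over_F h] G0_tmats[OF ring_over_F] by metis
 then have "Ad 4 s h (Ad 4 s g gm) : tmats 4 F" unfolding Ad_def[of _ _ h] using Y hF by (intro tmult_closed[OF ring_over_F])
 then show ?thesis using D_class_cob[OF hg] unfolding e c by simp
qed

lemma one_cocycle: "(\<lambda>sg\<in>Gal. id4) : cocI"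
 using galois_module.trivial_cocycle[OF module_I gal_comp] by simp

lemma one_GK: "id4 : carrier GK"
proof -
 interpret group GK by (rule group_GK)
 show ?thesis using one_closed by simp
qed

lemma cob_one: "cob (id4) = (\<lambda>sg\<in>Gal. id4)"
proof (rule restrict_ext)
 fix sg assume s: "sg : Gal"
 show "tmult s (tinv 4 s (id4)) (tmap sg (id4)) = id4"
  unfolding tmap_F[OF s one_F] by (rule GK_calculus(7)[OF one_GK one_GK one_GK])
qed

lemma comm_group_I: "comm_group I"
proof -
 interpret group I by (rule group_I)
 show ?thesis by (rule group_comm_groupI) (use I_comm in simp)
qed

lemma product_cocycle:
 assumes c: "c : cocI" and d: "d : cocI"
 shows "(\<lambda>sg\<in>Gal. tmult s (c sg) (d sg)) : cocI" (is "?e : _")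
proof -
 interpret M: galois_module I Gal tmap by (rule module_I)
 interpret CI: comm_group I by (rule comm_group_I)
 have "?e : Gal \<rightarrow>\<^sub>E carrier I" using M.m_closed[OF M.cocycle_value[OF c] M.cocycle_value[OF d]] by simp
 moreover have "?e (sg \<circ> ta) = ?e sg \<otimes>\<^bsub>I\<^esub> tmap sg (?e ta)" if s: "sg : Gal" and t: "ta : Gal" for sg ta
 proof -
  note C = M.cocycle_value[OF c s] M.cocycle_value[OF d s] M.cocycle_value[OF c t] M.cocycle_value[OF d t]
  note C' = C M.ga_closed[OF s C(3)] M.ga_closed[OF s C(4)]
  have e: "c (sg \<circ> ta) = c sg \<otimes>\<^bsub>I\<^esub> tmap sg (c ta)" "d (sg \<circ> ta) = d sg \<otimes>\<^bsub>I\<^esub> tmap sg (d ta)"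
   using c d s t unfolding cocycles_def by auto
  have "c (sg \<circ> ta) \<otimes>\<^bsub>I\<^esub> d (sg \<circ> ta) = (c sg \<otimes>\<^bsub>I\<^esub> d sg) \<otimes>\<^bsub>I\<^esub> tmap sg (c ta \<otimes>\<^bsub>I\<^esub> d ta)"
   unfolding e M.ga_mult[OF s C(3,4)] using C' by (simp add: CI.m_ac del: I_ops)
  then show ?thesis using s t gal_comp[OF s t] by simp
 qed
 moreover have "krull_continuous Gal ?e" unfolding krull_continuous_def
 proof
  fix sg assume s: "sg : Gal"
  have kr: "krull_continuous Gal c" "krull_continuous Gal d" using c d by (simp_all add: cocycles_def)
  obtain A where A: "finite A & (\<forall>ta\<in>Gal. (\<forall>a\<in>A. ta a = sg a) --> c ta = c sg)"
   using bspec[OF kr(1)[unfolded krull_continuous_def] s] by (elim exE)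
  obtain B where B: "finite B & (\<forall>ta\<in>Gal. (\<forall>a\<in>B. ta a = sg a) --> d ta = d sg)"
   using bspec[OF kr(2)[unfolded krull_continuous_def] s] by (elim exE)
  have "\<forall>ta\<in>Gal. (\<forall>a\<in>A\<union>B. ta a = sg a) --> ?e ta = ?e sg"
  proof (intro ballI impI)
   fix ta assume t: "ta : Gal" "\<forall>a\<in>A\<union>B. ta a = sg a"
   have "c ta = c sg" "d ta = d sg" using A B t by simp_all
   then show "?e ta = ?e sg" using t(1) s by simp
  qed
  then show "EX A. finite A & (\<forall>ta\<in>Gal. (\<forall>a\<in>A. ta a = sg a) --> ?e ta = ?e sg)"
   using A B by (intro exI[of _ "A \<union> B"] conjI) simp_all
 qed
 ultimately show ?thesis unfolding cocycles_def by blast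
qed

lemma D_mult:
 assumes c: "c : cocI" and d: "d : cocI"
 shows "cls c \<otimes>\<^bsub>DG\<^esub> cls d = cls (\<lambda>sg\<in>Gal. tmult s (c sg) (d sg))"
proof -
 interpret M: galois_module I Gal tmap by (rule module_I)
 have "cls (\<lambda>sg\<in>Gal. tmult s (c' sg) (d' sg)) = cls (\<lambda>sg\<in>Gal. tmult s (c sg) (d sg))" if c': "(c, c') : coh" and d': "(d, d') : coh" for c' d'
 proof -
  obtain m n where m: "m : carrier I" "\<forall>sg\<in>Gal. c' sg = inv\<^bsub>I\<^esub> m \<otimes>\<^bsub>I\<^esub> c sg \<otimes>\<^bsub>I\<^esub> tmap sg m"
   and n: "n : carrier I" "\<forall>sg\<in>Gal. d' sg = inv\<^bsub>I\<^esub> n \<otimes>\<^bsub>I\<^esub> d sg \<otimes>\<^bsub>I\<^esub> tmap sg n" using c' d' unfolding cohomologous_def by blast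
  interpret CI: comm_group I by (rule comm_group_I)
  have cc: "c' : cocI" "d' : cocI" using c' d' unfolding cohomologous_def by auto
  have "(\<lambda>sg\<in>Gal. tmult s (c' sg) (d' sg)) sg = inv\<^bsub>I\<^esub> (m \<otimes>\<^bsub>I\<^esub> n) \<otimes>\<^bsub>I\<^esub> (\<lambda>sg\<in>Gal. tmult s (c sg) (d sg)) sg \<otimes>\<^bsub>I\<^esub> tmap sg (m \<otimes>\<^bsub>I\<^esub> n)"
   if s: "sg : Gal" for sg
  proof -
   note C = m(1) n(1) M.inv_closed[OF m(1)] M.inv_closed[OF n(1)] M.cocycle_value[OF c s] M.cocycle_value[OF d s] M.ga_closed[OF s m(1)] M.ga_closed[OF s n(1)]
   have "c' sg \<otimes>\<^bsub>I\<^esub> d' sg = inv\<^bsub>I\<^esub> (m \<otimes>\<^bsub>I\<^esub> n) \<otimes>\<^bsub>I\<^esub> (c sg \<otimes>\<^bsub>I\<^esub> d sg) \<otimes>\<^bsub>I\<^esub> tmap sg (m \<otimes>\<^bsub>I\<^esub> n)"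
    unfolding m(2)[rule_format, OF s] n(2)[rule_format, OF s] M.ga_mult[OF s m(1) n(1)]
    using C by (simp add: CI.inv_mult CI.m_ac del: I_ops)
   then show ?thesis using s by simp
  qed
  then have "((\<lambda>sg\<in>Gal. tmult s (c sg) (d sg)), (\<lambda>sg\<in>Gal. tmult s (c' sg) (d' sg))) : coh"
   by (intro M.coboundary_cohomologous[OF product_cocycle[OF c d] product_cocycle[OF cc] M.m_closed[OF m(1) n(1)]]) simp
  then show ?thesis by (rule M.class_eq[symmetric])
 qed
 note const = this
 have ne: "c : cls c" "d : cls d"
  using equiv_class_self[OF M.equiv_cohomologous] c d by blast+
 have "cls c \<otimes>\<^bsub>DG\<^esub> cls d = (\<Union>c'\<in>cls c. \<Union>d'\<in>cls d. cls (\<lambda>sg\<in>Gal. tmult s (c' sg) (d' sg)))"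
  by (simp add: D_group_def kernel_H1_def)
 also have "... = (\<Union>c'\<in>cls c. \<Union>d'\<in>cls d. cls (\<lambda>sg\<in>Gal. tmult s (c sg) (d sg)))"
  using const by (intro SUP_cong refl) simp
 also have "... = cls (\<lambda>sg\<in>Gal. tmult s (c sg) (d sg))" using ne by (simp only: UN_constant empty_iff split: if_split) blast
 finally show ?thesis .
qed

text \<open>Classes of cocycles of the stabiliser that become trivial in the whole group come from stable conjugates.\<close>

lemma cocycles_I_GK:
 assumes c: "c : cocI" shows "c : cocycles Gal tmap GK"
proof -
 have "c : Gal \<rightarrow>\<^sub>E carrier GK" using c unfolding cocycles_def I_carrier by (simp add: PiE_iff)
 then show ?thesis using c unfolding cocycles_def by simp
qed

lemma kernel_image:
 assumes c: "c : cocI"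
 shows "cohomologous Gal tmap GK `` cls c = cohomologous Gal tmap GK `` {c}"
proof -
 interpret M: galois_module I Gal tmap by (rule module_I)
 interpret G: galois_module GK Gal tmap by (rule module_GK)
 have "(c, c') : cohomologous Gal tmap GK" if r: "(c, c') : coh" for c'
 proof -
  obtain m where m: "m : carrier I" "\<forall>sg\<in>Gal. c' sg = inv\<^bsub>I\<^esub> m \<otimes>\<^bsub>I\<^esub> c sg \<otimes>\<^bsub>I\<^esub> tmap sg m" and c': "c' : cocI"
   using r unfolding cohomologous_def by blast
  have mK: "m : carrier GK" using m(1) by (simp add: I_carrier)
  show ?thesis
   by (rule G.coboundary_cohomologous[OF cocycles_I_GK[OF c] cocycles_I_GK[OF c'] mK])
    (use m(2) inv_I[OF m(1)] G0_group(2)[OF infinite_k ring_over_K mK] in simp)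
 qed
 then have "cohomologous Gal tmap GK `` {c'} = cohomologous Gal tmap GK `` {c}" if "c' : cls c" for c'
  using that G.class_eq by blast
 moreover have "c : cls c" by (rule equiv_class_self[OF M.equiv_cohomologous c])
 ultimately show ?thesis by blast
qed

lemma D_carrier:
 "carrier (DG) = {C : cocI // coh.
    cohomologous Gal tmap GK `` C = cohomologous Gal tmap GK `` {\<lambda>sg\<in>Gal. id4}}"
 "\<one>\<^bsub>DG\<^esub> = cls (\<lambda>sg\<in>Gal. id4)"
 by (simp_all add: D_group_def kernel_H1_def H1_def)

lemma D_one: "\<one>\<^bsub>DG\<^esub> : carrier (DG)"
 "\<one>\<^bsub>DG\<^esub> \<otimes>\<^bsub>DG\<^esub> \<one>\<^bsub>DG\<^esub> = \<one>\<^bsub>DG\<^esub>"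
proof -
 show "\<one>\<^bsub>DG\<^esub> : carrier (DG)"
  unfolding D_carrier using kernel_image[OF one_cocycle] quotientI[OF one_cocycle] by blast
 have "(\<lambda>sg\<in>Gal. tmult s ((\<lambda>sg\<in>Gal. id4) sg) ((\<lambda>sg\<in>Gal. id4) sg)) = (\<lambda>sg\<in>Gal. id4)"
  using GK_calculus(9)[OF one_GK one_GK one_GK] by (intro restrict_ext) simp
 then show "\<one>\<^bsub>DG\<^esub> \<otimes>\<^bsub>DG\<^esub> \<one>\<^bsub>DG\<^esub> = \<one>\<^bsub>DG\<^esub>"
  unfolding D_carrier D_mult[OF one_cocycle one_cocycle] by simp
qed

text \<open>A cocycle that becomes trivial in \<open>G\<^sub>0\<close> has the form \<open>m\<^sup>-\<^sup>1 \<sigma>(m)\<close>, and \<open>Ad(m) \<gamma>\<close> is then rational.\<close>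

lemma D_elements:
 assumes C: "C : carrier (DG)"
 shows "\<exists>g\<in>carrier GK. Ad 4 s g gm : stable_class F s gm & C = D_class F s gm (Ad 4 s g gm)"
proof -
 interpret G: galois_module GK Gal tmap by (rule module_GK)
 obtain c where c: "c : cocI" "C = cls c"
  using C unfolding D_carrier by (auto elim: quotientE)
 have 1: "(\<lambda>sg\<in>Gal. id4) : cocycles Gal tmap GK" by (rule cocycles_I_GK[OF one_cocycle])
 have "cohomologous Gal tmap GK `` {c} = cohomologous Gal tmap GK `` {\<lambda>sg\<in>Gal. id4}"
  using C kernel_image[OF c(1)] unfolding D_carrier c(2) by simp
 then have "((\<lambda>sg\<in>Gal. id4), c) : cohomologous Gal tmap GK"
  using eq_equiv_class_iff[OF G.equiv_cohomologous cocycles_I_GK[OF c(1)] 1] G.equiv_cohomologous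
  by (meson equiv_def symD)
 then obtain m where m: "m : carrier GK" "\<forall>sg\<in>Gal. c sg = inv\<^bsub>GK\<^esub> m \<otimes>\<^bsub>GK\<^esub> (\<lambda>sg\<in>Gal. id4) sg \<otimes>\<^bsub>GK\<^esub> tmap sg m"
  unfolding cohomologous_def by blast
 have cv: "c sg = tmult s (tinv 4 s m) (tmap sg m)" if s: "sg : Gal" for sg
  using m(2) s GK_calculus(9)[OF tinv_GK[OF m(1)] m(1) m(1)] G0_group(2)[OF infinite_k ring_over_K m(1)] by simp
 have cm: "c = cob m"
 proof (rule extensionalityI[of _ Gal])
  show "c : extensional Gal" using c(1) unfolding cocycles_def by (auto simp: PiE_iff)
 qed (use cv in auto)
 have F: "Ad 4 s m gm : tmats 4 F"
  by (rule Ad_rational[OF m(1)]) (use cv galois_module.cocycle_value[OF module_I c(1)] in metis)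
 obtain k g where kg: "det2 k ~= 0" "det2 g ~= 0" "m = el k g"
  using GK_GU[OF m(1)] unfolding carrier_G0[OF infinite_k ring_over_UNIV] by blast
 have "Ad 4 s m gm : g1 s F" unfolding g1_iff[OF ring_over_F] using F unfolding kg(3) gamma_lie Ad_el[OF kg(1,2)] by blast
 then have "Ad 4 s m gm : stable_class F s gm" using GK_GU[OF m(1)] by (auto simp: stable_class_def orbit_of_def)
 then show ?thesis using D_class_cob[OF m(1) F] m(1) c(2) cm by auto
qed

text \<open>A class that is trivialised over \<open>E\<close> has order two: its cocycle takes one value \<open>\<omega>\<close> on the
 automorphisms moving \<open>s\<close>, so its square is the coboundary of \<open>\<omega>\<^sup>-\<^sup>1\<close>.\<close>

lemma D_square:
 assumes g: "g : carrier (G0 s E)" and Y: "Ad 4 s g gm : tmats 4 F"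
 shows "D_class F s gm (Ad 4 s g gm) \<otimes>\<^bsub>DG\<^esub> D_class F s gm (Ad 4 s g gm) = \<one>\<^bsub>DG\<^esub>"
proof -
 interpret M: galois_module I Gal tmap by (rule module_I)
 have gK: "g : carrier GK" by (rule G0_sub[OF ring_over_E ring_over_K E_K g])
 note c = cob_cocycle[OF gK Y]
 have tE: "tmap sg X = tmap ta X" if X: "X : tmats 4 E" and st: "sg : Gal" "ta : Gal" "sg s = ta s" for X sg ta
 proof (rule tmap_cong[OF tmats_U[OF X]])
  fix a assume "a : elements_mat (fst X) \<union> elements_mat (snd X)"
  then have "a : E" using X unfolding tmats_def by auto
  then obtain p r where "p : F" "r : F" "a = p + r * s" using s_props(3) by blast
  then show "sg a = ta a" using st by (simp add: gal)
 qed
 have gE: "g : tmats 4 E" by (rule G0_tmats[OF ring_over_E g])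
 have idG: "id : Gal" by (simp add: galois_group_def)
 have tid: "tmap id X = X" if "X : tmats 4 UNIV" for X
  by (cases X) (auto simp: tmap_def intro!: eq_matI)
 have triv: "cob g sg = id4" if s: "sg : Gal" "sg s = s" for sg
  using tE[OF gE s(1) idG] s tid[OF tmats_U[OF gE]] GK_calculus(7)[OF gK gK gK] by simp
 have "((\<lambda>sg\<in>Gal. id4), (\<lambda>sg\<in>Gal. tmult s (cob g sg) (cob g sg))) : coh"
 proof (cases "\<exists>ta\<in>Gal. ta s ~= s")
  case False
  then have "(\<lambda>sg\<in>Gal. tmult s (cob g sg) (cob g sg)) = (\<lambda>sg\<in>Gal. id4)"
   using triv GK_calculus(9)[OF one_GK one_GK one_GK] by (intro restrict_ext) simp
  then show ?thesis using equiv_class_self[OF M.equiv_cohomologous one_cocycle] by (simp only: Image_singleton_iff)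
 next
  case True
  then obtain ta where t: "ta : Gal" "ta s = - s" using gal(9) by blast
  define w where "w = cob g ta"
  have w: "w : carrier I" unfolding w_def by (rule M.cocycle_value[OF c t(1)])
  have wE: "w : tmats 4 E"
  proof -
   have "tmap ta g : tmats 4 E" unfolding tmats_entries[of _ 4 E]
   proof (intro conjI allI impI tmap_U tmats_U[OF gE])
    fix i j :: nat assume ij: "i < 4" "j < 4"
    have in_E: "ta a : E" if "a : E" for a
    proof -
    obtain p r where pr: "p : F" "r : F" "a = p + r * s" using \<open>a \<in> E\<close> s_props(3) by blast
    then have "ta a = p + (- r) * s" using t by (simp add: gal)
    then show ?thesis using E_I[of p "- r"] pr by simp
    qed
    have "fst g $$ (i, j) : E" "snd g $$ (i, j) : E" "fst g : carrier_mat 4 4" "snd g : carrier_mat 4 4"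
    using gE ij unfolding tmats_entries[of _ 4 E] tmats_UNIV by auto
    then show "fst (tmap ta g) $$ (i, j) : E" "snd (tmap ta g) $$ (i, j) : E" using ij in_E by (auto simp: tmap_def)
   qed
   moreover have "tinv 4 s g : tmats 4 E"
    using group.inv_closed[OF G0_group(1)[OF infinite_k ring_over_E] g] G0_group(2)[OF infinite_k ring_over_E g] G0_tmats[OF ring_over_E] by metis
   ultimately show ?thesis unfolding w_def using t(1) by (simp add: tmult_closed[OF ring_over_E])
  qed
  have val: "cob g sg = w" if s: "sg : Gal" "sg s = - s" for sg
   using tE[OF gE s(1) t(1)] s t unfolding w_def by simp
  have "cob g (ta \<circ> ta) = id4" by (rule triv[OF gal_comp[OF t(1) t(1)]]) (simp add: t gal(6))
  then have ww: "\<one>\<^bsub>I\<^esub> = w \<otimes>\<^bsub>I\<^esub> tmap ta w" using c t unfolding cocycles_def w_def by auto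
  then have tw: "tmap ta w = inv\<^bsub>I\<^esub> w" using M.inv_unique'[OF w M.ga_closed[OF t(1) w]] w M.ga_closed[OF t(1) w] I_comm by simp
  have iw: "inv\<^bsub>I\<^esub> w : carrier I" using w by (rule M.inv_closed)
  show ?thesis
  proof (rule M.coboundary_cohomologous[OF one_cocycle product_cocycle[OF c c] iw])
   fix sg assume s: "sg : Gal"
   have 2: "cob g sg \<otimes>\<^bsub>I\<^esub> cob g sg = inv\<^bsub>I\<^esub> (inv\<^bsub>I\<^esub> w) \<otimes>\<^bsub>I\<^esub> \<one>\<^bsub>I\<^esub> \<otimes>\<^bsub>I\<^esub> tmap sg (inv\<^bsub>I\<^esub> w)"
   proof (cases "sg s = s")
    case True
    have "tmap sg w = w" using tE[OF wE s idG] True tid[OF tmats_U[OF wE]] by simp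
    then have "tmap sg (inv\<^bsub>I\<^esub> w) = inv\<^bsub>I\<^esub> w" using M.ga_inv[OF s w] by simp
    moreover have "cob g sg = \<one>\<^bsub>I\<^esub>" using triv[OF s True] by simp
    ultimately show ?thesis using w iw by (simp del: I_ops)
   next
    case False
    then have m: "sg s = - s" using gal(9)[OF s] by blast
    have "tmap sg w = inv\<^bsub>I\<^esub> w" using tE[OF wE s t(1)] m t(2) tw by simp
    then have "tmap sg (inv\<^bsub>I\<^esub> w) = w" using M.ga_inv[OF s w] w by simp
    then show ?thesis unfolding val[OF s m] using w iw by (simp del: I_ops)
   qed
   then show "(\<lambda>sg\<in>Gal. tmult s (cob g sg) (cob g sg)) sg = inv\<^bsub>I\<^esub> (inv\<^bsub>I\<^esub> w) \<otimes>\<^bsub>I\<^esub> (\<lambda>sg\<in>Gal. id4) sg \<otimes>\<^bsub>I\<^esub> tmap sg (inv\<^bsub>I\<^esub> w)"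
    using s by simp
  qed
 qed
 then show ?thesis unfolding D_class_cob[OF gK Y] D_mult[OF c c] D_carrier by (rule M.class_eq[symmetric])
qed

text \<open>Consequently a nontrivial character is \<open>1\<close> on the rational orbit of \<open>\<gamma>\<close> and \<open>-1\<close> elsewhere.\<close>

lemma kappa_values:
 fixes \<kappa> :: "(('k => 'k) => 'k tmat) set => complex"
 assumes hom: "\<kappa> : hom (DG) complex_units" and nt: "\<exists>C \<in> carrier (DG). \<kappa> C ~= 1"
  and split: "!!Y. Y : stable_class F s gm ==> \<exists>g\<in>carrier (G0 s E). Y = Ad 4 s g gm"
  and two: "!!Y Z. Y : stable_class F s gm ==> Z : stable_class F s gm ==> Y ~: orbit_of GF (Ad 4 s) gm ==> Z ~: orbit_of GF (Ad 4 s) gm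
    ==> Z : orbit_of GF (Ad 4 s) Y"
  and X: "X : stable_class F s gm"
 shows "\<kappa> (D_class F s gm X) = (if X : orbit_of GF (Ad 4 s) gm then 1 else - 1)"
  and "\<exists>Y \<in> stable_class F s gm. Y ~: orbit_of GF (Ad 4 s) gm"
proof -
 have stF: "Y : tmats 4 F" if "Y : stable_class F s gm" for Y
  using that g1_iff[OF ring_over_F, of Y] unfolding stable_class_def by blast
 have mult: "\<kappa> (C \<otimes>\<^bsub>DG\<^esub> D) = \<kappa> C * \<kappa> D" "\<kappa> C ~= 0" if "C : carrier (DG)" "D : carrier (DG)" for C D
  using hom that by (auto simp: hom_def complex_units_def)
 have k1: "\<kappa> \<one>\<^bsub>DG\<^esub> = 1" using mult[OF D_one(1) D_one(1)] D_one(2) by simp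
 have triv: "\<kappa> (D_class F s gm Y) = 1" if Yo: "Y : orbit_of GF (Ad 4 s) gm" for Y
 proof -
  obtain h where h: "h : carrier GF" "Y = Ad 4 s h gm" using Yo unfolding orbit_of_def by blast
  have "Ad 4 s (id4) gm = gm" by (rule Ad_one[OF tmats_U[OF gamma_F]])
  then have "D_class F s gm Y = \<one>\<^bsub>DG\<^esub>"
   using D_class_orbit[OF one_GK _ h(1)] gamma_F h(2) cob_one D_carrier(2) by simp
  then show ?thesis using k1 by simp
 qed
 obtain C where C: "C : carrier (DG)" "\<kappa> C ~= 1" using nt by blast
 then obtain g where g: "g : carrier GK" "Ad 4 s g gm : stable_class F s gm" "C = D_class F s gm (Ad 4 s g gm)"
  using D_elements by blast
 have no: "Ad 4 s g gm ~: orbit_of GF (Ad 4 s) gm" using triv C(2) g(3) by blast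
 then show "\<exists>Y \<in> stable_class F s gm. Y ~: orbit_of GF (Ad 4 s) gm" using g(2) by blast
 obtain g' where g': "g' : carrier (G0 s E)" "Ad 4 s g gm = Ad 4 s g' gm" using split[OF g(2)] by blast
 have "Ad 4 s g' gm : tmats 4 F" using stF[OF g(2)] g'(2) by simp
 then have "C \<otimes>\<^bsub>DG\<^esub> C = \<one>\<^bsub>DG\<^esub>" using D_square[OF g'(1)] unfolding g(3) g'(2) by blast
 then have "\<kappa> C * \<kappa> C = 1" using mult(1)[OF C(1) C(1)] k1 by simp
 then have kC: "\<kappa> C = - 1" using C(2) by (simp add: square_eq_1_iff)
 show "\<kappa> (D_class F s gm X) = (if X : orbit_of GF (Ad 4 s) gm then 1 else - 1)"
 proof (cases "X : orbit_of GF (Ad 4 s) gm")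
  case False
  then obtain h where h: "h : carrier GF" "X = Ad 4 s h (Ad 4 s g gm)" using two[OF g(2) X no] unfolding orbit_of_def by blast
  have "D_class F s gm X = C"
   unfolding h(2) g(3) using D_class_orbit[OF g(1) stF[OF g(2)] h(1)] D_class_cob[OF g(1) stF[OF g(2)]] by simp
  then show ?thesis using kC False by simp
 qed (use triv in simp)
qed

end

section \<open>The rational orbits in the stable class\<close>

lemma inv2_cancel:
 assumes "det2 A ~= (0::'a::field)"
 shows "inv2 A * (A * X) = X" "A * (inv2 A * X) = X" "X * inv2 A * A = X" "X * A * inv2 A = X"
 using inv2[OF assms] by (simp_all flip: mult.assoc) (simp_all add: mult.assoc)

text \<open>Eigenvectors can be scaled into the field containing the spectral projection.\<close>

lemma rational_eigenbasis:
 assumes k: "det2 k ~= (0::'a::field)" and ab: "a ~= b"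
  and R: "!!c d. c : R ==> d : R ==> c - d : R" "!!c d. c : R ==> d : R ==> c / d : R" "0 : R" "a : R" "b : R"
  and M: "set_m2 (k * dia a b * inv2 k) <= R"
 shows "EX l m. l ~= 0 & m ~= 0 & set_m2 (k * dia l m) <= R"
proof -
 obtain p q r t where k': "k = M2 p q r t" by (cases k)
 define e where "e = inverse (p * t - q * r)"
 have e: "e ~= 0" "e * (p * t - q * r) = 1" using k unfolding k' e_def by auto
 have M': "k * dia a b * inv2 k = M2 (e * (a * p * t - b * q * r)) (e * (b - a) * p * q) (e * (a - b) * r * t) (e * (b * p * t - a * q * r))"
  unfolding k' dia_def by (simp add: e_def Let_def algebra_simps)
 have uminus: "- c : R" if "c : R" for c using R(1)[OF R(3) that] by simp
 have div: "c : R" if "c * (a - b) : R" for c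
  using R(2)[OF that R(1)[OF R(4,5)]] ab by simp
 have "e * (a * p * t - b * q * r) - b = (p * t * e) * (a - b)"
 proof -
  have "e * (a * p * t - b * q * r) - b * 1 = (p * t * e) * (a - b)"
   unfolding e(2)[symmetric] by (simp add: algebra_simps)
  then show ?thesis by simp
 qed
 moreover have "e * (b * p * t - a * q * r) - b * 1 = (- (q * r * e)) * (a - b)"
  unfolding e(2)[symmetric] by (simp add: algebra_simps)
 moreover have "e * (a * p * t - b * q * r) : R" "e * (b * p * t - a * q * r) : R"
   "e * (b - a) * p * q : R" "e * (a - b) * r * t : R"
  using M unfolding M' by auto
 moreover have "e * (b - a) * p * q = - (p * q * e) * (a - b)" "e * (a - b) * r * t = (r * t * e) * (a - b)"
  by (simp_all add: algebra_simps)
 ultimately have "p * t * e : R" "- (q * r * e) : R" "- (p * q * e) : R" "r * t * e : R"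
  using R(1)[OF _ R(5)] by (metis div mult_1_right)+
 then have mem: "p * t * e : R" "q * r * e : R" "p * q * e : R" "r * t * e : R"
  using uminus[of "- (q * r * e)"] uminus[of "- (p * q * e)"] by simp_all
 have "q ~= 0 | t ~= 0" "p ~= 0 | r ~= 0" using e(2) by auto
 then obtain l m where lm: "l : {q * e, t * e}" "l ~= 0" "m : {p * e, r * e}" "m ~= 0" using e(1) by fastforce
 then have "p * l : R" "r * l : R" "q * m : R" "t * m : R" using mem by (auto simp: mult.assoc mult.commute mult.left_commute)
 then have "set_m2 (k * dia l m) <= R" unfolding k' dia_def by simp
 then show ?thesis using lm by blast
qed

context unramified_extension
begin

text \<open>Similitudes with multiplier \<open>a\<close>.\<close>

definition SE :: "'k => 'k m2 set" where "SE a = {p. set_m2 p <= E & dag (barm p) * p = scal a}"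

lemma SE_D:
 assumes "p : SE a" "a ~= 0"
 shows "set_m2 p <= E" "det2 p ~= 0" "dag (barm p) = scal a * inv2 p"
proof -
 have e: "dag (barm p) * p = scal a" and s: "set_m2 p <= E" using assms(1) by (auto simp: SE_def)
 have "det2 (dag (barm p)) * det2 p = a * a" unfolding det2_mult[symmetric] e by simp
 then show d: "det2 p ~= 0" using assms(2) by auto
 show "set_m2 p <= E" by (rule s)
 show "dag (barm p) = scal a * inv2 p" unfolding e[symmetric] using inv2_cancel(4)[OF d] by simp
qed

lemma SE_1: "SE 1 = UE" by (simp add: SE_def UE_def dia_one)

lemma SE_dagger:
 assumes p: "p : SE a" and r: "r : SE a" and a: "a ~= 0" and x: "x : F" "y : F"
 shows "dag (barm (r * dia x y * inv2 p)) = p * dia x y * inv2 r"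
proof -
 note P = SE_D[OF p a] and Q = SE_D[OF r a]
 note dE = dia_E[OF F_E[OF x(1)] F_E[OF x(2)]]
 have "dag (barm (r * dia x y * inv2 p)) = dag (barm (inv2 p)) * (dia x y * dag (barm r))"
  using P Q x by (simp add: barm_mult mult_E dE inv2_E dag_mult barm_dia)
 also have "barm (inv2 p) = inv2 (barm p)" by (rule barm_inv2[OF P(1,2)])
 also have "dag (inv2 (barm p)) = inv2 (scal a * inv2 p)"
  unfolding P(3)[symmetric] using det2_barm[OF P(1)] P by (subst inv2_dag) (auto simp: bar_eq_0 det2_E)
 also have "... = p * inv2 (scal a)" using P a by (subst inv2_mult) (simp_all add: det2_inv2 inv2_inv2)
 also have "p * inv2 (scal a) * (dia x y * dag (barm r)) = p * (inv2 (scal a) * scal a) * (dia x y * inv2 r)"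
  unfolding Q(3) using scal_central[of a "dia x y"] by (simp add: mult.assoc) (metis mult.assoc)
 also have "... = p * dia x y * inv2 r" using a by (simp add: inv2_dia dia_mult dia_one mult.assoc)
 finally show ?thesis .
qed

lemma SE_mult:
 assumes p: "p : SE a" and r: "r : SE b" shows "p * r : SE (a * b)"
proof -
 have s: "set_m2 p <= E" "set_m2 r <= E" and e: "dag (barm p) * p = scal a" "dag (barm r) * r = scal b"
  using p r by (auto simp: SE_def)
 have "dag (barm (p * r)) * (p * r) = dag (barm r) * (dag (barm p) * p) * r" using s by (simp add: barm_mult dag_mult mult.assoc)
 also have "... = scal a * (dag (barm r) * r)" unfolding e(1) by (simp add: mult.assoc flip: scal_central[of a])
 finally show ?thesis using mult_E[OF s] by (simp add: SE_def e dia_mult)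
qed

lemma SE_scal: "l : E ==> scal l : SE (l * bar l)"
 by (simp add: SE_def dia_E barm_dia dia_mult mult.commute)

lemma SE_inv2:
 assumes p: "p : SE a" "a : F" "a ~= 0" shows "inv2 p : SE (inverse a)"
proof -
 note P = SE_D[OF p(1,3)]
 have "dag (barm (inv2 p)) = inv2 (dag (barm p))"
  unfolding barm_inv2[OF P(1,2)] using det2_barm[OF P(1)] P by (subst inv2_dag) (auto simp: bar_eq_0 det2_E)
 also have "... = p * scal (inverse a)" unfolding P(3) using P p(3) by (subst inv2_mult) (simp_all add: det2_inv2 inv2_inv2 inv2_dia)
 finally have "dag (barm (inv2 p)) * inv2 p = p * (inv2 p * scal (inverse a))" by (simp add: mult.assoc scal_central)
 then show ?thesis using inv2_E[OF P(1)] inv2_cancel(2)[OF P(2)] by (simp add: SE_def)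
qed

end

context nearly_singular_pair
begin

abbreviation "d \<equiv> dia x y"

lemma d_facts: "set_m2 d <= E" "barm d = d" "det2 d ~= 0" "d * d = dia (x * x) (y * y)" "x * x ~= y * y"
 using xy xyE by (simp_all add: dia_E barm_dia dia_mult square_eq_iff)

lemma el_in_E:
 assumes "set_m2 k <= E" "set_m2 g <= E" "det2 k ~= 0" "det2 g ~= 0"
 shows "el k g : carrier (G0 s E)"
proof -
 have e: "ALL i<4. ALL j<4. e4 k g $$ (i, j) : E" "ALL i<4. ALL j<4. e4 (dag (inv2 k)) (dag (inv2 g)) $$ (i, j) : E"
  using assms by (simp_all add: e4_entries dag_E inv2_E)
 have "2 : E" "s : E" using s_E by (auto intro: F_E)
 then have c: "1 / 2 : E" "1 / (2 * s) : E" by (intro EE.divide_closed EE.mult_closed EE.one_closed; simp)+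
 have tmE: "tm P Q : tmats 4 E" if P: "P : carrier_mat 4 4" "Q : carrier_mat 4 4" and PQ: "ALL i<4. ALL j<4. P $$ (i, j) : E" "ALL i<4. ALL j<4. Q $$ (i, j) : E" for P Q
 proof -
  have "tm P Q : tmats 4 E \<longleftrightarrow> (ALL i<4. ALL j<4. (1 / 2) * (P $$ (i, j) + Q $$ (i, j)) : E & (1 / (2 * s)) * (P $$ (i, j) - Q $$ (i, j)) : E)"
   unfolding tmats_entries[of _ 4 E] using P by (auto simp: tm_def tmats_UNIV)
  moreover have "ALL i<4. ALL j<4. (1 / 2) * (P $$ (i, j) + Q $$ (i, j)) : E & (1 / (2 * s)) * (P $$ (i, j) - Q $$ (i, j)) : E"
  proof (intro allI impI conjI)
   fix i j :: nat assume "i < 4" "j < 4"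
   then have "P $$ (i, j) : E" "Q $$ (i, j) : E" using PQ by simp_all
   then show "(1 / 2) * (P $$ (i, j) + Q $$ (i, j)) : E" "(1 / (2 * s)) * (P $$ (i, j) - Q $$ (i, j)) : E"
    by (rule EE.mult_closed[OF c(1) EE.add_closed], rule EE.mult_closed[OF c(2) EE.diff_closed])
  qed
  ultimately show ?thesis by (rule iffD2)
 qed
 have "el k g : tmats 4 E" unfolding el_def by (rule tmE[OF e4_carrier e4_carrier e])
 then show ?thesis unfolding carrier_G0[OF infinite_k ring_over_E] using assms by blast
qed

text \<open>Let \<open>Y = lie A B\<close>. The self-adjoint matrix \<open>M = B A\<close> has an eigenbasis \<open>u\<close> over \<open>E\<close>; its Gram matrix
 commutes with \<open>d\<^sup>2\<close> and so is diagonal, with entries \<open>t1\<close>, \<open>t2\<close> in \<open>F\<close>. The product \<open>t1 t2\<close> is the norm of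
 \<open>det u\<close>, so \<open>t1 / t2\<close> is a norm and scaling the second vector makes the Gram matrix scalar. Then
 \<open>w = A u d\<^sup>-\<^sup>1\<close> is a similitude with the same multiplier.\<close>

lemma stable_class_structure:
 assumes Y: "Y : stable_class F s (gamma x y)"
 shows "EX a u w. a : F & a ~= 0 & u : SE a & w : SE a & Y = Ad 4 s (el u w) (gamma x y) & Y = lie (w * d * inv2 u) (u * d * inv2 w)"
proof -
 obtain X where X: "X : carrier (G0 s UNIV)" "Y = Ad 4 s X (gamma x y)" using Y unfolding stable_class_def orbit_of_def by blast
 then obtain k g where kg: "det2 k ~= 0" "det2 g ~= 0" "X = el k g"
  unfolding carrier_G0[OF infinite_k ring_over_UNIV] by blast
 define A where "A = g * d * inv2 k"
 define B where "B = k * d * inv2 g"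
 have YAB: "Y = lie A B" unfolding X(2) kg(3) gamma_lie Ad_el[OF kg(1,2)] A_def B_def ..
 have "lie A B : tmats 4 F" using Y g1_iff[OF ring_over_F] unfolding stable_class_def YAB by blast
 then have A: "set_m2 A <= E" and B: "B = dag (barm A)" unfolding lie_in_F by auto
 have BE: "set_m2 B <= E" unfolding B by (intro dag_E barm_E A)
 define M where "M = B * A"
 have M: "M = k * dia (x * x) (y * y) * inv2 k" unfolding M_def A_def B_def d_facts(4)[symmetric]
  using inv2_cancel[OF kg(2)] by (simp add: mult.assoc)
 have ME: "set_m2 M <= E" unfolding M_def by (rule mult_E[OF BE A])
 have Mh: "dag (barm M) = M" unfolding M_def using A BE barm_mult[OF BE A] by (simp add: dag_mult B barm_dag barm_barm barm_E)
 obtain l m where lm: "l ~= 0" "m ~= 0" "set_m2 (k * dia l m) <= E"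
  using rational_eigenbasis[OF kg(1) d_facts(5), of E] ME xyE unfolding M by (auto intro: EE.divide_closed)
 define u where "u = k * dia l m"
 have uE: "set_m2 u <= E" unfolding u_def by (rule lm(3))
 have du: "det2 u ~= 0" unfolding u_def using kg lm by (simp add: det2_mult)
 have Mu: "M * u = u * (d * d)" unfolding M u_def d_facts(4) using inv2_cancel[OF kg(1)]
  by (simp add: mult.assoc dia_mult mult.commute)
 define T where "T = dag (barm u) * u"
 have TE: "set_m2 T <= E" unfolding T_def by (intro mult_E dag_E barm_E uE)
 have Th: "dag (barm T) = T" unfolding T_def using uE by (simp add: barm_mult dag_mult dag_E barm_E barm_dag barm_barm)
 have "T * (d * d) = dag (barm u) * M * u" unfolding T_def by (simp add: mult.assoc Mu)
 also have "dag (barm u) * M = dag (barm (M * u))" unfolding barm_mult[OF ME uE] dag_mult Mh ..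
 also have "... = d * d * dag (barm u)" unfolding Mu using uE d_facts(1,2) by (simp add: barm_mult mult_E dag_mult mult.assoc)
 finally have comm: "T * (d * d) = (d * d) * T" unfolding T_def by (simp add: mult.assoc)
 obtain t1 t2 where T: "T = dia t1 t2"
 proof -
  obtain p q r t where k: "T = M2 p q r t" by (cases T)
  have "q * (y * y) = x * x * q" "r * (x * x) = y * y * r" using comm by (simp_all add: k d_facts(4) dia_def)
  then have "q * (y * y - x * x) = 0" "r * (x * x - y * y) = 0" by (simp_all add: algebra_simps)
  then show ?thesis using d_facts(5) that[of p t] unfolding k by (auto simp: dia_def)
 qed
 have tE: "t1 : E" "t2 : E" using TE unfolding T dia_def by auto
 have tb: "bar t1 = t1" "bar t2 = t2" using Th unfolding T by (auto simp: barm_dia dia_def)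
 have tF: "t1 : F" "t2 : F" using bar_fixed tE tb by auto
 have dT: "t1 * t2 = det2 u * bar (det2 u)"
  using arg_cong[OF T, of det2] unfolding T_def det2_mult by (simp add: det2_barm[OF uE] mult.commute)
 have t0: "t1 ~= 0" "t2 ~= 0" using dT du det2_E[OF uE] bar_eq_0 by auto
 define \<mu> where "\<mu> = det2 u / t2"
 have mE: "\<mu> : E" unfolding \<mu>_def using det2_E[OF uE] tE by (intro EE.divide_closed)
 have "bar \<mu> * \<mu> * (t2 * t2) = t1 * t2" unfolding dT \<mu>_def using bar_divide[OF det2_E[OF uE] tE(2)] tb t0
  by (simp add: field_simps)
 then have mn: "bar \<mu> * t2 * \<mu> = t1" using t0 by (simp add: algebra_simps)
 define u' where "u' = u * dia 1 \<mu>"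
 have u'E: "set_m2 u' <= E" unfolding u'_def using uE mE by (intro mult_E dia_E) auto
 have "dag (barm u') * u' = dia 1 (bar \<mu>) * T * dia 1 \<mu>" unfolding u'_def T_def
  using uE mE by (simp add: barm_mult dia_E barm_dia dag_mult mult.assoc bar_F)
 also have "... = scal t1" unfolding T by (simp add: dia_mult mn)
 finally have u': "u' : SE t1" using u'E by (simp add: SE_def)
 note U = SE_D[OF u' t0(1)]
 have Mu': "M * u' = u' * (d * d)"
 proof -
  have "M * u' = u * (d * d * dia 1 \<mu>)" unfolding u'_def using Mu by (simp add: mult.assoc[symmetric])
  also have "d * d * dia 1 \<mu> = dia 1 \<mu> * (d * d)" unfolding d_facts(4) by (simp add: dia_mult mult.commute)
  finally show ?thesis by (simp add: u'_def mult.assoc)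
 qed
 define w where "w = A * u' * inv2 d"
 have wE: "set_m2 w <= E" unfolding w_def using A u'E d_facts(1) by (intro mult_E inv2_E)
 have di: "barm (inv2 d) = inv2 d" unfolding barm_inv2[OF d_facts(1,3)] d_facts(2) ..
 have di: "barm (inv2 d) = inv2 d" "dag (inv2 d) = inv2 d" using di xy by (simp_all add: inv2_dia)
 have "dag (barm w) * w = inv2 d * (dag (barm u') * (M * u')) * inv2 d" unfolding w_def M_def B
  using A u'E d_facts(1) by (simp add: barm_mult mult_E inv2_E dag_mult di mult.assoc)
 also have "dag (barm u') * (M * u') = d * scal t1 * d" unfolding Mu' U(3)
  using inv2_cancel(1)[OF U(2)] scal_central[of t1 d] by (simp add: mult.assoc) (metis mult.assoc)
 also have "inv2 d * (d * scal t1 * d) * inv2 d = scal t1" using inv2_cancel[OF d_facts(3)] by (simp add: mult.assoc)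
 finally have w: "w : SE t1" using wE by (simp add: SE_def)
 have Aw: "A = w * d * inv2 u'" unfolding w_def using inv2_cancel[OF d_facts(3)] inv2_cancel[OF U(2)] by (simp add: mult.assoc)
 have Bu: "B = u' * d * inv2 w" unfolding B Aw by (rule SE_dagger[OF u' w t0(1) xy(1,2)])
 have "Y = Ad 4 s (el u' w) (gamma x y)" unfolding gamma_lie Ad_el[OF U(2) SE_D(2)[OF w t0(1)]] YAB Aw Bu ..
 then show ?thesis using tF t0 u' w YAB Aw Bu by metis
qed

text \<open>With \<open>l\<close> of norm \<open>a / b\<close>, the unitary matrices \<open>u' l u\<^sup>-\<^sup>1\<close> and \<open>w' l w\<^sup>-\<^sup>1\<close> carry one point to the other.\<close>

lemma same_orbit:
 assumes a: "a : F" "a ~= 0" "u : SE a" "w : SE a" and b: "b : F" "b ~= 0" "u' : SE b" "w' : SE b"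
  and parity: "even (v a) \<longleftrightarrow> even (v b)"
 shows "lie (w' * d * inv2 u') (u' * d * inv2 w') : orbit_of (G0 s F) (Ad 4 s) (lie (w * d * inv2 u) (u * d * inv2 w))"
proof -
 have "even (v (a / b))" using parity a(1,2) b(1,2) by (simp add: FF.v_divide)
 then obtain l where l: "l : E" "l ~= 0" "l * bar l = a / b" using norm_of_even[of "a / b"] a b by auto
 have key: "r' * scal l * inv2 r : UE" if "r : SE a" "r' : SE b" for r r'
  using SE_mult[OF SE_mult[OF that(2) SE_scal[OF l(1)]] SE_inv2[OF that(1) a(1,2)]] a(2) b(2) unfolding l(3) by (simp add: SE_1)
 have c: "r' * scal l * inv2 r * (r * X * inv2 t) * inv2 (t' * scal l * inv2 t) = r' * X * inv2 t'"
  if "r : SE a" "r' : SE b" "t : SE a" "t' : SE b" for r r' t t' X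
 proof -
  note 1 = SE_D(2)[OF that(1) a(2)] SE_D(2)[OF that(2) b(2)] SE_D(2)[OF that(3) a(2)] SE_D(2)[OF that(4) b(2)]
  have l0: "det2 (scal l) ~= 0" using l(2) by simp
  have "inv2 (t' * scal l * inv2 t) = t * (inv2 (scal l) * inv2 t')"
   using 1 l0 by (simp add: inv2_mult det2_mult det2_inv2 inv2_inv2)
  then have "r' * scal l * inv2 r * (r * X * inv2 t) * inv2 (t' * scal l * inv2 t) = r' * (scal l * X) * (inv2 (scal l) * inv2 t')"
   using inv2_cancel[OF 1(1)] inv2_cancel[OF 1(3)] by (simp add: mult.assoc)
  also have "... = r' * X * inv2 t'" unfolding scal_central[of l X] using inv2_cancel[OF l0] by (simp add: mult.assoc)
  finally show ?thesis .
 qed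
 let ?p = "u' * scal l * inv2 u" and ?r = "w' * scal l * inv2 w"
 have P: "?p : UE" "?r : UE" using key a b by auto
 have e: "Ad 4 s (el ?p ?r) (lie (w * d * inv2 u) (u * d * inv2 w)) = lie (w' * d * inv2 u') (u' * d * inv2 w')"
  unfolding Ad_el[OF UE_D(2)[OF P(1)] UE_D(2)[OF P(2)]] using c[OF a(4) b(4) a(3) b(3)] c[OF a(3) b(3) a(4) b(4)] by simp
 have g: "el ?p ?r : carrier (G0 s F)" unfolding carrier_G0_F by (intro CollectI exI[of _ ?p] exI[of _ ?r] conjI P refl)
 show ?thesis unfolding orbit_of_def by (subst e[symmetric]) (rule imageI[OF g])
qed

lemma in_orbit_gamma:
 "X : orbit_of (G0 s F) (Ad 4 s) (gamma x y) \<longleftrightarrow> (EX u w. u : SE 1 & w : SE 1 & X = lie (w * d * inv2 u) (u * d * inv2 w))"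
proof -
 have "Ad 4 s (el u w) (gamma x y) = lie (w * d * inv2 u) (u * d * inv2 w)" if "u : UE" "w : UE" for u w
  unfolding gamma_lie using Ad_el[OF UE_D(2)[OF that(1)] UE_D(2)[OF that(2)]] by simp
 note Ad = this
 show ?thesis
 proof
  assume "X : orbit_of (G0 s F) (Ad 4 s) (gamma x y)"
  then obtain u w where uw: "u : UE" "w : UE" "X = Ad 4 s (el u w) (gamma x y)" unfolding orbit_of_def carrier_G0_F by blast
  show "EX u w. u : SE 1 & w : SE 1 & X = lie (w * d * inv2 u) (u * d * inv2 w)"
   unfolding SE_1 uw(3) Ad[OF uw(1,2)] by (intro exI[of _ u] exI[of _ w] conjI uw refl)
 next
  assume "EX u w. u : SE 1 & w : SE 1 & X = lie (w * d * inv2 u) (u * d * inv2 w)"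
  then obtain u w where uw: "u : UE" "w : UE" "X = lie (w * d * inv2 u) (u * d * inv2 w)" unfolding SE_1 by (elim exE conjE)
  show "X : orbit_of (G0 s F) (Ad 4 s) (gamma x y)" unfolding orbit_of_def carrier_G0_F uw(3) Ad[OF uw(1,2), symmetric]
   by (intro imageI CollectI exI[of _ u] exI[of _ w] conjI uw refl)
 qed
qed

lemma outside_orbit:
 assumes X: "X : stable_class F s (gamma x y)" "X ~: orbit_of (G0 s F) (Ad 4 s) (gamma x y)"
 shows "EX a u w. a : F & a ~= 0 & odd (v a) & u : SE a & w : SE a & X = lie (w * d * inv2 u) (u * d * inv2 w)"
proof -
 obtain a u w where a: "a : F" "a ~= 0" "u : SE a" "w : SE a" "X = lie (w * d * inv2 u) (u * d * inv2 w)"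
  using stable_class_structure[OF X(1)] by blast
 have 1: "1 : SE 1" using UE_one by (simp add: SE_1)
 have "odd (v a)"
 proof
  assume "even (v a)"
  then have "X : orbit_of (G0 s F) (Ad 4 s) (lie (1 * d * inv2 1) (1 * d * inv2 1))"
   unfolding a(5) using same_orbit[OF _ _ 1 1 a(1-4)] by simp
  then show False using X(2) by (simp add: gamma_lie)
 qed
 then show ?thesis using a by blast
qed

lemma outside_single_orbit:
 assumes "Y : stable_class F s (gamma x y)" "Z : stable_class F s (gamma x y)"
  "Y ~: orbit_of (G0 s F) (Ad 4 s) (gamma x y)" "Z ~: orbit_of (G0 s F) (Ad 4 s) (gamma x y)"
 shows "Z : orbit_of (G0 s F) (Ad 4 s) Y"
proof -
 obtain a u w where a: "a : F" "a ~= 0" "odd (v a)" "u : SE a" "w : SE a" "Y = lie (w * d * inv2 u) (u * d * inv2 w)"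
  using outside_orbit[OF assms(1,3)] by (elim exE conjE)
 obtain b u' w' where b: "b : F" "b ~= 0" "odd (v b)" "u' : SE b" "w' : SE b" "Z = lie (w' * d * inv2 u') (u' * d * inv2 w')"
  using outside_orbit[OF assms(2,4)] by (elim exE conjE)
 have "even (v a) = even (v b)" using a(3) b(3) by simp
 then show ?thesis unfolding a(6) b(6) by (rule same_orbit[OF a(1,2,4,5) b(1,2,4,5)])
qed

lemma splits_over_E:
 assumes "Y : stable_class F s (gamma x y)" shows "\<exists>g\<in>carrier (G0 s E). Y = Ad 4 s g (gamma x y)"
proof -
 obtain a u w where a: "a : F" "a ~= 0" "u : SE a" "w : SE a" "Y = Ad 4 s (el u w) (gamma x y)"
  using stable_class_structure[OF assms] by blast
 have "el u w : carrier (G0 s E)" by (rule el_in_E[OF SE_D(1)[OF a(3,2)] SE_D(1)[OF a(4,2)] SE_D(2)[OF a(3,2)] SE_D(2)[OF a(4,2)]])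
 then show ?thesis unfolding a(5) by (intro bexI[of _ "el u w"] refl)
qed

end

section \<open>Cosets of the integral subgroup\<close>

context unramified_extension
begin

text \<open>As \<open>2\<close> is a unit, integrality may be tested after this change of basis.\<close>

lemma vge0_four:
 assumes "p : E" "h : E" "r : E" "t : E"
 shows "EE.vge 0 p & EE.vge 0 h & EE.vge 0 r & EE.vge 0 t \<longleftrightarrow>
  EE.vge 0 (p + h + r + t) & EE.vge 0 (p - h - r + t) & EE.vge 0 (p + h - r - t) & EE.vge 0 (p - h + r - t)"
proof
 assume "EE.vge 0 p & EE.vge 0 h & EE.vge 0 r & EE.vge 0 t"
 then show "EE.vge 0 (p + h + r + t) & EE.vge 0 (p - h - r + t) & EE.vge 0 (p + h - r - t) & EE.vge 0 (p - h + r - t)"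
  by (intro conjI EE.vge_add EE.vge_diff) auto
next
 assume "EE.vge 0 (p + h + r + t) & EE.vge 0 (p - h - r + t) & EE.vge 0 (p + h - r - t) & EE.vge 0 (p - h + r - t)"
 then have h: "EE.vge 0 (p + h + r + t)" "EE.vge 0 (p - h - r + t)" "EE.vge 0 (p + h - r - t)" "EE.vge 0 (p - h + r - t)" by auto
 have f: "EE.vge 0 a" if "a : E" "EE.vge 0 (2 * (2 * a))" for a
 proof -
  have "2 * a : E" using that(1) by simp
  then show ?thesis using that(2) unfolding vge_double[OF \<open>2 * a \<in> E\<close>] vge_double[OF that(1)] by simp
 qed
 have "2 * (2 * p) = ((p + h + r + t) + (p - h - r + t)) + ((p + h - r - t) + (p - h + r - t))"
  "2 * (2 * h) = ((p + h + r + t) - (p - h - r + t)) + ((p + h - r - t) - (p - h + r - t))"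
  "2 * (2 * r) = ((p + h + r + t) - (p - h - r + t)) - ((p + h - r - t) - (p - h + r - t))"
  "2 * (2 * t) = ((p + h + r + t) + (p - h - r + t)) - ((p + h - r - t) + (p - h + r - t))"
  by (simp_all add: algebra_simps)
 note e = this
 have "EE.vge 0 (2 * (2 * p))" "EE.vge 0 (2 * (2 * h))" "EE.vge 0 (2 * (2 * r))" "EE.vge 0 (2 * (2 * t))"
  unfolding e by (intro EE.vge_add EE.vge_diff h)+
 then show "EE.vge 0 p & EE.vge 0 h & EE.vge 0 r & EE.vge 0 t"
  using f[OF assms(1)] f[OF assms(2)] f[OF assms(3)] f[OF assms(4)] by simp
qed

text \<open>A representative is diagonal in the isotropic basis \<open>(1, 1), (1, -1)\<close>, up to the rotation \<open>dia 1 z\<close>.\<close>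

definition expo :: "'k => nat => int" where "expo a m = (int m + v a) div 2"
definition iso1 :: "'k => nat => 'k" where "iso1 a m = unif powi (- expo a m)"
definition iso2 :: "'k => nat => 'k" where "iso2 a m = unif powi expo a m / a"

definition rep :: "'k => nat \<times> 'k => 'k m2" where
 "rep a = (%(m, z). dia 1 z * M2 ((iso1 a m + iso2 a m) / 2) ((iso1 a m - iso2 a m) / 2)
   ((iso1 a m - iso2 a m) / 2) ((iso1 a m + iso2 a m) / 2))"

lemma rep_entries:
 assumes a: "a : F" "a ~= 0" and m: "even (int m + v a)"
 obtains A B where "!!z. rep a (m, z) = dia 1 z * M2 A B B A" "A : F" "B : F" "A * A - B * B = inverse a"
  "A + B ~= 0" "A - B ~= 0" "v (A + B) = - expo a m" "v (A - B) = expo a m - v a" "2 * expo a m = int m + v a"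
proof -
 define f where "f = iso1 a m"
 define g where "g = iso2 a m"
 have fF: "f : F" "g : F" unfolding f_def g_def iso1_def iso2_def using unif a by (auto intro!: FF.divide_closed FF.powi_closed)
 have fg: "f * g = inverse a" unfolding f_def g_def iso1_def iso2_def using unif by (simp add: power_int_minus divide_inverse)
 have n: "f ~= 0" "g ~= 0" using fg a by auto
 have vf: "v f = - expo a m" "v g = expo a m - v a" unfolding f_def g_def iso1_def iso2_def
  using unif a by (auto simp: FF.v_powi FF.v_divide FF.powi_closed)
 define A where "A = (f + g) / 2"
 define B where "B = (f - g) / 2"
 have 2: "2 * A = f + g" "2 * B = f - g" unfolding A_def B_def using two_nonzero by simp_all
 have "2 * (A + B) = 2 * f" "2 * (A - B) = 2 * g" unfolding distrib_left right_diff_distrib 2 by simp_all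
 then have s: "A + B = f" "A - B = g" unfolding mult_left_cancel[OF two_nonzero] .
 have "A * A - B * B = (A + B) * (A - B)" by (simp add: algebra_simps)
 then have "A * A - B * B = inverse a" unfolding s fg .
 moreover have "A : F" "B : F" unfolding A_def B_def using fF by (auto intro!: FF.divide_closed)
 moreover have "rep a (m, z) = dia 1 z * M2 A B B A" for z unfolding rep_def A_def B_def f_def g_def by simp
 moreover have "2 * expo a m = int m + v a" using m unfolding expo_def by simp
 ultimately show ?thesis using that[of A B] s n vf by simp
qed

lemma rep_SE:
 assumes a: "a : F" "a ~= 0" and m: "even (int m + v a)" and z: "z : U1"
 shows "rep a (m, z) : SE (inverse a)"
proof -
 obtain A B where AB: "rep a (m, z) = dia 1 z * M2 A B B A" "A : F" "B : F" "A * A - B * B = inverse a"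
  using rep_entries[OF a m] by metis
 have ABE: "A : E" "B : E" using AB(2,3) by (auto intro: F_E)
 have zz: "bar z * z = 1" using z by (simp add: U1_def mult.commute)
 have "set_m2 (rep a (m, z)) <= E" unfolding AB(1) using ABE U1D(1)[OF z] by (auto simp: dia_def)
 moreover have "dag (barm (rep a (m, z))) * rep a (m, z) = scal (inverse a)"
 proof -
  have e: "A * A - bar z * B * (z * B) = A * A - (bar z * z) * (B * B)" "bar z * A * (z * A) - B * B = (bar z * z) * (A * A) - B * B"
   "A * B - bar z * B * (z * A) = A * B - (bar z * z) * (A * B)" "bar z * A * (z * B) - B * A = (bar z * z) * (A * B) - A * B"
   by (simp_all add: algebra_simps)
  have "barm (dia 1 z * M2 A B B A) = M2 A B (bar z * B) (bar z * A)"
   using U1D(1)[OF z] ABE AB(2,3) by (simp add: dia_def bar_mult bar_F)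
  then show ?thesis unfolding AB(1) using e zz AB(4) by (simp add: dia_def algebra_simps)
 qed
 ultimately show ?thesis by (simp add: SE_def)
qed

text \<open>In the isotropic basis all factors except \<open>dia X Y\<close> are diagonal, and \<open>dia X W\<close> splits into the
 scalar \<open>(X + W) / 2\<close> and \<open>(X - W) / 2\<close> times the exchange of the two isotropic lines. So the product has
 four entries, each a power of the uniformiser times \<open>X + W\<close> or \<open>X - W\<close>.\<close>

lemma rep_integral_iff:
 assumes a: "a : F" "a ~= 0" and m: "even (int m + v a)" "even (int m' + v a)" and z: "z : U1" "z' : U1"
  and X: "X : E" "Y : E"
 shows "intm (inv2 (rep a (m', z')) * dia X Y * rep a (m, z)) \<longleftrightarrow>
   EE.vge (int (m + m') div 2) (X * z' - Y * z) & EE.vge (\<bar>int m - int m'\<bar> div 2) (X * z' + Y * z)"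
proof -
 obtain A B where AB: "rep a (m, z) = dia 1 z * M2 A B B A" "A : F" "B : F" "A * A - B * B = inverse a"
  "A + B ~= 0" "A - B ~= 0" "v (A + B) = - expo a m" "v (A - B) = expo a m - v a" "2 * expo a m = int m + v a"
  using rep_entries[OF a m(1)] by metis
 obtain A' B' where AB': "rep a (m', z') = dia 1 z' * M2 A' B' B' A'" "A' : F" "B' : F" "A' * A' - B' * B' = inverse a"
  "A' + B' ~= 0" "A' - B' ~= 0" "v (A' + B') = - expo a m'" "v (A' - B') = expo a m' - v a" "2 * expo a m' = int m' + v a"
  using rep_entries[OF a m(2)] by metis
 note z0 = U1D(2)[OF z(1)] U1D(2)[OF z(2)] and zE = U1D(1)[OF z(1)] U1D(1)[OF z(2)]
 have ABE: "A : E" "B : E" "A' : E" "B' : E" using AB(2,3) AB'(2,3) by (auto intro: F_E)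
 define W where "W = Y * z * inverse z'"
 have WE: "W : E" unfolding W_def using X zE by (intro EE.mult_closed EE.inverse_closed)
 have "inv2 (rep a (m', z')) = scal a * M2 A' (- B') (- B') A' * dia 1 (inverse z')"
 proof (rule inv2_unique)
  have "M2 A' B' B' A' * M2 A' (- B') (- B') A' = scal (inverse a)" using AB'(4) by (simp add: dia_def algebra_simps)
  then have "M2 A' B' B' A' * (scal a * M2 A' (- B') (- B') A') = 1"
   unfolding scal_central mult.assoc[symmetric] using a by (simp add: dia_mult dia_one)
  then have "dia 1 z' * (M2 A' B' B' A' * (scal a * M2 A' (- B') (- B') A')) * dia 1 (inverse z') = 1"
   using z0 by (simp add: dia_mult dia_one)
  then show "rep a (m', z') * (scal a * M2 A' (- B') (- B') A' * dia 1 (inverse z')) = 1"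
   unfolding AB'(1) by (simp add: mult.assoc)
 qed
 note inv_rep = this
 have prod: "inv2 (rep a (m', z')) * dia X Y * rep a (m, z) = scal a * M2 A' (- B') (- B') A' * dia X W * M2 A B B A"
 proof -
  have "dia 1 (inverse z') * dia X Y * dia 1 z = dia X W" unfolding W_def by (simp add: dia_mult mult.commute mult.left_commute)
  moreover note inv_rep
  then have "inv2 (rep a (m', z')) * dia X Y * rep a (m, z) =
    scal a * M2 A' (- B') (- B') A' * (dia 1 (inverse z') * dia X Y * dia 1 z) * M2 A B B A"
   unfolding AB(1) by (simp only: mult.assoc)
  ultimately show ?thesis by simp
 qed
 define p h r t where e: "p = a * (A' * A * X - B' * B * W)" "h = a * (A' * B * X - B' * A * W)"
   "r = a * (A' * B * W - B' * A * X)" "t = a * (A' * A * W - B' * B * X)"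
 have prod': "inv2 (rep a (m', z')) * dia X Y * rep a (m, z) = M2 p h r t"
  unfolding prod e by (simp add: dia_def algebra_simps)
 have E4: "p : E" "h : E" "r : E" "t : E" unfolding e using a ABE X WE by (auto intro: F_E)
 have sums: "p + h + r + t = a * (A + B) * (A' - B') * (X + W)" "p - h - r + t = a * (A - B) * (A' + B') * (X + W)"
  "p + h - r - t = a * (A + B) * (A' + B') * (X - W)" "p - h + r - t = a * (A - B) * (A' - B') * (X - W)"
  unfolding e by (simp_all add: algebra_simps)
 have nz: "a * (A + B) * (A' - B') ~= 0" "a * (A - B) * (A' + B') ~= 0" "a * (A + B) * (A' + B') ~= 0" "a * (A - B) * (A' - B') ~= 0"
  using a AB(5,6) AB'(5,6) by simp_all
 have inE: "a * (A + B) * (A' - B') : E" "a * (A - B) * (A' + B') : E" "a * (A + B) * (A' + B') : E" "a * (A - B) * (A' - B') : E"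
  using a ABE by (auto intro: F_E)
 have vs: "v (a * (A + B) * (A' - B')) = expo a m' - expo a m" "v (a * (A - B) * (A' + B')) = expo a m - expo a m'"
  "v (a * (A + B) * (A' + B')) = v a - expo a m - expo a m'" "v (a * (A - B) * (A' - B')) = expo a m + expo a m' - v a"
  using a ABE AB(5-8) AB'(5-8) by (auto simp: EE.v_mult F_E)
 have zW: "X * z' + Y * z = z' * (X + W)" "X * z' - Y * z = z' * (X - W)" unfolding W_def using z0 by (simp_all add: algebra_simps)
 have sc: "EE.vge n (z' * c) \<longleftrightarrow> EE.vge n c" if "c : E" for n c using EE.vge_scale[OF zE(2) z0(2) that] U1D(4)[OF z(2)] by simp
 have XW: "X + W : E" "X - W : E" using X WE by auto
 have "intm (inv2 (rep a (m', z')) * dia X Y * rep a (m, z)) \<longleftrightarrow>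
   EE.vge (expo a m - expo a m') (X + W) & EE.vge (expo a m' - expo a m) (X + W) &
   EE.vge (expo a m + expo a m' - v a) (X - W) & EE.vge (v a - expo a m - expo a m') (X - W)"
 proof -
  have "intm (inv2 (rep a (m', z')) * dia X Y * rep a (m, z)) \<longleftrightarrow> EE.vge 0 p & EE.vge 0 h & EE.vge 0 r & EE.vge 0 t"
   unfolding prod' by (auto simp: intm_def)
  also have "... \<longleftrightarrow> EE.vge (expo a m - expo a m') (X + W) & EE.vge (expo a m' - expo a m) (X + W) &
   EE.vge (expo a m + expo a m' - v a) (X - W) & EE.vge (v a - expo a m - expo a m') (X - W)"
   unfolding vge0_four[OF E4] sums EE.vge_scale[OF inE(1) nz(1) XW(1)] EE.vge_scale[OF inE(2) nz(2) XW(1)]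
    EE.vge_scale[OF inE(3) nz(3) XW(2)] EE.vge_scale[OF inE(4) nz(4) XW(2)] vs
   by (simp add: algebra_simps)
  finally show ?thesis .
 qed
 also have "... \<longleftrightarrow> EE.vge (int (m + m') div 2) (X - W) & EE.vge (\<bar>int m - int m'\<bar> div 2) (X + W)"
 proof -
  define i j where ij: "i = expo a m" "j = expo a m'"
  have k: "expo a m + expo a m' - v a = int (m + m') div 2" "\<bar>expo a m - expo a m'\<bar> = \<bar>int m - int m'\<bar> div 2"
   using AB(9) AB'(9) unfolding ij[symmetric] by presburger+
  have le: "v a - expo a m - expo a m' <= int (m + m') div 2" using AB(9) AB'(9) unfolding ij[symmetric] by presburger
  show ?thesis
  proof
   assume "EE.vge (expo a m - expo a m') (X + W) & EE.vge (expo a m' - expo a m) (X + W) &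
    EE.vge (expo a m + expo a m' - v a) (X - W) & EE.vge (v a - expo a m - expo a m') (X - W)"
   then show "EE.vge (int (m + m') div 2) (X - W) & EE.vge (\<bar>int m - int m'\<bar> div 2) (X + W)"
    unfolding k(1) k(2)[symmetric] by (simp add: abs_if)
  next
   assume h: "EE.vge (int (m + m') div 2) (X - W) & EE.vge (\<bar>int m - int m'\<bar> div 2) (X + W)"
   have "EE.vge (expo a m - expo a m') (X + W)" "EE.vge (expo a m' - expo a m) (X + W)"
    using h unfolding k(2)[symmetric] by (auto elim: EE.vge_mono)
   moreover have "EE.vge (v a - expo a m - expo a m') (X - W)" using h le by (auto elim: EE.vge_mono)
   ultimately show "EE.vge (expo a m - expo a m') (X + W) & EE.vge (expo a m' - expo a m) (X + W) &
    EE.vge (expo a m + expo a m' - v a) (X - W) & EE.vge (v a - expo a m - expo a m') (X - W)" using h unfolding k(1) by simp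
  qed
 qed
 finally show ?thesis unfolding zW sc[OF XW(1)] sc[OF XW(2)] .
qed

lemma SE_column_relations:
 assumes P: "M2 p h r t : SE b"
 shows "bar p * p - bar r * r = b" "bar t * t - bar h * h = b" "bar p * h = bar r * t" "bar h * p = bar t * r"
 using P unfolding SE_def by (auto simp: dia_def algebra_simps)

text \<open>Let \<open>f\<close>, \<open>f2\<close> be the entries of the image of one isotropic vector and \<open>g\<close>, \<open>g2\<close> those of the other. The image is
 isotropic, so \<open>f2 / f\<close> has norm one and determines \<open>z\<close>; the valuation of \<open>f\<close> determines \<open>m\<close>. By
 multiplying with \<open>dia 1 (-1)\<close>, which exchanges the two vectors, \<open>v f \<le> v g\<close> may be assumed.\<close>

lemma coset_representative:
 assumes a: "a : F" "a ~= 0" and P: "P : SE (inverse a)"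
  and T: "!!m. EE.transversal U1 (int m) (T m)"
 shows "EX m z. even (int m + v a) & z : T m & inv2 (rep a (m, z)) * P : UO"
proof -
 have main: "EX m z. even (int m + v a) & z : T m & inv2 (rep a (m, z)) * M2 p h r t : UO"
  if P: "M2 p h r t : SE (inverse a)" and vle: "p - h = 0 | p + h ~= 0 & v (p + h) <= v (p - h)" for p h r t
 proof -
  have pE: "p : E" "h : E" "r : E" "t : E" using P by (auto simp: SE_def)
  note rel = SE_column_relations[OF P]
  define f g f2 g2 where d: "f = p + h" "g = p - h" "f2 = r + t" "g2 = r - t"
  have fE: "f : E" "g : E" "f2 : E" "g2 : E" unfolding d using pE by auto
  have bars: "bar f = bar p + bar h" "bar g = bar p - bar h" "bar f2 = bar r + bar t" "bar g2 = bar r - bar t"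
   unfolding d using pE by (simp_all add: bar_add bar_diff)
  have "bar f * f - bar f2 * f2 = (bar p * p - bar r * r) - (bar t * t - bar h * h) + (bar p * h - bar r * t) + (bar h * p - bar t * r)"
   unfolding bars unfolding d by (simp add: algebra_simps)
  then have ff: "bar f * f = bar f2 * f2" unfolding rel by simp
  have "bar g * g - bar g2 * g2 = (bar p * p - bar r * r) - (bar t * t - bar h * h) - (bar p * h - bar r * t) - (bar h * p - bar t * r)"
   unfolding bars unfolding d by (simp add: algebra_simps)
  then have gg: "bar g * g = bar g2 * g2" unfolding rel by simp
  have "bar g * f - bar g2 * f2 = (bar p * p - bar r * r) + (bar t * t - bar h * h) + (bar p * h - bar r * t) - (bar h * p - bar t * r)"
   unfolding bars unfolding d by (simp add: algebra_simps)
  then have gf: "bar g * f - bar g2 * f2 = 2 * inverse a" unfolding rel by simp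
  have "bar f2 * f2 = 0 \<longleftrightarrow> f2 = 0" "bar f * f = 0 \<longleftrightarrow> f = 0" "bar g2 * g2 = 0 \<longleftrightarrow> g2 = 0" "bar g * g = 0 \<longleftrightarrow> g = 0"
   using fE bar_eq_0 by auto
  moreover have "2 * inverse a ~= 0" using two_nonzero a by simp
  ultimately have n: "f ~= 0" "g ~= 0" "f2 ~= 0" "g2 ~= 0"
   using gf ff gg bar_eq_0[OF fE(2)] bar_eq_0[OF fE(4)] by fastforce+
  have vfg: "v f <= v g" using vle n unfolding d by blast
  have vf2: "v f2 = v f" using v_norm[OF fE(1) n(1)] v_norm[OF fE(3) n(3)] ff by (simp add: mult.commute)
  have vg2: "v g2 = v g" using v_norm[OF fE(2) n(2)] v_norm[OF fE(4) n(4)] gg by (simp add: mult.commute)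
  have bn: "bar g ~= 0" "bar g2 ~= 0" "bar f ~= 0" "bar f2 ~= 0" using n fE bar_eq_0 by auto
  have aE: "a : E" using a by (auto intro: F_E)
  have v2a: "v (2 * inverse a) = - v a" using a aE two_nonzero by (simp add: EE.v_mult v_two EE.v_inverse)
  have "EE.vge (v f + v g) (bar g * f - bar g2 * f2)"
  proof (rule EE.vge_diff)
   show "EE.vge (v f + v g) (bar g * f)" "EE.vge (v f + v g) (bar g2 * f2)"
    using fE n bn vf2 vg2 by (auto simp: EE.vge_iff EE.v_mult bar_closed)
  qed
  then have "v f + v g <= - v a" unfolding gf using v2a two_nonzero a aE by (subst (asm) EE.vge_iff) auto
  then have m0: "0 <= - 2 * v f - v a" using vfg by linarith
  define m where "m = nat (- 2 * v f - v a)"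
  have m: "int m = - 2 * v f - v a" "even (int m + v a)" using m0 by (simp_all add: m_def)
  define z where "z = f2 / f"
  have zE: "z : E" unfolding z_def using fE by auto
  have "z * bar z = 1" unfolding z_def bar_divide[OF fE(3,1)] using ff n bn by (simp add: field_simps)
  then have zU: "z : U1" using zE by (simp add: U1_def)
  obtain w where w: "w : T m" "EE.vge (int m) (z - w)" using T[of m] zU unfolding EE.transversal_def by blast
  have wU: "w : U1" using T[of m] w(1) unfolding EE.transversal_def by blast
  define e where "e = inverse w"
  have e: "e : E" "e ~= 0" "v e = 0" "w * e = 1" unfolding e_def using U1D[OF wU] by (auto simp: EE.v_inverse)
  obtain A B where AB: "rep a (m, w) = dia 1 w * M2 A B B A" "A : F" "B : F" "A * A - B * B = inverse a"
   "A + B ~= 0" "A - B ~= 0" "v (A + B) = - expo a m" "v (A - B) = expo a m - v a" "2 * expo a m = int m + v a"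
   using rep_entries[OF a m(2)] by metis
  have ABE: "A : E" "B : E" using AB(2,3) by (auto intro: F_E)
  have ex: "expo a m = - v f" using AB(9) m by linarith
  have "inv2 (rep a (m, w)) = scal a * M2 A (- B) (- B) A * dia 1 e"
  proof (rule inv2_unique)
   have "M2 A B B A * M2 A (- B) (- B) A = scal (inverse a)" using AB(4) by (simp add: dia_def algebra_simps)
   then have "M2 A B B A * (scal a * M2 A (- B) (- B) A) = 1"
    unfolding scal_central mult.assoc[symmetric] using a by (simp add: dia_mult dia_one)
   then have "dia 1 w * (M2 A B B A * (scal a * M2 A (- B) (- B) A)) * dia 1 e = 1"
    using e by (simp add: dia_mult dia_one)
   then show "rep a (m, w) * (scal a * M2 A (- B) (- B) A * dia 1 e) = 1"
    unfolding AB(1) by (simp add: mult.assoc)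
  qed
  then have prod: "inv2 (rep a (m, w)) * M2 p h r t = M2 (a * (A * p - B * e * r)) (a * (A * h - B * e * t)) (a * (A * e * r - B * p)) (a * (A * e * t - B * h))"
   (is "_ = M2 ?p ?h ?r ?t") by (simp add: dia_def algebra_simps)
  have E4: "?p : E" "?h : E" "?r : E" "?t : E" using aE ABE pE e(1) by auto
  have sums: "?p + ?h + ?r + ?t = a * (A - B) * (f + e * f2)" "?p - ?h - ?r + ?t = a * (A + B) * (g - e * g2)"
   "?p + ?h - ?r - ?t = a * (A + B) * (f - e * f2)" "?p - ?h + ?r - ?t = a * (A - B) * (g + e * g2)"
   unfolding d by (simp_all add: algebra_simps)
  have nz: "a * (A + B) ~= 0" "a * (A - B) ~= 0" using a AB by simp_all
  have inE: "a * (A + B) : E" "a * (A - B) : E" using aE ABE by auto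
  have vs: "v (a * (A + B)) = v a + v f" "v (a * (A - B)) = - v f"
   using a aE ABE AB(5-8) ex by (simp_all add: EE.v_mult)
  have c1: "EE.vge (v f) (f + e * f2)" using fE n e vf2 by (intro EE.vge_add) (auto simp: EE.vge_iff EE.v_mult)
  have c2: "EE.vge (v f) (g + e * g2)" using fE n e vg2 vfg by (intro EE.vge_add) (auto simp: EE.vge_iff EE.v_mult)
  have c3: "EE.vge (- v a - v f) (f - e * f2)"
  proof -
   have "f - e * f2 = (e * f) * (w - z)" unfolding z_def using e(4) n by (simp add: algebra_simps)
   moreover have "EE.vge (v f + int m) ((e * f) * (w - z))"
    using fE n e w(2) EE.vge_diff_commute[of "int m" z w] by (intro EE.vge_mult) (auto simp: EE.vge_iff EE.v_mult)
   moreover have "v f + int m = - v a - v f" using m by simp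
   ultimately show ?thesis by metis
  qed
  have c4: "EE.vge (- v a - v f) (g - e * g2)"
  proof -
   have bz: "bar z * z = 1" using zU by (simp add: U1_def mult.commute)
   have 1: "g - e * g2 = (g - bar z * g2) + (e * bar z * g2) * (w - z)"
   proof -
    have "(e * bar z * g2) * (w - z) = (w * e) * (bar z * g2) - (bar z * z) * (e * g2)" by (simp add: algebra_simps)
    then show ?thesis unfolding e(4) bz by simp
   qed
   have bzf: "bar z * bar f = bar f2" unfolding z_def bar_divide[OF fE(3,1)] using bn by simp
   have "bar ((g - bar z * g2)) * f = bar g * f - bar g2 * f2"
    unfolding bar_diff[OF fE(2) EE.mult_closed[OF bar_closed[OF zE] fE(4)]] bar_mult[OF bar_closed[OF zE] fE(4)] bar_bar[OF zE]
    unfolding z_def using n by (simp add: field_simps)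
   then have 2: "bar (g - bar z * g2) = 2 * inverse a / f" unfolding gf nonzero_eq_divide_eq[OF n(1)] .
   have gz: "g - bar z * g2 : E" using fE zE bar_closed by auto
   have "EE.vge (- v a - v f) (2 * inverse a / f)"
    using v2a n fE a aE two_nonzero by (subst EE.vge_iff) (auto simp: EE.v_divide)
   then have "EE.vge (- v a - v f) (g - bar z * g2)" using vge_bar[OF gz] 2 by simp
   moreover have "EE.vge (v g + int m) ((e * bar z * g2) * (w - z))"
    using fE n e w(2) EE.vge_diff_commute[of "int m" z w] zE bar_closed vg2 U1D[OF zU]
    by (intro EE.vge_mult) (auto simp: EE.vge_iff EE.v_mult EE.v_inverse)
   then have "EE.vge (- v a - v f) ((e * bar z * g2) * (w - z))" by (rule EE.vge_mono) (use vfg m in linarith)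
   ultimately show ?thesis unfolding 1 by (rule EE.vge_add)
  qed
  have XE: "f + e * f2 : E" "g + e * g2 : E" "f - e * f2 : E" "g - e * g2 : E" using fE e(1) by auto
  have "EE.vge 0 ?p & EE.vge 0 ?h & EE.vge 0 ?r & EE.vge 0 ?t"
   unfolding vge0_four[OF E4] sums EE.vge_scale[OF inE(1) nz(1) XE(3)] EE.vge_scale[OF inE(1) nz(1) XE(4)]
    EE.vge_scale[OF inE(2) nz(2) XE(1)] EE.vge_scale[OF inE(2) nz(2) XE(2)] vs using c1 c2 c3 c4 by simp
  then have "intm (inv2 (rep a (m, w)) * M2 p h r t)" unfolding prod by (auto simp: intm_def)
  moreover have "inv2 (rep a (m, w)) * M2 p h r t : SE 1"
   using SE_mult[OF SE_inv2[OF rep_SE[OF a m(2) wU]] P] a by simp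
  ultimately have "inv2 (rep a (m, w)) * M2 p h r t : UO" by (simp add: UO_def SE_1)
  then show ?thesis using m(2) w(1) by blast
 qed
 obtain p h r t where P': "P = M2 p h r t" by (cases P)
 show ?thesis
 proof (cases "p - h = 0 | p + h ~= 0 & v (p + h) <= v (p - h)")
  case True
  then show ?thesis using main P unfolding P' by blast
 next
  case False
  let ?s = "dia 1 (- 1) :: 'k m2"
  have sUO: "?s : UO" unfolding UO_def UE_def intm_def by (auto simp: barm_dia dia_mult dia_one) (auto simp: dia_def intro: EE.vge_minus)
  then have sU: "?s : SE 1" unfolding SE_1 UO_def by blast
  have "M2 p (- h) r (- t) = P * ?s" unfolding P' by (simp add: dia_def)
  then have Q: "M2 p (- h) r (- t) : SE (inverse a)" "M2 p (- h) r (- t) = P * ?s" using SE_mult[OF P sU] by simp_all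
  have "p - - h = 0 | p + - h ~= 0 & v (p + - h) <= v (p - - h)" using False by auto
  then obtain m z where mz: "even (int m + v a)" "z : T m" "inv2 (rep a (m, z)) * (P * ?s) : UO" using main[OF Q(1)] unfolding Q(2) by blast
  have "inv2 (rep a (m, z)) * (P * ?s) * ?s : UO" by (rule UO_mult[OF mz(3) sUO])
  then have "inv2 (rep a (m, z)) * P : UO" by (simp add: mult.assoc dia_mult dia_one)
  then show ?thesis using mz by blast
 qed
qed

text \<open>This is the previous criterion for \<open>X = Y = 1\<close>. As \<open>(z' - z) + (z' + z)\<close> is a unit, both congruences cannot hold
 with positive exponents, which forces \<open>m = m'\<close>, and then the first one gives \<open>z = z'\<close>.\<close>

lemma representative_unique:
 assumes a: "a : F" "a ~= 0" and m: "even (int m + v a)" "even (int m' + v a)" and T: "!!m. EE.transversal U1 (int m) (T m)"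
  and z: "z : T m" "z' : T m'" and i: "intm (inv2 (rep a (m', z')) * rep a (m, z))"
 shows "m = m' & z = z'"
proof -
 have zU: "z : U1" "z' : U1" using T[of m] T[of m'] z unfolding EE.transversal_def by blast+
 have c: "EE.vge (int (m + m') div 2) (z' - z)" "EE.vge (\<bar>int m - int m'\<bar> div 2) (z' + z)"
  using i rep_integral_iff[OF a m zU EE.one_closed EE.one_closed] by (simp_all add: dia_one)
 have mm: "m = m'"
 proof (rule ccontr)
  assume ne: "m ~= m'"
  have "even (int m - int m')" using m by presburger
  then have "1 <= int (m + m') div 2" "1 <= \<bar>int m - int m'\<bar> div 2" using ne by presburger+
  then have "EE.vge 1 (z' - z)" "EE.vge 1 (z' + z)" using c by (auto elim: EE.vge_mono)
  then have "EE.vge 1 ((z' - z) + (z' + z))" by (rule EE.vge_add)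
  then have "EE.vge 1 (2 * z')" by simp
  then show False using vge_double U1D[OF zU(2)] by (simp add: EE.vge_iff)
 qed
 have "EE.vge (int m) (z - z')" "EE.vge (int m) (z - z)" using c(1) mm EE.vge_diff_commute[of "int m" z z'] by auto
 moreover have "z' : T m" using z mm by simp
 moreover have "\<exists>!t. t : T m & EE.vge (int m) (z - t)"
 proof -
  have "\<forall>a\<in>U1. \<exists>!t. t : T m & EE.vge (int m) (a - t)" using T[of m] unfolding EE.transversal_def by (elim conjE)
  then show ?thesis by (rule bspec[OF _ zU(1)])
 qed
 ultimately have "z = z'" using z(1) ex1E[of "%t. t : T m & EE.vge (int m) (z - t)" "z = z'"] by metis
 then show ?thesis using mm by simp
qed

end

section \<open>Orbital integrals as numbers of cosets\<close>

lemma stabiliser_subgroup: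
 assumes "group G" and act_mult: "!!g h. g : carrier G ==> h : carrier G ==> act (g \<otimes>\<^bsub>G\<^esub> h) X = act g (act h X)"
  and act_one: "act \<one>\<^bsub>G\<^esub> X = X"
 shows "subgroup (carrier (stabiliser G act X)) G"
proof -
 interpret group G by fact
 show ?thesis
 proof (rule subgroupI)
  show "carrier (stabiliser G act X) <= carrier G" by (auto simp: stabiliser_def)
  show "carrier (stabiliser G act X) ~= {}" using act_one by (auto simp: stabiliser_def)
  fix g assume "g : carrier (stabiliser G act X)"
  then have g: "g : carrier G" "act g X = X" by (auto simp: stabiliser_def)
  have "act (inv\<^bsub>G\<^esub> g) X = act (inv\<^bsub>G\<^esub> g \<otimes>\<^bsub>G\<^esub> g) X" using act_mult[of "inv\<^bsub>G\<^esub> g" g] g by simp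
  then show "inv\<^bsub>G\<^esub> g : carrier (stabiliser G act X)" using g act_one by (simp add: stabiliser_def)
  fix h assume "h : carrier (stabiliser G act X)"
  then have h: "h : carrier G" "act h X = X" by (auto simp: stabiliser_def)
  show "g \<otimes>\<^bsub>G\<^esub> h : carrier (stabiliser G act X)" using g h act_mult[of g h] by (simp add: stabiliser_def)
 qed
qed

text \<open>The set \<open>U\<close> of all \<open>g\<close> with \<open>g\<^sup>-\<^sup>1 X \<in> B\<close> is invariant under the stabiliser on the left, so the
 integral of \<open>B\<close> over the orbit is the volume of \<open>U\<close>; and \<open>U\<close> is a union of cosets of volume one.\<close>

lemma orbital_integral_count:
 assumes G: "group G" and act_mult: "!!g h. g : carrier G ==> h : carrier G ==> act (g \<otimes>\<^bsub>G\<^esub> h) X = act g (act h X)"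
  and act_one: "act \<one>\<^bsub>G\<^esub> X = X"
  and nm: "normalised_measures G T K act S \<mu> \<nu> \<rho>" and X: "X : S"
  and U: "U = {g : carrier G. act (inv\<^bsub>G\<^esub> g) X : B}"
  and Um: "U : sets \<mu>" and Vm: "{c : rcosets\<^bsub>G\<^esub> (carrier (stabiliser G act X)). c <= U} : sets (\<rho> X)"
  and Q: "finite Q" "c : Q \<rightarrow> carrier G" "U = (\<Union>q\<in>Q. c q <#\<^bsub>G\<^esub> K)" "disjoint_family_on (%q. c q <#\<^bsub>G\<^esub> K) Q"
 shows "orbital_integral G act (\<rho> X) (indicator B) X = of_nat (card Q)"
proof -
 interpret group G by fact
 define I where "I = carrier (stabiliser G act X)"
 interpret I: subgroup I G unfolding I_def by (rule stabiliser_subgroup[OF G act_mult act_one])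
 define V where "V = {c : rcosets\<^bsub>G\<^esub> I. c <= U}"
 have Vm: "V : sets (\<rho> X)" using Vm unfolding V_def I_def .
 have h: "haar_measure G T \<mu>" "emeasure \<mu> K = 1" using nm by (auto simp: normalised_measures_def)
 have "haar_measure (stabiliser G act X) (subtopology T I) (\<nu> X)" "emeasure (\<nu> X) I = 1" "quotient_measure G T I \<mu> (\<nu> X) (\<rho> X)"
  using nm X unfolding I_def by (auto simp: normalised_measures_def Let_def)
 then have spI: "space (\<nu> X) = I" and eI: "emeasure (\<nu> X) I = 1" and qm: "space (\<rho> X) = rcosets\<^bsub>G\<^esub> I"
  "!!ph. ph : borel_measurable \<mu> ==> (\<integral>\<^sup>+ g. ph g \<partial>\<mu>) = (\<integral>\<^sup>+ c. (\<integral>\<^sup>+ t. ph (t \<otimes>\<^bsub>G\<^esub> (SOME g. g : c)) \<partial>(\<nu> X)) \<partial>(\<rho> X))"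
  by (auto simp: haar_measure_def quotient_measure_def I_def)
 have K: "K : sets \<mu>" using h(2) emeasure_notin_sets[of K \<mu>] by auto
 have cK: "emeasure \<mu> (c q <#\<^bsub>G\<^esub> K) = 1" if "q : Q" for q
  using h K funcset_mem[OF Q(2) that] by (simp add: haar_measure_def)
 then have cKs: "c q <#\<^bsub>G\<^esub> K : sets \<mu>" if "q : Q" for q
  using that emeasure_notin_sets[of "c q <#\<^bsub>G\<^esub> K" \<mu>] by fastforce
 have "emeasure \<mu> U = (\<Sum>q\<in>Q. emeasure \<mu> (c q <#\<^bsub>G\<^esub> K))"
  unfolding Q(3) using cKs by (intro sum_emeasure[symmetric] Q(4) Q(1)) blast
 then have eU: "emeasure \<mu> U = of_nat (card Q)" using cK by simp
 have tU: "t \<otimes>\<^bsub>G\<^esub> g : U \<longleftrightarrow> g : U" if t: "t : I" and g: "g : carrier G" for t g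
 proof -
  have "inv\<^bsub>G\<^esub> t : I" by (rule I.m_inv_closed[OF t])
  then have "act (inv\<^bsub>G\<^esub> t) X = X" unfolding I_def stabiliser_def by simp
  moreover have tG: "t : carrier G" using t I.subset by blast
  ultimately have "act (inv\<^bsub>G\<^esub> (t \<otimes>\<^bsub>G\<^esub> g)) X = act (inv\<^bsub>G\<^esub> g) X"
   using act_mult[of "inv\<^bsub>G\<^esub> g" "inv\<^bsub>G\<^esub> t"] g by (simp add: inv_mult_group)
  then show ?thesis unfolding U using tG g by simp
 qed
 have rep: "(SOME g. g : C) : carrier G & ((SOME g. g : C) : U \<longleftrightarrow> C : V)" if C: "C : rcosets\<^bsub>G\<^esub> I" for C
 proof -
  obtain g where g: "g : carrier G" "C = I #>\<^bsub>G\<^esub> g" using C unfolding RCOSETS_def by blast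
  have Cel: "\<exists>t\<in>I. k = t \<otimes>\<^bsub>G\<^esub> g" if "k : C" for k using that unfolding g(2) r_coset_def by blast
  have "g : C" unfolding g(2) using rcos_self[OF g(1)] I.subgroup_axioms by blast
  then have r: "(SOME g. g : C) : C" by (rule someI)
  then obtain t where t: "t : I" "(SOME g. g : C) = t \<otimes>\<^bsub>G\<^esub> g" using Cel by blast
  have tG: "t : carrier G" using t(1) I.subset by blast
  have "C : V \<longleftrightarrow> g : U"
  proof
   assume "C : V" then show "g : U" using \<open>g \<in> C\<close> unfolding V_def by blast
  next
   assume gU: "g : U"
   have "k : U" if "k : C" for k using Cel[OF that] tU[OF _ g(1)] gU by blast
   then show "C : V" unfolding V_def using C by blast
  qed
  then show ?thesis using tU[OF t(1) g(1)] t(2) tG g(1) by simp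
 qed
 have orb: "orbital_integral G act (\<rho> X) (indicator B) X = (\<integral>C. indicator V C \<partial>(\<rho> X))"
  unfolding orbital_integral_def
 proof (rule Bochner_Integration.integral_cong[OF refl])
  fix C assume "C : space (\<rho> X)"
  then have "(SOME g. g : C) : carrier G" "(SOME g. g : C) : U \<longleftrightarrow> C : V" using rep qm(1) by auto
  then show "indicator B (act (inv\<^bsub>G\<^esub> (SOME g. g : C)) X) = (indicator V C :: complex)"
   unfolding U by (auto simp: indicator_def)
 qed
 have emV: "emeasure (\<rho> X) V = emeasure \<mu> U"
  proof -
   have "emeasure \<mu> U = (\<integral>\<^sup>+ g. indicator U g \<partial>\<mu>)" using Um by simp
   also have "... = (\<integral>\<^sup>+ C. (\<integral>\<^sup>+ t. indicator U (t \<otimes>\<^bsub>G\<^esub> (SOME g. g : C)) \<partial>(\<nu> X)) \<partial>(\<rho> X))"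
    by (rule qm(2)) (use Um in measurable)
   also have "... = (\<integral>\<^sup>+ C. indicator V C \<partial>(\<rho> X))"
   proof (rule nn_integral_cong)
    fix C assume "C : space (\<rho> X)"
    then have r: "(SOME g. g : C) : carrier G" "(SOME g. g : C) : U \<longleftrightarrow> C : V" using rep qm(1) by auto
    have "(\<integral>\<^sup>+ t. indicator U (t \<otimes>\<^bsub>G\<^esub> (SOME g. g : C)) \<partial>(\<nu> X)) = (\<integral>\<^sup>+ t. indicator V C \<partial>(\<nu> X))"
    proof (rule nn_integral_cong)
    fix t assume "t : space (\<nu> X)"
    then have "t \<otimes>\<^bsub>G\<^esub> (SOME g. g : C) : U \<longleftrightarrow> C : V" using tU[of t] r spI by blast
    then show "(indicator U (t \<otimes>\<^bsub>G\<^esub> (SOME g. g : C)) :: ennreal) = indicator V C" by (simp add: indicator_def)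
    qed
    then show "(\<integral>\<^sup>+ t. indicator U (t \<otimes>\<^bsub>G\<^esub> (SOME g. g : C)) \<partial>(\<nu> X)) = indicator V C" using spI eI by simp
   qed
   also have "... = emeasure (\<rho> X) V" using Vm by simp
   finally show ?thesis by simp
  qed
 have Vs: "V \<inter> space (\<rho> X) = V" using sets.sets_into_space[OF Vm] by blast
 note orb
 also have "(\<integral>C. indicator V C \<partial>(\<rho> X)) = (\<integral>C. complex_of_real (indicator V C) \<partial>(\<rho> X))" by (simp add: of_real_indicator)
 also have "... = complex_of_real (\<integral>C. indicator V C \<partial>(\<rho> X))" by (rule integral_complex_of_real)
 also have "(\<integral>C. indicator V C \<partial>(\<rho> X)) = measure (\<rho> X) V" by (simp add: Vs)
 also have "measure (\<rho> X) V = real (card Q)" using emV eU by (simp add: measure_def)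
 finally show ?thesis by simp
qed

context unramified_extension
begin

lemma tdist_less:
 assumes "0 < n" "X : tmats n UNIV" "Y : tmats n UNIV" "!!i j. i < n ==> j < n ==> teval s X $$ (i, j) : E" "!!i j. i < n ==> j < n ==> teval s Y $$ (i, j) : E"
 shows "tdist n E v s X Y < 2 powi (- N) \<longleftrightarrow> (ALL i<n. ALL j<n. EE.vge (N + 1) (teval s X $$ (i, j) - teval s Y $$ (i, j)))"
proof -
 have "tdist n E v s X Y < 2 powi (- N) \<longleftrightarrow> (\<forall>ij \<in> {..<n} \<times> {..<n}. vdist E v (teval s X $$ ij) (teval s Y $$ ij) < 2 powi (- N))"
  unfolding tdist_def using assms(1) by (subst Max_less_iff) auto
 also have "... \<longleftrightarrow> (ALL i<n. ALL j<n. vdist E v (teval s X $$ (i, j)) (teval s Y $$ (i, j)) < 2 powi (- N))" by auto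
 also have "... \<longleftrightarrow> (ALL i<n. ALL j<n. EE.vge (N + 1) (teval s X $$ (i, j) - teval s Y $$ (i, j)))"
  using EE.vdist_less_iff assms(4,5) by simp
 finally show ?thesis .
qed

lemma teval_el_E: "k : UE ==> g : UE ==> i < 4 ==> j < 4 ==> teval s (el k g) $$ (i, j) : E"
 using e4_entries[of k g] UE_D(1)[of k] UE_D(1)[of g] by (simp add: teval_el)

lemma Metric_space_G0: "Metric_space (carrier (G0 s F)) (tdist 4 E v s)"
proof -
 let ?P = "{..<4::nat} \<times> {..<4::nat}"
 have fin: "finite ((%ij. vdist E v (teval s X $$ ij) (teval s Y $$ ij)) ` ?P)" "(%ij. vdist E v (teval s X $$ ij) (teval s Y $$ ij)) ` ?P ~= {}" for X Y
 proof -
  have "(0, 0) : ?P" by simp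
  then show "(%ij. vdist E v (teval s X $$ ij) (teval s Y $$ ij)) ` ?P ~= {}" by blast
 qed simp
 have le: "vdist E v (teval s X $$ ij) (teval s Y $$ ij) <= tdist 4 E v s X Y" if "ij : ?P" for X Y ij
  unfolding tdist_def using fin that by (intro Max_ge) auto
 have inE: "teval s X $$ ij : E" if "X : carrier (G0 s F)" "ij : ?P" for X ij
  using that teval_el_E unfolding carrier_G0_F by auto
 show ?thesis
 proof
  fix X Y Z :: "'k tmat"
  show "0 <= tdist 4 E v s X Y"
   by (rule order_trans[OF EE.vdist_nonneg le[of "(0, 0)"]]) simp
  show "tdist 4 E v s X Y = tdist 4 E v s Y X" unfolding tdist_def using EE.vdist_commute by metis
  assume X: "X : carrier (G0 s F)" and Y: "Y : carrier (G0 s F)"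
  obtain k g where kg: "X = el k g" using X unfolding carrier_G0_F by blast
  obtain k' g' where kg': "Y = el k' g'" using Y unfolding carrier_G0_F by blast
  show "tdist 4 E v s X Y = 0 \<longleftrightarrow> X = Y"
  proof
   assume z: "tdist 4 E v s X Y = 0"
   have "teval s X $$ (i, j) = teval s Y $$ (i, j)" if "i < 4" "j < 4" for i j
   proof -
    have "vdist E v (teval s X $$ (i, j)) (teval s Y $$ (i, j)) = 0"
    using le[of "(i, j)" X Y] z EE.vdist_nonneg[of "teval s X $$ (i, j)" "teval s Y $$ (i, j)"] that by auto
    then show ?thesis using EE.vdist_zero inE[OF X, of "(i, j)"] inE[OF Y, of "(i, j)"] that by simp
   qed
   then have "e4 k g = e4 k' g'" unfolding kg kg' teval_el by (intro mat4_eqI) auto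
   then show "X = Y" unfolding kg kg' e4_inject by simp
  next
   assume "X = Y"
   then show "tdist 4 E v s X Y = 0" unfolding tdist_def
    by (intro Max_eqI) (auto simp: vdist_def intro!: image_eqI[of _ _ "(0, 0)"])
  qed
  assume Z: "Z : carrier (G0 s F)"
  show "tdist 4 E v s X Z <= tdist 4 E v s X Y + tdist 4 E v s Y Z"
  proof -
   have "vdist E v (teval s X $$ ij) (teval s Z $$ ij) <= tdist 4 E v s X Y + tdist 4 E v s Y Z" if ij: "ij : ?P" for ij
    using Metric_space.triangle[OF EE.Metric_space_vdist inE[OF X ij] inE[OF Y ij] inE[OF Z ij]] le[OF ij, of X Y] le[OF ij, of Y Z] by linarith
   then show ?thesis unfolding tdist_def[of 4 E v s X Z] using fin by (intro Max.boundedI) auto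
  qed
 qed
qed

lemma e4_coordinates:
 "P = e4 k g ==> k = M2 (P $$ (0,0) + P $$ (0,3)) (P $$ (0,1) - P $$ (0,2)) (P $$ (1,0) + P $$ (1,3)) (P $$ (1,1) - P $$ (1,2))"
 "P = e4 k g ==> g = M2 (P $$ (0,0) - P $$ (0,3)) (P $$ (0,1) + P $$ (0,2)) (P $$ (1,0) - P $$ (1,3)) (P $$ (1,1) + P $$ (1,2))"
proof -
 assume P: "P = e4 k g"
 obtain a b c e where k: "k = M2 a b c e" by (cases k)
 obtain a' b' c' e' where g: "g = M2 a' b' c' e'" by (cases g)
 have half: "(p + p') / 2 + (p - p') / 2 = p" "(p + p') / 2 - (p - p') / 2 = p'" for p p' :: 'k
  using two_nonzero by (simp_all add: add_divide_distrib[symmetric] diff_divide_distrib[symmetric])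
 have "P = evn (M2 ((a + a') / 2) ((b + b') / 2) ((c + c') / 2) ((e + e') / 2)) (M2 ((a - a') / 2) ((b - b') / 2) ((c - c') / 2) ((e - e') / 2))"
  unfolding P e4_def k g by (simp add: dia_def)
 then have "P = mk4 ((a + a') / 2) ((b + b') / 2) (- ((b - b') / 2)) ((a - a') / 2) ((c + c') / 2) ((e + e') / 2) (- ((e - e') / 2)) ((c - c') / 2)
   (- ((c - c') / 2)) (- ((e - e') / 2)) ((e + e') / 2) (- ((c + c') / 2)) ((a - a') / 2) ((b - b') / 2) (- ((b + b') / 2)) ((a + a') / 2)"
  unfolding evn.simps .
 then have i: "P $$ (0,0) = (a + a') / 2" "P $$ (0,1) = (b + b') / 2" "P $$ (0,2) = - ((b - b') / 2)" "P $$ (0,3) = (a - a') / 2"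
   "P $$ (1,0) = (c + c') / 2" "P $$ (1,1) = (e + e') / 2" "P $$ (1,2) = - ((e - e') / 2)" "P $$ (1,3) = (c - c') / 2"
  by (simp_all add: mk4_index del: minus_divide_left minus_diff_eq)
 show "k = M2 (P $$ (0,0) + P $$ (0,3)) (P $$ (0,1) - P $$ (0,2)) (P $$ (1,0) + P $$ (1,3)) (P $$ (1,1) - P $$ (1,2))"
  "g = M2 (P $$ (0,0) - P $$ (0,3)) (P $$ (0,1) + P $$ (0,2)) (P $$ (1,0) - P $$ (1,3)) (P $$ (1,1) + P $$ (1,2))"
  unfolding i k g diff_minus_eq_add add_uminus_conv_diff half by (rule refl)+
qed

lemma m2_vge_mult:
 assumes "\<forall>a\<in>set_m2 A. EE.vge m a" "\<forall>a\<in>set_m2 B. EE.vge n a" shows "\<forall>a\<in>set_m2 (A * B). EE.vge (m + n) a"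
proof -
 obtain a b c e where A: "A = M2 a b c e" by (cases A)
 obtain a' b' c' e' where B: "B = M2 a' b' c' e'" by (cases B)
 show ?thesis using assms unfolding A B by (auto intro!: EE.vge_add EE.vge_mult)
qed

lemma m2_vge_bound: assumes "set_m2 A <= E" shows "EX m. \<forall>a\<in>set_m2 A. EE.vge (- m) a"
proof -
 have fin: "finite (set_m2 A)" by (cases A) simp
 have "EX m. \<forall>a\<in>S. EE.vge (- m) a" if "finite S" "S <= E" for S using that
 proof (induction S)
  case (insert c S)
  then obtain m where m: "\<forall>a\<in>S. EE.vge (- m) a" by auto
  have "EE.vge (v c) c" using insert by (intro EE.vge_v) auto
  then have "EE.vge (- max m (- v c)) c" by (rule EE.vge_mono) simp
  moreover have "EE.vge (- max m (- v c)) a" if "a : S" for a using m that by (auto intro: EE.vge_mono[of "- m"])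
  ultimately show ?case by (intro exI[of _ "max m (- v c)"]) simp
 qed simp
 then show ?thesis using fin assms by blast
qed

text \<open>The integral subgroup is open: a point close to \<open>X\<close> lies in the coset of \<open>X\<close>.\<close>

lemma near_same_coset:
 assumes k: "k : UE" "g : UE"
 shows "\<exists>r>0. \<forall>k'\<in>UE. \<forall>g'\<in>UE. tdist 4 E v s (el k g) (el k' g') < r --> inv2 k * k' : UO & inv2 g * g' : UO"
proof -
 obtain m where m: "\<forall>a\<in>set_m2 (inv2 k). EE.vge (- m) a" using m2_vge_bound[OF UE_D(1)[OF UE_inv2[OF k(1)]]] by blast
 obtain n where n: "\<forall>a\<in>set_m2 (inv2 g). EE.vge (- n) a" using m2_vge_bound[OF UE_D(1)[OF UE_inv2[OF k(2)]]] by blast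
 define N where "N = max m n"
 have "inv2 k * k' : UO & inv2 g * g' : UO"
  if k': "k' : UE" "g' : UE" and near: "tdist 4 E v s (el k g) (el k' g') < 2 powi (- N)" for k' g'
 proof -
  define P where "P = e4 k g"
  define P' where "P' = e4 k' g'"
  have ent: "ALL i<4. ALL j<4. EE.vge (N + 1) (P $$ (i, j) - P' $$ (i, j))"
   using near tdist_less[of 4 "el k g" "el k' g'" N] teval_el_E k k' unfolding P_def P'_def by (simp add: teval_el)
  have D: "EE.vge N (P' $$ (i, j) - P $$ (i, j))" if "i < 4" "j < 4" for i j
  proof -
   have "EE.vge (N + 1) (P' $$ (i, j) - P $$ (i, j))" using ent that EE.vge_diff_commute by blast
   then show ?thesis by (rule EE.vge_mono) simp
  qed
  have comb: "EE.vge N ((b + b') - (a + a'))" "EE.vge N ((b - b') - (a - a'))" if "EE.vge N (b - a)" "EE.vge N (b' - a')" for a b a' b'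
   using EE.vge_add[OF that] EE.vge_diff[OF that] by (simp_all add: algebra_simps)
  have dk: "\<forall>a\<in>set_m2 (k' - k). EE.vge N a" "\<forall>a\<in>set_m2 (g' - g). EE.vge N a"
   unfolding e4_coordinates[OF P_def] e4_coordinates[OF P'_def] using D by (auto intro!: comb)
  have near1: "inv2 h * h' : UO" if h: "h : UE" "h' : UE" "\<forall>a\<in>set_m2 (inv2 h). EE.vge (- N) a" "\<forall>a\<in>set_m2 (h' - h). EE.vge N a" for h h'
  proof -
   have "intm (inv2 h * (h' - h))" using m2_vge_mult[OF h(3,4)] by (simp add: intm_def)
   then have i: "intm (inv2 h * h' - 1)" using inv2(2)[OF UE_D(2)[OF h(1)]] by (simp add: right_diff_distrib)
   have "intm (inv2 h * h')"
   proof -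
    obtain a b c e where 1: "inv2 h * h' = M2 a b c e" by (cases "inv2 h * h'")
    have "EE.vge 0 (a - 1)" "EE.vge 0 b" "EE.vge 0 c" "EE.vge 0 (e - 1)" using i unfolding 1 by (auto simp: intm_def one_m2_def)
    then show ?thesis unfolding 1 using EE.vge_add[of 0 "a - 1" 1] EE.vge_add[of 0 "e - 1" 1] by (auto simp: intm_def)
   qed
   then show ?thesis using UE_mult[OF UE_inv2[OF h(1)] h(2)] by (simp add: UO_def)
  qed
  have mono: "\<forall>a\<in>S. EE.vge (- N) a" if "\<forall>a\<in>S. EE.vge (- j) a" "j <= N" for S j
   using that by (auto intro: EE.vge_mono[of "- j"])
  show ?thesis using near1[OF k(1) k'(1) mono[OF m] dk(1)] near1[OF k(2) k'(2) mono[OF n] dk(2)] by (simp add: N_def)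
 qed
 then show ?thesis by (intro exI[of _ "2 powi (- N)"]) auto
qed

end

context setting
begin

lemma Ad_GF:
 assumes X: "X : tmats 4 UNIV"
 shows "g : carrier GF ==> h : carrier GF ==> Ad 4 s (g \<otimes>\<^bsub>GF\<^esub> h) X = Ad 4 s g (Ad 4 s h X)" "Ad 4 s \<one>\<^bsub>GF\<^esub> X = X"
 using Ad_mult[OF GF_GU GF_GU X] Ad_one[OF X] by simp_all

context
 fixes a :: 'k and u w :: "'k m2"
 assumes a: "a : F" "a ~= 0" and u: "u : SE a" and w: "w : SE a"
begin

abbreviation "X0 \<equiv> lie (w * d * inv2 u) (u * d * inv2 w)"
abbreviation "par \<equiv> nat (v a mod 2)"
abbreviation "good_set \<equiv> {G : carrier GF. Ad 4 s (inv\<^bsub>GF\<^esub> G) X0 : g1_int F E v s}"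

lemma par_iff: "m mod 2 = par \<longleftrightarrow> even (int m + v a)"
proof -
 have "v a mod 2 = (if even (v a) then 0 else 1)" by presburger
 then show ?thesis by (cases "even (v a)") (simp_all, presburger+)
qed

lemma UO_intm: "k : UO ==> intm k" by (simp add: UO_def)

lemma good_set_iff:
 assumes k: "k : UE" and g: "g : UE"
 shows "el k g : good_set \<longleftrightarrow> intm (inv2 (inv2 w * g) * d * (inv2 u * k))"
proof -
 note ku = SE_D[OF u a(2)] SE_D[OF w a(2)]
 note dk = UE_D(2)[OF k] and dg = UE_D(2)[OF g]
 have gF: "el k g : carrier GF" unfolding carrier_G0_F using k g by blast
 have p: "inv2 k * u : SE a" "inv2 g * w : SE a"
  using SE_mult[of "inv2 k" 1 u a] SE_mult[of "inv2 g" 1 w a] UE_inv2[OF k] UE_inv2[OF g] u w by (simp_all add: SE_1)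
 have i: "inv2 (inv2 k * u) = inv2 u * k" "inv2 (inv2 w * g) = inv2 g * w"
  using ku dk dg by (simp_all add: inv2_mult det2_inv2 inv2_inv2)
 have i': "inv2 (inv2 g * w) = inv2 w * g" using ku dk dg by (simp add: inv2_mult det2_inv2 inv2_inv2)
 have "Ad 4 s (inv\<^bsub>GF\<^esub> (el k g)) X0 = lie (inv2 g * w * d * inv2 (inv2 k * u)) (inv2 k * u * d * inv2 (inv2 g * w))"
  unfolding G0_group(2)[OF infinite_k ring_over_F gF] tinv_el[OF dk dg] Ad_el[OF det2_inv2[OF dk] det2_inv2[OF dg]] i i'
   inv2_inv2[OF dk] inv2_inv2[OF dg] by (simp add: mult.assoc)
 also have "inv2 k * u * d * inv2 (inv2 g * w) = dag (barm (inv2 g * w * d * inv2 (inv2 k * u)))"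
  by (rule SE_dagger[OF p a(2) xy(1,2), symmetric])
 finally show ?thesis using gF unfolding i by (simp add: g1_int_F i mult.assoc)
qed

abbreviation "coset_rep \<equiv> (%(p, p'). el (u * rep a p) (w * rep a p'))"

lemma rep_UE:
 assumes "even (int m + v a)" "z : U1" "r : SE a" shows "r * rep a (m, z) : UE"
 using SE_mult[OF assms(3) rep_SE[OF a assms(1,2)]] a by (simp add: SE_1)

lemma coset_G0_int: "G <#\<^bsub>GF\<^esub> G0_int F E v s = {tmult s G (el k g) | k g. k : UO & g : UO}"
 unfolding l_coset_def G0_int_F G0_ops by blast

lemma coset_rep_coset:
 assumes "even (int m + v a)" "even (int m' + v a)" "z : U1" "z' : U1"
 shows "coset_rep ((m, z), (m', z')) <#\<^bsub>GF\<^esub> G0_int F E v s =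
   {el (u * rep a (m, z) * k) (w * rep a (m', z') * g) | k g. k : UO & g : UO}"
proof -
 have e: "tmult s (coset_rep ((m, z), (m', z'))) (el k g) = el (u * rep a (m, z) * k) (w * rep a (m', z') * g)" if kg: "k : UO" "g : UO" for k g
 proof -
  have "k : UE" "g : UE" using kg by (auto simp: UO_def)
  then show ?thesis
   using el_mult[OF UE_D(2)[OF rep_UE[OF assms(1,3) u]] UE_D(2)[OF rep_UE[OF assms(2,4) w]] UE_D(2) UE_D(2)] by simp
 qed
 show ?thesis unfolding coset_G0_int
 proof (intro subset_antisym subsetI)
  fix X assume "X : {tmult s (coset_rep ((m, z), (m', z'))) (el k g) | k g. k : UO & g : UO}"
  then obtain k g where kg: "k : UO" "g : UO" "X = tmult s (coset_rep ((m, z), (m', z'))) (el k g)" by (elim CollectE exE conjE)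
  show "X : {el (u * rep a (m, z) * k) (w * rep a (m', z') * g) | k g. k : UO & g : UO}"
   unfolding kg(3) e[OF kg(1,2)] by (intro CollectI exI[of _ k] exI[of _ g] conjI kg refl)
 next
  fix X assume "X : {el (u * rep a (m, z) * k) (w * rep a (m', z') * g) | k g. k : UO & g : UO}"
  then obtain k g where kg: "k : UO" "g : UO" "X = el (u * rep a (m, z) * k) (w * rep a (m', z') * g)" by (elim CollectE exE conjE)
  show "X : {tmult s (coset_rep ((m, z), (m', z'))) (el k g) | k g. k : UO & g : UO}"
   unfolding kg(3) e[OF kg(1,2), symmetric] by (intro CollectI exI[of _ k] exI[of _ g] conjI kg refl)
 qed
qed

lemma good_set_cosets:
 "good_set = (\<Union>p\<in>Good par. coset_rep p <#\<^bsub>GF\<^esub> G0_int F E v s)"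
proof (intro subset_antisym subsetI)
 fix G assume G: "G : good_set"
 then obtain k g where kg: "k : UE" "g : UE" "G = el k g" unfolding carrier_G0_F by blast
 have P: "inv2 u * k : SE (inverse a)" "inv2 w * g : SE (inverse a)"
  using SE_mult[OF SE_inv2[OF u a]] SE_mult[OF SE_inv2[OF w a]] kg(1,2) unfolding SE_1[symmetric] by fastforce+
 obtain m z where m: "even (int m + v a)" "z : T m" "inv2 (rep a (m, z)) * (inv2 u * k) : UO"
  using coset_representative[OF a P(1) T(1)] by blast
 obtain m' z' where m': "even (int m' + v a)" "z' : T m'" "inv2 (rep a (m', z')) * (inv2 w * g) : UO"
  using coset_representative[OF a P(2) T(1)] by blast
 define al where "al = inv2 (rep a (m, z)) * (inv2 u * k)"
 define bt where "bt = inv2 (rep a (m', z')) * (inv2 w * g)"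
 have ab: "al : UO" "bt : UO" using m(3) m'(3) by (simp_all add: al_def bt_def)
 have abE: "al : UE" "bt : UE" using ab by (simp_all add: UO_def)
 note z = T_U1[OF m(2)] T_U1[OF m'(2)]
 note du = SE_D(2)[OF u a(2)] SE_D(2)[OF w a(2)]
 have ia: "inverse a ~= 0" using a by simp
 note dr = SE_D(2)[OF rep_SE[OF a m(1) z(1)] ia] SE_D(2)[OF rep_SE[OF a m'(1) z(2)] ia]
 have e: "inv2 u * k = rep a (m, z) * al" "inv2 w * g = rep a (m', z') * bt"
  unfolding al_def bt_def using inv2_cancel(2)[OF dr(1)] inv2_cancel(2)[OF dr(2)] by simp_all
 have "intm (inv2 (rep a (m', z') * bt) * d * (rep a (m, z) * al))" using G good_set_iff[OF kg(1,2)] unfolding kg(3) e by blast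
 then have "intm (bt * (inv2 (rep a (m', z') * bt) * d * (rep a (m, z) * al)) * inv2 al)"
  by (rule intm_mult[OF intm_mult[OF UO_intm[OF ab(2)]] UO_intm[OF UO_inv2[OF ab(1)]]])
 moreover have "bt * (inv2 (rep a (m', z') * bt) * d * (rep a (m, z) * al)) * inv2 al = inv2 (rep a (m', z')) * d * rep a (m, z)"
  using inv2_mult[OF dr(2) UE_D(2)[OF abE(2)]] inv2_cancel(2)[OF UE_D(2)[OF abE(2)]] inv2(1)[OF UE_D(2)[OF abE(1)]] by (simp add: mult.assoc)
 ultimately have "good m z m' z'" unfolding good_def using rep_integral_iff[OF a m(1) m'(1) z xyE] by simp
 then have q: "((m, z), (m', z')) : Good par" unfolding Good_def using m m' par_iff by simp
 have "k = u * rep a (m, z) * al" "g = w * rep a (m', z') * bt"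
  using arg_cong[OF e(1), of "%x. u * x"] arg_cong[OF e(2), of "%x. w * x"] inv2_cancel(2)[OF du(1)] inv2_cancel(2)[OF du(2)]
  by (simp_all add: mult.assoc)
 then have "G : coset_rep ((m, z), (m', z')) <#\<^bsub>GF\<^esub> G0_int F E v s"
  unfolding kg(3) coset_rep_coset[OF m(1) m'(1) z] using ab by blast
 then show "G : (\<Union>p\<in>Good par. coset_rep p <#\<^bsub>GF\<^esub> G0_int F E v s)" using q by (rule UN_I[rotated])
next
 fix G assume "G : (\<Union>p\<in>Good par. coset_rep p <#\<^bsub>GF\<^esub> G0_int F E v s)"
 then obtain q where q: "q : Good par" "G : coset_rep q <#\<^bsub>GF\<^esub> G0_int F E v s" by (rule UN_E)
 obtain m z m' z' where q': "q = ((m, z), (m', z'))" by (metis surj_pair)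
 have h: "m mod 2 = par" "m' mod 2 = par" "z : T m" "z' : T m'" "good m z m' z'" using q(1) unfolding q' Good_def by auto
 note m = h(1)[unfolded par_iff] h(2)[unfolded par_iff] and z = T_U1[OF h(3)] T_U1[OF h(4)]
 obtain al bt where ab: "al : UO" "bt : UO" "G = el (u * rep a (m, z) * al) (w * rep a (m', z') * bt)"
  using q(2) unfolding q' coset_rep_coset[OF m z] by (elim CollectE exE conjE)
 have abE: "al : UE" "bt : UE" using ab by (simp_all add: UO_def)
 have kg: "u * rep a (m, z) * al : UE" "w * rep a (m', z') * bt : UE"
  using UE_mult[OF rep_UE[OF m(1) z(1) u] abE(1)] UE_mult[OF rep_UE[OF m(2) z(2) w] abE(2)] by simp_all
 note du = SE_D(2)[OF u a(2)] SE_D(2)[OF w a(2)]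
 have ia: "inverse a ~= 0" using a by simp
 note dr = SE_D(2)[OF rep_SE[OF a m(1) z(1)] ia] SE_D(2)[OF rep_SE[OF a m(2) z(2)] ia]
 have e: "inv2 u * (u * rep a (m, z) * al) = rep a (m, z) * al" "inv2 w * (w * rep a (m', z') * bt) = rep a (m', z') * bt"
  using inv2_cancel(1)[OF du(1)] inv2_cancel(1)[OF du(2)] by (simp_all add: mult.assoc)
 have "intm (inv2 (rep a (m', z')) * d * rep a (m, z))"
  using rep_integral_iff[OF a m z xyE] h(5) unfolding good_def by simp
 then have "intm (inv2 bt * (inv2 (rep a (m', z')) * d * rep a (m, z)) * al)"
  by (rule intm_mult[OF intm_mult[OF UO_intm[OF UO_inv2[OF ab(2)]]] UO_intm[OF ab(1)]])
 moreover have "inv2 bt * (inv2 (rep a (m', z')) * d * rep a (m, z)) * al = inv2 (rep a (m', z') * bt) * d * (rep a (m, z) * al)"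
  using inv2_mult[OF dr(2) UE_D(2)[OF abE(2)]] by (simp add: mult.assoc)
 ultimately show "G : good_set" unfolding ab(3) good_set_iff[OF kg] e by simp
qed

lemma cosets_disjoint: "disjoint_family_on (%p. coset_rep p <#\<^bsub>GF\<^esub> G0_int F E v s) (Good par)"
 unfolding disjoint_family_on_def
proof (intro ballI impI)
 fix q1 q2 assume q: "q1 : Good par" "q2 : Good par" "q1 ~= q2"
 obtain m z m' z' where q1: "q1 = ((m, z), (m', z'))" by (metis surj_pair)
 obtain n y n' y' where q2: "q2 = ((n, y), (n', y'))" by (metis surj_pair)
 have h: "m mod 2 = par" "m' mod 2 = par" "z : T m" "z' : T m'" using q(1) unfolding q1 Good_def by auto
 have h': "n mod 2 = par" "n' mod 2 = par" "y : T n" "y' : T n'" using q(2) unfolding q2 Good_def by auto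
 note m = h(1)[unfolded par_iff] h(2)[unfolded par_iff] and z = T_U1[OF h(3)] T_U1[OF h(4)]
 note n = h'(1)[unfolded par_iff] h'(2)[unfolded par_iff] and y = T_U1[OF h'(3)] T_U1[OF h'(4)]
 have ia: "inverse a ~= 0" using a by simp
 have uniq: "i = j & t = r" if t: "even (int i + v a)" "even (int j + v a)" "t : T i" "r : T j" and ab: "al : UO" "bt : UO"
  and eq: "g * rep a (i, t) * al = g * rep a (j, r) * bt" and g: "det2 g ~= 0" for i j t r al bt g
 proof -
  have abE: "al : UE" using ab by (simp add: UO_def)
  have dr: "det2 (rep a (j, r)) ~= 0" using SE_D(2)[OF rep_SE[OF a t(2) T_U1[OF t(4)]] ia] .
  have "rep a (i, t) * al = rep a (j, r) * bt"
   using arg_cong[OF eq, of "%x. inv2 g * x"] inv2_cancel(1)[OF g] by (simp add: mult.assoc)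
  then have "inv2 (rep a (j, r)) * (rep a (i, t) * al) * inv2 al = inv2 (rep a (j, r)) * (rep a (j, r) * bt) * inv2 al" by simp
  moreover have "inv2 (rep a (j, r)) * (rep a (i, t) * al) * inv2 al = inv2 (rep a (j, r)) * rep a (i, t)"
   using inv2(1)[OF UE_D(2)[OF abE]] by (simp add: mult.assoc)
  ultimately have "inv2 (rep a (j, r)) * rep a (i, t) = bt * inv2 al" using inv2_cancel(1)[OF dr] by simp
  moreover have "intm (bt * inv2 al)" by (rule intm_mult[OF UO_intm[OF ab(2)] UO_intm[OF UO_inv2[OF ab(1)]]])
  ultimately show ?thesis using representative_unique[OF a t(1,2) T(1) t(3,4)] by simp
 qed
 show "(coset_rep q1 <#\<^bsub>GF\<^esub> G0_int F E v s) \<inter> (coset_rep q2 <#\<^bsub>GF\<^esub> G0_int F E v s) = {}"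
 proof (rule ccontr)
  assume "(coset_rep q1 <#\<^bsub>GF\<^esub> G0_int F E v s) \<inter> (coset_rep q2 <#\<^bsub>GF\<^esub> G0_int F E v s) ~= {}"
  then obtain G where G: "G : coset_rep q1 <#\<^bsub>GF\<^esub> G0_int F E v s" "G : coset_rep q2 <#\<^bsub>GF\<^esub> G0_int F E v s" by blast
  obtain al bt where ab: "al : UO" "bt : UO" "G = el (u * rep a (m, z) * al) (w * rep a (m', z') * bt)"
   using G(1) unfolding q1 coset_rep_coset[OF m z] by (elim CollectE exE conjE)
  obtain al' bt' where ab': "al' : UO" "bt' : UO" "G = el (u * rep a (n, y) * al') (w * rep a (n', y') * bt')"
   using G(2) unfolding q2 coset_rep_coset[OF n y] by (elim CollectE exE conjE)
  have eq: "u * rep a (m, z) * al = u * rep a (n, y) * al'" "w * rep a (m', z') * bt = w * rep a (n', y') * bt'"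
   using ab(3) ab'(3) el_inject by metis+
  have "m = n & z = y" by (rule uniq[OF m(1) n(1) h(3) h'(3) ab(1) ab'(1) eq(1) SE_D(2)[OF u a(2)]])
  moreover have "m' = n' & z' = y'" by (rule uniq[OF m(2) n(2) h(4) h'(4) ab(2) ab'(2) eq(2) SE_D(2)[OF w a(2)]])
  ultimately show False using q(3) q1 q2 by simp
 qed
qed

lemma good_set_open: "openin (G0_top F E v s) good_set"
proof -
 interpret Metric_space "carrier GF" "tdist 4 E v s" by (rule Metric_space_G0)
 show ?thesis unfolding G0_top_def openin_mtopology
 proof (intro conjI allI impI)
  show "good_set <= carrier GF" by blast
  fix G assume G: "G : good_set"
  then obtain k g where kg: "k : UE" "g : UE" "G = el k g" unfolding carrier_G0_F by blast
  obtain r where r: "r > 0" "!!k' g'. k' : UE ==> g' : UE ==> tdist 4 E v s (el k g) (el k' g') < r ==> inv2 k * k' : UO & inv2 g * g' : UO"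
   using near_same_coset[OF kg(1,2)] by blast
  have "mball G r <= good_set"
  proof
   fix G' assume "G' : mball G r"
   then have G': "G' : carrier GF" "tdist 4 E v s G G' < r" by auto
   then obtain k' g' where kg': "k' : UE" "g' : UE" "G' = el k' g'" unfolding carrier_G0_F by blast
   have c: "inv2 k * k' : UO" "inv2 g * g' : UO" using r(2)[OF kg'(1,2)] G'(2) unfolding kg(3) kg'(3) by auto
   have "intm (inv2 (inv2 w * g) * d * (inv2 u * k))" using G unfolding kg(3) good_set_iff[OF kg(1,2)] .
   then have "intm (inv2 (inv2 g * g') * (inv2 (inv2 w * g) * d * (inv2 u * k)) * (inv2 k * k'))"
    by (rule intm_mult[OF intm_mult[OF UO_intm[OF UO_inv2[OF c(2)]]] UO_intm[OF c(1)]])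
   moreover have "inv2 (inv2 g * g') * (inv2 (inv2 w * g) * d * (inv2 u * k)) * (inv2 k * k') = inv2 (inv2 w * g') * d * (inv2 u * k')"
   proof -
    note D = SE_D(2)[OF w a(2)] UE_D(2)[OF kg(1)] UE_D(2)[OF kg(2)] UE_D(2)[OF kg'(1)] UE_D(2)[OF kg'(2)]
    have "inv2 (inv2 g * g') = inv2 g' * g" "inv2 (inv2 w * g) = inv2 g * w" "inv2 (inv2 w * g') = inv2 g' * w"
    using D by (simp_all add: inv2_mult det2_inv2 inv2_inv2)
    then show ?thesis using inv2_cancel(2)[OF D(3)] inv2_cancel(2)[OF D(2)] by (simp add: mult.assoc)
   qed
   ultimately show "G' : good_set" unfolding kg'(3) good_set_iff[OF kg'(1,2)] by simp
  qed
  then show "\<exists>r>0. mball G r <= good_set" using r(1) by blast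
 qed
qed

lemma orbital_integral_G:
 assumes nm: "normalised_measures GF (G0_top F E v s) (G0_int F E v s) (Ad 4 s) S dg dt dq" and X: "X0 : S"
 shows "orbital_integral GF (Ad 4 s) (dq X0) (indicator (g1_int F E v s)) X0 = of_nat (card (Good par))"
proof (rule orbital_integral_count[OF group_GF Ad_GF(1)[OF lie_in] Ad_GF(2)[OF lie_in] nm X refl])
 define J where "J = carrier (stabiliser GF (Ad 4 s) X0)"
 interpret group GF by (rule group_GF)
 interpret J: subgroup J GF unfolding J_def by (rule stabiliser_subgroup[OF group_GF Ad_GF[OF lie_in]])
 have hm: "haar_measure GF (G0_top F E v s) dg" using nm by (simp add: normalised_measures_def)
 then show "good_set : sets dg" using good_set_open by (simp add: haar_measure_def borel_sets_def sigma_sets.Basic)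
 have "sets (dq X0) = sigma_sets (rcosets\<^bsub>GF\<^esub> J) {V. V <= rcosets\<^bsub>GF\<^esub> J & openin (G0_top F E v s) (\<Union>V)}"
  using nm X unfolding J_def by (simp add: normalised_measures_def quotient_measure_def Let_def)
 moreover have "\<Union>{c \<in> rcosets\<^bsub>GF\<^esub> J. c <= good_set} = good_set"
 proof (intro subset_antisym subsetI)
  fix G assume G: "G : good_set"
  then have GF: "G : carrier GF" by blast
  have "t \<otimes>\<^bsub>GF\<^esub> G : good_set" if t: "t : J" for t
  proof -
   have tG: "t : carrier GF" using t J.subset by blast
   have "inv\<^bsub>GF\<^esub> t : J" by (rule J.m_inv_closed[OF t])
   then have "Ad 4 s (inv\<^bsub>GF\<^esub> t) X0 = X0" unfolding J_def stabiliser_def by simp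
   then have "Ad 4 s (inv\<^bsub>GF\<^esub> (t \<otimes>\<^bsub>GF\<^esub> G)) X0 = Ad 4 s (inv\<^bsub>GF\<^esub> G) X0"
    unfolding inv_mult_group[OF tG GF] Ad_GF(1)[OF lie_in inv_closed[OF GF] inv_closed[OF tG]] by simp
   then show ?thesis using G m_closed[OF tG GF] by (simp del: G0_ops)
  qed
  then have "J #>\<^bsub>GF\<^esub> G <= good_set" unfolding r_coset_def by blast
  moreover have "J #>\<^bsub>GF\<^esub> G : rcosets\<^bsub>GF\<^esub> J" using GF unfolding RCOSETS_def by blast
  moreover have "G : J #>\<^bsub>GF\<^esub> G" by (rule rcos_self[OF GF J.subgroup_axioms])
  ultimately show "G : \<Union>{c \<in> rcosets\<^bsub>GF\<^esub> J. c <= good_set}" by blast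
 qed blast
 ultimately show "{c : rcosets\<^bsub>GF\<^esub> (carrier (stabiliser GF (Ad 4 s) X0)). c <= good_set} : sets (dq X0)"
  using good_set_open unfolding J_def[symmetric] by (simp add: sigma_sets.Basic)
 show "finite (Good par)"
 proof (cases "v x \<ge> 0")
  case False
  have "Good par = {}"
  proof (rule equals0I)
   fix q assume q: "q : Good par"
   obtain m z m' z' where q1: "q = ((m, z), (m', z'))" by (metis surj_pair)
   have "z : T m" "z' : T m'" "good m z m' z'" using q unfolding q1 Good_def by auto
   then show False using good_negative[of z z' m m'] False T_U1 by auto
  qed
  then show ?thesis by simp
 qed (rule finite_Good)
 show "coset_rep : Good par \<rightarrow> carrier GF"
 proof
  fix q assume q: "q : Good par"
  obtain m z m' z' where q1: "q = ((m, z), (m', z'))" by (metis surj_pair)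
  have h: "m mod 2 = par" "m' mod 2 = par" "z : T m" "z' : T m'" using q unfolding q1 Good_def by auto
  show "coset_rep q : carrier GF" unfolding q1 carrier_G0_F
   using rep_UE[OF h(1)[unfolded par_iff] T_U1[OF h(3)] u] rep_UE[OF h(2)[unfolded par_iff] T_U1[OF h(4)] w] by auto
 qed
 show "good_set = (\<Union>p\<in>Good par. coset_rep p <#\<^bsub>GF\<^esub> G0_int F E v s)" by (rule good_set_cosets)
 show "disjoint_family_on (%p. coset_rep p <#\<^bsub>GF\<^esub> G0_int F E v s) (Good par)" by (rule cosets_disjoint)
qed

end

end

section \<open>The symmetric space of \<open>U\<^sub>2 \<times> U\<^sub>2\<close>\<close>

definition mk2 :: "'a => 'a => 'a => 'a => 'a mat" where
 "mk2 a b c d = mat 2 2 (%(i, j). if i = 0 then if j = 0 then a else b else if j = 0 then c else d)"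

lemma all2: "(ALL i<2. P i) \<longleftrightarrow> P 0 & P (1::nat)"
 by (auto simp: less_Suc_eq numeral_2_eq_2)

lemma mk2_carrier [simp]: "mk2 a b c d : carrier_mat 2 2" by (simp add: mk2_def)

lemma mk2_index [simp]: "mk2 a b c d $$ (0, 0) = a" "mk2 a b c d $$ (0, Suc 0) = b"
 "mk2 a b c d $$ (Suc 0, 0) = c" "mk2 a b c d $$ (Suc 0, Suc 0) = d"
 by (simp_all add: mk2_def)

lemma mat2_eqI:
 assumes "A : carrier_mat 2 2" "B : carrier_mat 2 2" "ALL i<2. ALL j<2. A $$ (i, j) = B $$ (i, j)" shows "A = B"
 using assms by (intro eq_matI) auto

lemma mk2_eta: "A : carrier_mat 2 2 ==> A = mk2 (A $$ (0,0)) (A $$ (0,1)) (A $$ (1,0)) (A $$ (1,1))"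
 by (rule mat2_eqI) (simp_all add: all2)

lemma mk2_inject: "mk2 a b c d = mk2 a' b' c' d' \<longleftrightarrow> a = a' & b = b' & c = c' & d = d'"
 by (metis mk2_index)

lemma mk2_mult: "mk2 a b c d * mk2 a' b' c' d' = mk2 (a * a' + b * c') (a * b' + b * d') (c * a' + d * c') (c * b' + d * (d' :: 'a::comm_ring_1))"
proof (rule mat2_eqI)
 have e: "(mk2 a b c d * mk2 a' b' c' d') $$ (i, j) =
   mk2 a b c d $$ (i, 0) * mk2 a' b' c' d' $$ (0, j) + mk2 a b c d $$ (i, 1) * mk2 a' b' c' d' $$ (1, j)" if "i < 2" "j < 2" for i j
  using that mk2_carrier[of a b c d] mk2_carrier[of a' b' c' d'] by (simp add: scalar_prod_def numeral_2_eq_2)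
 show "ALL i<2. ALL j<2. (mk2 a b c d * mk2 a' b' c' d') $$ (i, j) =
  mk2 (a * a' + b * c') (a * b' + b * d') (c * a' + d * c') (c * b' + d * d') $$ (i, j)"
  unfolding all2 by (simp add: e)
qed (simp_all add: times_mat_def mk2_def)

lemma mk2_transpose: "transpose_mat (mk2 a b c d) = mk2 a c b d"
 by (rule mat2_eqI) (simp_all add: all2, simp_all add: mk2_def)

lemma mk2_uminus: "- mk2 a b c d = mk2 (- a) (- b) (- c) (- (d :: 'a::comm_ring_1))"
 by (rule mat2_eqI) (simp_all add: all2, simp_all add: mk2_def)

lemma mk2_one: "1\<^sub>m 2 = mk2 1 0 0 (1::'a::comm_ring_1)"
 by (rule mat2_eqI) (simp_all add: all2)

lemma mk2_J: "Jmat 2 = mk2 0 1 1 (0::'a::field)"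
 by (rule mat2_eqI) (simp_all add: all2 Jmat_def)

context tensor
begin

definition C2 :: "'k => 'k => 'k mat" where
 "C2 p r = mk2 (1 / 2 * (p + r)) (1 / 2 * (p - r)) (1 / 2 * (p - r)) (1 / 2 * (p + r))"
definition L2 :: "'k => 'k => 'k mat" where
 "L2 t u = mk2 (1 / 2 * (t + u)) (- (1 / 2 * (t - u))) (1 / 2 * (t - u)) (- (1 / 2 * (t + u)))"

lemma C2_carrier [simp]: "C2 p r : carrier_mat 2 2" by (simp add: C2_def)
lemma L2_carrier [simp]: "L2 p r : carrier_mat 2 2" by (simp add: L2_def)

lemma half_laws:
 "1 / 2 * (p + r) + 1 / 2 * (p - r) = (p :: 'k)" "1 / 2 * (p + r) - 1 / 2 * (p - r) = r"
proof -
 have "1 / 2 * (p + r) + 1 / 2 * (p - r) = 1 / 2 * (2 * p)" "1 / 2 * (p + r) - 1 / 2 * (p - r) = 1 / 2 * (2 * r)"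
  unfolding distrib_left[symmetric] right_diff_distrib[symmetric] by (simp_all add: algebra_simps)
 then show "1 / 2 * (p + r) + 1 / 2 * (p - r) = (p :: 'k)" "1 / 2 * (p + r) - 1 / 2 * (p - r) = r" using two_nz by simp_all
qed

lemma C2_products:
 "C2 p r * C2 p' r' = C2 (p * p') (r * r')" "C2 p r * L2 t u = L2 (p * t) (r * u)" "L2 t u * C2 p r = L2 (t * r) (u * p)"
proof -
 define h :: 'k where "h = 1 / 2"
 have "h * (1 + 1) = 1" unfolding h_def using two_nz by simp
 then have h1: "h + h = 1" by (simp add: algebra_simps)
 have hc: "h * h * (c + c) = h * c" for c
 proof -
  have "h * h * (c + c) = (h + h) * (h * c)" by (simp add: algebra_simps)
  then show ?thesis unfolding h1 by simp
 qed
 have key: "X = h * c" if "X = h * h * (c + c)" for X c using that unfolding hc .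
 have key': "X = - (h * c)" if "X = - (h * h * (c + c))" for X c using that unfolding hc .
 show "C2 p r * C2 p' r' = C2 (p * p') (r * r')" "C2 p r * L2 t u = L2 (p * t) (r * u)" "L2 t u * C2 p r = L2 (t * r) (u * p)"
  unfolding C2_def L2_def h_def[symmetric] mk2_mult mk2_inject
  by (intro conjI; (rule key' | rule key), simp add: algebra_simps)+
qed

lemma C2_one: "C2 1 1 = 1\<^sub>m 2" using half_laws(1)[of 1 1] by (simp add: C2_def mk2_one)

lemma C2_inject: "C2 p r = C2 p' r' \<longleftrightarrow> p = p' & r = r'"
 unfolding C2_def mk2_inject using half_laws by metis
lemma L2_inject: "L2 p r = L2 p' r' \<longleftrightarrow> p = p' & r = r'"
 unfolding L2_def mk2_inject using half_laws by metis

lemma J_mk2_J: "Jmat 2 * mk2 a b c d * Jmat 2 = mk2 d c b (a::'k)"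
 by (simp add: mk2_J mk2_mult)
lemma madj_mk2: "madj 2 (mk2 a b c d) = mk2 d b c a"
 unfolding madj_def mk2_transpose by (simp add: J_mk2_J)

lemma C2_J: "Jmat 2 * C2 p r * Jmat 2 = C2 p r" "madj 2 (C2 p r) = C2 p r"
 by (simp_all add: C2_def J_mk2_J madj_mk2)
lemma L2_J: "Jmat 2 * L2 t u * Jmat 2 = - L2 t u" "- madj 2 (L2 t u) = L2 u t"
proof -
 have e: "- (1 / 2 * (t - u)) = 1 / 2 * (u - t)" "1 / 2 * (t - u) = - (1 / 2 * (u - t))" by (simp_all add: algebra_simps minus_divide_left)
 show "Jmat 2 * L2 t u * Jmat 2 = - L2 t u" by (simp add: L2_def J_mk2_J mk2_uminus)
 show "- madj 2 (L2 t u) = L2 u t" unfolding L2_def madj_mk2 mk2_uminus mk2_inject by (simp only: e add.commute[of t u] minus_minus simp_thms)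
qed

lemma J_fixed_C2: "P : carrier_mat 2 2 ==> Jmat 2 * P * Jmat 2 = P ==> EX p r. P = C2 p r"
proof -
 assume P: "P : carrier_mat 2 2" "Jmat 2 * P * Jmat 2 = P"
 obtain a b c d where abcd: "P = mk2 a b c d" using mk2_eta[OF P(1)] by blast
 have "mk2 d c b a = mk2 a b c d" using P(2) unfolding abcd J_mk2_J .
 then have e: "d = a" "c = b" unfolding mk2_inject by blast+
 have "1 / 2 * ((a + b) + (a - b)) = a" "1 / 2 * ((a + b) - (a - b)) = b"
  unfolding distrib_left[of _ "a + b" "a - b"] right_diff_distrib[of _ "a + b" "a - b"] by (rule half_laws)+
 then have "P = C2 (a + b) (a - b)"
  unfolding abcd e C2_def mk2_inject by (simp only: simp_thms)
 then show ?thesis by blast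
qed

lemma J_antifixed_L2: "P : carrier_mat 2 2 ==> Jmat 2 * P * Jmat 2 = - P ==> EX t u. P = L2 t u"
proof -
 assume P: "P : carrier_mat 2 2" "Jmat 2 * P * Jmat 2 = - P"
 obtain a b c d where abcd: "P = mk2 a b c d" using mk2_eta[OF P(1)] by blast
 have "mk2 d c b a = mk2 (- a) (- b) (- c) (- d)" using P(2) unfolding abcd J_mk2_J mk2_uminus .
 then have e: "d = - a" "c = - b" unfolding mk2_inject by blast+
 have "1 / 2 * ((a + b) + (a - b)) = a" "1 / 2 * ((a + b) - (a - b)) = b"
  unfolding distrib_left[of _ "a + b" "a - b"] right_diff_distrib[of _ "a + b" "a - b"] by (rule half_laws)+
 moreover have "(a - b) + (a + b) = (a + b) + (a - b)" "(a - b) - (a + b) = - ((a + b) - (a - b))" by simp_all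
 ultimately have "1 / 2 * ((a - b) + (a + b)) = a" "1 / 2 * ((a - b) - (a + b)) = - b" by (simp_all only: mult_minus_right)
 then have "P = L2 (a - b) (a + b)" unfolding abcd e L2_def mk2_inject by (simp only: minus_minus simp_thms)
 then show ?thesis by blast
qed

definition hel :: "'k => 'k => 'k tmat" where "hel p r = tm (C2 p r) (C2 (inverse p) (inverse r))"
definition hlie :: "'k => 'k => 'k tmat" where "hlie t u = tm (L2 t u) (L2 u t)"

lemma hel_in [simp]: "hel p r : tmats 2 UNIV" by (simp add: hel_def)
lemma hlie_in [simp]: "hlie p r : tmats 2 UNIV" by (simp add: hlie_def)
lemma teval_hel: "teval s (hel p r) = C2 p r" "teval (- s) (hel p r) = C2 (inverse p) (inverse r)"
 by (simp_all add: hel_def teval_tm[of _ 2])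
lemma teval_hlie: "teval s (hlie t u) = L2 t u" "teval (- s) (hlie t u) = L2 u t"
 by (simp_all add: hlie_def teval_tm[of _ 2])

lemma hel_mult: "tmult s (hel p r) (hel p' r') = hel (p * p') (r * r')"
 unfolding hel_def by (subst tm_mult[of _ 2]) (simp_all add: C2_products mult.commute)
lemma hel_one: "hel 1 1 = temb 2 (1\<^sub>m 2)"
 by (simp add: hel_def C2_one temb_tm)
lemma tinv_hel: "p ~= 0 ==> r ~= 0 ==> tinv 2 s (hel p r) = hel (inverse p) (inverse r)"
 by (rule tinv_eq) (simp_all add: hel_mult hel_one)
lemma Ad_hel:
 assumes "p ~= 0" "r ~= 0" shows "Ad 2 s (hel p r) (hlie t u) = hlie (p / r * t) (u / (p / r))"
proof -
 have "Ad 2 s (hel p r) (hlie t u) = tm (L2 (p * t * inverse r) (r * u * inverse p)) (L2 (inverse p * u * r) (inverse r * t * p))"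
  unfolding Ad_def tinv_hel[OF assms] unfolding hel_def hlie_def by (simp add: tm_mult[of _ 2] C2_products)
 then show ?thesis unfolding hlie_def by (simp add: divide_inverse mult_ac)
qed

lemma thetaJ:
 assumes "X : tmats 2 UNIV"
 shows "Ad 2 s (temb 2 (Jmat 2)) X : tmats 2 UNIV"
  "teval s (Ad 2 s (temb 2 (Jmat 2)) X) = Jmat 2 * teval s X * Jmat 2"
  "teval (- s) (Ad 2 s (temb 2 (Jmat 2)) X) = Jmat 2 * teval (- s) X * Jmat 2"
proof -
 have J: "(Jmat 2 :: 'k mat) : carrier_mat 2 2" "Jmat 2 * Jmat 2 = (1\<^sub>m 2 :: 'k mat)" by (simp_all add: mk2_J mk2_mult mk2_one)
 have "tinv 2 s (temb 2 (Jmat 2)) = temb 2 (Jmat 2)"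
  by (rule tinv_eq) (use J in \<open>auto intro!: tmat_eqI[of _ 2] simp: tevals[of _ 2]\<close>)
 then have t: "Ad 2 s (temb 2 (Jmat 2)) X = tmult s (tmult s (temb 2 (Jmat 2)) X) (temb 2 (Jmat 2))" by (simp add: Ad_def)
 show "Ad 2 s (temb 2 (Jmat 2)) X : tmats 2 UNIV"
  "teval s (Ad 2 s (temb 2 (Jmat 2)) X) = Jmat 2 * teval s X * Jmat 2"
  "teval (- s) (Ad 2 s (temb 2 (Jmat 2)) X) = Jmat 2 * teval (- s) X * Jmat 2"
  using J(1) assms unfolding t by (simp_all add: tevals[of _ 2])
qed

lemma tensor_form_2: "tensor_form s 2"
 by unfold_locales (simp add: mk2_J mk2_mult mk2_one)

lemma H_factor_iff:
 assumes R: "ring_over R"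
 shows "X : unitary 2 s R & Ad 2 s (temb 2 (Jmat 2)) X = X \<longleftrightarrow> X : tmats 2 R & (EX p r. p ~= 0 & r ~= 0 & X = hel p r)"
proof -
 interpret f: tensor_form s 2 by (rule tensor_form_2)
 show ?thesis
 proof
  assume h: "X : unitary 2 s R & Ad 2 s (temb 2 (Jmat 2)) X = X"
  then have XR: "X : tmats 2 R" using f.unitary_tmats by blast
  note XU = tmats_U[OF XR]
  obtain p r where P: "teval s X = C2 p r" using J_fixed_C2[OF teval_carrier[OF XU]] thetaJ(2)[OF XU] h by metis
  obtain p' r' where Q: "teval (- s) X = C2 p' r'" using J_fixed_C2[OF teval_carrier[OF XU]] thetaJ(3)[OF XU] h by metis
  have "C2 (p * p') (r * r') = C2 1 1" using f.unitary_iff(1)[OF R XR] h unfolding P Q C2_J C2_products C2_one by blast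
  then have e: "p * p' = 1" "r * r' = 1" unfolding C2_inject by auto
  then have "p' = inverse p" "r' = inverse r" by (simp_all add: inverse_unique)
  then have "X = hel p r" using XU P Q by (intro tmat_eqI[of _ 2]) (simp_all add: teval_hel)
  moreover have "p ~= 0" "r ~= 0" using e by auto
  ultimately show "X : tmats 2 R & (EX p r. p ~= 0 & r ~= 0 & X = hel p r)" using XR by blast
 next
  assume "X : tmats 2 R & (EX p r. p ~= 0 & r ~= 0 & X = hel p r)"
  then obtain p r where X: "X : tmats 2 R" "p ~= 0" "r ~= 0" "X = hel p r" by blast
  have "X : unitary 2 s R" unfolding f.unitary_iff(1)[OF R X(1)] using X(2,3)
   unfolding X(4) teval_hel C2_J C2_products by (simp add: C2_one)
  moreover have "Ad 2 s (temb 2 (Jmat 2)) X = X"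
   by (rule tmat_eqI[of _ 2]) (use X(4) in \<open>simp_all add: thetaJ teval_hel C2_J\<close>)
  ultimately show "X : unitary 2 s R & Ad 2 s (temb 2 (Jmat 2)) X = X" ..
 qed
qed

lemma h_factor_iff:
 assumes R: "ring_over R"
 shows "X : unitary_Lie 2 s R & Ad 2 s (temb 2 (Jmat 2)) X = tneg X \<longleftrightarrow> X : tmats 2 R & (EX t u. X = hlie t u)"
proof -
 interpret f: tensor_form s 2 by (rule tensor_form_2)
 show ?thesis
 proof
  assume h: "X : unitary_Lie 2 s R & Ad 2 s (temb 2 (Jmat 2)) X = tneg X"
  then have XR: "X : tmats 2 R" by (simp add: unitary_Lie_def)
  note XU = tmats_U[OF XR]
  have tt: "Jmat 2 * teval s X * Jmat 2 = - teval s X" "Jmat 2 * teval (- s) X * Jmat 2 = - teval (- s) X"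
   using thetaJ(2,3)[OF XU] teval_tneg[OF XU] h by simp_all
  obtain t u where P: "teval s X = L2 t u" using J_antifixed_L2[OF teval_carrier[OF XU] tt(1)] by blast
  obtain t' u' where Q: "teval (- s) X = L2 t' u'" using J_antifixed_L2[OF teval_carrier[OF XU] tt(2)] by blast
  have "L2 u' t' = L2 t u" using f.unitary_Lie_iff[OF XR] h unfolding P Q L2_J by simp
  then have "t' = u" "u' = t" unfolding L2_inject by auto
  then have "X = hlie t u" using XU P Q by (intro tmat_eqI[of _ 2]) (simp_all add: teval_hlie)
  then show "X : tmats 2 R & (EX t u. X = hlie t u)" using XR by blast
 next
  assume "X : tmats 2 R & (EX t u. X = hlie t u)"
  then obtain t u where X: "X : tmats 2 R" "X = hlie t u" by blast
  have "X : unitary_Lie 2 s R" using f.unitary_Lie_iff[OF X(1)] unfolding X(2) teval_hlie L2_J by simp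
  moreover have "Ad 2 s (temb 2 (Jmat 2)) X = tneg X"
   by (rule tmat_eqI[of _ 2]) (use X(2) in \<open>simp_all add: thetaJ teval_hlie L2_J teval_tneg[of _ 2]\<close>)
  ultimately show "X : unitary_Lie 2 s R & Ad 2 s (temb 2 (Jmat 2)) X = tneg X" ..
 qed
qed

definition HT :: "'k set => 'k tmat set" where
 "HT R = {X : tmats 2 R. EX p r. p ~= 0 & r ~= 0 & X = hel p r}"
definition LT :: "'k set => 'k tmat set" where
 "LT R = {X : tmats 2 R. EX t u. X = hlie t u}"

lemma H_theta_iff: assumes R: "ring_over R" shows "H_theta s R = HT R \<times> HT R"
proof -
 have "h : H_theta s R \<longleftrightarrow> (fst h : unitary 2 s R & Ad 2 s (temb 2 (Jmat 2)) (fst h) = fst h) &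
   (snd h : unitary 2 s R & Ad 2 s (temb 2 (Jmat 2)) (snd h) = snd h)" for h
  unfolding H_theta_def thetaH_def AdH_def mem_Times_iff mem_Collect_eq prod_eq_iff fst_conv snd_conv by blast
 then have "h : H_theta s R \<longleftrightarrow> h : HT R \<times> HT R" for h
  unfolding H_factor_iff[OF R] HT_def mem_Times_iff mem_Collect_eq .
 then show ?thesis by (rule Set.set_eqI)
qed

lemma h1_iff: assumes R: "ring_over R" shows "h1 s R = LT R \<times> LT R"
proof -
 have "h : h1 s R \<longleftrightarrow> (fst h : unitary_Lie 2 s R & Ad 2 s (temb 2 (Jmat 2)) (fst h) = tneg (fst h)) &
   (snd h : unitary_Lie 2 s R & Ad 2 s (temb 2 (Jmat 2)) (snd h) = tneg (snd h))" for h
  unfolding h1_def thetaH_def AdH_def mem_Times_iff mem_Collect_eq prod_eq_iff fst_conv snd_conv by blast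
 then have "h : h1 s R \<longleftrightarrow> h : LT R \<times> LT R" for h
  unfolding h_factor_iff[OF R] LT_def mem_Times_iff mem_Collect_eq .
 then show ?thesis by (rule Set.set_eqI)
qed

lemma rational_hel:
 assumes "rational_off B f" "rational_off B g" "!!t. t ~: B ==> f t ~= 0" "!!t. t ~: B ==> g t ~= 0" "i < 2" "j < 2"
 shows "rational_off B (%t. fst (hel (f t) (g t)) $$ (i, j))" "rational_off B (%t. snd (hel (f t) (g t)) $$ (i, j))"
proof -
 have C: "ALL i<2. ALL j<2. rational_off B (%t. C2 (p t) (r t) $$ (i, j))" if "rational_off B p" "rational_off B r" for p r
  unfolding all2 C2_def One_nat_def mk2_index by (intro conjI rational_mult[OF rational_const] rational_add rational_diff that)
 have PQ: "rational_off B (%t. C2 (f t) (g t) $$ (i, j))" "rational_off B (%t. C2 (inverse (f t)) (inverse (g t)) $$ (i, j))"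
  using C[OF assms(1,2)] C[OF rational_inverse[OF assms(1,3)] rational_inverse[OF assms(2,4)]] assms(5,6) by auto
 have gen: "fst (tm P Q) $$ (i, j) = (1 / 2) * (P $$ (i, j) + Q $$ (i, j))" "snd (tm P Q) $$ (i, j) = (1 / (2 * s)) * (P $$ (i, j) - Q $$ (i, j))"
  if "P : carrier_mat 2 2" "Q : carrier_mat 2 2" for P Q using that assms(5,6) by (simp_all add: tm_def)
 have "fst (hel p r) $$ (i, j) = (1 / 2) * (C2 p r $$ (i, j) + C2 (inverse p) (inverse r) $$ (i, j))"
  "snd (hel p r) $$ (i, j) = (1 / (2 * s)) * (C2 p r $$ (i, j) - C2 (inverse p) (inverse r) $$ (i, j))" for p r
  unfolding hel_def by (rule gen[OF C2_carrier C2_carrier])+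
 note e = this
 show "rational_off B (%t. fst (hel (f t) (g t)) $$ (i, j))" "rational_off B (%t. snd (hel (f t) (g t)) $$ (i, j))"
  unfolding e by (rule rational_mult[OF rational_const rational_add[OF PQ]], rule rational_mult[OF rational_const rational_diff[OF PQ]])
qed

lemma carrier_H0:
 assumes inf: "infinite (UNIV :: 'k set)" and R: "ring_over R"
 shows "carrier (H0 s R) = HT R \<times> HT R"
proof -
 have "connected_component_of (zariski_on H_coords (H_theta s UNIV)) (temb 2 (1\<^sub>m 2), temb 2 (1\<^sub>m 2)) (hel p r, hel p' r')"
  if n: "p ~= 0" "r ~= 0" "p' ~= 0" "r' ~= 0" for p r p' r'
 proof -
  define l where "l a t = 1 + t * (a - 1)" for a t :: 'k
  define c where "c t = (hel (l p t) (l r t), hel (l p' t) (l r' t))" for t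
  define B where "B = {t. l p t = 0 | l r t = 0 | l p' t = 0 | l r' t = 0}"
  have fin: "finite {t. l a t = 0}" for a
  proof -
   have "l a t = poly [:1, a - 1:] t" for t by (simp add: l_def)
   moreover have "[:1, a - 1:] ~= 0" by simp
   ultimately show ?thesis using poly_roots_finite[of "[:1, a - 1:]"] by presburger
  qed
  have B: "finite B" unfolding B_def using fin by (simp add: Collect_disj_eq)
  have l: "rational_off B (l a)" for a unfolding l_def by (intro rational_intros)
  have nB: "l p t ~= 0" "l r t ~= 0" "l p' t ~= 0" "l r' t ~= 0" if "t ~: B" for t using that by (auto simp: B_def)
  have ends: "0 ~: B" "1 ~: B" "c 0 = (temb 2 (1\<^sub>m 2), temb 2 (1\<^sub>m 2))" "c 1 = (hel p r, hel p' r')"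
   unfolding B_def c_def l_def using n by (simp_all add: hel_one)
  have "connected_component_of (zariski_on H_coords (H_theta s UNIV)) (c 0) (c 1)"
  proof (rule rational_curve_connected[OF inf B _ _ ends(1,2)])
   show "c t : H_theta s UNIV" if "t ~: B" for t
    unfolding H_theta_iff[OF ring_over_UNIV] c_def HT_def using nB[OF that] hel_in by blast
   fix f :: "'k tmat \<times> 'k tmat => 'k" assume "f : H_coords"
   then obtain i j where ij: "i < 2" "j < 2" "f : {%X. fst (fst X) $$ (i, j), %X. snd (fst X) $$ (i, j), %X. fst (snd X) $$ (i, j), %X. snd (snd X) $$ (i, j)}"
    unfolding H_coords_def tcoords_def by (auto simp: o_def)
   have "rational_off B (%t. fst (fst (c t)) $$ (i, j))" "rational_off B (%t. snd (fst (c t)) $$ (i, j))"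
    "rational_off B (%t. fst (snd (c t)) $$ (i, j))" "rational_off B (%t. snd (snd (c t)) $$ (i, j))"
    unfolding c_def fst_conv snd_conv using rational_hel[OF l l nB(1,2) ij(1,2)] rational_hel[OF l l nB(3,4) ij(1,2)] by auto
   then show "rational_off B (%t. f (c t))" using ij(3) by auto
  qed
  then show ?thesis unfolding ends .
 qed
 note conn = this
 have "connected_component_of (zariski_on H_coords (H_theta s UNIV)) (temb 2 (1\<^sub>m 2), temb 2 (1\<^sub>m 2)) h" if h: "h : HT R \<times> HT R" for h
 proof -
  obtain p r where p: "p ~= 0" "r ~= 0" "fst h = hel p r" using h unfolding HT_def by auto
  obtain p' r' where p': "p' ~= 0" "r' ~= 0" "snd h = hel p' r'" using h unfolding HT_def by auto
  have "h = (hel p r, hel p' r')" using p(3) p'(3) by (simp add: prod_eq_iff)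
  then show ?thesis using conn[OF p(1,2) p'(1,2)] by simp
 qed
 then show ?thesis unfolding H0_def H_theta_iff[OF R] by auto
qed

lemma H0_ops: "(X, Y) \<otimes>\<^bsub>H0 s R\<^esub> (X', Y') = (tmult s X X', tmult s Y Y')" "\<one>\<^bsub>H0 s R\<^esub> = (temb 2 (1\<^sub>m 2), temb 2 (1\<^sub>m 2))"
 by (simp_all add: H0_def tmat_monoid_def DirProd_def)

lemma gammaH_hlie: "gammaH x y = (hlie x x, hlie y y)"
proof -
 have "mat_diag 2 (%i. [z, - z] ! i) = L2 z z" for z :: 'k
  using half_laws(1)[of z z] by (intro mat2_eqI) (simp_all add: all2 L2_def mat_diag_def)
 then show ?thesis by (simp add: gammaH_def hlie_def temb_tm)
qed

end

context unramified_extension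
begin

lemma halves_E: "1 / 2 * (p + r) : E & 1 / 2 * (p - r) : E \<longleftrightarrow> p : E & r : E"
proof
 assume h: "1 / 2 * (p + r) : E & 1 / 2 * (p - r) : E"
 have "1 / 2 * (p + r) + 1 / 2 * (p - r) : E" "1 / 2 * (p + r) - 1 / 2 * (p - r) : E"
  using h by (intro EE.add_closed EE.diff_closed; blast)+
 then show "p : E & r : E" unfolding half_laws by blast
next
 have "1 / 2 : E" by (intro EE.divide_closed EE.one_closed F_E) simp
 then show "p : E & r : E ==> 1 / 2 * (p + r) : E & 1 / 2 * (p - r) : E"
  by (intro conjI EE.mult_closed EE.add_closed EE.diff_closed; blast)
qed

lemma hel_in_F:
 assumes "p ~= 0" "r ~= 0" shows "hel p r : tmats 2 F \<longleftrightarrow> p : U1 & r : U1"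
proof -
 have h2: "1 / 2 : F" by (intro FF.divide_closed FF.one_closed) simp
 have bars: "bar (1 / 2 * (p + r)) = 1 / 2 * (bar p + bar r)" "bar (1 / 2 * (p - r)) = 1 / 2 * (bar p - bar r)" if "p : E" "r : E"
  using that h2 by (simp_all only: bar_mult[OF F_E[OF h2] EE.add_closed] bar_mult[OF F_E[OF h2] EE.diff_closed] bar_F bar_add bar_diff)
 have "hel p r : tmats 2 F \<longleftrightarrow> p : E & r : E & C2 (inverse p) (inverse r) = C2 (bar p) (bar r)"
 proof -
  have "hel p r : tmats 2 F \<longleftrightarrow> (ALL i<2. ALL j<2. C2 p r $$ (i, j) : E & C2 (inverse p) (inverse r) $$ (i, j) = bar (C2 p r $$ (i, j)))"
   unfolding hel_def by (rule tm_in_F[OF C2_carrier C2_carrier])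
  also have "... \<longleftrightarrow> (p : E & r : E) & 1 / 2 * (inverse p + inverse r) = bar (1 / 2 * (p + r)) & 1 / 2 * (inverse p - inverse r) = bar (1 / 2 * (p - r))"
   unfolding all2 C2_def One_nat_def mk2_index halves_E[of p r, symmetric] by blast
  also have "... \<longleftrightarrow> p : E & r : E & C2 (inverse p) (inverse r) = C2 (bar p) (bar r)"
   unfolding C2_def mk2_inject using bars by metis
  finally show ?thesis .
 qed
 also have "... \<longleftrightarrow> p : U1 & r : U1" unfolding C2_inject U1_def using assms by (auto simp: field_simps)
 finally show ?thesis .
qed

lemma hlie_in_F: "hlie t u : tmats 2 F \<longleftrightarrow> t : E & u = bar t"
proof -
 have h2: "1 / 2 : F" by (intro FF.divide_closed FF.one_closed) simp
 have bars: "bar (1 / 2 * (p + r)) = 1 / 2 * (bar p + bar r)" "bar (1 / 2 * (p - r)) = 1 / 2 * (bar p - bar r)"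
  "bar (- (1 / 2 * (p + r))) = - (1 / 2 * (bar p + bar r))" "bar (- (1 / 2 * (p - r))) = - (1 / 2 * (bar p - bar r))" if "p : E" "r : E" for p r
 proof -
  have E: "1 / 2 * (p + r) : E" "1 / 2 * (p - r) : E" using halves_E that by blast+
  show b: "bar (1 / 2 * (p + r)) = 1 / 2 * (bar p + bar r)" "bar (1 / 2 * (p - r)) = 1 / 2 * (bar p - bar r)"
   using that h2 by (simp_all only: bar_mult[OF F_E[OF h2] EE.add_closed] bar_mult[OF F_E[OF h2] EE.diff_closed] bar_F bar_add bar_diff)
  show "bar (- (1 / 2 * (p + r))) = - (1 / 2 * (bar p + bar r))" "bar (- (1 / 2 * (p - r))) = - (1 / 2 * (bar p - bar r))"
   unfolding bar_minus[OF E(1)] bar_minus[OF E(2)] b by (rule refl)+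
 qed
 have neg: "- a : E \<longleftrightarrow> a : E" for a using EE.uminus_closed[of a] EE.uminus_closed[of "- a"] by auto
 have "hlie t u : tmats 2 F \<longleftrightarrow> (ALL i<2. ALL j<2. L2 t u $$ (i, j) : E & L2 u t $$ (i, j) = bar (L2 t u $$ (i, j)))"
  unfolding hlie_def by (rule tm_in_F[OF L2_carrier L2_carrier])
 also have "... \<longleftrightarrow> (t : E & u : E) & 1 / 2 * (u + t) = bar (1 / 2 * (t + u)) & - (1 / 2 * (u - t)) = bar (- (1 / 2 * (t - u))) &
   1 / 2 * (u - t) = bar (1 / 2 * (t - u)) & - (1 / 2 * (u + t)) = bar (- (1 / 2 * (t + u)))"
  unfolding all2 L2_def One_nat_def mk2_index halves_E[of t u, symmetric] neg by blast
 also have "... \<longleftrightarrow> (t : E & u : E) & L2 u t = L2 (bar t) (bar u)"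
  unfolding L2_def mk2_inject using bars by metis
 also have "... \<longleftrightarrow> t : E & u = bar t" unfolding L2_inject using bar_closed bar_bar by metis
 finally show ?thesis .
qed

lemma tintegral_hlie: "tintegral E v s (hlie t u) \<longleftrightarrow> EE.vge 0 t & EE.vge 0 u"
proof -
 have "tintegral E v s (hlie t u) \<longleftrightarrow> (ALL i<2. ALL j<2. L2 t u $$ (i, j) : {a. EE.vge 0 a})"
  unfolding tintegral_iff[OF hlie_in] teval_hlie ..
 also have "... \<longleftrightarrow> EE.vge 0 (1 / 2 * (t + u)) & EE.vge 0 (1 / 2 * (t - u))"
  unfolding all2 L2_def One_nat_def mk2_index mem_Collect_eq vge0_minus_iff by blast
 finally show ?thesis unfolding vge0_halves .
qed

lemma tintegral_hel: "tintegral E v s (hel p r) \<longleftrightarrow> EE.vge 0 p & EE.vge 0 r"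
proof -
 have "tintegral E v s (hel p r) \<longleftrightarrow> (ALL i<2. ALL j<2. C2 p r $$ (i, j) : {a. EE.vge 0 a})"
  unfolding tintegral_iff[OF hel_in] teval_hel ..
 also have "... \<longleftrightarrow> EE.vge 0 (1 / 2 * (p + r)) & EE.vge 0 (1 / 2 * (p - r))"
  unfolding all2 C2_def One_nat_def mk2_index mem_Collect_eq by blast
 finally show ?thesis unfolding vge0_halves .
qed

lemma HT_F: "HT F = {hel p r | p r. p : U1 & r : U1}"
proof (intro subset_antisym subsetI)
 fix X assume "X : HT F"
 then obtain p r where p: "X : tmats 2 F" "p ~= 0" "r ~= 0" "X = hel p r" unfolding HT_def by blast
 then show "X : {hel p r | p r. p : U1 & r : U1}" using hel_in_F[OF p(2,3)] by blast
next
 fix X assume "X : {hel p r | p r. p : U1 & r : U1}"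
 then obtain p r where p: "p : U1" "r : U1" "X = hel p r" by blast
 note n = U1D(2)[OF p(1)] U1D(2)[OF p(2)]
 show "X : HT F" unfolding HT_def using p hel_in_F[OF n] n by blast
qed

lemma HT_F_group:
 "X : HT F ==> Y : HT F ==> tmult s X Y : HT F" "temb 2 (1\<^sub>m 2) : HT F"
 "X : HT F ==> \<exists>Y\<in>HT F. tmult s Y X = temb 2 (1\<^sub>m 2)"
proof -
 show "tmult s X Y : HT F" if XY: "X : HT F" "Y : HT F"
 proof -
  obtain p r where p: "p : U1" "r : U1" "X = hel p r" using XY(1) unfolding HT_F by blast
  obtain p' r' where p': "p' : U1" "r' : U1" "Y = hel p' r'" using XY(2) unfolding HT_F by blast
  show ?thesis unfolding HT_F p(3) p'(3) hel_mult using U1_mult[OF p(1) p'(1)] U1_mult[OF p(2) p'(2)] by blast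
 qed
 show "temb 2 (1\<^sub>m 2) : HT F" unfolding HT_F hel_one[symmetric] using U1_one by blast
 show "\<exists>Y\<in>HT F. tmult s Y X = temb 2 (1\<^sub>m 2)" if X: "X : HT F"
 proof -
  obtain p r where p: "p : U1" "r : U1" "X = hel p r" using X unfolding HT_F by blast
  have "tmult s (hel (inverse p) (inverse r)) X = temb 2 (1\<^sub>m 2)"
   unfolding p(3) hel_mult hel_one[symmetric] using U1D(2)[OF p(1)] U1D(2)[OF p(2)] by simp
  moreover have "hel (inverse p) (inverse r) : HT F" unfolding HT_F using U1_inverse[OF p(1)] U1_inverse[OF p(2)] by blast
  ultimately show ?thesis by blast
 qed
qed

lemma group_H0: "group (H0 s F)"
proof (rule groupI)
 note C = carrier_H0[OF infinite_k ring_over_F]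
 have U: "X : tmats 2 UNIV" if "X : HT F" for X using that tmats_U unfolding HT_def by blast
 show "\<one>\<^bsub>H0 s F\<^esub> : carrier (H0 s F)" unfolding C H0_ops using HT_F_group(2) by blast
 fix X assume X: "X : carrier (H0 s F)"
 obtain X1 X2 where X': "X = (X1, X2)" by (cases X)
 have X12: "X1 : HT F" "X2 : HT F" using X unfolding C X' by auto
 show "\<one>\<^bsub>H0 s F\<^esub> \<otimes>\<^bsub>H0 s F\<^esub> X = X" unfolding X' H0_ops using tmult_one(2)[OF U[OF X12(1)]] tmult_one(2)[OF U[OF X12(2)]] by simp
 obtain Y1 Y2 where "Y1 : HT F" "Y2 : HT F" "tmult s Y1 X1 = temb 2 (1\<^sub>m 2)" "tmult s Y2 X2 = temb 2 (1\<^sub>m 2)"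
  using HT_F_group(3)[OF X12(1)] HT_F_group(3)[OF X12(2)] by blast
 then show "\<exists>Y\<in>carrier (H0 s F). Y \<otimes>\<^bsub>H0 s F\<^esub> X = \<one>\<^bsub>H0 s F\<^esub>"
  unfolding C X' by (intro bexI[of _ "(Y1, Y2)"]) (simp_all add: H0_ops)
 fix Y assume Y: "Y : carrier (H0 s F)"
 obtain Z1 Z2 where Y': "Y = (Z1, Z2)" by (cases Y)
 have Z12: "Z1 : HT F" "Z2 : HT F" using Y unfolding C Y' by auto
 show "X \<otimes>\<^bsub>H0 s F\<^esub> Y : carrier (H0 s F)" unfolding X' Y' H0_ops C
  using HT_F_group(1)[OF X12(1) Z12(1)] HT_F_group(1)[OF X12(2) Z12(2)] by blast
 fix Z assume Z: "Z : carrier (H0 s F)"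
 obtain W1 W2 where Z': "Z = (W1, W2)" by (cases Z)
 have W12: "W1 : HT F" "W2 : HT F" using Z unfolding C Z' by auto
 show "X \<otimes>\<^bsub>H0 s F\<^esub> Y \<otimes>\<^bsub>H0 s F\<^esub> Z = X \<otimes>\<^bsub>H0 s F\<^esub> (Y \<otimes>\<^bsub>H0 s F\<^esub> Z)" unfolding X' Y' Z' H0_ops
  using tmult_assoc[OF U[OF X12(1)] U[OF Z12(1)] U[OF W12(1)]] tmult_assoc[OF U[OF X12(2)] U[OF Z12(2)] U[OF W12(2)]] by simp
qed

text \<open>All rational points of \<open>H\<^sub>0\<close> are integral, because elements of norm one are units.\<close>

lemma H0_int_carrier: "H0_int F E v s = carrier (H0 s F)"
proof -
 have "tintegral E v s X & tintegral E v s (tinv 2 s X)" if X: "X : HT F" for X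
 proof -
  obtain p r where p: "p : U1" "r : U1" "X = hel p r" using X unfolding HT_F by blast
  show ?thesis unfolding p(3) tinv_hel[OF U1D(2)[OF p(1)] U1D(2)[OF p(2)]] tintegral_hel
   using U1D(5)[OF p(1)] U1D(5)[OF p(2)] U1D(5)[OF U1_inverse[OF p(1)]] U1D(5)[OF U1_inverse[OF p(2)]] by blast
 qed
 note i = this
 show ?thesis unfolding H0_int_def carrier_H0[OF infinite_k ring_over_F]
 proof (intro subset_antisym subsetI)
  fix h assume h: "h : HT F \<times> HT F"
  then have "fst h : HT F" "snd h : HT F" by auto
  then show "h : {h : HT F \<times> HT F. tintegral E v s (fst h) & tintegral E v s (tinv 2 s (fst h)) &
   tintegral E v s (snd h) & tintegral E v s (tinv 2 s (snd h))}" using i h by simp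
 qed simp
qed

definition hpt :: "'k => 'k => 'k => 'k => 'k tmat \<times> 'k tmat" where
 "hpt x y c c' = (hlie (c * x) (x / c), hlie (c' * y) (y / c'))"

lemma AdH_hpt:
 assumes "p ~= 0" "r ~= 0" "p' ~= 0" "r' ~= 0"
 shows "AdH s (hel p r, hel p' r') (hpt x y c c') = hpt x y (p / r * c) (p' / r' * c')"
 unfolding AdH_def hpt_def fst_conv snd_conv Ad_hel[OF assms(1,2)] Ad_hel[OF assms(3,4)] by (simp add: mult_ac)

lemma carrier_H0_F: "carrier (H0 s F) = {(hel p r, hel p' r') | p r p' r'. p : U1 & r : U1 & p' : U1 & r' : U1}"
proof (intro subset_antisym subsetI)
 fix h assume "h : carrier (H0 s F)"
 then have h: "fst h : HT F" "snd h : HT F" unfolding carrier_H0[OF infinite_k ring_over_F] by auto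
 obtain p r where p: "p : U1" "r : U1" "fst h = hel p r" using h(1) unfolding HT_F by (elim CollectE exE conjE)
 obtain p' r' where p': "p' : U1" "r' : U1" "snd h = hel p' r'" using h(2) unfolding HT_F by (elim CollectE exE conjE)
 have "h = (hel p r, hel p' r')" using p(3) p'(3) by (simp add: prod_eq_iff)
 then show "h : {(hel p r, hel p' r') | p r p' r'. p : U1 & r : U1 & p' : U1 & r' : U1}"
  using p(1,2) p'(1,2) by (intro CollectI exI[of _ p] exI[of _ r] exI[of _ p'] exI[of _ r'] conjI)
next
 fix h assume "h : {(hel p r, hel p' r') | p r p' r'. p : U1 & r : U1 & p' : U1 & r' : U1}"
 then obtain p r p' r' where p: "h = (hel p r, hel p' r')" "p : U1" "r : U1" "p' : U1" "r' : U1" by (elim CollectE exE conjE)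
 have "hel p r : HT F" "hel p' r' : HT F" unfolding HT_F
  by (intro CollectI exI[of _ p] exI[of _ r] conjI refl p, intro CollectI exI[of _ p'] exI[of _ r'] conjI refl p)
 then show "h : carrier (H0 s F)" unfolding carrier_H0[OF infinite_k ring_over_F] p(1) by (rule SigmaI)
qed

lemma orbit_hpt:
 assumes c: "c : U1" "c' : U1"
 shows "orbit_of (H0 s F) (AdH s) (hpt x y c c') = {hpt x y e e' | e e'. e : U1 & e' : U1}"
proof (intro subset_antisym subsetI)
 fix X assume "X : orbit_of (H0 s F) (AdH s) (hpt x y c c')"
 then obtain h where h: "h : carrier (H0 s F)" "X = AdH s h (hpt x y c c')" unfolding orbit_of_def by blast
 obtain p r p' r' where p: "p : U1" "r : U1" "p' : U1" "r' : U1" "h = (hel p r, hel p' r')" using h(1) unfolding carrier_H0_F by blast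
 have "X = hpt x y (p / r * c) (p' / r' * c')" unfolding h(2) p(5) by (rule AdH_hpt) (use p(1-4) U1D(2) in blast)+
 moreover have "p / r * c : U1" "p' / r' * c' : U1" unfolding divide_inverse by (intro U1_mult U1_inverse p c)+
 ultimately show "X : {hpt x y e e' | e e'. e : U1 & e' : U1}" by blast
next
 fix X assume "X : {hpt x y e e' | e e'. e : U1 & e' : U1}"
 then obtain e e' where e: "e : U1" "e' : U1" "X = hpt x y e e'" by blast
 have h: "(hel (e / c) 1, hel (e' / c') 1) : carrier (H0 s F)" unfolding carrier_H0_F divide_inverse
  using U1_mult[OF e(1) U1_inverse[OF c(1)]] U1_mult[OF e(2) U1_inverse[OF c(2)]] U1_one by blast
 have "X = AdH s (hel (e / c) 1, hel (e' / c') 1) (hpt x y c c')"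
  using AdH_hpt[of "e / c" 1 "e' / c'" 1 x y c c'] U1D(2)[OF e(1)] U1D(2)[OF e(2)] U1D(2)[OF c(1)] U1D(2)[OF c(2)] unfolding e(3) by simp
 then show "X : orbit_of (H0 s F) (AdH s) (hpt x y c c')" unfolding orbit_of_def using h by blast
qed

end

context nearly_singular_pair
begin

text \<open>A point of the geometric orbit is \<open>hpt x y e e'\<close>; it is rational if and only if \<open>e\<close>, \<open>e'\<close> have norm one, and
 then they lift to rational elements of the group. So the stable class is one rational orbit.\<close>

lemma stable_classH_eq: "stable_classH F s (gammaH x y) = {hpt x y e e' | e e'. e : U1 & e' : U1}"
proof (intro subset_antisym subsetI)
 have g: "gammaH x y = hpt x y 1 1" by (simp add: gammaH_hlie hpt_def)
 {
  fix X assume "X : stable_classH F s (gammaH x y)"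
  then have X: "X : orbit_of (H0 s UNIV) (AdH s) (hpt x y 1 1)" "X : h1 s F" unfolding stable_classH_def g by blast+
  obtain h where h: "h : carrier (H0 s UNIV)" "X = AdH s h (hpt x y 1 1)" using X(1) unfolding orbit_of_def by blast
  obtain p r p' r' where p: "p ~= 0" "r ~= 0" "p' ~= 0" "r' ~= 0" "h = (hel p r, hel p' r')"
   using h(1) unfolding carrier_H0[OF infinite_k ring_over_UNIV] HT_def by blast
  have Xe: "X = hpt x y (p / r) (p' / r')" unfolding h(2) p(5) AdH_hpt[OF p(1-4)] by simp
  have inF: "hlie (p / r * x) (x / (p / r)) : tmats 2 F" "hlie (p' / r' * y) (y / (p' / r')) : tmats 2 F"
   using X(2) unfolding Xe h1_iff[OF ring_over_F] LT_def hpt_def by auto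
  have key: "c : U1" if c: "c ~= 0" "hlie (c * z) (z / c) : tmats 2 F" and z: "z : F" "z ~= 0" for c z
  proof -
   have h: "c * z : E" "z / c = bar (c * z)" using c(2) unfolding hlie_in_F by auto
   have "c * z / z : E" by (rule EE.divide_closed[OF h(1) F_E[OF z(1)]])
   then have cE: "c : E" using z by simp
   have "bar (c * z) = bar c * z" using bar_mult[OF cE F_E[OF z(1)]] bar_F[OF z(1)] by simp
   then have "c * bar c = 1" using h(2) c(1) z(2) by (simp add: field_simps)
   then show ?thesis using cE by (simp add: U1_def)
  qed
  have "p / r ~= 0" "p' / r' ~= 0" using p by simp_all
  then have "p / r : U1" "p' / r' : U1" using key inF xy by blast+
  then show "X : {hpt x y e e' | e e'. e : U1 & e' : U1}" unfolding Xe by blast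
 next
  fix X assume "X : {hpt x y e e' | e e'. e : U1 & e' : U1}"
  then obtain e e' where e: "e : U1" "e' : U1" "X = hpt x y e e'" by blast
  note n = U1D(2)[OF e(1)] U1D(2)[OF e(2)]
  have h: "(hel e 1, hel e' 1) : carrier (H0 s UNIV)"
   unfolding carrier_H0[OF infinite_k ring_over_UNIV] HT_def using n hel_in one_neq_zero by blast
  have X: "X = AdH s (hel e 1, hel e' 1) (hpt x y 1 1)" using AdH_hpt[OF n(1) one_neq_zero n(2) one_neq_zero, of x y 1 1] unfolding e(3) by simp
  have "hlie (c * z) (z / c) : tmats 2 F" if c: "c : U1" and z: "z : F" for c z
  proof -
   have "bar (c * z) = z / c" using bar_mult[OF U1D(1)[OF c] F_E[OF z]] bar_F[OF z] U1D(3)[OF c] by (simp add: divide_inverse)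
   then show ?thesis unfolding hlie_in_F using EE.mult_closed[OF U1D(1)[OF c] F_E[OF z]] by simp
  qed
  then have "X : h1 s F" unfolding h1_iff[OF ring_over_F] LT_def e(3) hpt_def using e xy by blast
  then show "X : stable_classH F s (gammaH x y)" unfolding stable_classH_def orbit_of_def g using h X by blast
 }
qed

lemma hpt_integral:
 assumes "c : U1" "c' : U1" shows "hpt x y c c' : h1_int F E v s \<longleftrightarrow> 0 <= v x"
proof -
 have "hpt x y c c' : h1 s F" using stable_classH_eq assms unfolding stable_classH_def by blast
 moreover have "EE.vge 0 (c * z) \<longleftrightarrow> 0 <= v z" "EE.vge 0 (z / c) \<longleftrightarrow> 0 <= v z" if c: "c : U1" and z: "z : E" "z ~= 0" for c z
  using U1D(1,2,4)[OF c] z by (simp_all add: EE.vge_iff EE.v_mult EE.v_divide EE.divide_closed)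
 ultimately show ?thesis unfolding h1_int_def hpt_def using tintegral_hlie assms xy xyE v_xy by simp
qed

lemma orbital_integral_H:
 assumes nm: "normalised_measures (H0 s F) (H0_top F E v s) (H0_int F E v s) (AdH s) S dh dt dq" and X: "hpt x y c c' : S" and c: "c : U1" "c' : U1"
 shows "orbital_integral (H0 s F) (AdH s) (dq (hpt x y c c')) (indicator (h1_int F E v s)) (hpt x y c c') = (if 0 <= v x then 1 else 0)"
proof -
 let ?H = "H0 s F" and ?X = "hpt x y c c'"
 interpret group ?H by (rule group_H0)
 have act: "EX e e'. e : U1 & e' : U1 & AdH s g ?X = hpt x y e e'" if "g : carrier ?H" for g
  using that orbit_hpt[OF c, of x y] unfolding orbit_of_def by blast
 have act_mult: "AdH s (g \<otimes>\<^bsub>?H\<^esub> h) ?X = AdH s g (AdH s h ?X)" if gh: "g : carrier ?H" "h : carrier ?H" for g h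
 proof -
  obtain p r p' r' where p: "p : U1" "r : U1" "p' : U1" "r' : U1" "g = (hel p r, hel p' r')" using gh(1) unfolding carrier_H0_F by blast
  obtain a b a' b' where a: "a : U1" "b : U1" "a' : U1" "b' : U1" "h = (hel a b, hel a' b')" using gh(2) unfolding carrier_H0_F by blast
  note n = U1D(2)[OF p(1)] U1D(2)[OF p(2)] U1D(2)[OF p(3)] U1D(2)[OF p(4)] U1D(2)[OF a(1)] U1D(2)[OF a(2)] U1D(2)[OF a(3)] U1D(2)[OF a(4)]
  have n': "p * a ~= 0" "r * b ~= 0" "p' * a' ~= 0" "r' * b' ~= 0" using n by simp_all
  have e: "p * a / (r * b) * c = p / r * (a / b * c)" "p' * a' / (r' * b') * c' = p' / r' * (a' / b' * c')" by simp_all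
  show ?thesis unfolding p(5) a(5) H0_ops hel_mult AdH_hpt[OF n(5-8)] AdH_hpt[OF n(1-4)] AdH_hpt[OF n'] e ..
 qed
 have act_one: "AdH s \<one>\<^bsub>?H\<^esub> ?X = ?X" unfolding H0_ops hel_one[symmetric] using AdH_hpt[of 1 1 1 1 x y c c'] by simp
 define U where "U = {g : carrier ?H. AdH s (inv\<^bsub>?H\<^esub> g) ?X : h1_int F E v s}"
 have int: "AdH s (inv\<^bsub>?H\<^esub> g) ?X : h1_int F E v s \<longleftrightarrow> 0 <= v x" if "g : carrier ?H" for g
  using act[OF inv_closed[OF that]] hpt_integral by metis
 have Ue: "U = (if 0 <= v x then carrier ?H else {})" unfolding U_def using int by auto
 have sp: "space dh = carrier ?H" "space (dq ?X) = rcosets\<^bsub>?H\<^esub> (carrier (stabiliser ?H (AdH s) ?X))"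
  using nm X by (auto simp: normalised_measures_def haar_measure_def quotient_measure_def Let_def)
 have Us: "U : sets dh" unfolding Ue using sets.top[of dh] sp(1) by simp
 interpret J: subgroup "carrier (stabiliser ?H (AdH s) ?X)" ?H by (rule stabiliser_subgroup[OF group_H0 act_mult act_one])
 have V: "{C : rcosets\<^bsub>?H\<^esub> (carrier (stabiliser ?H (AdH s) ?X)). C <= U} : sets (dq ?X)"
 proof (cases "0 <= v x")
  case True
  have "C <= carrier ?H" if "C : rcosets\<^bsub>?H\<^esub> (carrier (stabiliser ?H (AdH s) ?X))" for C
   using rcosets_part_G[OF J.subgroup_axioms] that by blast
  then have "{C : rcosets\<^bsub>?H\<^esub> (carrier (stabiliser ?H (AdH s) ?X)). C <= U} = space (dq ?X)" unfolding Ue sp using True by auto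
  then show ?thesis by simp
 next
  case False
  have "C ~= {}" if "C : rcosets\<^bsub>?H\<^esub> (carrier (stabiliser ?H (AdH s) ?X))" for C
   using that rcos_self[OF _ J.subgroup_axioms] unfolding RCOSETS_def by blast
  then have e: "{C : rcosets\<^bsub>?H\<^esub> (carrier (stabiliser ?H (AdH s) ?X)). C <= U} = {}" unfolding Ue using False by auto
  show ?thesis unfolding e by (rule sets.empty_sets)
 qed
 define Q where "Q = (if 0 <= v x then {()} else {})"
 have one_coset: "\<one>\<^bsub>?H\<^esub> <#\<^bsub>?H\<^esub> carrier ?H = carrier ?H" by (rule lcos_mult_one) blast
 have "orbital_integral ?H (AdH s) (dq ?X) (indicator (h1_int F E v s)) ?X = of_nat (card Q)"
 proof (rule orbital_integral_count[OF group_H0 act_mult act_one nm X U_def Us V, of Q "%_. \<one>\<^bsub>?H\<^esub>"])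
  show "U = (\<Union>q\<in>Q. \<one>\<^bsub>?H\<^esub> <#\<^bsub>?H\<^esub> H0_int F E v s)" unfolding Ue Q_def H0_int_carrier one_coset by simp
 qed (auto simp: Q_def disjoint_family_on_def)
 then show ?thesis by (simp add: Q_def)
qed

lemma stable_orbital_integral_H:
 assumes nm: "normalised_measures (H0 s F) (H0_top F E v s) (H0_int F E v s) (AdH s) (stable_classH F s (gammaH x y)) dh dt dq"
 shows "stable_orbital_integralH F s dq (gammaH x y) (indicator (h1_int F E v s)) = (if 0 <= v x then 1 else 0)"
proof -
 let ?S = "stable_classH F s (gammaH x y)"
 have orb: "orbit_of (H0 s F) (AdH s) X = ?S" if "X : ?S" for X
  using that orbit_hpt unfolding stable_classH_eq by blast
 have ne: "hpt x y 1 1 : ?S" unfolding stable_classH_eq using U1_one by blast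
 have orbs: "orbit_of (H0 s F) (AdH s) ` ?S = {?S}" using orb ne by blast
 have "(SOME X. X : ?S) : ?S" using ne by (rule someI)
 then obtain c c' where c: "c : U1" "c' : U1" "(SOME X. X : ?S) = hpt x y c c'" unfolding stable_classH_eq by blast
 have "hpt x y c c' : ?S" unfolding stable_classH_eq using c by blast
 from orbital_integral_H[OF nm this c(1,2)]
 show ?thesis unfolding stable_orbital_integralH_def weighted_orbital_integral_def orbs Let_def by (simp add: c(3))
qed

end

section \<open>The comparison\<close>

context setting
begin

lemma kappa_orbital_integral_value:
 fixes \<kappa> :: "(('k => 'k) => 'k tmat) set => complex"
 assumes kappa: "\<kappa> : hom (DG) complex_units" "\<exists>C \<in> carrier (DG). \<kappa> C ~= 1"
  and nm: "normalised_measures GF (G0_top F E v s) (G0_int F E v s) (Ad 4 s) (stable_class F s gm) dg dt dq"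
 shows "kappa_orbital_integral F s dq \<kappa> gm (indicator (g1_int F E v s)) = of_nat (card (Good 0)) - of_nat (card (Good 1))"
proof -
 let ?S = "stable_class F s gm" and ?O = "orbit_of GF (Ad 4 s)"
 interpret group GF by (rule group_GF)
 have SU: "X : tmats 4 UNIV" if "X : ?S" for X
  using that g1_iff[OF ring_over_F, of X] tmats_U[of X] unfolding stable_class_def by blast
 have sub: "?O X <= ?S" if X: "X : ?S" for X
 proof
  fix Y assume "Y : ?O X"
  then obtain h where h: "h : carrier GF" "Y = Ad 4 s h X" unfolding orbit_of_def by blast
  obtain g where g: "g : carrier GU" "X = Ad 4 s g gm" using X unfolding stable_class_def orbit_of_def by blast
  have hg: "tmult s h g : carrier GU" using group.subgroup_self[OF group_GU] monoid.m_closed[OF group.is_monoid[OF group_GU] GF_GU[OF h(1)] g(1)] by simp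
  have Y: "Y = Ad 4 s (tmult s h g) gm" unfolding h(2) g(2) using Ad_mult[OF GF_GU[OF h(1)] g(1) tmats_U[OF gamma_F]] by simp
  have XF: "X : tmats 4 F" using X g1_iff[OF ring_over_F, of X] unfolding stable_class_def by blast
  have "tinv 4 s h : tmats 4 F"
   using inv_closed[OF h(1)] G0_group(2)[OF infinite_k ring_over_F h(1)] G0_tmats[OF ring_over_F] by metis
  then have YF: "Y : tmats 4 F" unfolding h(2) Ad_def using XF G0_tmats[OF ring_over_F h(1)] by (intro tmult_closed[OF ring_over_F])
  obtain k l where kl: "det2 k ~= 0" "det2 l ~= 0" "tmult s h g = el k l" using hg unfolding carrier_G0[OF infinite_k ring_over_UNIV] by blast
  have "Y : g1 s F" unfolding g1_iff[OF ring_over_F] using YF unfolding Y kl(3) gamma_lie Ad_el[OF kl(1,2)] by blast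
  then show "Y : ?S" unfolding stable_class_def orbit_of_def using Y hg by blast
 qed
 have self: "X : ?O X" if "X : ?S" for X
  using Ad_GF(2)[OF SU[OF that]] one_closed unfolding orbit_of_def by (metis image_eqI)
 have trans: "?O Y <= ?O X" if XY: "X : ?S" "Y : ?O X" for X Y
 proof
  fix Z assume "Z : ?O Y"
  then obtain h where h: "h : carrier GF" "Z = Ad 4 s h Y" unfolding orbit_of_def by blast
  obtain g where g: "g : carrier GF" "Y = Ad 4 s g X" using XY(2) unfolding orbit_of_def by blast
  have "Z = Ad 4 s (h \<otimes>\<^bsub>GF\<^esub> g) X" unfolding h(2) g(2) by (rule Ad_GF(1)[OF SU[OF XY(1)] h(1) g(1), symmetric])
  then show "Z : ?O X" unfolding orbit_of_def using m_closed[OF h(1) g(1)] by blast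
 qed
 have symm: "X : ?O Y" if X: "X : ?S" and Y: "Y : ?O X" for X Y
 proof -
  obtain g where g: "g : carrier GF" "Y = Ad 4 s g X" using Y unfolding orbit_of_def by blast
  have "X = Ad 4 s (tinv 4 s g) Y" using Ad_inv[OF GF_GU[OF g(1)] SU[OF X] g(2)[symmetric]] by simp
  then show ?thesis unfolding orbit_of_def using inv_closed[OF g(1)] G0_group(2)[OF infinite_k ring_over_F g(1)] by (metis image_eqI)
 qed
 have orb_eq: "?O Y = ?O X" if "X : ?S" "Y : ?O X" for X Y
  using trans[OF that] trans[OF _ symm[OF that]] sub[OF that(1)] that by blast
 have gS: "gm : ?S"
 proof -
  have "id4 : carrier GU" using monoid.one_closed[OF group.is_monoid[OF group_GU]] by simp
  then show ?thesis unfolding stable_class_def orbit_of_def using Ad_one[OF tmats_U[OF gamma_F]] gamma_g1 by (metis IntI image_eqI)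
 qed
 have kv: "\<kappa> (D_class F s gm X) = (if X : ?O gm then 1 else - 1)" if X: "X : ?S" for X
 proof (rule kappa_values(1)[OF kappa])
  show "!!Y. Y : ?S ==> \<exists>g\<in>carrier (G0 s E). Y = Ad 4 s g gm" by (rule splits_over_E)
  show "!!Y Z. Y : ?S ==> Z : ?S ==> Y ~: ?O gm ==> Z ~: ?O gm ==> Z : ?O Y" by (rule outside_single_orbit)
  show "X : ?S" by (rule X)
 qed
 have "\<exists>Y\<in>?S. Y ~: ?O gm"
 proof (rule kappa_values(2)[OF kappa])
  show "!!Y. Y : ?S ==> \<exists>g\<in>carrier (G0 s E). Y = Ad 4 s g gm" by (rule splits_over_E)
  show "!!Y Z. Y : ?S ==> Z : ?S ==> Y ~: ?O gm ==> Z ~: ?O gm ==> Z : ?O Y" by (rule outside_single_orbit)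
  show "gm : ?S" by (rule gS)
 qed
 then obtain Y where Y: "Y : ?S" "Y ~: ?O gm" by blast
 have orbs: "?O ` ?S = {?O gm, ?O Y}"
 proof -
  have "?O Z = ?O gm | ?O Z = ?O Y" if Z: "Z : ?S" for Z
   using orb_eq[OF gS, of Z] orb_eq[OF Y(1), of Z] outside_single_orbit[OF Y(1) Z Y(2)] by blast
  then show ?thesis using gS Y(1) by blast
 qed
 have ne: "?O gm ~= ?O Y" using self[OF Y(1)] Y(2) by blast
 have integral: "orbital_integral GF (Ad 4 s) (dq X) (indicator (g1_int F E v s)) X = of_nat (card (Good (if X : ?O gm then 0 else 1)))" if X: "X : ?S" for X
 proof (cases "X : ?O gm")
  case True
  then obtain u w where uw: "u : SE 1" "w : SE 1" "X = lie (w * d * inv2 u) (u * d * inv2 w)" unfolding in_orbit_gamma by blast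
  have "orbital_integral GF (Ad 4 s) (dq X) (indicator (g1_int F E v s)) X = of_nat (card (Good (nat (v 1 mod 2))))"
   unfolding uw(3) by (rule orbital_integral_G[OF FF.one_closed one_neq_zero uw(1,2) nm]) (use X uw(3) in simp)
  then show ?thesis using True by simp
 next
  case False
  then obtain a u w where a: "a : F" "a ~= 0" "odd (v a)" "u : SE a" "w : SE a" "X = lie (w * d * inv2 u) (u * d * inv2 w)"
   using outside_orbit[OF X False] by blast
  have "orbital_integral GF (Ad 4 s) (dq X) (indicator (g1_int F E v s)) X = of_nat (card (Good (nat (v a mod 2))))"
   unfolding a(6) by (rule orbital_integral_G[OF a(1,2,4,5) nm]) (use X a(6) in simp)
  moreover have "v a mod 2 = 1" using a(3) by presburger
  ultimately show ?thesis using False by simp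
 qed
 define r where "r C = (SOME X. X : C)" for C :: "'k tmat set"
 have r: "r (?O X) : ?O X" if "X : ?S" for X unfolding r_def using self[OF that] by (rule someI)
 define val where "val X = \<kappa> (D_class F s gm X) * orbital_integral GF (Ad 4 s) (dq X) (indicator (g1_int F E v s)) X" for X
 have vals: "val (r (?O gm)) = of_nat (card (Good 0))" "val (r (?O Y)) = - of_nat (card (Good 1))"
 proof -
  have 1: "r (?O gm) : ?S" "r (?O gm) : ?O gm" using r[OF gS] sub[OF gS] by blast+
  then show "val (r (?O gm)) = of_nat (card (Good 0))" unfolding val_def integral[OF 1(1)] kv[OF 1(1)] using 1(2) by simp
  have 2: "r (?O Y) : ?S" "r (?O Y) : ?O Y" using r[OF Y(1)] sub[OF Y(1)] by blast+
  have 3: "r (?O Y) ~: ?O gm" using orb_eq[OF gS] orb_eq[OF Y(1) 2(2)] ne by blast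
  show "val (r (?O Y)) = - of_nat (card (Good 1))" unfolding val_def integral[OF 2(1)] kv[OF 2(1)] using 3 by simp
 qed
 have "kappa_orbital_integral F s dq \<kappa> gm (indicator (g1_int F E v s)) = (\<Sum>C\<in>{?O gm, ?O Y}. val (r C))"
  unfolding kappa_orbital_integral_def weighted_orbital_integral_def orbs Let_def val_def r_def ..
 also have "... = val (r (?O gm)) + val (r (?O Y))" using ne by simp
 finally show ?thesis unfolding vals by simp
qed

lemma kappa_orbital_integral_closed_form:
 fixes \<kappa> :: "(('k => 'k) => 'k tmat) set => complex"
 assumes "\<kappa> : hom (DG) complex_units" "\<exists>C \<in> carrier (DG). \<kappa> C ~= 1"
  and "normalised_measures GF (G0_top F E v s) (G0_int F E v s) (Ad 4 s) (stable_class F s gm) dg dt dq"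
 shows "kappa_orbital_integral F s dq \<kappa> gm (indicator (g1_int F E v s)) =
  (if 0 <= v x then (- 1) ^ depth * of_nat q powi (int depth + 2 * v x) else 0)"
proof (cases "0 <= v x")
 case True
 have "(of_nat (card (Good 0)) - of_nat (card (Good 1)) :: complex) = of_int (int (card (Good 0)) - int (card (Good 1)))" by simp
 also have "... = (- 1) ^ depth * of_nat q ^ (depth + 2 * nat (v x))" unfolding card_Good_diff[OF True] by simp
 also have "(of_nat q :: complex) ^ (depth + 2 * nat (v x)) = of_nat q powi (int depth + 2 * v x)"
 proof -
  have e: "int depth + 2 * v x = int (depth + 2 * nat (v x))" using True by simp
  show ?thesis unfolding e by (rule power_int_of_nat[symmetric])
 qed
 finally show ?thesis using True kappa_orbital_integral_value[OF assms] by simp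
next
 case False
 have "Good par = {}" for par
 proof (rule equals0I)
  fix p assume p: "p : Good par"
  obtain m z m' z' where q1: "p = ((m, z), (m', z'))" by (metis surj_pair)
  have "z : T m" "z' : T m'" "good m z m' z'" using p unfolding q1 Good_def by auto
  then show False using good_negative[of z z' m m'] False T_U1 by auto
 qed
 then show ?thesis using False kappa_orbital_integral_value[OF assms] by simp
qed

end

theorem theorem1p2p1:
  fixes F E :: "'k::alg_closed_field set" and v :: "'k \<Rightarrow> int" and s x y :: 'k
    and \<kappa> :: "(('k \<Rightarrow> 'k) \<Rightarrow> 'k tmat) set \<Rightarrow> complex"
    and dg :: "'k tmat measure" and dt :: "'k tmat \<Rightarrow> 'k tmat measure"
    and dq :: "'k tmat \<Rightarrow> 'k tmat set measure"
    and dh :: "('k tmat \<times> 'k tmat) measure"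
    and dtH :: "'k tmat \<times> 'k tmat \<Rightarrow> ('k tmat \<times> 'k tmat) measure"
    and dqH :: "'k tmat \<times> 'k tmat \<Rightarrow> ('k tmat \<times> 'k tmat) set measure"
  assumes F: "local_field F v" and char: "CHAR('k) > 0" "odd CHAR('k)"
    and closure: "\<And>a. algebraic_over F a"
    and E: "unramified_quadratic_ext F E v s"
    and xy: "x \<in> F" "y \<in> F" "x \<noteq> 0" "y \<noteq> 0" "x \<noteq> y" "x \<noteq> - y"
    and nearly_singular: "v (x + y) > v (x - y)"
    and kappa: "\<kappa> \<in> hom (D_group F s (gamma x y)) complex_units"
      "\<exists>C \<in> carrier (D_group F s (gamma x y)). \<kappa> C \<noteq> 1"
    and measures: "normalised_measures (G0 s F) (G0_top F E v s) (G0_int F E v s) (Ad 4 s)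
      (stable_class F s (gamma x y)) dg dt dq"
    and measuresH: "normalised_measures (H0 s F) (H0_top F E v s) (H0_int F E v s) (AdH s)
      (stable_classH F s (gammaH x y)) dh dtH dqH"
  shows "\<exists>\<Delta> \<zeta> :: complex. \<exists>(N :: nat) (k :: int).
    N > 0 \<and> \<zeta> ^ N = 1 \<and> \<Delta> = \<zeta> * of_nat (card (residue_field F v)) powi k \<and>
    kappa_orbital_integral F s dq \<kappa> (gamma x y) (indicator (g1_int F E v s)) =
      \<Delta> * stable_orbital_integralH F s dqH (gammaH x y) (indicator (h1_int F E v s))"
proof -
 have sub: "is_subfield F" using F by (simp add: local_field_def)
 interpret setting F E v s x y
  by unfold_locales (use F char closure E xy nearly_singular sub in \<open>simp_all\<close>)
 let ?\<zeta> = "(- 1) ^ depth :: complex" and ?k = "int depth + 2 * v x"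
 have "?\<zeta> ^ 2 = 1" by (simp add: power2_eq_square flip: power_add)
 moreover have "kappa_orbital_integral F s dq \<kappa> (gamma x y) (indicator (g1_int F E v s)) =
   ?\<zeta> * of_nat (card (residue_field F v)) powi ?k * stable_orbital_integralH F s dqH (gammaH x y) (indicator (h1_int F E v s))"
  unfolding kappa_orbital_integral_closed_form[OF kappa measures] stable_orbital_integral_H[OF measuresH] by (simp add: q_def)
 ultimately show ?thesis
  by (intro exI[of _ "?\<zeta> * of_nat (card (residue_field F v)) powi ?k"] exI[of _ ?\<zeta>] exI[of _ 2] exI[of _ ?k] conjI refl) simp_all
qed

end
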